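(* Suppose that $q=p$, let $\chi:H\to\overline{\mathbf F}_p^\times$ be a character and let $\gamma=\{\chi,\chi^s\}$. Consider the representations $\mathrm{inj}\,\rho_{\chi,J}$ and $\mathrm{inj}\,\rho_{\chi^s,\overline J}$ of $\Gamma$ as representations of $K$, via $K\to K/K_1\cong\Gamma$. If $\chi=\chi^s$ then the action of $\mathcal H_K$ on $(\mathrm{inj}\,\rho_{\chi,\emptyset}\oplus\mathrm{inj}\,\rho_{\chi,\{s\}})^{I_1}$ extends to an action of $\mathcal H$ so that $$(\mathrm{inj}\,\rho_{\chi,\emptyset}\oplus\mathrm{inj}\,\rho_{\chi,\{s\}})^{I_1}\cong M_\gamma.$$ If $\chi\neq\chi^s$ then the action of $\mathcal H_K$ on $(\mathrm{inj}\,\rho_{\chi,\emptyset}\oplus\mathrm{inj}\,\rho_{\chi^s,\emptyset})^{I_1}$ extends to an action of $\mathcal H$ so that $$(\mathrm{inj}\,\rho_{\chi,\emptyset}\oplus\mathrm{inj}\,\rho_{\chi^s,\emptyset})^{I_1}\cong L_\gamma.$$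
   Context: All representations are on $\overline{\mathbf F}_p$-vector spaces. $F$ is a non-Archimedean local field with ring of integers $\mathfrak o_F$, fixed uniformiser $\varpi_F$ and residue field $\mathbf F_q$ of characteristic $p$. $G=\mathrm{GL}_2(F)$, $K=\mathrm{GL}_2(\mathfrak o_F)$, $\Gamma=\mathrm{GL}_2(\mathbf F_q)$; $B,H,U\subset\Gamma$ are the upper triangular, diagonal, and unipotent upper triangular matrices. $K_1$ is the kernel of reduction $K\to\Gamma$; $I$, $I_1$ are the preimages of $B$, $U$ in $K$. $\Pi=\begin{pmatrix}0&1\\ \varpi_F&0\end{pmatrix}$, $n_s=\begin{pmatrix}0&-1\\1&0\end{pmatrix}$, $s=\begin{pmatrix}0&1\\1&0\end{pmatrix}$. For a character $\chi$ of $H$, $\chi^s(h)=\chi(s^{-1}hs)$. Irreducible representations: $J_0(\chi)=\{s\}$ if $\chi=\chi^s$, $\emptyset$ otherwise; for $J\subseteq J_0(\chi)$, $\overline J=J_0(\chi)\setminus J$. If $\chi\neq\chi^s$, $\rho_{\chi,\emptyset}$ is the unique irreducible representation of $\Gamma$ on whose (one-dimensional) $U$-invariants $B$ acts by $\chi$. If $\chi=\chi^s$, write $\chi=\chi'\circ\det$; $\rho_{\chi,\{s\}}=\chi'\circ\det$, $\rho_{\chi,\emptyset}=\mathrm{St}\otimes\chi'\circ\det$, $\mathrm{St}$ the $q$-dimensional Steinberg representation. $\mathrm{inj}\,\rho$ is an injective envelope of $\rho$ in the category of $\overline{\mathbf F}_p$-representations of $\Gamma$. Hecke algebras: $\mathcal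 H=\mathrm{End}_G(\text{c-Ind}_{I_1}^G\mathbf 1)$ and $\mathcal H_K=\mathrm{End}_K(\mathrm{Ind}_{I_1}^K\mathbf 1)$, which is naturally a subalgebra of $\mathcal H$ (via functions supported on $K$). For $g\in G$, $T_g\in\mathcal H$ is $(T_gf)(I_1g_1)=\sum_{I_1g_2\subseteq I_1g^{-1}I_1g_1}f(I_1g_2)$; for $h\in H$, $T_h=T_t$ for any diagonal lift $t\in K$ of $h$; $e_\chi=\frac1{|H|}\sum_{h\in H}\chi(h)T_h$. $\mathcal H$ is generated by $T_{n_s},T_\Pi,T_\Pi^{-1}=T_{\Pi^{-1}}$ and the $e_\chi$; $\mathcal H_K$ is generated by $T_{n_s}$ and the $e_\chi$. For a smooth representation of $K$, $\mathcal H_K$ acts on the right on its $I_1$-invariants by $vT_{n_s}=\sum_{u\in I_1/K_1}un_s^{-1}v$ (when $K_1$ acts trivially) and $ve_\chi$ = projection to the $\chi$-isotypic part for $I/I_1\cong H$. Modules: for $\gamma=\{\chi,\chi^s\}$, $M_\gamma$ is the right $\mathcal H$-module with basis $v_1,v_2$, with $v_1T_\Pi=v_2$, $v_2T_\Pi=v_1$, $v_1e_\chi=v_1$, $v_2e_{\chi^s}=v_2$, $v_2T_{n_s}=0$, and $v_1T_{n_s}=-v_1$ if $\chi=\chi^s$, $v_1T_{n_s}=0$ if $\chi\ne\chi^s$. For $\chi\neq\chi^s$, with $\mathcal H^1=\mathcal H/(T_\Pi^2-1)\mathcal H$ ($T_\Pi^2$ is central), $L_\gamma=e_\chi\mathcal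 H^1/e_\chi(T_\Pi T_{n_s}-T_{n_s}T_\Pi)\mathcal H^1$. *)

theory Defs
  imports
    "HOL-Analysis.Determinants"
    "HOL-Computational_Algebra.Polynomial"
    "HOL-Algebra.QuotRing"
    "HOL-Library.Function_Algebras"
begin

section \<open>Local fields and subgroups of \<open>GL\<^sub>2\<close>\<close>

definition mat2 :: "'a::zero \<Rightarrow> 'a \<Rightarrow> 'a \<Rightarrow> 'a \<Rightarrow> 'a^2^2" where
  "mat2 a b c d = vector [vector [a, b], vector [c, d]]"

definition GL2 :: "('a::field^2^2) monoid" where
  "GL2 = \<lparr>carrier = {A. invertible A}, monoid.mult = (**), one = mat 1\<rparr>"

text \<open>The value of a valuation at \<open>0\<close> is \<open>\<infinity>\<close>; since \<open>val\<close> is integer-valued, \<open>val 0\<close> is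
  never used and all conditions go through the following predicate.\<close>

definition val_ge :: "('f::field \<Rightarrow> int) \<Rightarrow> 'f \<Rightarrow> int \<Rightarrow> bool" where
  "val_ge val x n \<longleftrightarrow> x = 0 \<or> n \<le> val x"

definition val_ring :: "('f::field \<Rightarrow> int) \<Rightarrow> 'f set" where
  "val_ring val = {x. val_ge val x 0}"

definition max_ideal :: "('f::field \<Rightarrow> int) \<Rightarrow> 'f set" where
  "max_ideal val = {x. val_ge val x 1}"

text \<open>A non-Archimedean local field \<open>'f\<close>: complete for a normalised discrete valuation, with
  finite residue field. The residue field is presented as a type \<open>'k\<close> together with the reduction
  map, a surjective ring homomorphism on the valuation ring whose kernel is the maximal ideal
  (its values outside the valuation ring are irrelevant).\<close>

locale nonarch_local_field =
  fixes val :: "'f::field \<Rightarrow> int"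
    and red :: "'f \<Rightarrow> 'k::{field,finite}"
    and varpi :: 'f
  assumes val_mult: "x \<noteq> 0 \<Longrightarrow> y \<noteq> 0 \<Longrightarrow> val (x * y) = val x + val y"
    and val_add: "val_ge val x n \<Longrightarrow> val_ge val y n \<Longrightarrow> val_ge val (x + y) n"
    and uniformiser: "varpi \<noteq> 0" "val varpi = 1"
    and complete: "(\<And>N. \<exists>n0. \<forall>m\<ge>n0. \<forall>n\<ge>n0. val_ge val (a m - a n) N)
          \<Longrightarrow> \<exists>l. \<forall>N. \<exists>n0. \<forall>n\<ge>n0. val_ge val ((a :: nat \<Rightarrow> 'f) n - l) N"
    and red_add: "x \<in> val_ring val \<Longrightarrow> y \<in> val_ring val \<Longrightarrow> red (x + y) = red x + red y"
    and red_mult: "x \<in> val_ring val \<Longrightarrow> y \<in> val_ring val \<Longrightarrow> red (x * y) = red x * red y"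
    and red_one: "red 1 = 1"
    and red_surj: "red ` val_ring val = UNIV"
    and red_ker: "x \<in> val_ring val \<Longrightarrow> red x = 0 \<longleftrightarrow> x \<in> max_ideal val"

text \<open>\<open>B\<close>, \<open>H\<close>, \<open>U\<close> and \<open>s\<close>, for an arbitrary field.\<close>

definition borel2 :: "('k::field^2^2) set" where
  "borel2 = {A \<in> carrier GL2. A $ 2 $ 1 = 0}"

definition diag2 :: "('k::field^2^2) set" where
  "diag2 = {A \<in> carrier GL2. A $ 1 $ 2 = 0 \<and> A $ 2 $ 1 = 0}"

definition unip2 :: "('k::field^2^2) set" where
  "unip2 = {A \<in> carrier GL2. A $ 1 $ 1 = 1 \<and> A $ 2 $ 2 = 1 \<and> A $ 2 $ 1 = 0}"

definition s_mat :: "'k::field^2^2" where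
  "s_mat = mat2 0 1 1 0"

definition n_s :: "'f::field^2^2" where
  "n_s = mat2 0 (-1) 1 0"

definition Pi_mat :: "'f::field \<Rightarrow> 'f^2^2" where
  "Pi_mat varpi = mat2 0 1 varpi 0"

definition GL2_int :: "('f::field \<Rightarrow> int) \<Rightarrow> ('f^2^2) set" where
  "GL2_int val = {A \<in> carrier GL2. (\<forall>i j. A $ i $ j \<in> val_ring val) \<and>
                     (\<forall>i j. (inv\<^bsub>GL2\<^esub> A) $ i $ j \<in> val_ring val)}"

definition red_mat :: "('f \<Rightarrow> 'k) \<Rightarrow> 'f^2^2 \<Rightarrow> 'k^2^2" where
  "red_mat red A = (\<chi> i j. red (A $ i $ j))"

definition iwahori1 :: "('f::field \<Rightarrow> int) \<Rightarrow> ('f \<Rightarrow> 'k::field) \<Rightarrow> ('f^2^2) set" where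
  "iwahori1 val red = {A \<in> GL2_int val. red_mat red A \<in> unip2}"

section \<open>Representations\<close>

text \<open>A representation is a scalar multiplication and a group action on (a subspace \<open>W\<close> of) an
  additive group \<open>'v\<close>.\<close>

record ('c, 'g, 'v) rep =
  scl :: "'c \<Rightarrow> 'v \<Rightarrow> 'v"
  act :: "'g \<Rightarrow> 'v \<Rightarrow> 'v"

definition is_rep_on ::
  "('g, 'm) monoid_scheme \<Rightarrow> 'v set \<Rightarrow> ('c::field, 'g, 'v::ab_group_add) rep \<Rightarrow> bool" where
  "is_rep_on G W V \<longleftrightarrow> vector_space (scl V) \<and> module.subspace (scl V) W \<and>
     (\<forall>g \<in> carrier G. \<forall>v \<in> W. act V g v \<in> W) \<and>
     (\<forall>g \<in> carrier G. \<forall>v \<in> W. \<forall>w \<in> W. act V g (v + w) = act V g v + act V g w) \<and>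
     (\<forall>g \<in> carrier G. \<forall>a. \<forall>v \<in> W. act V g (scl V a v) = scl V a (act V g v)) \<and>
     (\<forall>v \<in> W. act V \<one>\<^bsub>G\<^esub> v = v) \<and>
     (\<forall>g \<in> carrier G. \<forall>h \<in> carrier G. \<forall>v \<in> W. act V (g \<otimes>\<^bsub>G\<^esub> h) v = act V g (act V h v))"

abbreviation is_rep ::
  "('g, 'm) monoid_scheme \<Rightarrow> ('c::field, 'g, 'v::ab_group_add) rep \<Rightarrow> bool" where
  "is_rep G V \<equiv> is_rep_on G UNIV V"

definition rep_hom_on :: "('g, 'm) monoid_scheme \<Rightarrow> 'v set \<Rightarrow> ('c, 'g, 'v::ab_group_add) rep \<Rightarrow>
    ('c, 'g, 'w::ab_group_add) rep \<Rightarrow> ('v \<Rightarrow> 'w) \<Rightarrow> bool" where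
  "rep_hom_on G W V V' f \<longleftrightarrow>
     (\<forall>v \<in> W. \<forall>w \<in> W. f (v + w) = f v + f w) \<and>
     (\<forall>a. \<forall>v \<in> W. f (scl V a v) = scl V' a (f v)) \<and>
     (\<forall>g \<in> carrier G. \<forall>v \<in> W. f (act V g v) = act V' g (f v))"

definition irreducible_rep ::
  "('g, 'm) monoid_scheme \<Rightarrow> ('c::field, 'g, 'v::ab_group_add) rep \<Rightarrow> bool" where
  "irreducible_rep G V \<longleftrightarrow> is_rep G V \<and> (\<exists>v :: 'v. v \<noteq> 0) \<and>
     (\<forall>W. is_rep_on G W V \<longrightarrow> W = {0} \<or> W = UNIV)"

definition invariants :: "'g set \<Rightarrow> ('c, 'g, 'v) rep \<Rightarrow> 'v set" where
  "invariants S V = {v. \<forall>g \<in> S. act V g v = v}"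

definition rep_sum :: "('c, 'g, 'v) rep \<Rightarrow> ('c, 'g, 'w) rep \<Rightarrow> ('c, 'g, 'v \<times> 'w) rep" where
  "rep_sum V W = \<lparr>scl = (\<lambda>a (v, w). (scl V a v, scl W a w)),
               act = (\<lambda>g (v, w). (act V g v, act W g w))\<rparr>"

text \<open>Inflation of a representation of \<open>GL\<^sub>2(k)\<close> along reduction.\<close>

definition inflate ::
  "('f \<Rightarrow> 'k) \<Rightarrow> ('c, 'k^2^2, 'v) rep \<Rightarrow> ('c, 'f^2^2, 'v) rep" where
  "inflate red V = \<lparr>scl = scl V, act = (\<lambda>x. act V (red_mat red x))\<rparr>"

text \<open>Injectivity: every homomorphism from a subrepresentation \<open>A\<close> of a representation \<open>B\<close> extends
  to \<open>B\<close>. HOL cannot quantify over types inside a formula, so the test objects are the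
  representations on subspaces of the space of all sequences in \<open>'c\<close>, which has uncountable
  dimension and hence contains every representation of countable dimension up to isomorphism. For
  a finite group this is equivalent to testing against all representations: by Baer's criterion
  the group algebra and its left ideals already suffice.\<close>

definition injective_rep ::
  "('g, 'm) monoid_scheme \<Rightarrow> ('c::field, 'g, 'v::ab_group_add) rep \<Rightarrow> bool" where
  "injective_rep G V \<longleftrightarrow> is_rep G V \<and>
     (\<forall>A B Q f. is_rep_on G B \<lparr>scl = (\<lambda>(a::'c) x (n::nat). a * x n), act = Q\<rparr> \<longrightarrow>
          is_rep_on G A \<lparr>scl = (\<lambda>a x n. a * x n), act = Q\<rparr> \<longrightarrow> A \<subseteq> B \<longrightarrow>
          rep_hom_on G A \<lparr>scl = (\<lambda>a x n. a * x n), act = Q\<rparr> V f \<longrightarrow>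
        (\<exists>f'. rep_hom_on G B \<lparr>scl = (\<lambda>a x n. a * x n), act = Q\<rparr> V f' \<and> (\<forall>x \<in> A. f' x = f x)))"

text \<open>\<open>E\<close> is an injective envelope of \<open>V\<close>: an injective essential extension.\<close>

definition injective_envelope :: "('g, 'm) monoid_scheme \<Rightarrow> ('c::field, 'g, 'v::ab_group_add) rep \<Rightarrow>
    ('c, 'g, 'w::ab_group_add) rep \<Rightarrow> bool" where
  "injective_envelope G V E \<longleftrightarrow> is_rep G V \<and> injective_rep G E \<and>
     (\<exists>i. rep_hom_on G UNIV V E i \<and> inj i \<and>
        (\<forall>W. is_rep_on G W E \<longrightarrow> W \<noteq> {0} \<longrightarrow> W \<inter> range i \<noteq> {0}))"

section \<open>Characters and the irreducible representations of \<open>GL\<^sub>2(k)\<close>\<close>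

text \<open>Characters of \<open>H\<close> are functions on all matrices of which only the values on \<open>H\<close> matter.\<close>

definition is_char_H :: "('k::field^2^2 \<Rightarrow> 'c::field) \<Rightarrow> bool" where
  "is_char_H chi \<longleftrightarrow> (\<forall>h \<in> diag2. chi h \<noteq> 0) \<and>
     (\<forall>h \<in> diag2. \<forall>h' \<in> diag2. chi (h ** h') = chi h * chi h')"

definition conj_s :: "('k::field^2^2 \<Rightarrow> 'c) \<Rightarrow> 'k^2^2 \<Rightarrow> 'c" where
  "conj_s chi h = chi (inv\<^bsub>GL2\<^esub> s_mat ** h ** s_mat)"

definition self_conj :: "('k::field^2^2 \<Rightarrow> 'c) \<Rightarrow> bool" where
  "self_conj chi \<longleftrightarrow> (\<forall>h \<in> diag2. chi h = conj_s chi h)"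

definition is_char_units :: "('k::field \<Rightarrow> 'c::field) \<Rightarrow> bool" where
  "is_char_units chi' \<longleftrightarrow> (\<forall>x. x \<noteq> 0 \<longrightarrow> chi' x \<noteq> 0) \<and>
     (\<forall>x y. x \<noteq> 0 \<longrightarrow> y \<noteq> 0 \<longrightarrow> chi' (x * y) = chi' x * chi' y)"

text \<open>\<open>Ind\<^sub>B 1\<close>: functions on \<open>B \<setminus> GL\<^sub>2(k)\<close> (extended by \<open>0\<close> to all matrices), acted on by right
  translation.\<close>

definition ind_borel :: "('k::field^2^2 \<Rightarrow> 'c::field) set" where
  "ind_borel = {f. (\<forall>b \<in> borel2. \<forall>g \<in> carrier GL2. f (b ** g) = f g) \<and>
                   (\<forall>g. g \<notin> carrier GL2 \<longrightarrow> f g = 0)}"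

definition ind_borel_rep :: "('c::field, 'k::field^2^2, 'k^2^2 \<Rightarrow> 'c) rep" where
  "ind_borel_rep = \<lparr>scl = (\<lambda>a f x. a * f x), act = (\<lambda>g f x. f (x ** g))\<rparr>"

text \<open>The Steinberg representation is the quotient of \<open>Ind\<^sub>B 1\<close> by the constant functions; \<open>\<pi>\<close> below
  is the quotient map.\<close>

definition is_steinberg :: "('c::field, 'k::field^2^2, 'v::ab_group_add) rep \<Rightarrow> bool" where
  "is_steinberg V \<longleftrightarrow> is_rep GL2 V \<and>
     (\<exists>\<pi>. rep_hom_on GL2 ind_borel ind_borel_rep V \<pi> \<and> \<pi> ` ind_borel = UNIV \<and>
        (\<forall>f \<in> ind_borel. \<pi> f = 0 \<longleftrightarrow> (\<exists>a. \<forall>g \<in> carrier GL2. f g = a)))"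

definition twist_det ::
  "('k::field \<Rightarrow> 'c) \<Rightarrow> ('c, 'k^2^2, 'v) rep \<Rightarrow> ('c, 'k^2^2, 'v) rep" where
  "twist_det chi' V = \<lparr>scl = scl V, act = (\<lambda>g v. scl V (chi' (det g)) (act V g v))\<rparr>"

definition is_trivial_rep :: "('c::field, 'k::field^2^2, 'v::ab_group_add) rep \<Rightarrow> bool" where
  "is_trivial_rep V \<longleftrightarrow> is_rep GL2 V \<and> vector_space.dim (scl V) (UNIV :: 'v set) = 1 \<and>
     (\<forall>g \<in> carrier GL2. \<forall>v. act V g v = v)"

definition J0 :: "('k::field^2^2 \<Rightarrow> 'c) \<Rightarrow> ('k^2^2) set" where
  "J0 chi = (if self_conj chi then {s_mat} else {})"

text \<open>\<open>V\<close> is (a model of) \<open>\<rho>\<^bsub>\<chi>,J\<^esub>\<close>. In the regular case \<open>B\<close> acts on the \<open>U\<close>-invariants through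
  its projection to \<open>H\<close>.\<close>

definition is_rho :: "('k::field^2^2 \<Rightarrow> 'c::field) \<Rightarrow> ('k^2^2) set \<Rightarrow>
    ('c, 'k^2^2, 'v::ab_group_add) rep \<Rightarrow> bool" where
  "is_rho chi J V \<longleftrightarrow> J \<subseteq> J0 chi \<and>
     (if self_conj chi
      then \<exists>chi' V'. is_char_units chi' \<and> (\<forall>h \<in> diag2. chi h = chi' (det h)) \<and>
             (if J = {} then is_steinberg V' else is_trivial_rep V') \<and> V = twist_det chi' V'
      else irreducible_rep GL2 V \<and> vector_space.dim (scl V) (invariants unip2 V) = 1 \<and>
             (\<forall>b \<in> borel2. \<forall>v \<in> invariants unip2 V.
                act V b v = scl V (chi (mat2 (b $ 1 $ 1) 0 0 (b $ 2 $ 2))) v))"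

section \<open>Hecke algebras\<close>

text \<open>\<open>c-Ind\<^sub>L\<^sup>G 1\<close> for a subgroup \<open>L\<close> (below \<open>L = I\<^sub>1\<close>) of \<open>G = GL\<^sub>2(F)\<close>: finitely supported
  functions on the right cosets \<open>Lg\<close>, extended by \<open>0\<close> to all sets of matrices. The action of \<open>G\<close>
  is right translation.\<close>

definition cInd :: "('f::field^2^2) set \<Rightarrow> (('f^2^2) set \<Rightarrow> 'c::field) set" where
  "cInd L = {f. {C. f C \<noteq> 0} \<subseteq> rcosets\<^bsub>GL2\<^esub> L \<and> finite {C. f C \<noteq> 0}}"

definition rtrans :: "'f::field^2^2 \<Rightarrow> (('f^2^2) set \<Rightarrow> 'c) \<Rightarrow> ('f^2^2) set \<Rightarrow> 'c" where
  "rtrans g f = (\<lambda>C. f (C #>\<^bsub>GL2\<^esub> g))"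

text \<open>\<open>Ind\<^sub>L\<^sup>K 1\<close> inside \<open>c-Ind\<^sub>L\<^sup>G 1\<close>, extending functions by \<open>0\<close>.\<close>

definition IndK :: "('f::field^2^2) set \<Rightarrow> ('f^2^2) set \<Rightarrow> (('f^2^2) set \<Rightarrow> 'c::field) set" where
  "IndK K L = {f \<in> cInd L. \<forall>C. f C \<noteq> 0 \<longrightarrow> C \<subseteq> K}"

type_synonym ('f, 'c) hecke = "(('f^2^2) set \<Rightarrow> 'c) \<Rightarrow> (('f^2^2) set \<Rightarrow> 'c)"

text \<open>Endomorphisms, commuting with translation by \<open>S\<close>, of a translation-stable space \<open>X\<close> of
  functions. They are extended by \<open>0\<close> outside \<open>X\<close>, so that sums are pointwise sums and the product
  is plain composition.\<close>

definition equiv_End ::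
  "('f::field^2^2) set \<Rightarrow> (('f^2^2) set \<Rightarrow> 'c::field) set \<Rightarrow> ('f, 'c) hecke set" where
  "equiv_End S X = {\<phi>. \<phi> ` X \<subseteq> X \<and> (\<forall>f. f \<notin> X \<longrightarrow> \<phi> f = 0) \<and>
     (\<forall>f \<in> X. \<forall>f' \<in> X. \<phi> (f + f') = \<phi> f + \<phi> f') \<and>
     (\<forall>a. \<forall>f \<in> X. \<phi> (\<lambda>C. a * f C) = (\<lambda>C. a * \<phi> f C)) \<and>
     (\<forall>g \<in> S. \<forall>f \<in> X. \<phi> (rtrans g f) = rtrans g (\<phi> f))}"

definition hecke_scalar :: "('f::field^2^2) set \<Rightarrow> 'c::field \<Rightarrow> ('f, 'c) hecke" where
  "hecke_scalar L a = (\<lambda>f. if f \<in> cInd L then (\<lambda>C. a * f C) else 0)"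

definition hecke_ring :: "('f::field^2^2) set \<Rightarrow> ('f, 'c::field) hecke ring" where
  "hecke_ring L = \<lparr>carrier = equiv_End (carrier GL2) (cInd L), monoid.mult = (\<circ>),
     one = hecke_scalar L 1, zero = 0, ring.add = (+)\<rparr>"

definition hecke_K :: "('f::field^2^2) set \<Rightarrow> ('f^2^2) set \<Rightarrow> ('f, 'c::field) hecke set" where
  "hecke_K K L = equiv_End K (IndK K L)"

text \<open>The embedding of \<open>\<H>\<^sub>K\<close> into \<open>\<H>\<close>: since \<open>c-Ind\<^sub>L\<^sup>G 1\<close> is generated over \<open>G\<close> by
  \<open>Ind\<^sub>L\<^sup>K 1\<close>, an element of \<open>\<H>\<^sub>K\<close> has a unique extension to an element of \<open>\<H>\<close>, and the elements
  of \<open>\<H>\<close> arising in this way are those sending the characteristic function of \<open>L\<close> to a function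
  supported on \<open>K\<close>.\<close>

definition hecke_K_incl ::
  "('f::field^2^2) set \<Rightarrow> ('f^2^2) set \<Rightarrow> ('f, 'c::field) hecke \<Rightarrow> ('f, 'c) hecke" where
  "hecke_K_incl K L \<psi> = (THE \<phi>. \<phi> \<in> carrier (hecke_ring L) \<and> (\<forall>f \<in> IndK K L. \<phi> f = \<psi> f))"

definition hecke_T :: "('f::field^2^2) set \<Rightarrow> 'f^2^2 \<Rightarrow> ('f, 'c::field) hecke" where
  "hecke_T L g = (\<lambda>f. if f \<in> cInd L
     then (\<lambda>C. if C \<in> rcosets\<^bsub>GL2\<^esub> L
               then \<Sum>D | D \<in> rcosets\<^bsub>GL2\<^esub> L \<and> D \<subseteq> (L #>\<^bsub>GL2\<^esub> inv\<^bsub>GL2\<^esub> g) <#>\<^bsub>GL2\<^esub> C. f D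
               else 0)
     else 0)"

definition diag_lift :: "('f::field \<Rightarrow> int) \<Rightarrow> ('f \<Rightarrow> 'k::field) \<Rightarrow> 'k^2^2 \<Rightarrow> 'f^2^2" where
  "diag_lift val red h = (SOME t. t \<in> GL2_int val \<inter> diag2 \<and> red_mat red t = h)"

definition hecke_e :: "('f::field \<Rightarrow> int) \<Rightarrow> ('f \<Rightarrow> 'k::{field,finite}) \<Rightarrow>
    ('k^2^2 \<Rightarrow> 'c::field) \<Rightarrow> ('f, 'c) hecke" where
  "hecke_e val red chi = (\<lambda>f C. inverse (of_nat (card (diag2 :: ('k^2^2) set))) *
     (\<Sum>h \<in> diag2. chi h * hecke_T (iwahori1 val red) (diag_lift val red h) f C))"

text \<open>The right action of \<open>\<H>\<^sub>K\<close> on the \<open>L\<close>-invariants of a representation \<open>V\<close> of \<open>K\<close>: by Frobenius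
  reciprocity \<open>v\<close> corresponds to the homomorphism from \<open>Ind\<^sub>L\<^sup>K 1\<close> to \<open>V\<close> sending \<open>f\<close> to
  the sum of \<open>f(Lx) x\<^sup>-\<^sup>1 v\<close> over the cosets \<open>Lx\<close> in \<open>K\<close>, and \<open>\<H>\<^sub>K\<close> acts by precomposition, so
  \<open>v\<psi>\<close> is the image of \<open>\<psi>(1\<^sub>L)\<close>. As \<open>T\<^sub>g 1\<^sub>L\<close> is the characteristic function of \<open>LgL\<close>, this gives
  \<open>v T\<^sub>g = \<Sum>\<^sub>u u g\<^sup>-\<^sup>1 v\<close>, over \<open>u\<close> in \<open>L/(L \<inter> g\<^sup>-\<^sup>1Lg)\<close>.\<close>

definition hecke_K_act :: "('f::field^2^2) set \<Rightarrow> ('f^2^2) set \<Rightarrow>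
    ('c::field, 'f^2^2, 'v::ab_group_add) rep \<Rightarrow> 'v \<Rightarrow> ('f, 'c) hecke \<Rightarrow> 'v" where
  "hecke_K_act K L V v \<psi> =
     (\<Sum>C | C \<in> rcosets\<^bsub>GL2\<^esub> L \<and> C \<subseteq> K.
        scl V (\<psi> (\<lambda>D. if D = L then 1 else 0) C) (act V (inv\<^bsub>GL2\<^esub> (SOME x. x \<in> C)) v))"

section \<open>Right modules\<close>

locale right_module = R: ring R + M: abelian_group M
  for R :: "('r, 'x) ring_scheme" (structure) and M :: "('m, 'y) ring_scheme" (structure) +
  fixes ract :: "'m \<Rightarrow> 'r \<Rightarrow> 'm"
  assumes ract_closed: "m \<in> carrier M \<Longrightarrow> r \<in> carrier R \<Longrightarrow> ract m r \<in> carrier M"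
    and ract_add_left: "m \<in> carrier M \<Longrightarrow> m' \<in> carrier M \<Longrightarrow> r \<in> carrier R \<Longrightarrow>
          ract (m \<oplus>\<^bsub>M\<^esub> m') r = ract m r \<oplus>\<^bsub>M\<^esub> ract m' r"
    and ract_add_right: "m \<in> carrier M \<Longrightarrow> r \<in> carrier R \<Longrightarrow> r' \<in> carrier R \<Longrightarrow>
          ract m (r \<oplus>\<^bsub>R\<^esub> r') = ract m r \<oplus>\<^bsub>M\<^esub> ract m r'"
    and ract_mult: "m \<in> carrier M \<Longrightarrow> r \<in> carrier R \<Longrightarrow> r' \<in> carrier R \<Longrightarrow>
          ract m (r \<otimes>\<^bsub>R\<^esub> r') = ract (ract m r) r'"
    and ract_one: "m \<in> carrier M \<Longrightarrow> ract m \<one>\<^bsub>R\<^esub> = m"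

definition right_module_iso :: "('r, 'x) ring_scheme \<Rightarrow> ('m, 'y) ring_scheme \<Rightarrow>
    ('m \<Rightarrow> 'r \<Rightarrow> 'm) \<Rightarrow> ('n, 'z) ring_scheme \<Rightarrow> ('n \<Rightarrow> 'r \<Rightarrow> 'n) \<Rightarrow> bool" where
  "right_module_iso R M ract N ract' \<longleftrightarrow> (\<exists>f. bij_betw f (carrier M) (carrier N) \<and>
     (\<forall>x \<in> carrier M. \<forall>y \<in> carrier M. f (x \<oplus>\<^bsub>M\<^esub> y) = f x \<oplus>\<^bsub>N\<^esub> f y) \<and>
     (\<forall>x \<in> carrier M. \<forall>r \<in> carrier R. f (ract x r) = ract' (f x) r))"

text \<open>An additive subgroup of a type as an abelian group; the multiplicative fields are unused.\<close>

definition add_struct :: "'m::ab_group_add set \<Rightarrow> 'm ring" where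
  "add_struct X = \<lparr>carrier = X, monoid.mult = undefined, one = undefined,
                   zero = 0, ring.add = (+)\<rparr>"

text \<open>\<open>ract\<close> is a right \<open>\<H>\<close>-module structure on \<open>V\<^bsup>I\<^sub>1\<^esup>\<close> extending the action of \<open>\<H>\<^sub>K\<close>.\<close>

definition extends_hecke_K :: "('f::field \<Rightarrow> int) \<Rightarrow> ('f \<Rightarrow> 'k::field) \<Rightarrow>
    ('c::field, 'f^2^2, 'v::ab_group_add) rep \<Rightarrow> ('v \<Rightarrow> ('f, 'c) hecke \<Rightarrow> 'v) \<Rightarrow> bool" where
  "extends_hecke_K val red V ract \<longleftrightarrow>
     right_module (hecke_ring (iwahori1 val red)) (add_struct (invariants (iwahori1 val red) V)) ract \<and>
     (\<forall>\<psi> \<in> hecke_K (GL2_int val) (iwahori1 val red). \<forall>v \<in> invariants (iwahori1 val red) V.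
        ract v (hecke_K_incl (GL2_int val) (iwahori1 val red) \<psi>)
          = hecke_K_act (GL2_int val) (iwahori1 val red) V v \<psi>)"

text \<open>\<open>ract\<close> is the right \<open>\<H>\<close>-module structure \<open>M\<^sub>\<gamma>\<close> on the vector space \<open>'c \<times> 'c\<close> with basis
  \<open>v\<^sub>1 = (1, 0)\<close>, \<open>v\<^sub>2 = (0, 1)\<close>. As \<open>\<H>\<close> is generated by \<open>T\<^bsub>n_s\<^esub>\<close>, \<open>T\<^sub>\<Pi>\<close>, \<open>T\<^sub>\<Pi>\<^sup>-\<^sup>1\<close> and the idempotents
  \<open>e\<^sub>\<psi>\<close>, there is only one such structure.\<close>

definition is_M_gamma :: "('f::field \<Rightarrow> int) \<Rightarrow> ('f \<Rightarrow> 'k::{field,finite}) \<Rightarrow> 'f \<Rightarrow>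
    ('k^2^2 \<Rightarrow> 'c::field) \<Rightarrow> ('c \<times> 'c \<Rightarrow> ('f, 'c) hecke \<Rightarrow> 'c \<times> 'c) \<Rightarrow> bool" where
  "is_M_gamma val red varpi chi ract \<longleftrightarrow>
     right_module (hecke_ring (iwahori1 val red)) (add_struct UNIV) ract \<and>
     (\<forall>a x y. ract (x, y) (hecke_scalar (iwahori1 val red) a) = (a * x, a * y)) \<and>
     ract (1, 0) (hecke_T (iwahori1 val red) (Pi_mat varpi)) = (0, 1) \<and>
     ract (0, 1) (hecke_T (iwahori1 val red) (Pi_mat varpi)) = (1, 0) \<and>
     ract (1, 0) (hecke_e val red chi) = (1, 0) \<and>
     ract (0, 1) (hecke_e val red (conj_s chi)) = (0, 1) \<and>
     ract (0, 1) (hecke_T (iwahori1 val red) n_s) = (0, 0) \<and>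
     ract (1, 0) (hecke_T (iwahori1 val red) n_s) = (if self_conj chi then (-1, 0) else (0, 0))"

text \<open>\<open>L\<^sub>\<gamma> = e\<^sub>\<chi>\<H>\<^sup>1 / e\<^sub>\<chi>(T\<^sub>\<Pi>T\<^bsub>n_s\<^esub> - T\<^bsub>n_s\<^esub>T\<^sub>\<Pi>)\<H>\<^sup>1\<close>, as a set of cosets in \<open>\<H>\<^sup>1\<close>.\<close>

definition T_Pi_ideal :: "('f::field \<Rightarrow> int) \<Rightarrow> ('f \<Rightarrow> 'k::field) \<Rightarrow> 'f \<Rightarrow> ('f, 'c::field) hecke set" where
  "T_Pi_ideal val red varpi = (let R = hecke_ring (iwahori1 val red);
       T = hecke_T (iwahori1 val red) (Pi_mat varpi)
     in {((T \<otimes>\<^bsub>R\<^esub> T) \<ominus>\<^bsub>R\<^esub> \<one>\<^bsub>R\<^esub>) \<otimes>\<^bsub>R\<^esub> X | X. X \<in> carrier R})"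

definition hecke1_ring ::
  "('f::field \<Rightarrow> int) \<Rightarrow> ('f \<Rightarrow> 'k::field) \<Rightarrow> 'f \<Rightarrow> ('f, 'c::field) hecke set ring" where
  "hecke1_ring val red varpi = hecke_ring (iwahori1 val red) Quot T_Pi_ideal val red varpi"

definition hecke1_proj :: "('f::field \<Rightarrow> int) \<Rightarrow> ('f \<Rightarrow> 'k::field) \<Rightarrow> 'f \<Rightarrow>
    ('f, 'c::field) hecke \<Rightarrow> ('f, 'c) hecke set" where
  "hecke1_proj val red varpi X =
     T_Pi_ideal val red varpi +>\<^bsub>hecke_ring (iwahori1 val red)\<^esub> X"

definition L_numer :: "('f::field \<Rightarrow> int) \<Rightarrow> ('f \<Rightarrow> 'k::{field,finite}) \<Rightarrow> 'f \<Rightarrow>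
    ('k^2^2 \<Rightarrow> 'c::field) \<Rightarrow> ('f, 'c) hecke set set" where
  "L_numer val red varpi chi =
     {hecke1_proj val red varpi (hecke_e val red chi) \<otimes>\<^bsub>hecke1_ring val red varpi\<^esub> X | X.
        X \<in> carrier (hecke1_ring val red varpi)}"

definition L_denom :: "('f::field \<Rightarrow> int) \<Rightarrow> ('f \<Rightarrow> 'k::{field,finite}) \<Rightarrow> 'f \<Rightarrow>
    ('k^2^2 \<Rightarrow> 'c::field) \<Rightarrow> ('f, 'c) hecke set set" where
  "L_denom val red varpi chi = (let R = hecke_ring (iwahori1 val red);
       T = hecke_T (iwahori1 val red) (Pi_mat varpi);
       Tn = hecke_T (iwahori1 val red) n_s
     in {hecke1_proj val red varpi
           (hecke_e val red chi \<otimes>\<^bsub>R\<^esub> ((T \<otimes>\<^bsub>R\<^esub> Tn) \<ominus>\<^bsub>R\<^esub> (Tn \<otimes>\<^bsub>R\<^esub> T)))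
           \<otimes>\<^bsub>hecke1_ring val red varpi\<^esub> X | X.
        X \<in> carrier (hecke1_ring val red varpi)})"

definition L_gamma :: "('f::field \<Rightarrow> int) \<Rightarrow> ('f \<Rightarrow> 'k::{field,finite}) \<Rightarrow> 'f \<Rightarrow>
    ('k^2^2 \<Rightarrow> 'c::field) \<Rightarrow> ('f, 'c) hecke set set ring" where
  "L_gamma val red varpi chi =
     \<lparr>carrier = {L_denom val red varpi chi +>\<^bsub>hecke1_ring val red varpi\<^esub> X | X.
                   X \<in> L_numer val red varpi chi},
      monoid.mult = undefined, one = undefined,
      zero = L_denom val red varpi chi,
      ring.add = (<+>\<^bsub>hecke1_ring val red varpi\<^esub>)\<rparr>"

definition L_gamma_act :: "('f::field \<Rightarrow> int) \<Rightarrow> ('f \<Rightarrow> 'k::{field,finite}) \<Rightarrow> 'f \<Rightarrow>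
    ('k^2^2 \<Rightarrow> 'c::field) \<Rightarrow> ('f, 'c) hecke set set \<Rightarrow> ('f, 'c) hecke \<Rightarrow> ('f, 'c) hecke set set" where
  "L_gamma_act val red varpi chi S T =
     L_denom val red varpi chi <+>\<^bsub>hecke1_ring val red varpi\<^esub>
       ((\<lambda>X. X \<otimes>\<^bsub>hecke1_ring val red varpi\<^esub> hecke1_proj val red varpi T) ` S)"

section \<open>Coefficients\<close>

text \<open>The algebraically closed field \<open>'c\<close> is an algebraic closure of \<open>\<bold>F\<^sub>p\<close>: it has characteristic
  \<open>p\<close> and is algebraic over its prime field, the image of the integers.\<close>

definition alg_closure_of_Fp :: "nat \<Rightarrow> 'c::alg_closed_field itself \<Rightarrow> bool" where
  "alg_closure_of_Fp p _ \<longleftrightarrow> prime p \<and> CHAR('c) = p \<and>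
     (\<forall>x :: 'c. \<exists>P. P \<noteq> 0 \<and> (\<forall>i. coeff P i \<in> range of_int) \<and> poly P x = 0)"

end

theory Submission
  imports Defs "HOL-Library.Groups_Big_Fun"
begin

text \<open>Since \<open>q = 0\<close> in the coefficient field, averaging functions on \<open>I\<^sub>1\<close>-double cosets over \<open>H\<close> and over the powers
  of \<open>\<varpi>\<close> yields linear functionals on \<open>\<H>\<close> whose behaviour under left multiplication by \<open>T\<^sub>\<Pi>\<close> and \<open>T\<^sub>n\<close>
  involves only double cosets of length at most one. For \<open>\<chi> = \<chi>\<^sup>s\<close> four of them are the matrix coefficients of
  \<open>M\<^sub>\<gamma>\<close>; for \<open>\<chi> \<noteq> \<chi>\<^sup>s\<close> they show that the classes of \<open>1, T\<^sub>\<Pi>, T\<^sub>n, T\<^sub>\<Pi> T\<^sub>n\<close> are linearly independent in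
  \<open>L\<^sub>\<gamma>\<close>, while the Bruhat decomposition shows that they span. On the side of \<open>\<Gamma>\<close>, an eigenvector of \<open>H\<close> and
  \<open>T\<^sub>n\<close> in the \<open>U\<close>-invariants generates a subrepresentation that is cyclic over the cyclic group \<open>U\<close> and so has
  one-dimensional \<open>U\<close>-invariants; as the envelope is essential, all such eigenvectors lie on one line \<open>\<langle>e\<rangle>\<close>. The
  relation for \<open>T\<^sub>n\<^sup>2\<close> then leaves only \<open>\<langle>e\<rangle>\<close> if \<open>\<chi> = \<chi>\<^sup>s\<close>, and \<open>\<langle>e, w\<rangle>\<close> with \<open>w T\<^sub>n = e\<close> if
  \<open>\<chi> \<noteq> \<chi>\<^sup>s\<close>, where injectivity produces \<open>w\<close>.\<close>

section \<open>Two by two matrices\<close>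

text \<open>The proof establishes that \<open>\<H>\<close> is generated by the listed operators, but
  no presentation by relations. An action therefore cannot be defined on generators alone; it must
  be given on every element at once. For \<open>M_\<gamma>\<close> the matrix entries are explicit
  functionals of the element, and generation is used only to check that they multiply correctly. For
  \<open>L_\<gamma>\<close> the module is there from the start and the danger is collapse: the
  relations bound its dimension above by four, and only functionals vanishing on all relations can
  bound it below. Summing over powers of \<open>\<varpi>\<close> reflects
  \<open>T_\<Pi>\<^sup>2 = 1\<close> in both modules. Extending the action is then no computation.
  Invariants and module are matched through bases and the action is carried over; only elements
  supported on \<open>K\<close> need comparing, and on both sides these act through their averages
  over \<open>H\<close> and \<open>n_s H\<close>. The equality \<open>q = p\<close> enters on the
  side of \<Gamma>: there \<open>U\<close> is generated by one element \<open>u\<close> with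
  \<open>(u - 1)^p = 0\<close>, so a module generated over \<open>U\<close> by a single nonzero
  vector has just one line of invariants. The same equality embeds the residue field in the
  coefficients, which diagonalises \<open>H\<close>.\<close>

lemma mat2_nth [simp]:
  "mat2 a b c d $ 1 $ 1 = a" "mat2 a b c d $ 1 $ 2 = b"
  "mat2 a b c d $ 2 $ 1 = c" "mat2 a b c d $ 2 $ 2 = d"
  by (simp_all add: mat2_def)

lemma mat2_eta: "mat2 (A $ 1 $ 1) (A $ 1 $ 2) (A $ 2 $ 1) (A $ 2 $ 2) = A"
  by (simp add: vec_eq_iff forall_2)

lemma mat2_cases [cases type]: obtains a b c d where "A = mat2 a b c d"
  by (metis mat2_eta)

lemma mat2_eq_iff [simp]:
  "mat2 a b c d = mat2 a' b' c' d' \<longleftrightarrow> a = a' \<and> b = b' \<and> c = c' \<and> d = d'"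
  by (metis mat2_nth)

lemma mat2_mult [simp]:
  fixes a :: "'a::semiring_1"
  shows "mat2 a b c d ** mat2 a' b' c' d' =
    mat2 (a * a' + b * c') (a * b' + b * d') (c * a' + d * c') (c * b' + d * d')"
  by (simp add: vec_eq_iff forall_2 matrix_matrix_mult_def sum_2)

lemma mat_1_eq_mat2: "mat 1 = mat2 1 0 0 1"
  by (simp add: vec_eq_iff forall_2 mat_def)

lemma det_mat2 [simp]: "det (mat2 a b c d) = a * d - b * c"
  by (simp add: det_2)

lemma trace_mat2 [simp]: "trace (mat2 a b c d) = a + d"
  by (simp add: trace_def sum_2)

lemma GL2_mat2_iff: "mat2 a b c d \<in> carrier GL2 \<longleftrightarrow> a * d - b * c \<noteq> 0"
  by (simp add: GL2_def invertible_det_nz)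

lemma GL2_iff: "A \<in> carrier GL2 \<longleftrightarrow> det A \<noteq> 0"
  by (simp add: GL2_def invertible_det_nz)

lemma GL2_simps [simp]: "x \<otimes>\<^bsub>GL2\<^esub> y = x ** y" "\<one>\<^bsub>GL2\<^esub> = mat 1"
  by (simp_all add: GL2_def)

lemma GL2_mult [simp]: "A \<in> carrier GL2 \<Longrightarrow> B \<in> carrier GL2 \<Longrightarrow> A ** B \<in> carrier GL2"
  by (simp add: GL2_iff det_mul)

lemma GL2_one [simp]: "mat 1 \<in> carrier GL2"
  by (simp add: GL2_iff)

lemma mat2_left_inverse:
  fixes a :: "'a::field"
  assumes "a * d - b * c \<noteq> 0"
  defines "D \<equiv> a * d - b * c"
  shows "mat2 (d / D) (- b / D) (- c / D) (a / D) ** mat2 a b c d = mat 1"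
proof -
  have D: "D \<noteq> 0" using assms by simp
  have "d / D * a + - b / D * c = 1" "- c / D * b + a / D * d = 1"
    using D by (simp_all add: field_simps) (simp_all add: D_def algebra_simps)
  then show ?thesis by (simp add: mat_1_eq_mat2)
qed

lemma group_GL2 [simp]: "group GL2"
proof (rule groupI)
  fix x :: "'a^2^2" assume x: "x \<in> carrier GL2"
  then show "\<exists>y\<in>carrier GL2. y \<otimes>\<^bsub>GL2\<^esub> x = \<one>\<^bsub>GL2\<^esub>"
    by (auto simp: GL2_def invertible_def)
qed (auto simp: matrix_mul_assoc)

lemma inv_GL2_unique: "A \<in> carrier GL2 \<Longrightarrow> B ** A = mat 1 \<Longrightarrow> inv\<^bsub>GL2\<^esub> A = B"
proof -
  assume A: "A \<in> carrier GL2" and B: "B ** A = mat 1"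
  have "B \<in> carrier GL2"
    using B by (metis GL2_iff det_I det_mul mult_zero_left zero_neq_one)
  then show ?thesis
    using A B group.inv_equality[OF group_GL2] by (metis GL2_simps)
qed

lemma inv_GL2_mat2:
  "a * d - b * c \<noteq> 0 \<Longrightarrow>
    inv\<^bsub>GL2\<^esub> (mat2 a b c d) = mat2 (d / (a * d - b * c)) (- b / (a * d - b * c))
      (- c / (a * d - b * c)) (a / (a * d - b * c))"
  using mat2_left_inverse by (intro inv_GL2_unique) (auto simp: GL2_mat2_iff)

lemma inv_GL2_closed [simp]: "A \<in> carrier GL2 \<Longrightarrow> inv\<^bsub>GL2\<^esub> A \<in> carrier GL2"
  using group.inv_closed[OF group_GL2] .

lemma inv_GL2_cancel [simp]:
  "A \<in> carrier GL2 \<Longrightarrow> A ** inv\<^bsub>GL2\<^esub> A = mat 1"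
  "A \<in> carrier GL2 \<Longrightarrow> inv\<^bsub>GL2\<^esub> A ** A = mat 1"
  "A \<in> carrier GL2 \<Longrightarrow> X ** A ** inv\<^bsub>GL2\<^esub> A = X"
  "A \<in> carrier GL2 \<Longrightarrow> X ** inv\<^bsub>GL2\<^esub> A ** A = X"
  using group.r_inv[OF group_GL2, of A] group.l_inv[OF group_GL2, of A]
  by (simp_all flip: matrix_mul_assoc)

lemma inv_GL2_mult:
  "A \<in> carrier GL2 \<Longrightarrow> B \<in> carrier GL2 \<Longrightarrow>
    inv\<^bsub>GL2\<^esub> (A ** B) = inv\<^bsub>GL2\<^esub> B ** inv\<^bsub>GL2\<^esub> A"
  using group.inv_mult_group[OF group_GL2] by (metis GL2_simps(1))

lemma inv_GL2_inv [simp]: "A \<in> carrier GL2 \<Longrightarrow> inv\<^bsub>GL2\<^esub> (inv\<^bsub>GL2\<^esub> A) = A"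
  using group.inv_inv[OF group_GL2] .

lemma inv_GL2_one [simp]: "inv\<^bsub>GL2\<^esub> (mat 1) = mat 1"
  by (rule inv_GL2_unique) auto

section \<open>The valuation ring and its subgroups\<close>

context nonarch_local_field
begin

abbreviation \<O> :: "'f set" where "\<O> \<equiv> val_ring val"
abbreviation K :: "('f^2^2) set" where "K \<equiv> GL2_int val"
abbreviation L :: "('f^2^2) set" where "L \<equiv> iwahori1 val red"

lemma val_one [simp]: "val 1 = 0"
  using val_mult[of 1 1] by simp

lemma val_minus [simp]: "val (- x) = val x"
proof (cases "x = 0")
  case False
  have "val (- 1) = 0"
    using val_mult[of "-1" "-1"] by simp
  then show ?thesis
    using val_mult[of "-1" x] False by simp
qed simp

lemma val_inverse: "x \<noteq> 0 \<Longrightarrow> val (inverse x) = - val x"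
  using val_mult[of x "inverse x"] by simp

lemma val_divide: "x \<noteq> 0 \<Longrightarrow> y \<noteq> 0 \<Longrightarrow> val (x / y) = val x - val y"
  by (simp add: divide_inverse val_mult val_inverse)

lemma val_powi: "val (varpi powi j) = j"
proof -
  have *: "val (varpi ^ m) = int m" for m
    by (induction m) (auto simp: val_mult uniformiser)
  show ?thesis
    using * uniformiser by (simp add: power_int_def power_inverse val_inverse)
qed

lemma varpi_nz [simp]: "varpi \<noteq> 0" and val_varpi [simp]: "val varpi = 1"
  using uniformiser by auto

lemma OO_iff: "x \<in> \<O> \<longleftrightarrow> x = 0 \<or> 0 \<le> val x"
  by (simp add: val_ring_def val_ge_def)

lemma OO_zero [simp]: "0 \<in> \<O>" and OO_one [simp]: "1 \<in> \<O>"
  by (auto simp: OO_iff)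

lemma OO_add [simp]: "x \<in> \<O> \<Longrightarrow> y \<in> \<O> \<Longrightarrow> x + y \<in> \<O>"
  using val_add by (simp add: val_ring_def)

lemma OO_minus [simp]: "- x \<in> \<O> \<longleftrightarrow> x \<in> \<O>"
  by (auto simp: OO_iff)

lemma OO_diff [simp]: "x \<in> \<O> \<Longrightarrow> y \<in> \<O> \<Longrightarrow> x - y \<in> \<O>"
  using OO_add[of x "- y"] by simp

lemma OO_mult [simp]: "x \<in> \<O> \<Longrightarrow> y \<in> \<O> \<Longrightarrow> x * y \<in> \<O>"
  by (cases "x = 0 \<or> y = 0") (auto simp: OO_iff val_mult)

lemma red_zero [simp]: "red 0 = 0"
proof -
  have "red 0 + red 0 = red 0 + 0"
    using red_add[of 0 0] by (metis OO_zero add.right_neutral)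
  then show ?thesis by (simp only: add_left_cancel)
qed

lemma red_minus [simp]: "x \<in> \<O> \<Longrightarrow> red (- x) = - red x"
  using red_add[of x "- x"] by (simp add: eq_neg_iff_add_eq_0 add.commute)

lemma red_diff [simp]: "x \<in> \<O> \<Longrightarrow> y \<in> \<O> \<Longrightarrow> red (x - y) = red x - red y"
  using red_add[of x "- y"] by simp

declare red_add [simp] red_mult [simp] red_one [simp]

lemma red_eq_0_iff: "x \<in> \<O> \<Longrightarrow> red x = 0 \<longleftrightarrow> x = 0 \<or> 1 \<le> val x"
  by (simp add: red_ker max_ideal_def val_ge_def)

lemma unit_val: "x \<in> \<O> \<Longrightarrow> red x \<noteq> 0 \<Longrightarrow> val x = 0"
  by (auto simp: red_eq_0_iff OO_iff)

lemma unit_nz: "x \<in> \<O> \<Longrightarrow> red x \<noteq> 0 \<Longrightarrow> x \<noteq> 0"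
  by auto

lemma unit_iff: "x \<noteq> 0 \<Longrightarrow> val x = 0 \<Longrightarrow> x \<in> \<O> \<and> red x \<noteq> 0"
  by (auto simp: red_eq_0_iff OO_iff)

lemma unit_inverse: "x \<in> \<O> \<Longrightarrow> red x \<noteq> 0 \<Longrightarrow> inverse x \<in> \<O>"
proof -
  assume x: "x \<in> \<O>" "red x \<noteq> 0"
  have "val (inverse x) = 0" using val_inverse[OF unit_nz[OF x]] unit_val[OF x] by simp
  then show ?thesis unfolding OO_iff by simp
qed

lemma red_inverse: "x \<in> \<O> \<Longrightarrow> red x \<noteq> 0 \<Longrightarrow> red (inverse x) = inverse (red x)"
proof -
  assume x: "x \<in> \<O>" "red x \<noteq> 0"
  have "red x * red (inverse x) = red (x * inverse x)"
    using x unit_inverse[OF x] by (rule_tac red_mult[symmetric])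
  also have "x * inverse x = 1" using unit_nz[OF x] by simp
  finally have "red x * red (inverse x) = 1" by simp
  then show ?thesis by (rule inverse_unique[symmetric])
qed

lemma unit_divide: "x \<in> \<O> \<Longrightarrow> y \<in> \<O> \<Longrightarrow> red y \<noteq> 0 \<Longrightarrow> x / y \<in> \<O>"
  by (simp add: divide_inverse unit_inverse)

lemma red_divide: "x \<in> \<O> \<Longrightarrow> y \<in> \<O> \<Longrightarrow> red y \<noteq> 0 \<Longrightarrow> red (x / y) = red x / red y"
  by (simp add: divide_inverse unit_inverse red_inverse)

lemma varpi_OO [simp]: "varpi \<in> \<O>" and red_varpi [simp]: "red varpi = 0"
  using uniformiser red_eq_0_iff[of varpi] by (auto simp: OO_iff)

lemma div_varpi_OO: "x \<in> \<O> \<Longrightarrow> red x = 0 \<Longrightarrow> x / varpi \<in> \<O>"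
  using uniformiser by (cases "x = 0") (auto simp: OO_iff red_eq_0_iff val_divide)

text \<open>The determinant of the inverse matrix is the inverse of the determinant; if both
  matrices are integral, the determinant is a unit. Conversely, Cramer's formula only divides by a
  unit.\<close>

lemma K_mat2_iff:
  "mat2 a b c d \<in> K \<longleftrightarrow>
    a \<in> \<O> \<and> b \<in> \<O> \<and> c \<in> \<O> \<and> d \<in> \<O> \<and> red (a * d - b * c) \<noteq> 0"
  (is "?l \<longleftrightarrow> ?r")
proof
  assume l: ?l
  let ?D = "a * d - b * c"
  have D: "?D \<noteq> 0" using l by (simp add: GL2_int_def GL2_mat2_iff)
  have O: "a \<in> \<O>" "b \<in> \<O>" "c \<in> \<O>" "d \<in> \<O>"
    using l by (simp_all add: GL2_int_def forall_2)
  have I: "d / ?D \<in> \<O>" "- b / ?D \<in> \<O>" "- c / ?D \<in> \<O>" "a / ?D \<in> \<O>"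
    using l D by (simp_all add: GL2_int_def forall_2 inv_GL2_mat2)
  have DO: "?D \<in> \<O>" using O by simp
  have "1 / ?D = (a / ?D) * (d / ?D) - (- b / ?D) * (- c / ?D)"
  proof -
    have "(a / ?D) * (d / ?D) - (- b / ?D) * (- c / ?D) = ?D / (?D * ?D)"
      by (simp add: diff_divide_distrib)
    then show ?thesis using D by simp
  qed
  then have "1 / ?D \<in> \<O>" using I by (metis OO_diff OO_mult)
  then have "red ?D * red (1 / ?D) = 1"
    using DO D by (metis mult.commute nonzero_eq_divide_eq red_mult red_one)
  then show ?r using O by auto
next
  assume r: ?r
  let ?D = "a * d - b * c"
  have DO: "?D \<in> \<O>" using r by simp
  have D: "?D \<noteq> 0" using r by auto
  show ?l
    using r DO D by (simp add: GL2_int_def GL2_mat2_iff forall_2 inv_GL2_mat2 unit_divide del: red_diff red_mult)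
qed

lemma red_mat_mat2 [simp]: "red_mat red (mat2 a b c d) = mat2 (red a) (red b) (red c) (red d)"
  by (simp add: red_mat_def vec_eq_iff forall_2)

lemma unip2_mat2_iff: "mat2 a b c d \<in> unip2 \<longleftrightarrow> a = 1 \<and> d = 1 \<and> c = 0"
  by (auto simp: unip2_def GL2_mat2_iff)

lemma L_mat2_iff:
  "mat2 a b c d \<in> L \<longleftrightarrow>
    a \<in> \<O> \<and> b \<in> \<O> \<and> c \<in> \<O> \<and> d \<in> \<O> \<and> red a = 1 \<and> red d = 1 \<and> red c = 0"
  by (auto simp: iwahori1_def K_mat2_iff unip2_mat2_iff)

lemma K_inv [simp]: "x \<in> K \<Longrightarrow> inv\<^bsub>GL2\<^esub> x \<in> K"
  by (simp add: GL2_int_def)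

lemma L_subset_K: "L \<subseteq> K" and K_subset_GL2: "K \<subseteq> carrier GL2"
  by (auto simp: iwahori1_def GL2_int_def)

lemma L_GL2 [simp]: "x \<in> L \<Longrightarrow> x \<in> carrier GL2" and K_GL2 [simp]: "x \<in> K \<Longrightarrow> x \<in> carrier GL2"
  using L_subset_K K_subset_GL2 by auto

lemma K_mult [simp]: "x \<in> K \<Longrightarrow> y \<in> K \<Longrightarrow> x ** y \<in> K"
proof -
  assume x: "x \<in> K" and y: "y \<in> K"
  obtain a b c d where X: "x = mat2 a b c d" by (rule mat2_cases)
  obtain a' b' c' d' where Y: "y = mat2 a' b' c' d'" by (rule mat2_cases)
  let ?D = "a * d - b * c" and ?D' = "a' * d' - b' * c'"
  have O: "a \<in> \<O>" "b \<in> \<O>" "c \<in> \<O>" "d \<in> \<O>" "red ?D \<noteq> 0"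
    "a' \<in> \<O>" "b' \<in> \<O>" "c' \<in> \<O>" "d' \<in> \<O>" "red ?D' \<noteq> 0"
    using x y by (auto simp: X Y K_mat2_iff)
  have "(a * a' + b * c') * (c * b' + d * d') - (a * b' + b * d') * (c * a' + d * c') = ?D * ?D'"
    by (simp add: algebra_simps)
  moreover have "red (?D * ?D') \<noteq> 0"
    using O by (metis OO_diff OO_mult mult_eq_0_iff red_mult)
  ultimately show ?thesis
    using O unfolding X Y mat2_mult K_mat2_iff by (metis OO_add OO_mult)
qed

lemma red_mat_mult: "x \<in> K \<Longrightarrow> y \<in> K \<Longrightarrow> red_mat red (x ** y) = red_mat red x ** red_mat red y"
  by (cases x; cases y) (auto simp: K_mat2_iff)

lemma red_mat_one [simp]: "red_mat red (mat 1) = mat 1"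
  by (simp add: mat_1_eq_mat2)

lemma red_mat_GL2 [simp]: "x \<in> K \<Longrightarrow> red_mat red x \<in> carrier GL2"
  by (cases x) (auto simp: K_mat2_iff GL2_mat2_iff)

lemma red_mat_inv: "x \<in> K \<Longrightarrow> red_mat red (inv\<^bsub>GL2\<^esub> x) = inv\<^bsub>GL2\<^esub> (red_mat red x)"
  by (rule inv_GL2_unique[symmetric]) (auto simp flip: red_mat_mult)

lemma L_mult [simp]: "x \<in> L \<Longrightarrow> y \<in> L \<Longrightarrow> x ** y \<in> L"
  by (cases x; cases y) (auto simp: L_mat2_iff)

lemma L_one [simp]: "mat 1 \<in> L"
  by (simp add: mat_1_eq_mat2 L_mat2_iff)

lemma L_inv [simp]: "x \<in> L \<Longrightarrow> inv\<^bsub>GL2\<^esub> x \<in> L"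
proof (cases x)
  fix a b c d assume x: "x \<in> L" and X: "x = mat2 a b c d"
  have "red (a * d - b * c) = 1" "a * d - b * c \<in> \<O>"
    using x by (auto simp: X L_mat2_iff)
  moreover from this have "a * d - b * c \<noteq> 0" by auto
  ultimately show ?thesis
    using x unfolding X by (simp add: inv_GL2_mat2 L_mat2_iff unit_divide red_divide del: red_diff)
qed

lemma subgroup_L: "subgroup L GL2"
  by (rule subgroup.intro) (auto simp: subsetI)

end

section \<open>The Hecke ring of a subgroup\<close>

lemma r_coset_mult: "(C #>\<^bsub>GL2\<^esub> a) #>\<^bsub>GL2\<^esub> b = C #>\<^bsub>GL2\<^esub> (a ** b)"
  by (force simp: r_coset_def matrix_mul_assoc)

lemma r_coset_one [simp]: "C #>\<^bsub>GL2\<^esub> mat 1 = C"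
  by (force simp: r_coset_def)

lemma r_coset_inv [simp]:
  "g \<in> carrier GL2 \<Longrightarrow> C #>\<^bsub>GL2\<^esub> (x ** g) #>\<^bsub>GL2\<^esub> inv\<^bsub>GL2\<^esub> g = C #>\<^bsub>GL2\<^esub> x"
  by (simp add: r_coset_mult)

text \<open>The formal part of the theory is valid for every subgroup of \<open>GL2\<close>;
  arithmetic first enters with the generators.\<close>

locale GL2_subgroup =
  fixes L :: "('f::field^2^2) set"
  assumes subgroup: "subgroup L GL2"
begin

abbreviation cs :: "'f^2^2 \<Rightarrow> ('f^2^2) set" where "cs g \<equiv> L #>\<^bsub>GL2\<^esub> g"
abbreviation cosets :: "('f^2^2) set set" where "cosets \<equiv> rcosets\<^bsub>GL2\<^esub> L"
abbreviation rep_of :: "('f^2^2) set \<Rightarrow> 'f^2^2" where "rep_of C \<equiv> SOME x. x \<in> C"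
abbreviation HR :: "('f, 'c::field) hecke ring" where "HR \<equiv> hecke_ring L"

definition delta :: "('f^2^2) set \<Rightarrow> 'c::field" where
  "delta = (\<lambda>D. if D = L then 1 else 0)"

lemma L_carrier [simp]: "l \<in> L \<Longrightarrow> l \<in> carrier GL2"
  using subgroup.subset[OF subgroup] by auto

lemma L_closed [simp]:
  "mat 1 \<in> L" "l \<in> L \<Longrightarrow> l' \<in> L \<Longrightarrow> l ** l' \<in> L" "l \<in> L \<Longrightarrow> inv\<^bsub>GL2\<^esub> l \<in> L"
  using subgroup.one_closed[OF subgroup] subgroup.m_closed[OF subgroup]
    subgroup.m_inv_closed[OF subgroup] by auto

lemma mem_cs: "x \<in> cs g \<longleftrightarrow> (\<exists>l\<in>L. x = l ** g)"
  by (auto simp: r_coset_def)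

lemma cs_self: "g \<in> cs g"
  by (auto simp: mem_cs intro: bexI[of _ "mat 1"])

lemma cs_left [simp]: "l \<in> L \<Longrightarrow> cs (l ** g) = cs g"
proof -
  assume l: "l \<in> L"
  have "L #>\<^bsub>GL2\<^esub> l = L"
    using l subgroup group.coset_join2[OF group_GL2, of l L] by simp
  then show ?thesis by (metis r_coset_mult)
qed

lemma cs_eq_L: "l \<in> L \<Longrightarrow> cs l = L"
  using cs_left[of l "mat 1"] by simp

lemma cs_eq_iff:
  assumes "g \<in> carrier GL2" "h \<in> carrier GL2"
  shows "cs g = cs h \<longleftrightarrow> g ** inv\<^bsub>GL2\<^esub> h \<in> L"
proof
  assume "cs g = cs h"
  then obtain l where "l \<in> L" "g = l ** h" using cs_self[of g] by (auto simp: mem_cs)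
  then show "g ** inv\<^bsub>GL2\<^esub> h \<in> L" using assms by simp
next
  assume "g ** inv\<^bsub>GL2\<^esub> h \<in> L"
  then show "cs g = cs h" using cs_left[of "g ** inv\<^bsub>GL2\<^esub> h" h] assms by simp
qed

lemma cs_eq_L_iff: "g \<in> carrier GL2 \<Longrightarrow> cs g = L \<longleftrightarrow> g \<in> L"
  using cs_eq_iff[of g "mat 1"] by simp

lemma cs_in [simp]: "g \<in> carrier GL2 \<Longrightarrow> cs g \<in> cosets"
  by (auto simp: RCOSETS_def)

lemma L_in_cosets [simp]: "L \<in> cosets"
  using cs_in[of "mat 1"] by simp

lemma cosetsE:
  assumes "C \<in> cosets" obtains g where "g \<in> carrier GL2" "C = cs g"
  using assms by (auto simp: RCOSETS_def)

lemma mem_cs_eq: "g \<in> carrier GL2 \<Longrightarrow> x \<in> cs g \<Longrightarrow> x \<in> carrier GL2 \<and> cs x = cs g"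
  by (auto simp: mem_cs)

lemma rep_of:
  assumes "C \<in> cosets"
  shows "rep_of C \<in> carrier GL2" "cs (rep_of C) = C" "rep_of C \<in> C"
proof -
  obtain g where g: "g \<in> carrier GL2" "C = cs g" using assms by (rule cosetsE)
  show "rep_of C \<in> C" using cs_self[of g] g by (auto intro: someI)
  then show "rep_of C \<in> carrier GL2" "cs (rep_of C) = C" using mem_cs_eq[of g "rep_of C"] g by auto
qed

lemma coset_shift: "C \<in> cosets \<Longrightarrow> g \<in> carrier GL2 \<Longrightarrow> C #>\<^bsub>GL2\<^esub> g \<in> cosets"
  by (elim cosetsE) (simp add: r_coset_mult)

lemma coset_shift_iff: "g \<in> carrier GL2 \<Longrightarrow> C #>\<^bsub>GL2\<^esub> g \<in> cosets \<longleftrightarrow> C \<in> cosets"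
  using coset_shift[of C g] coset_shift[of "C #>\<^bsub>GL2\<^esub> g" "inv\<^bsub>GL2\<^esub> g"]
  by (auto simp: r_coset_mult)

lemma cIndI:
  assumes "\<And>C. f C \<noteq> 0 \<Longrightarrow> C \<in> cosets" "finite S" "\<And>C. f C \<noteq> 0 \<Longrightarrow> C \<in> S"
  shows "f \<in> cInd L"
  using assms by (auto simp: cInd_def intro: finite_subset[of _ S])

lemma cIndD: "f \<in> cInd L \<Longrightarrow> f C \<noteq> 0 \<Longrightarrow> C \<in> cosets" and
  cInd_finite: "f \<in> cInd L \<Longrightarrow> finite {C. f C \<noteq> 0}"
  by (auto simp: cInd_def)

lemma cInd_outside: "f \<in> cInd L \<Longrightarrow> C \<notin> cosets \<Longrightarrow> f C = 0"
  using cIndD by blast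

lemma cInd_zero [simp]: "0 \<in> cInd L" "(\<lambda>C. 0) \<in> cInd L"
  by (auto simp: cInd_def)

lemma cInd_add [simp]:
  assumes "f \<in> cInd L" "f' \<in> cInd L" shows "f + f' \<in> cInd L"
  using assms cIndD[of f] cIndD[of f']
  by (intro cIndI[where S = "{C. f C \<noteq> 0} \<union> {C. f' C \<noteq> 0}"]) (auto simp: cInd_finite; force)+

lemma cInd_scale [simp]: "f \<in> cInd L \<Longrightarrow> (\<lambda>C. a * f C) \<in> cInd L"
  using cIndD[of f] by (intro cIndI[where S = "{C. f C \<noteq> 0}"]) (auto simp: cInd_finite)

lemma cInd_lincomb:
  "finite S \<Longrightarrow> (\<And>i. i \<in> S \<Longrightarrow> f i \<in> cInd L) \<Longrightarrow> (\<lambda>C. \<Sum>i\<in>S. a i * f i C) \<in> cInd L"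
proof (induction S rule: finite_induct)
  case (insert j S)
  have "(\<lambda>C. \<Sum>i\<in>insert j S. a i * f i C) = (\<lambda>C. a j * f j C) + (\<lambda>C. \<Sum>i\<in>S. a i * f i C)"
    using insert by (auto simp: fun_eq_iff)
  then show ?case using insert by (simp del: plus_fun_apply)
qed auto

lemma rtrans_cInd [simp]:
  assumes "f \<in> cInd L" "g \<in> carrier GL2" shows "rtrans g f \<in> cInd L"
proof (rule cIndI[where S = "(\<lambda>C. C #>\<^bsub>GL2\<^esub> inv\<^bsub>GL2\<^esub> g) ` {C. f C \<noteq> 0}"])
  fix C assume C: "rtrans g f C \<noteq> 0"
  then show "C \<in> cosets" using assms cIndD coset_shift_iff by (auto simp: rtrans_def)
  have "C = (C #>\<^bsub>GL2\<^esub> g) #>\<^bsub>GL2\<^esub> inv\<^bsub>GL2\<^esub> g" using assms by (simp add: r_coset_mult)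
  then show "C \<in> (\<lambda>C. C #>\<^bsub>GL2\<^esub> inv\<^bsub>GL2\<^esub> g) ` {C. f C \<noteq> 0}" using C by (auto simp: rtrans_def)
qed (use assms cInd_finite in auto)

lemma delta_cInd [simp]: "delta \<in> cInd L"
  by (rule cIndI[where S = "{L}"]) (auto simp: delta_def split: if_splits)

lemma shift_eq_L_iff:
  "g \<in> carrier GL2 \<Longrightarrow> C #>\<^bsub>GL2\<^esub> inv\<^bsub>GL2\<^esub> g = L \<longleftrightarrow> C = cs g"
proof
  assume g: "g \<in> carrier GL2" and "C #>\<^bsub>GL2\<^esub> inv\<^bsub>GL2\<^esub> g = L"
  then have "(C #>\<^bsub>GL2\<^esub> inv\<^bsub>GL2\<^esub> g) #>\<^bsub>GL2\<^esub> g = cs g" by simp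
  then show "C = cs g" using g by (simp add: r_coset_mult)
qed (simp add: r_coset_mult)

lemma rtrans_inv_delta: "g \<in> carrier GL2 \<Longrightarrow> rtrans (inv\<^bsub>GL2\<^esub> g) delta C = (if C = cs g then 1 else 0)"
  by (simp add: rtrans_def delta_def shift_eq_L_iff)

lemma rtrans_L_delta [simp]:
  assumes "l \<in> L" shows "rtrans l delta = (delta :: _ \<Rightarrow> 'c::field)"
proof
  fix C show "rtrans l delta C = (delta C :: 'c)"
    using rtrans_inv_delta[of "inv\<^bsub>GL2\<^esub> l" C, where 'a = 'c] assms
    by (simp add: cs_eq_L) (simp add: delta_def)
qed

text \<open>Every coset indicator is a translate of \<open>delta\<close>, so \<open>delta\<close>
  generates the induced representation. A finite superset \<open>S\<close> of the support is allowed
  because the support changes under sums and scalars.\<close>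

lemma cInd_expand:
  assumes f: "f \<in> cInd L" and S: "finite S" "\<And>C. f C \<noteq> 0 \<Longrightarrow> C \<in> S" "S \<subseteq> cosets"
  shows "f = (\<lambda>C. \<Sum>D\<in>S. f D * rtrans (inv\<^bsub>GL2\<^esub> (rep_of D)) delta C)"
proof
  fix C
  have "(\<Sum>D\<in>S. f D * rtrans (inv\<^bsub>GL2\<^esub> (rep_of D)) delta C) = (\<Sum>D\<in>S. if C = D then f D else 0)"
  proof (intro sum.cong refl)
    fix D assume "D \<in> S"
    then have "D \<in> cosets" using S by auto
    then show "f D * rtrans (inv\<^bsub>GL2\<^esub> (rep_of D)) delta C = (if C = D then f D else 0)"
      using rep_of[of D] by (simp add: rtrans_inv_delta)
  qed
  also have "\<dots> = f C" using S by (auto simp: sum.delta')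
  finally show "f C = (\<Sum>D\<in>S. f D * rtrans (inv\<^bsub>GL2\<^esub> (rep_of D)) delta C)" by simp
qed

lemma HR_carrierI:
  assumes "\<And>f. f \<in> cInd L \<Longrightarrow> x f \<in> cInd L" "\<And>f. f \<notin> cInd L \<Longrightarrow> x f = 0"
    "\<And>f f'. f \<in> cInd L \<Longrightarrow> f' \<in> cInd L \<Longrightarrow> x (f + f') = x f + x f'"
    "\<And>a f. f \<in> cInd L \<Longrightarrow> x (\<lambda>C. a * f C) = (\<lambda>C. a * x f C)"
    "\<And>g f. g \<in> carrier GL2 \<Longrightarrow> f \<in> cInd L \<Longrightarrow> x (rtrans g f) = rtrans g (x f)"
  shows "x \<in> carrier HR"
  using assms by (auto simp: hecke_ring_def equiv_End_def)

lemma HR_carrierD: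
  assumes "x \<in> carrier HR"
  shows "f \<in> cInd L \<Longrightarrow> x f \<in> cInd L" "f \<notin> cInd L \<Longrightarrow> x f = 0"
    "f \<in> cInd L \<Longrightarrow> f' \<in> cInd L \<Longrightarrow> x (f + f') = x f + x f'"
    "f \<in> cInd L \<Longrightarrow> x (\<lambda>C. a * f C) = (\<lambda>C. a * x f C)"
    "g \<in> carrier GL2 \<Longrightarrow> f \<in> cInd L \<Longrightarrow> x (rtrans g f) = rtrans g (x f)"
  using assms by (auto simp: hecke_ring_def equiv_End_def)

lemma HR_zero: "x \<in> carrier HR \<Longrightarrow> x 0 = 0"
  using HR_carrierD(3)[of x 0 0] by simp

lemma HR_simps [simp]:
  "x \<otimes>\<^bsub>HR\<^esub> y = x \<circ> y" "x \<oplus>\<^bsub>HR\<^esub> y = x + y" "\<zero>\<^bsub>HR\<^esub> = 0"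
  "\<one>\<^bsub>HR\<^esub> = hecke_scalar L 1"
  by (simp_all add: hecke_ring_def)

lemma hecke_scalar_closed [simp]: "hecke_scalar L a \<in> carrier HR"
  by (rule HR_carrierI)
    (auto simp: hecke_scalar_def fun_eq_iff rtrans_def algebra_simps dest: rtrans_cInd)

lemma HR_add_closed [simp]:
  assumes "x \<in> carrier HR" "y \<in> carrier HR" shows "x + y \<in> carrier HR"
  using HR_carrierD[OF assms(1)] HR_carrierD[OF assms(2)]
  by (intro HR_carrierI) (auto simp: fun_eq_iff algebra_simps rtrans_def)

lemma HR_mult_closed [simp]:
  assumes "x \<in> carrier HR" "y \<in> carrier HR" shows "x \<circ> y \<in> carrier HR"
  using HR_carrierD[OF assms(1)] HR_carrierD[OF assms(2)] HR_zero[OF assms(1)]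
  by (intro HR_carrierI) auto

lemma HR_zero_closed [simp]: "0 \<in> carrier HR"
  by (rule HR_carrierI) (auto simp: fun_eq_iff rtrans_def)

lemma scalar_comp_apply:
  "x \<in> carrier HR \<Longrightarrow> (hecke_scalar L a \<circ> x) f C = a * x f C"
  using HR_carrierD(1,2)[of x f] by (cases "f \<in> cInd L") (auto simp: hecke_scalar_def)

lemma ring_HR: "ring (HR :: ('f, 'c::field) hecke ring)"
proof (rule ringI)
  show "abelian_group (HR :: ('f, 'c) hecke ring)"
  proof (rule abelian_groupI)
    fix x :: "('f, 'c) hecke" assume x: "x \<in> carrier HR"
    show "\<exists>y\<in>carrier HR. y \<oplus>\<^bsub>HR\<^esub> x = \<zero>\<^bsub>HR\<^esub>"
      using x scalar_comp_apply[of x "-1"]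
      by (intro bexI[of _ "hecke_scalar L (-1) \<circ> x"]) (auto simp: fun_eq_iff)
  qed (auto simp: add_ac)
  show "monoid (HR :: ('f, 'c) hecke ring)"
  proof (rule monoidI)
    fix x :: "('f, 'c) hecke" assume x: "x \<in> carrier HR"
    show "\<one>\<^bsub>HR\<^esub> \<otimes>\<^bsub>HR\<^esub> x = x" using scalar_comp_apply[OF x, of 1] by (simp add: fun_eq_iff)
    show "x \<otimes>\<^bsub>HR\<^esub> \<one>\<^bsub>HR\<^esub> = x"
      using HR_zero[OF x] HR_carrierD(2)[OF x] by (auto simp: fun_eq_iff hecke_scalar_def)
  qed (auto simp: o_assoc)
  fix x y z :: "('f, 'c) hecke"
  assume x: "x \<in> carrier HR" and y: "y \<in> carrier HR" and z: "z \<in> carrier HR"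
  show "(x \<oplus>\<^bsub>HR\<^esub> y) \<otimes>\<^bsub>HR\<^esub> z = x \<otimes>\<^bsub>HR\<^esub> z \<oplus>\<^bsub>HR\<^esub> y \<otimes>\<^bsub>HR\<^esub> z"
    by (simp add: fun_eq_iff)
  show "z \<otimes>\<^bsub>HR\<^esub> (x \<oplus>\<^bsub>HR\<^esub> y) = z \<otimes>\<^bsub>HR\<^esub> x \<oplus>\<^bsub>HR\<^esub> z \<otimes>\<^bsub>HR\<^esub> y"
  proof
    fix f
    show "(z \<otimes>\<^bsub>HR\<^esub> (x \<oplus>\<^bsub>HR\<^esub> y)) f = (z \<otimes>\<^bsub>HR\<^esub> x \<oplus>\<^bsub>HR\<^esub> z \<otimes>\<^bsub>HR\<^esub> y) f"
      using HR_carrierD[OF x] HR_carrierD[OF y] HR_carrierD(3)[OF z] HR_zero[OF z]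
      by (cases "f \<in> cInd L") simp_all
  qed
qed

lemma HR_lincomb:
  fixes x :: "('f, 'c::field) hecke"
  assumes x: "x \<in> carrier HR" and S: "finite S" "\<And>i. i \<in> S \<Longrightarrow> f i \<in> cInd L"
  shows "x (\<lambda>C. \<Sum>i\<in>S. a i * f i C) = (\<lambda>C. \<Sum>i\<in>S. a i * x (f i) C)"
  using S
proof (induction S rule: finite_induct)
  case empty
  then show ?case using HR_zero[OF x] by (simp add: zero_fun_def)
next
  case (insert j S)
  have *: "(\<lambda>C. \<Sum>i\<in>insert j S. a i * h i C) = (\<lambda>C. a j * h j C) + (\<lambda>C. \<Sum>i\<in>S. a i * h i C)"
    for h :: "_ \<Rightarrow> ('f^2^2) set \<Rightarrow> 'c"
    using insert by (auto simp: fun_eq_iff)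
  show ?case
    unfolding * using insert cInd_lincomb[of S f] HR_carrierD(3,4)[OF x]
    by (simp del: plus_fun_apply)
qed

text \<open>Equivariance carries the expansion into translates of \<open>delta\<close> through
  \<open>x\<close>, so \<open>x\<close> is determined by the single function
  \<open>x delta\<close>.\<close>

lemma HR_expand:
  assumes x: "x \<in> carrier HR" and f: "f \<in> cInd L"
  shows "x f = (\<lambda>C. \<Sum>D | f D \<noteq> 0. f D * x delta (C #>\<^bsub>GL2\<^esub> inv\<^bsub>GL2\<^esub> (rep_of D)))"
proof -
  let ?S = "{D. f D \<noteq> 0}"
  have S: "finite ?S" "?S \<subseteq> cosets" using f cInd_finite cIndD by auto
  have "x f = x (\<lambda>C. \<Sum>D\<in>?S. f D * rtrans (inv\<^bsub>GL2\<^esub> (rep_of D)) delta C)"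
    using cInd_expand[OF f, of ?S] S by simp
  also have "\<dots> = (\<lambda>C. \<Sum>D\<in>?S. f D * x (rtrans (inv\<^bsub>GL2\<^esub> (rep_of D)) delta) C)"
    using S rep_of by (intro HR_lincomb x) auto
  also have "\<dots> = (\<lambda>C. \<Sum>D\<in>?S. f D * x delta (C #>\<^bsub>GL2\<^esub> inv\<^bsub>GL2\<^esub> (rep_of D)))"
    using S rep_of HR_carrierD(5)[OF x]
    by (intro ext sum.cong refl) (auto simp: rtrans_def subset_iff)
  finally show ?thesis .
qed

lemma HR_eqI:
  assumes "x \<in> carrier HR" "y \<in> carrier HR" "x delta = y delta" shows "x = y"
proof
  fix f show "x f = y f"
    using HR_expand[OF assms(1), of f] HR_expand[OF assms(2), of f] assms(3)
      HR_carrierD(2)[OF assms(1), of f] HR_carrierD(2)[OF assms(2), of f]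
    by (cases "f \<in> cInd L") auto
qed

text \<open>Frobenius reciprocity in coordinates: elements of the ring correspond to functions on
  \<open>GL2\<close> invariant under \<open>L\<close> on both sides, and \<open>T_g\<close> to the
  indicator of the double coset of \<open>g\<close>.\<close>

definition hf :: "('f, 'c::field) hecke \<Rightarrow> 'f^2^2 \<Rightarrow> 'c" where
  "hf x g = x delta (cs g)"

lemma HR_eqI_hf:
  assumes x: "x \<in> carrier HR" and y: "y \<in> carrier HR" and eq: "\<And>g. g \<in> carrier GL2 \<Longrightarrow> hf x g = hf y g"
  shows "x = y"
proof (rule HR_eqI[OF x y], rule ext)
  fix C show "x delta C = y delta C"
    using eq cInd_outside[OF HR_carrierD(1)[OF x delta_cInd], of C]
      cInd_outside[OF HR_carrierD(1)[OF y delta_cInd], of C]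
    by (cases "C \<in> cosets") (auto simp: hf_def elim: cosetsE)
qed

lemma hf_left [simp]: "l \<in> L \<Longrightarrow> hf x (l ** g) = hf x g"
  by (simp add: hf_def)

lemma HR_right_inv: "x \<in> carrier HR \<Longrightarrow> l \<in> L \<Longrightarrow> rtrans l (x delta) = x delta"
  using HR_carrierD(5)[of x l delta] by simp

lemma hf_right [simp]: "x \<in> carrier HR \<Longrightarrow> l \<in> L \<Longrightarrow> hf x (g ** l) = hf x g"
  using fun_cong[OF HR_right_inv[of x l], of "cs g"]
  by (simp add: hf_def rtrans_def r_coset_mult)

lemma hf_add: "hf (x + y) g = hf x g + hf y g"
  by (simp add: hf_def)

lemma hf_scalar: "x \<in> carrier HR \<Longrightarrow> hf (hecke_scalar L a \<circ> x) g = a * hf x g"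
  by (simp add: hf_def scalar_comp_apply del: comp_apply)

lemma hf_hecke_scalar: "g \<in> carrier GL2 \<Longrightarrow> hf (hecke_scalar L a) g = (if g \<in> L then a else 0)"
  using delta_cInd by (simp add: hf_def hecke_scalar_def) (simp add: delta_def cs_eq_L_iff)

lemma hf_finite: "x \<in> carrier HR \<Longrightarrow> finite {C. \<exists>g\<in>carrier GL2. C = cs g \<and> hf x g \<noteq> 0}"
  using cInd_finite[OF HR_carrierD(1)[OF _ delta_cInd], of x]
  by (rule rev_finite_subset) (auto simp: hf_def)

text \<open>The inverse of \<open>x \<mapsto> x delta\<close>. The chosen representatives become
  irrelevant once \<open>X\<close> is fixed by all translations from \<open>L\<close>.\<close>

definition extension :: "(('f^2^2) set \<Rightarrow> 'c::field) \<Rightarrow> ('f, 'c) hecke" where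
  "extension X = (\<lambda>f. if f \<in> cInd L
     then (\<lambda>C. \<Sum>D | f D \<noteq> 0. f D * X (C #>\<^bsub>GL2\<^esub> inv\<^bsub>GL2\<^esub> (rep_of D))) else 0)"

lemma extension_delta:
  fixes X :: "('f^2^2) set \<Rightarrow> 'c::field"
  assumes X: "\<And>l. l \<in> L \<Longrightarrow> rtrans l X = X" shows "extension X delta = X"
proof
  fix C
  have "{D. delta D \<noteq> (0::'c)} = {L}" by (auto simp: delta_def)
  moreover have "X (C #>\<^bsub>GL2\<^esub> inv\<^bsub>GL2\<^esub> (rep_of L)) = X C"
    using fun_cong[OF X[of "inv\<^bsub>GL2\<^esub> (rep_of L)"], of C] rep_of[of L] by (simp add: rtrans_def)
  ultimately show "extension X delta C = X C"
    by (simp add: extension_def) (simp add: delta_def)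
qed

lemma extension_closed:
  fixes X :: "('f^2^2) set \<Rightarrow> 'c::field"
  assumes X: "X \<in> cInd L" and inv: "\<And>l. l \<in> L \<Longrightarrow> rtrans l X = X"
  shows "extension X \<in> carrier HR"
proof (rule HR_carrierI)
  let ?t = "\<lambda>D. rtrans (inv\<^bsub>GL2\<^esub> (rep_of D)) X"
  have eq: "extension X f = (\<lambda>C. \<Sum>D\<in>S. f D * ?t D C)"
    if "f \<in> cInd L" "finite S" "{D. f D \<noteq> 0} \<subseteq> S" for f :: "('f^2^2) set \<Rightarrow> 'c" and S
    using that by (auto simp: extension_def rtrans_def fun_eq_iff intro!: sum.mono_neutral_left)
  {
    fix f :: "('f^2^2) set \<Rightarrow> 'c" assume f: "f \<in> cInd L"
    have "{D. f D \<noteq> 0} \<subseteq> cosets" using f cIndD by auto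
    then show "extension X f \<in> cInd L"
      unfolding eq[OF f cInd_finite[OF f] order_refl]
      using f X rep_of by (intro cInd_lincomb cInd_finite) auto
    fix a
    show "extension X (\<lambda>C. a * f C) = (\<lambda>C. a * extension X f C)"
      using eq[OF f cInd_finite[OF f] order_refl]
        eq[OF cInd_scale[OF f, of a] cInd_finite[OF f]]
      by (auto simp: sum_distrib_left mult.assoc)
    fix f' :: "('f^2^2) set \<Rightarrow> 'c" assume f': "f' \<in> cInd L"
    let ?S = "{D. f D \<noteq> 0} \<union> {D. f' D \<noteq> 0}"
    have S: "finite ?S" "{D. (f + f') D \<noteq> 0} \<subseteq> ?S" using f f' cInd_finite by auto
    have "extension X (f + f') = (\<lambda>C. \<Sum>D\<in>?S. (f + f') D * ?t D C)"
      by (rule eq[OF cInd_add[OF f f'] S])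
    then show "extension X (f + f') = extension X f + extension X f'"
      using eq[OF f S(1)] eq[OF f' S(1)] by (simp add: fun_eq_iff sum.distrib algebra_simps)
  next
    fix f :: "('f^2^2) set \<Rightarrow> 'c" and g :: "'f^2^2" assume g: "g \<in> carrier GL2" and f: "f \<in> cInd L"
    \<comment> \<open>The chosen representative of \<open>D #> g\<close> and the product
      \<open>rep_of D ** g\<close> differ by some \<open>l\<close> in \<open>L\<close>. After
      inversion \<open>l\<close> stands on the right, where \<open>X\<close> does not see
      it.\<close>
    have X': "X (C #>\<^bsub>GL2\<^esub> (z ** l)) = X (C #>\<^bsub>GL2\<^esub> z)" if "l \<in> L" for C z l
      using fun_cong[OF inv[OF that], of "C #>\<^bsub>GL2\<^esub> z"] by (simp add: rtrans_def r_coset_mult)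
    have "(\<Sum>D | rtrans g f D \<noteq> 0. rtrans g f D * X (C #>\<^bsub>GL2\<^esub> inv\<^bsub>GL2\<^esub> (rep_of D))) =
      (\<Sum>D | f D \<noteq> 0. f D * X (C #>\<^bsub>GL2\<^esub> g #>\<^bsub>GL2\<^esub> inv\<^bsub>GL2\<^esub> (rep_of D)))" for C
    proof (rule sum.reindex_bij_witness[where i = "\<lambda>D. D #>\<^bsub>GL2\<^esub> inv\<^bsub>GL2\<^esub> g" and j = "\<lambda>D. D #>\<^bsub>GL2\<^esub> g"])
      fix D assume "D \<in> {D. rtrans g f D \<noteq> 0}"
      then have nz: "f (D #>\<^bsub>GL2\<^esub> g) \<noteq> 0" by (simp add: rtrans_def)
      then have D': "D #>\<^bsub>GL2\<^esub> g \<in> cosets" using f cIndD by auto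
      then have D: "D \<in> cosets" using g coset_shift_iff by auto
      let ?d = "rep_of D" and ?d' = "rep_of (D #>\<^bsub>GL2\<^esub> g)"
      have "?d' \<in> cs (?d ** g)"
        using rep_of(3)[OF D'] rep_of(2)[OF D] by (metis r_coset_mult)
      then obtain l where l: "l \<in> L" "?d' = l ** (?d ** g)" by (auto simp: mem_cs)
      have "inv\<^bsub>GL2\<^esub> ?d' = inv\<^bsub>GL2\<^esub> g ** inv\<^bsub>GL2\<^esub> ?d ** inv\<^bsub>GL2\<^esub> l"
        using l g rep_of(1)[OF D] by (simp add: inv_GL2_mult)
      then have "X (C #>\<^bsub>GL2\<^esub> g #>\<^bsub>GL2\<^esub> inv\<^bsub>GL2\<^esub> ?d') = X (C #>\<^bsub>GL2\<^esub> inv\<^bsub>GL2\<^esub> ?d)"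
        using X'[of "inv\<^bsub>GL2\<^esub> l" C "inv\<^bsub>GL2\<^esub> ?d"] l g
        by (simp add: r_coset_mult matrix_mul_assoc)
      then show "f (D #>\<^bsub>GL2\<^esub> g) * X (C #>\<^bsub>GL2\<^esub> g #>\<^bsub>GL2\<^esub> inv\<^bsub>GL2\<^esub> ?d') =
          rtrans g f D * X (C #>\<^bsub>GL2\<^esub> inv\<^bsub>GL2\<^esub> ?d)"
        by (simp add: rtrans_def)
    qed (use g in \<open>auto simp: rtrans_def r_coset_mult\<close>)
    then show "extension X (rtrans g f) = rtrans g (extension X f)"
      using f rtrans_cInd[OF f g] by (simp add: extension_def fun_eq_iff) (simp add: rtrans_def)
  }
qed (simp add: extension_def)

text \<open>A finite family \<open>r\<close> of representatives of the cosets in \<open>L g\<inverse> L\<close>, together with finiteness of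
  \<open>L \<setminus> L g L\<close>, which makes \<open>T\<^sub>g\<close> preserve finite supports.\<close>

definition T_reps :: "'f^2^2 \<Rightarrow> 'i set \<Rightarrow> ('i \<Rightarrow> 'f^2^2) \<Rightarrow> bool" where
  "T_reps g J r \<longleftrightarrow> g \<in> carrier GL2 \<and> finite J \<and> (\<forall>i\<in>J. r i \<in> carrier GL2) \<and> inj_on (\<lambda>i. cs (r i)) J \<and>
     (\<forall>x. (\<exists>l\<in>L. \<exists>l'\<in>L. x = l ** inv\<^bsub>GL2\<^esub> g ** l') \<longleftrightarrow> (\<exists>i\<in>J. x \<in> cs (r i))) \<and>
     (\<exists>F. finite F \<and> F \<subseteq> carrier GL2 \<and> (\<forall>l\<in>L. \<forall>l'\<in>L. \<exists>x\<in>F. l ** g ** l' \<in> cs x))"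

text \<open>Multiplying the double coset of the inverse of \<open>g\<close> by \<open>c\<close> on
  the right shifts its cosets one by one, and a shift keeps them distinct.\<close>

lemma hecke_T_formula:
  assumes r: "T_reps g J r" and f: "f \<in> cInd L" and c: "c \<in> carrier GL2"
  shows "hecke_T L g f (cs c) = (\<Sum>i\<in>J. f (cs (r i ** c)))"
proof -
  have J: "finite J" "\<And>i. i \<in> J \<Longrightarrow> r i \<in> carrier GL2" "inj_on (\<lambda>i. cs (r i)) J"
    using r by (auto simp: T_reps_def)
  have mem: "x \<in> (L #>\<^bsub>GL2\<^esub> inv\<^bsub>GL2\<^esub> g) <#>\<^bsub>GL2\<^esub> cs c \<longleftrightarrow> (\<exists>i\<in>J. x \<in> cs (r i ** c))" for x
  proof -
    have "x \<in> (L #>\<^bsub>GL2\<^esub> inv\<^bsub>GL2\<^esub> g) <#>\<^bsub>GL2\<^esub> cs c \<longleftrightarrow>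
      (\<exists>y. (\<exists>l\<in>L. \<exists>l'\<in>L. y = l ** inv\<^bsub>GL2\<^esub> g ** l') \<and> x = y ** c)"
      by (fastforce simp: set_mult_def r_coset_def matrix_mul_assoc)
    also have "\<dots> \<longleftrightarrow> (\<exists>y. (\<exists>i\<in>J. y \<in> cs (r i)) \<and> x = y ** c)"
      using r unfolding T_reps_def by (simp only:)
    also have "\<dots> \<longleftrightarrow> (\<exists>i\<in>J. x \<in> cs (r i ** c))"
      by (force simp: mem_cs matrix_mul_assoc)
    finally show ?thesis .
  qed
  have "{D. D \<in> cosets \<and> D \<subseteq> (L #>\<^bsub>GL2\<^esub> inv\<^bsub>GL2\<^esub> g) <#>\<^bsub>GL2\<^esub> cs c} = (\<lambda>i. cs (r i ** c)) ` J"
  proof (intro equalityI subsetI)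
    fix D assume "D \<in> {D. D \<in> cosets \<and> D \<subseteq> (L #>\<^bsub>GL2\<^esub> inv\<^bsub>GL2\<^esub> g) <#>\<^bsub>GL2\<^esub> cs c}"
    then have D: "D \<in> cosets" "D \<subseteq> (L #>\<^bsub>GL2\<^esub> inv\<^bsub>GL2\<^esub> g) <#>\<^bsub>GL2\<^esub> cs c" by auto
    then obtain i where i: "i \<in> J" "rep_of D \<in> cs (r i ** c)"
      using mem[of "rep_of D"] rep_of(3)[OF D(1)] by auto
    then have "D = cs (r i ** c)"
      using mem_cs_eq[of "r i ** c" "rep_of D"] rep_of(2)[OF D(1)] J c by auto
    then show "D \<in> (\<lambda>i. cs (r i ** c)) ` J" using i by auto
  next
    fix D assume "D \<in> (\<lambda>i. cs (r i ** c)) ` J"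
    then show "D \<in> {D. D \<in> cosets \<and> D \<subseteq> (L #>\<^bsub>GL2\<^esub> inv\<^bsub>GL2\<^esub> g) <#>\<^bsub>GL2\<^esub> cs c}"
      using J c mem by auto
  qed
  moreover have "inj_on (\<lambda>i. cs (r i ** c)) J"
  proof (rule inj_onI)
    fix i j assume ij: "i \<in> J" "j \<in> J" and eq: "cs (r i ** c) = cs (r j ** c)"
    have "cs (r i ** c) #>\<^bsub>GL2\<^esub> inv\<^bsub>GL2\<^esub> c = cs (r j ** c) #>\<^bsub>GL2\<^esub> inv\<^bsub>GL2\<^esub> c"
      using eq by simp
    then have "cs (r i) = cs (r j)" using c by simp
    then show "i = j" using inj_onD[OF J(3)] ij by blast
  qed
  ultimately show ?thesis
    using f c by (simp add: hecke_T_def sum.reindex)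
qed

lemma hecke_T_closed:
  assumes r: "T_reps g J r" shows "hecke_T L g \<in> carrier (HR :: ('f, 'c::field) hecke ring)"
proof (rule HR_carrierI)
  have J: "finite J" "\<And>i. i \<in> J \<Longrightarrow> r i \<in> carrier GL2" and g: "g \<in> carrier GL2"
    using r by (auto simp: T_reps_def)
  note T = hecke_T_formula[OF r]
  have outside: "hecke_T L g f C = 0" if "f \<in> cInd L" "C \<notin> cosets" for f :: "('f^2^2) set \<Rightarrow> 'c" and C
    using that by (simp add: hecke_T_def)
  {
    fix f :: "('f^2^2) set \<Rightarrow> 'c" assume f: "f \<in> cInd L"
    obtain F where F: "finite F" "F \<subseteq> carrier GL2" "\<And>l l'. l \<in> L \<Longrightarrow> l' \<in> L \<Longrightarrow> \<exists>x\<in>F. l ** g ** l' \<in> cs x"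
      using r by (auto simp: T_reps_def)
    \<comment> \<open>A nonzero value at \<open>c\<close> forces \<open>f\<close> to be nonzero at
      some coset with representative \<open>d\<close>, and then \<open>c\<close> lies in
      \<open>L g L d\<close>. The finite set \<open>F\<close> thus bounds the new support in terms
      of the old one.\<close>
    show "hecke_T L g f \<in> cInd L"
    proof (rule cIndI[where S = "(\<lambda>(x, D). cs (x ** rep_of D)) ` (F \<times> {D. f D \<noteq> 0})"])
      fix C assume nz: "hecke_T L g f C \<noteq> 0"
      then show C: "C \<in> cosets" using outside f by blast
      let ?c = "rep_of C"
      have c: "?c \<in> carrier GL2" "C = cs ?c" using rep_of[OF C] by auto
      have "(\<Sum>i\<in>J. f (cs (r i ** ?c))) \<noteq> 0" using nz T[OF f c(1)] c(2) by auto
      then obtain i where i: "i \<in> J" "f (cs (r i ** ?c)) \<noteq> 0" by (meson sum.neutral)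
      let ?D = "cs (r i ** ?c)" and ?d = "rep_of (cs (r i ** ?c))"
      have D: "?D \<in> cosets" using i J c by simp
      obtain l0 where l0: "l0 \<in> L" "?d = l0 ** (r i ** ?c)" using rep_of(3)[OF D] by (auto simp: mem_cs)
      obtain l1 l2 where l: "l1 \<in> L" "l2 \<in> L" "r i = l1 ** inv\<^bsub>GL2\<^esub> g ** l2"
        using r i(1) cs_self[of "r i"] unfolding T_reps_def by meson
      have "?d = l0 ** l1 ** inv\<^bsub>GL2\<^esub> g ** l2 ** ?c"
        using l0 l by (simp add: matrix_mul_assoc)
      then have "inv\<^bsub>GL2\<^esub> l2 ** g ** inv\<^bsub>GL2\<^esub> (l0 ** l1) ** ?d =
          inv\<^bsub>GL2\<^esub> l2 ** g ** (inv\<^bsub>GL2\<^esub> (l0 ** l1) ** (l0 ** l1)) ** inv\<^bsub>GL2\<^esub> g ** l2 ** ?c"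
        by (simp add: matrix_mul_assoc del: inv_GL2_cancel)
      also have "\<dots> = ?c" using l l0 g by (simp flip: matrix_mul_assoc)
      finally have eq: "inv\<^bsub>GL2\<^esub> l2 ** g ** inv\<^bsub>GL2\<^esub> (l0 ** l1) ** ?d = ?c" .
      obtain x where x: "x \<in> F" "inv\<^bsub>GL2\<^esub> l2 ** g ** inv\<^bsub>GL2\<^esub> (l0 ** l1) \<in> cs x"
        using F(3)[of "inv\<^bsub>GL2\<^esub> l2" "inv\<^bsub>GL2\<^esub> (l0 ** l1)"] l l0 by auto
      then obtain l3 where l3: "l3 \<in> L" "inv\<^bsub>GL2\<^esub> l2 ** g ** inv\<^bsub>GL2\<^esub> (l0 ** l1) = l3 ** x"
        by (auto simp: mem_cs)
      have "?c = l3 ** (x ** ?d)" using eq[symmetric] unfolding l3(2) by (simp only: matrix_mul_assoc)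
      then have "C = cs (x ** ?d)" using c(2) cs_left[OF l3(1)] by metis
      then show "C \<in> (\<lambda>(x, D). cs (x ** rep_of D)) ` (F \<times> {D. f D \<noteq> 0})"
        using x i by force
    qed (use F cInd_finite[OF f] in auto)
    fix a show "hecke_T L g (\<lambda>C. a * f C) = (\<lambda>C. a * hecke_T L g f C)"
      using f by (auto simp: hecke_T_def fun_eq_iff sum_distrib_left)
  next
    fix f f' :: "('f^2^2) set \<Rightarrow> 'c" assume "f \<in> cInd L" "f' \<in> cInd L"
    then show "hecke_T L g (f + f') = hecke_T L g f + hecke_T L g f'"
      by (auto simp: hecke_T_def fun_eq_iff sum.distrib)
  next
    fix f :: "('f^2^2) set \<Rightarrow> 'c" and h :: "'f^2^2" assume f: "f \<in> cInd L" and h: "h \<in> carrier GL2"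
    show "hecke_T L g (rtrans h f) = rtrans h (hecke_T L g f)"
    proof
      fix C show "hecke_T L g (rtrans h f) C = rtrans h (hecke_T L g f) C"
      proof (cases "C \<in> cosets")
        case True
        then obtain c where c: "c \<in> carrier GL2" "C = cs c" by (rule cosetsE)
        show ?thesis
          using T[OF rtrans_cInd[OF f h] c(1)] T[OF f, of "c ** h"] c h
          by (simp add: rtrans_def r_coset_mult matrix_mul_assoc)
      next
        case False
        then show ?thesis
          using outside[OF f, of "C #>\<^bsub>GL2\<^esub> h"] outside[OF rtrans_cInd[OF f h]] coset_shift_iff[OF h]
          by (simp add: rtrans_def)
      qed
    qed
  }
qed (simp add: hecke_T_def)

lemma hf_T_mult:
  assumes "T_reps g J r" "x \<in> carrier HR" "c \<in> carrier GL2"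
  shows "hf (hecke_T L g \<circ> x) c = (\<Sum>i\<in>J. hf x (r i ** c))"
  using hecke_T_formula[OF assms(1) HR_carrierD(1)[OF assms(2) delta_cInd] assms(3)]
  by (simp add: hf_def)

text \<open>For such \<open>g\<close> the double coset is a single coset, and multiplying by
  \<open>T_g\<close> on the left merely translates the kernel \<open>hf\<close>. In the Iwahori case
  \<open>Pi\<close> and the integral torus are of this kind.\<close>

definition normalizes :: "'f^2^2 \<Rightarrow> bool" where
  "normalizes g \<longleftrightarrow> g \<in> carrier GL2 \<and> (\<forall>l\<in>L. g ** l ** inv\<^bsub>GL2\<^esub> g \<in> L \<and> inv\<^bsub>GL2\<^esub> g ** l ** g \<in> L)"

lemma normalizes_GL2 [simp]: "normalizes g \<Longrightarrow> g \<in> carrier GL2"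
  by (simp add: normalizes_def)

lemma normalizes_inv [simp]: "normalizes g \<Longrightarrow> normalizes (inv\<^bsub>GL2\<^esub> g)"
  by (auto simp: normalizes_def)

lemma normalizes_left: "normalizes g \<Longrightarrow> l \<in> L \<Longrightarrow> \<exists>l'\<in>L. l ** g = g ** l'"
  by (rule bexI[of _ "inv\<^bsub>GL2\<^esub> g ** l ** g"]) (auto simp: normalizes_def matrix_mul_assoc)

lemma normalizes_right: "normalizes g \<Longrightarrow> l \<in> L \<Longrightarrow> \<exists>l'\<in>L. g ** l = l' ** g"
  by (rule bexI[of _ "g ** l ** inv\<^bsub>GL2\<^esub> g"]) (auto simp: normalizes_def)

lemma normalizesI:
  assumes "g \<in> carrier GL2" "\<And>l. l \<in> L \<Longrightarrow> \<exists>l'\<in>L. l ** g = g ** l'" "\<And>l. l \<in> L \<Longrightarrow> \<exists>l'\<in>L. g ** l = l' ** g"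
  shows "normalizes g"
  unfolding normalizes_def
proof (intro conjI ballI)
  fix l assume "l \<in> L"
  then obtain l1 l2 where "l1 \<in> L" "g ** l = l1 ** g" "l2 \<in> L" "l ** g = g ** l2" using assms by meson
  then show "g ** l ** inv\<^bsub>GL2\<^esub> g \<in> L" "inv\<^bsub>GL2\<^esub> g ** l ** g \<in> L"
    using assms(1) by (simp_all flip: matrix_mul_assoc) (simp add: matrix_mul_assoc)
qed (use assms in auto)

lemma normalizes_mult [simp]:
  assumes "normalizes g" "normalizes h" shows "normalizes (g ** h)"
proof (rule normalizesI)
  fix l assume l: "l \<in> L"
  show "\<exists>l'\<in>L. l ** (g ** h) = g ** h ** l'"
    using normalizes_left[OF assms(1) l] normalizes_left[OF assms(2)] by (metis matrix_mul_assoc)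
  show "\<exists>l'\<in>L. g ** h ** l = l' ** (g ** h)"
    using normalizes_right[OF assms(2) l] normalizes_right[OF assms(1)] by (metis matrix_mul_assoc)
qed (use assms in auto)

lemma normalizes_L: "l \<in> L \<Longrightarrow> normalizes l"
  by (auto simp: normalizes_def)

lemma T_reps_normalizes:
  assumes "normalizes g" shows "T_reps g {()} (\<lambda>_. inv\<^bsub>GL2\<^esub> g)"
  unfolding T_reps_def
proof (intro conjI allI)
  fix x
  show "(\<exists>l\<in>L. \<exists>l'\<in>L. x = l ** inv\<^bsub>GL2\<^esub> g ** l') \<longleftrightarrow> (\<exists>i\<in>{()}. x \<in> cs (inv\<^bsub>GL2\<^esub> g))"
    using normalizes_right[OF normalizes_inv[OF assms]]
    by (auto simp: mem_cs) (metis L_closed(1,2) matrix_mul_assoc matrix_mul_rid)+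
  have "\<exists>x\<in>{g}. l ** g ** l' \<in> cs x" if "l \<in> L" "l' \<in> L" for l l'
    using normalizes_right[OF assms that(2)] that(1) by (auto simp: mem_cs) (metis L_closed(2) matrix_mul_assoc)
  then show "\<exists>F. finite F \<and> F \<subseteq> carrier GL2 \<and> (\<forall>l\<in>L. \<forall>l'\<in>L. \<exists>x\<in>F. l ** g ** l' \<in> cs x)"
    using assms by (intro exI[of _ "{g}"]) auto
qed (use assms in auto)

lemma hecke_T_normalizes_closed [simp]: "normalizes g \<Longrightarrow> hecke_T L g \<in> carrier HR"
  using hecke_T_closed[OF T_reps_normalizes] .

lemma hf_T_normalizes:
  "normalizes g \<Longrightarrow> x \<in> carrier HR \<Longrightarrow> c \<in> carrier GL2 \<Longrightarrow>
    hf (hecke_T L g \<circ> x) c = hf x (inv\<^bsub>GL2\<^esub> g ** c)"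
  using hf_T_mult[OF T_reps_normalizes] by simp

lemma T_normalizes_apply:
  assumes "normalizes g" "f \<in> cInd L" "c \<in> carrier GL2"
  shows "hecke_T L g f (cs c) = f (cs (inv\<^bsub>GL2\<^esub> g ** c))"
  using hecke_T_formula[OF T_reps_normalizes] assms by simp

lemma hf_one: "g \<in> carrier GL2 \<Longrightarrow> hf (hecke_scalar L 1 :: ('f,'c::field) hecke) g = (if g \<in> L then 1 else 0)"
  by (rule hf_hecke_scalar)

lemma HR_comp_one [simp]:
  "x \<in> carrier HR \<Longrightarrow> x \<circ> hecke_scalar L 1 = x" "x \<in> carrier HR \<Longrightarrow> hecke_scalar L 1 \<circ> x = x"
  using monoid.r_one[OF ring.is_monoid[OF ring_HR], of x] monoid.l_one[OF ring.is_monoid[OF ring_HR], of x]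
  by auto

lemma hf_T_normalizes':
  assumes "normalizes g" "c \<in> carrier GL2"
  shows "hf (hecke_T L g :: ('f, 'c::field) hecke) c = (if inv\<^bsub>GL2\<^esub> g ** c \<in> L then 1 else 0)"
  using hf_T_normalizes[of g "hecke_scalar L 1 :: ('f, 'c) hecke" c]
    hf_one[of "inv\<^bsub>GL2\<^esub> g ** c", where 'c = 'c] assms
  by simp

lemma T_normalizes_mult:
  assumes "normalizes g" "normalizes h"
  shows "hecke_T L g \<circ> hecke_T L h = (hecke_T L (g ** h) :: ('f,'c::field) hecke)"
proof (rule HR_eqI_hf)
  fix c :: "'f^2^2" assume c: "c \<in> carrier GL2"
  show "hf (hecke_T L g \<circ> hecke_T L h) c = hf (hecke_T L (g ** h) :: ('f,'c) hecke) c"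
    using assms c
    by (simp add: hf_T_normalizes hf_T_normalizes' inv_GL2_mult matrix_mul_assoc)
qed (use assms in auto)

lemma T_normalizes_coset:
  assumes "normalizes g" "l \<in> L"
  shows "hecke_T L (g ** l) = (hecke_T L g :: ('f,'c::field) hecke)"
proof (rule HR_eqI_hf)
  have "normalizes (g ** l)" using assms by (simp add: normalizes_L)
  then show "hecke_T L (g ** l) \<in> carrier (HR :: ('f,'c) hecke ring)" by simp
  fix c :: "'f^2^2" assume c: "c \<in> carrier GL2"
  have "inv\<^bsub>GL2\<^esub> (g ** l) ** c = inv\<^bsub>GL2\<^esub> l ** (inv\<^bsub>GL2\<^esub> g ** c)"
    using assms by (simp add: inv_GL2_mult matrix_mul_assoc)
  moreover have "inv\<^bsub>GL2\<^esub> l ** (inv\<^bsub>GL2\<^esub> g ** c) \<in> L \<longleftrightarrow> inv\<^bsub>GL2\<^esub> g ** c \<in> L"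
  proof
    assume "inv\<^bsub>GL2\<^esub> l ** (inv\<^bsub>GL2\<^esub> g ** c) \<in> L"
    then have "l ** (inv\<^bsub>GL2\<^esub> l ** (inv\<^bsub>GL2\<^esub> g ** c)) \<in> L" using assms L_closed(2) by blast
    then show "inv\<^bsub>GL2\<^esub> g ** c \<in> L" using assms by (simp add: matrix_mul_assoc)
  qed (use assms in auto)
  ultimately show "hf (hecke_T L (g ** l)) c = hf (hecke_T L g :: ('f,'c) hecke) c"
    using assms c \<open>normalizes (g ** l)\<close> by (simp add: hf_T_normalizes')
qed (use assms in auto)

end

section \<open>Generators of the pro-p Iwahori--Hecke algebra\<close>

context nonarch_local_field
begin

sublocale GL2_subgroup "iwahori1 val red"
  by (rule GL2_subgroup.intro) (rule subgroup_L)

definition lf :: "'k \<Rightarrow> 'f" where "lf t = (SOME x. x \<in> \<O> \<and> red x = t)"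

lemma lf [simp]: "lf t \<in> \<O>" "red (lf t) = t"
proof -
  have "\<exists>x. x \<in> \<O> \<and> red x = t" using red_surj by (metis UNIV_I imageE)
  then have "lf t \<in> \<O> \<and> red (lf t) = t" unfolding lf_def by (rule someI_ex)
  then show "lf t \<in> \<O>" "red (lf t) = t" by auto
qed

abbreviation Pi :: "'f^2^2" where "Pi \<equiv> Pi_mat varpi"
abbreviation ut :: "'f \<Rightarrow> 'f^2^2" where "ut x \<equiv> mat2 1 x 0 1"
abbreviation dg :: "'f \<Rightarrow> 'f \<Rightarrow> 'f^2^2" where "dg a d \<equiv> mat2 a 0 0 d"
abbreviation ni :: "'f^2^2" where "ni \<equiv> mat2 0 1 (-1) 0"
abbreviation TPi :: "('f, 'c::field) hecke" where "TPi \<equiv> hecke_T L Pi"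
abbreviation TPi' :: "('f, 'c::field) hecke" where "TPi' \<equiv> hecke_T L (inv\<^bsub>GL2\<^esub> Pi)"
abbreviation Tn :: "('f, 'c::field) hecke" where "Tn \<equiv> hecke_T L n_s"

lemma Pi_eq: "Pi = mat2 0 1 varpi 0" and n_s_eq: "(n_s :: 'f^2^2) = mat2 0 (-1) 1 0"
  by (simp_all add: Pi_mat_def n_s_def)

lemma Pi_GL2 [simp]: "Pi \<in> carrier GL2" and n_s_GL2 [simp]: "(n_s :: 'f^2^2) \<in> carrier GL2"
  by (simp_all add: Pi_eq n_s_eq GL2_mat2_iff)

lemma inv_Pi: "inv\<^bsub>GL2\<^esub> Pi = mat2 0 (1 / varpi) 1 0"
  by (rule inv_GL2_unique) (simp_all add: Pi_eq GL2_mat2_iff mat_1_eq_mat2)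

lemma inv_n_s: "inv\<^bsub>GL2\<^esub> (n_s :: 'f^2^2) = ni"
  by (rule inv_GL2_unique) (simp_all add: n_s_eq GL2_mat2_iff mat_1_eq_mat2)

lemma L_cases:
  assumes "l \<in> L"
  obtains a b c d where "l = mat2 a b c d" "a \<in> \<O>" "b \<in> \<O>" "c \<in> \<O>" "d \<in> \<O>"
    "red a = 1" "red d = 1" "red c = 0"
  using assms by (cases l) (auto simp: L_mat2_iff)

lemma ut_L [simp]: "x \<in> \<O> \<Longrightarrow> ut x \<in> L"
  by (simp add: L_mat2_iff)

text \<open>Conjugation by \<open>Pi\<close> swaps the diagonal entries and trades \<open>b\<close>
  for \<open>c / \<varpi>\<close>, which is integral as \<open>c\<close> reduces to
  \<open>0\<close>. One witness serves both directions because \<open>Pi ** Pi\<close> is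
  central.\<close>

lemma normalizes_Pi [simp]: "normalizes Pi"
proof (rule normalizesI)
  fix l assume "l \<in> L"
  then obtain a b c d where l: "l = mat2 a b c d" "a \<in> \<O>" "b \<in> \<O>" "c \<in> \<O>" "d \<in> \<O>"
    "red a = 1" "red d = 1" "red c = 0" by (rule L_cases)
  show "\<exists>l'\<in>L. l ** Pi = Pi ** l'" "\<exists>l'\<in>L. Pi ** l = l' ** Pi"
    using l div_varpi_OO[of c]
    by (auto simp: Pi_eq L_mat2_iff intro!: bexI[of _ "mat2 d (c / varpi) (varpi * b) a"])
qed simp

lemma normalizes_dg [simp]:
  assumes "a \<in> \<O>" "d \<in> \<O>" "red a \<noteq> 0" "red d \<noteq> 0" shows "normalizes (dg a d)"
proof (rule normalizesI)
  have nz: "a \<noteq> 0" "d \<noteq> 0" using assms by auto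
  then show "dg a d \<in> carrier GL2" by (simp add: GL2_mat2_iff)
  fix l assume "l \<in> L"
  then obtain x y z w where l: "l = mat2 x y z w" "x \<in> \<O>" "y \<in> \<O>" "z \<in> \<O>" "w \<in> \<O>"
    "red x = 1" "red w = 1" "red z = 0" by (rule L_cases)
  show "\<exists>l'\<in>L. l ** dg a d = dg a d ** l'"
    using assms nz l by (intro bexI[of _ "mat2 x (y * d / a) (z * a / d) w"])
      (auto simp: L_mat2_iff unit_divide red_divide)
  show "\<exists>l'\<in>L. dg a d ** l = l' ** dg a d"
    using assms nz l by (intro bexI[of _ "mat2 x (a * y / d) (d * z / a) w"])
      (auto simp: L_mat2_iff unit_divide red_divide)
qed

text \<open>Everything in an element of \<open>L\<close> can be moved to the left of
  \<open>n_s\<close>, except the residue of its upper right entry. So the cosets are indexed by the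
  residue field.\<close>

lemma T_reps_n_s: "T_reps n_s (UNIV :: 'k set) (\<lambda>t. ni ** ut (lf t))"
  unfolding T_reps_def
proof (intro conjI allI)
  have ni: "l' \<in> L \<Longrightarrow> \<exists>t. \<exists>l\<in>L. ni ** l' = l ** (ni ** ut (lf t))" for l'
  proof (elim L_cases)
    fix a b c d assume l: "l' = mat2 a b c d" "a \<in> \<O>" "b \<in> \<O>" "c \<in> \<O>" "d \<in> \<O>"
      "red a = 1" "red d = 1" "red c = 0"
    let ?t = "lf (red b)"
    \<comment> \<open>The witness is the product \<open>ni ** l' ** ut (- ?t) ** n_s\<close>; its
      lower left entry reduces to \<open>0\<close> exactly by the choice of
      \<open>?t\<close>.\<close>
    show "\<exists>t. \<exists>l\<in>L. ni ** l' = l ** (ni ** ut (lf t))"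
      using l by (intro exI[of _ "red b"] bexI[of _ "mat2 (d - c * ?t) (- c) (- b + a * ?t) a"])
        (auto simp: L_mat2_iff algebra_simps)
  qed
  have n: "l' \<in> L \<Longrightarrow> \<exists>t. \<exists>l\<in>L. n_s ** l' = l ** (n_s ** ut (lf t))" for l'
  proof (elim L_cases)
    fix a b c d assume l: "l' = mat2 a b c d" "a \<in> \<O>" "b \<in> \<O>" "c \<in> \<O>" "d \<in> \<O>"
      "red a = 1" "red d = 1" "red c = 0"
    let ?t = "lf (red b)"
    show "\<exists>t. \<exists>l\<in>L. n_s ** l' = l ** (n_s ** ut (lf t))"
      using l by (intro exI[of _ "red b"] bexI[of _ "mat2 (d - c * ?t) (- c) (- b + a * ?t) a"])
        (auto simp: L_mat2_iff n_s_eq algebra_simps)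
  qed
  fix x :: "'f^2^2"
  show "(\<exists>l\<in>L. \<exists>l'\<in>L. x = l ** inv\<^bsub>GL2\<^esub> n_s ** l') \<longleftrightarrow> (\<exists>t\<in>UNIV. x \<in> cs (ni ** ut (lf t)))"
  proof
    assume "\<exists>l\<in>L. \<exists>l'\<in>L. x = l ** inv\<^bsub>GL2\<^esub> n_s ** l'"
    then obtain l l' where l: "l \<in> L" "l' \<in> L" "x = l ** ni ** l'" by (auto simp: inv_n_s)
    obtain t l1 where "l1 \<in> L" "ni ** l' = l1 ** (ni ** ut (lf t))" using ni[OF l(2)] by blast
    then have "x = (l ** l1) ** (ni ** ut (lf t))" "l ** l1 \<in> L"
      using l by (auto simp: matrix_mul_assoc[symmetric] simp del: mat2_mult)
    then show "\<exists>t\<in>UNIV. x \<in> cs (ni ** ut (lf t))" by (auto simp: mem_cs simp del: mat2_mult)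
  next
    assume "\<exists>t\<in>UNIV. x \<in> cs (ni ** ut (lf t))"
    then obtain t l where "l \<in> L" "x = l ** (ni ** ut (lf t))" by (auto simp: mem_cs simp del: mat2_mult)
    then show "\<exists>l\<in>L. \<exists>l'\<in>L. x = l ** inv\<^bsub>GL2\<^esub> n_s ** l'"
      by (intro bexI[of _ l] bexI[of _ "ut (lf t)"]) (auto simp: inv_n_s matrix_mul_assoc simp del: mat2_mult)
  qed
  have "\<exists>x\<in>range (\<lambda>t. n_s ** ut (lf t)). l ** n_s ** l' \<in> cs x" if ll: "l \<in> L" "l' \<in> L" for l l'
  proof -
    obtain t l1 where "l1 \<in> L" "n_s ** l' = l1 ** (n_s ** ut (lf t))" using n[OF ll(2)] by blast
    then have "l ** n_s ** l' = (l ** l1) ** (n_s ** ut (lf t))" "l ** l1 \<in> L"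
      using ll by (auto simp: matrix_mul_assoc[symmetric])
    then have "l ** n_s ** l' \<in> cs (n_s ** ut (lf t))" unfolding mem_cs by blast
    then show ?thesis by blast
  qed
  then show "\<exists>F. finite F \<and> F \<subseteq> carrier GL2 \<and> (\<forall>l\<in>L. \<forall>l'\<in>L. \<exists>x\<in>F. l ** n_s ** l' \<in> cs x)"
    by (intro exI[of _ "range (\<lambda>t. n_s ** ut (lf t))"]) auto
  show "\<forall>t\<in>UNIV. ni ** ut (lf t) \<in> carrier GL2" by (auto simp: GL2_mat2_iff)
  show "inj_on (\<lambda>t. cs (ni ** ut (lf t))) UNIV"
  proof (rule inj_onI)
    fix t t' assume "cs (ni ** ut (lf t)) = cs (ni ** ut (lf t'))"
    then have "(ni ** ut (lf t)) ** inv\<^bsub>GL2\<^esub> (ni ** ut (lf t')) \<in> L"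
      using cs_eq_iff[of "ni ** ut (lf t)" "ni ** ut (lf t')"] by (auto simp: GL2_mat2_iff)
    then show "t = t'" by (auto simp: inv_GL2_mat2 L_mat2_iff)
  qed
qed auto

lemma Tn_closed [simp]: "Tn \<in> carrier HR"
  using hecke_T_closed[OF T_reps_n_s] .

lemma hf_Tn: "x \<in> carrier HR \<Longrightarrow> c \<in> carrier GL2 \<Longrightarrow>
    hf (Tn \<circ> x) c = (\<Sum>t\<in>UNIV. hf x (ni ** ut (lf t) ** c))"
  by (rule hf_T_mult[OF T_reps_n_s])

section \<open>Double cosets and generation of the Hecke ring\<close>

definition dcoset :: "'f^2^2 \<Rightarrow> 'f^2^2 \<Rightarrow> bool" where
  "dcoset g c \<longleftrightarrow> (\<exists>l\<in>L. \<exists>l'\<in>L. c = l ** g ** l')"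

text \<open>This says that \<open>y\<close> is \<open>T_g\<close> through its kernel alone, which
  spares finding coset representatives for every double coset.\<close>

definition is_dcoset_ind :: "('f, 'c::field) hecke \<Rightarrow> 'f^2^2 \<Rightarrow> bool" where
  "is_dcoset_ind y g \<longleftrightarrow> y \<in> carrier HR \<and> (\<forall>c\<in>carrier GL2. hf y c = (if dcoset g c then 1 else 0))"

lemma dcoset_left [simp]: "l \<in> L \<Longrightarrow> dcoset g (l ** c) = dcoset g c"
proof -
  have *: "dcoset g (l ** c)" if "l \<in> L" "dcoset g c" for l c
    using that unfolding dcoset_def by (metis L_closed(2) matrix_mul_assoc)
  assume l: "l \<in> L"
  have "inv\<^bsub>GL2\<^esub> l ** (l ** c) = c" using l by (simp add: matrix_mul_assoc)
  then show ?thesis using *[OF l] *[of "inv\<^bsub>GL2\<^esub> l" "l ** c"] l by auto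
qed

lemma dcoset_right [simp]: "l \<in> L \<Longrightarrow> dcoset g (c ** l) = dcoset g c"
proof -
  have *: "dcoset g (c ** l)" if "l \<in> L" "dcoset g c" for l c
    using that unfolding dcoset_def by (metis L_closed(2) matrix_mul_assoc)
  assume l: "l \<in> L"
  have "(c ** l) ** inv\<^bsub>GL2\<^esub> l = c" using l by simp
  then show ?thesis using *[OF l] *[of "inv\<^bsub>GL2\<^esub> l" "c ** l"] l by auto
qed

lemma dcoset_refl [simp]: "dcoset g g"
  unfolding dcoset_def by (metis L_closed(1) matrix_mul_lid matrix_mul_rid)

lemma hf_dcoset: "x \<in> carrier HR \<Longrightarrow> dcoset g c \<Longrightarrow> hf x c = hf x g"
  unfolding dcoset_def by (auto simp: matrix_mul_assoc[symmetric])

lemma is_dcoset_ind_one: "is_dcoset_ind (hecke_scalar L 1) (mat 1)"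
  unfolding is_dcoset_ind_def by (auto simp: hf_one dcoset_def) (metis L_closed(1) matrix_mul_rid)

lemma is_dcoset_ind_normalizes:
  assumes g: "normalizes g" and y: "is_dcoset_ind y h" shows "is_dcoset_ind (hecke_T L g \<circ> y) (g ** h)"
  unfolding is_dcoset_ind_def
proof (intro conjI ballI)
  fix c :: "'f^2^2" assume c: "c \<in> carrier GL2"
  have "dcoset h (inv\<^bsub>GL2\<^esub> g ** c) \<longleftrightarrow> dcoset (g ** h) c"
  proof
    assume "dcoset h (inv\<^bsub>GL2\<^esub> g ** c)"
    then obtain l l' where l: "l \<in> L" "l' \<in> L" "inv\<^bsub>GL2\<^esub> g ** c = l ** h ** l'" by (auto simp: dcoset_def)
    have "c = g ** (inv\<^bsub>GL2\<^esub> g ** c)" using g by (simp add: matrix_mul_assoc)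
    also have "\<dots> = (g ** l) ** h ** l'" unfolding l by (simp add: matrix_mul_assoc)
    finally have "c = (g ** l) ** h ** l'" .
    moreover obtain l'' where "l'' \<in> L" "g ** l = l'' ** g" using normalizes_right[OF g l(1)] by blast
    ultimately have "c = l'' ** (g ** h) ** l'" by (simp add: matrix_mul_assoc)
    then show "dcoset (g ** h) c" unfolding dcoset_def using l \<open>l'' \<in> L\<close> by blast
  next
    assume "dcoset (g ** h) c"
    then obtain l l' where l: "l \<in> L" "l' \<in> L" "c = l ** (g ** h) ** l'" by (auto simp: dcoset_def)
    obtain l'' where l'': "l'' \<in> L" "l ** g = g ** l''" using normalizes_left[OF g l(1)] by blast
    have "c = (l ** g) ** h ** l'" using l by (simp add: matrix_mul_assoc)
    also have "\<dots> = g ** (l'' ** h ** l')" using l'' by (simp add: matrix_mul_assoc)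
    finally have "inv\<^bsub>GL2\<^esub> g ** c = l'' ** h ** l'" using g by (simp add: matrix_mul_assoc)
    then show "dcoset h (inv\<^bsub>GL2\<^esub> g ** c)" unfolding dcoset_def using l l'' by blast
  qed
  then show "hf (hecke_T L g \<circ> y) c = (if dcoset (g ** h) c then 1 else 0)"
    using y g c by (simp add: hf_T_normalizes is_dcoset_ind_def)
qed (use assms in \<open>auto simp: is_dcoset_ind_def\<close>)

text \<open>Elements of \<open>g L g\<inverse>\<close> have trace \<open>2\<close> modulo \<open>\<varpi>\<close>. If this group contains the integral upper
  unipotent matrices, it therefore contains no integral matrix whose lower left entry is a unit,
  and this is what makes all nonzero coefficients of \<open>T\<^sub>n T\<^sub>g\<close> equal to \<open>1\<close>.\<close>

lemma is_dcoset_ind_n_s: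
  assumes g: "g \<in> carrier GL2" and u: "\<And>s. s \<in> \<O> \<Longrightarrow> inv\<^bsub>GL2\<^esub> g ** ut s ** g \<in> L"
    and y: "is_dcoset_ind y g"
  shows "is_dcoset_ind (Tn \<circ> y) (n_s ** g)"
  unfolding is_dcoset_ind_def
proof (intro conjI ballI)
  fix c :: "'f^2^2" assume c: "c \<in> carrier GL2"
  have eq: "hf (Tn \<circ> y) c = (\<Sum>t\<in>UNIV. if dcoset g (ni ** ut (lf t) ** c) then 1 else 0)"
    using y c by (simp add: hf_Tn is_dcoset_ind_def GL2_mat2_iff)
  have conv: "ut s ** g = g ** (inv\<^bsub>GL2\<^esub> g ** ut s ** g)" for s
    using g by (simp add: matrix_mul_assoc)
  \<comment> \<open>Of \<open>l\<close> only \<open>ut (b / a)\<close> remains to the right of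
    \<open>n_s\<close>, and the hypothesis on \<open>g\<close> moves it through \<open>g\<close>
    into \<open>L\<close>.\<close>
  have dn: "dcoset (n_s ** g) (n_s ** l ** g)" if "l \<in> L" for l
  proof -
    obtain a b c' d where l: "l = mat2 a b c' d" "a \<in> \<O>" "b \<in> \<O>" "c' \<in> \<O>" "d \<in> \<O>"
      "red a = 1" "red d = 1" "red c' = 0" using \<open>l \<in> L\<close> by (rule L_cases)
    have "a \<noteq> 0" using l by auto
    have ba: "b / a \<in> \<O>" using l by (simp add: unit_divide)
    let ?k = "mat2 (d - c' * (b / a)) (- c') 0 a"
    have k: "?k \<in> L" using l ba by (simp add: L_mat2_iff del: times_divide_eq_right)
    have "n_s ** l = ?k ** n_s ** ut (b / a)"
      using l \<open>a \<noteq> 0\<close> by (simp add: n_s_eq)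
    then have "n_s ** l ** g = ?k ** n_s ** (ut (b / a) ** g)"
      by (simp add: matrix_mul_assoc)
    also have "\<dots> = ?k ** (n_s ** g) ** (inv\<^bsub>GL2\<^esub> g ** ut (b / a) ** g)"
      unfolding conv[of "b / a"] by (simp add: matrix_mul_assoc)
    finally show ?thesis using k u[OF ba] unfolding dcoset_def by blast
  qed
  show "hf (Tn \<circ> y) c = (if dcoset (n_s ** g) c then 1 else 0)"
  proof (cases "dcoset (n_s ** g) c")
    case False
    have "\<not> dcoset g (ni ** ut (lf t) ** c)" for t
    proof
      assume "dcoset g (ni ** ut (lf t) ** c)"
      then obtain l l' where l: "l \<in> L" "l' \<in> L" "ni ** ut (lf t) ** c = l ** g ** l'" by (auto simp: dcoset_def)
      have "ut (- lf t) ** n_s ** (ni ** ut (lf t)) = mat 1" by (simp add: n_s_eq mat_1_eq_mat2)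
      then have "c = ut (- lf t) ** n_s ** (ni ** ut (lf t) ** c)"
        by (simp only: matrix_mul_assoc matrix_mul_lid)
      also have "\<dots> = ut (- lf t) ** (n_s ** l ** g) ** l'" unfolding l by (simp only: matrix_mul_assoc)
      finally have "c = ut (- lf t) ** (n_s ** l ** g) ** l'" .
      moreover have "dcoset (n_s ** g) (ut (- lf t) ** (n_s ** l ** g) ** l')"
        using dn[OF l(1)] l(2) dcoset_left[OF ut_L, of "- lf t"] by simp
      ultimately show False using False by simp
    qed
    then show ?thesis using False eq by simp
  next
    case True
    then obtain l l' where l: "l \<in> L" "l' \<in> L" "c = l ** (n_s ** g) ** l'" by (auto simp: dcoset_def)
    obtain a b c' d where l': "l = mat2 a b c' d" "a \<in> \<O>" "b \<in> \<O>" "c' \<in> \<O>" "d \<in> \<O>"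
      "red a = 1" "red d = 1" "red c' = 0" using \<open>l \<in> L\<close> by (rule L_cases)
    let ?m = "\<lambda>t. ni ** ut (lf t) ** l ** n_s"
    have m: "?m t = mat2 d (- c') (- (b + lf t * d)) (a + lf t * c')" for t
      using l' by (simp add: n_s_eq)
    have dm: "dcoset g (ni ** ut (lf t) ** c) = dcoset g (?m t ** g)" for t
    proof -
      have "ni ** ut (lf t) ** c = (?m t ** g) ** l'" using l by (simp only: matrix_mul_assoc)
      then show ?thesis using l dcoset_right by simp
    qed
    \<comment> \<open>The lower left entry of \<open>?m t\<close> vanishes modulo
      \<open>\<varpi>\<close> for exactly one \<open>t\<close>; then \<open>?m t\<close> is absorbed
      by \<open>L\<close>, and otherwise the trace argument excludes it.\<close>
    have "dcoset g (ni ** ut (lf t) ** c) \<longleftrightarrow> t = - red b" for t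
    proof
      assume "t = - red b"
      then have "?m t \<in> L" unfolding m using l' by (simp add: L_mat2_iff)
      then have "dcoset g (?m t ** g)" by simp
      then show "dcoset g (ni ** ut (lf t) ** c)" by (simp only: dm)
    next
      assume "dcoset g (ni ** ut (lf t) ** c)"
      then have "dcoset g (?m t ** g)" by (simp only: dm)
      then obtain l1 l2 where l12: "l1 \<in> L" "l2 \<in> L" "?m t ** g = l1 ** g ** l2" by (auto simp: dcoset_def)
      let ?m' = "inv\<^bsub>GL2\<^esub> l1 ** ?m t"
      have "?m' ** g = (inv\<^bsub>GL2\<^esub> l1 ** l1) ** g ** l2"
        using l12(3) by (metis matrix_mul_assoc)
      then have m'g: "?m' ** g = g ** l2" using l12 by simp
      \<comment> \<open>Both \<open>ut s\<close> and \<open>?m'\<close> become elements of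
        \<open>L\<close> when conjugated by \<open>g\<close>, hence so does their product, and the
        trace ignores conjugation.\<close>
      have tr: "red (trace (ut s ** ?m')) = 2 \<and> trace (ut s ** ?m') \<in> \<O>" if s: "s \<in> \<O>" for s
      proof -
        let ?v = "inv\<^bsub>GL2\<^esub> g ** ut s ** g"
        have "ut s ** ?m' ** g = g ** (?v ** l2)"
        proof -
          have "ut s ** ?m' ** g = ut s ** (?m' ** g)" by (simp only: matrix_mul_assoc)
          also have "\<dots> = (ut s ** g) ** l2" unfolding m'g by (simp only: matrix_mul_assoc)
          also have "\<dots> = g ** (?v ** l2)" unfolding conv[of s] by (simp only: matrix_mul_assoc)
          finally show ?thesis .
        qed
        then have "ut s ** ?m' ** g ** inv\<^bsub>GL2\<^esub> g = g ** (?v ** l2) ** inv\<^bsub>GL2\<^esub> g" by simp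
        then have "trace (ut s ** ?m') = trace (g ** (?v ** l2) ** inv\<^bsub>GL2\<^esub> g)"
          using g by simp
        also have "\<dots> = trace (inv\<^bsub>GL2\<^esub> g ** (g ** (?v ** l2)))" by (rule trace_mul_sym)
        also have "inv\<^bsub>GL2\<^esub> g ** (g ** (?v ** l2)) = ?v ** l2" using g by (simp add: matrix_mul_assoc)
        finally have eq: "trace (ut s ** ?m') = trace (?v ** l2)" .
        have "?v ** l2 \<in> L" using u[OF s] l12 by simp
        then show ?thesis unfolding eq by (rule L_cases) auto
      qed
      obtain p q r w where l1: "inv\<^bsub>GL2\<^esub> l1 = mat2 p q r w" "p \<in> \<O>" "q \<in> \<O>" "r \<in> \<O>" "w \<in> \<O>"
        "red p = 1" "red w = 1" "red r = 0" using l12(1) by (meson L_cases L_inv)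
      \<comment> \<open>The lower left entry of \<open>?m'\<close>: passing from \<open>ut 0\<close>
        to \<open>ut 1\<close> increases the trace by precisely this amount.\<close>
      let ?x = "r * d - w * (b + lf t * d)"
      have "trace (ut 1 ** ?m') = trace (ut 0 ** ?m') + ?x"
        unfolding m l1 by (simp add: algebra_simps)
      moreover have x: "?x \<in> \<O>" using l1 l' by simp
      ultimately have "red (trace (ut 1 ** ?m')) = red (trace (ut 0 ** ?m')) + red ?x"
        using tr[of 0] by (metis OO_zero red_add)
      then have "red ?x = 0" using tr[of 0] tr[of 1] by simp
      moreover have "red ?x = - (red b + t)" using l1 l' by simp
      ultimately have "red b + t = 0" by (metis neg_equal_0_iff_equal)
      then show "t = - red b" by (simp add: eq_neg_iff_add_eq_0 add.commute)
    qed
    then show ?thesis using True eq by simp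
  qed
qed (use y in \<open>simp add: is_dcoset_ind_def\<close>)

text \<open>The pivot is an entry of minimal valuation in its row and column. Clearing by a lower
  unipotent matrix needs a multiplier in the maximal ideal, so the inequality must be strict there;
  ties are settled in favour of \<open>c\<close> and against \<open>b\<close>.\<close>

lemma monomial_reduction:
  assumes g: "g \<in> carrier GL2"
  obtains a d where "a \<noteq> 0" "d \<noteq> 0" "dcoset (mat2 a 0 0 d) g"
  | b c where "b \<noteq> 0" "c \<noteq> 0" "dcoset (mat2 0 b c 0) g"
proof -
  obtain a b c d where G: "g = mat2 a b c d" by (rule mat2_cases)
  have D: "a * d - b * c \<noteq> 0" using g G by (simp add: GL2_mat2_iff)
  have key: "\<exists>a' d'. a' \<noteq> 0 \<and> d' \<noteq> 0 \<and> (dcoset (mat2 a' 0 0 d') g \<or> dcoset (mat2 0 a' d' 0) g)"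
  proof -
    let ?q = "\<lambda>x y. x / y \<in> \<O>" and ?r = "\<lambda>x y. x / y \<in> \<O> \<and> red (x / y) = 0"
    have q: "?q x y" if "y \<noteq> 0" "x = 0 \<or> val y \<le> val x" for x y
      using that by (cases "x = 0") (auto simp: OO_iff val_divide)
    have r: "?r x y" if "y \<noteq> 0" "x = 0 \<or> val y < val x" for x y
      using that q[OF that(1), of x] by (cases "x = 0") (auto simp: red_eq_0_iff val_divide)
    consider
      (c) "c \<noteq> 0" "?q a c" "?q d c" | (a) "a \<noteq> 0" "?r c a" "?q b a"
      | (d) "d \<noteq> 0" "?r c d" "?q b d" | (b) "b \<noteq> 0" "?r a b" "?r d b"
    proof -
      have "(c \<noteq> 0 \<and> (a = 0 \<or> val c \<le> val a) \<and> (d = 0 \<or> val c \<le> val d)) \<or>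
        (a \<noteq> 0 \<and> (c = 0 \<or> val a < val c) \<and> (b = 0 \<or> val a \<le> val b)) \<or>
        (d \<noteq> 0 \<and> (c = 0 \<or> val d < val c) \<and> (b = 0 \<or> val d \<le> val b)) \<or>
        (b \<noteq> 0 \<and> (a = 0 \<or> val b < val a) \<and> (d = 0 \<or> val b < val d))"
        using D by (cases "a = 0"; cases "b = 0"; cases "c = 0"; cases "d = 0") (simp_all, linarith+)
      then show thesis using that q r by blast
    qed
    then show ?thesis
    proof cases
      case c
      let ?b = "b - a * (d / c)"
      have "g = ut (a / c) ** mat2 0 ?b c 0 ** ut (d / c)" using c by (simp add: G field_simps)
      then have "dcoset (mat2 0 ?b c 0) g" unfolding dcoset_def using c by (metis ut_L)
      moreover have "?b \<noteq> 0" using D c by (auto simp: field_simps)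
      ultimately show ?thesis using c by blast
    next
      case a
      let ?d = "d - c * (b / a)"
      have "g = mat2 1 0 (c / a) 1 ** mat2 a 0 0 ?d ** ut (b / a)" using a by (simp add: G field_simps)
      moreover have "mat2 1 0 (c / a) 1 \<in> L" using a by (simp add: L_mat2_iff)
      ultimately have "dcoset (mat2 a 0 0 ?d) g" unfolding dcoset_def using a by (metis ut_L)
      moreover have "?d \<noteq> 0" using D a by (auto simp: field_simps)
      ultimately show ?thesis using a by blast
    next
      case d
      let ?a = "a - b * (c / d)"
      have "g = ut (b / d) ** mat2 ?a 0 0 d ** mat2 1 0 (c / d) 1" using d by (simp add: G field_simps)
      moreover have "mat2 1 0 (c / d) 1 \<in> L" using d by (simp add: L_mat2_iff)
      ultimately have "dcoset (mat2 ?a 0 0 d) g" unfolding dcoset_def using d by (metis ut_L)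
      moreover have "?a \<noteq> 0" using D d by (auto simp: field_simps)
      ultimately show ?thesis using d by blast
    next
      case b
      let ?c = "c - d * (a / b)"
      have "g = mat2 1 0 (d / b) 1 ** mat2 0 b ?c 0 ** mat2 1 0 (a / b) 1" using b by (simp add: G field_simps)
      moreover have "mat2 1 0 (d / b) 1 \<in> L" "mat2 1 0 (a / b) 1 \<in> L" using b by (simp_all add: L_mat2_iff)
      ultimately have "dcoset (mat2 0 b ?c 0) g" unfolding dcoset_def by metis
      moreover have "?c \<noteq> 0" using D b by (auto simp: field_simps)
      ultimately show ?thesis using b by blast
    qed
  qed
  then show thesis using that by blast
qed

text \<open>Induction on the length of a monomial representative, a reduced word multiplying
  indicators without overlap; a general element is a finite combination of these indicators. Closure
  under left multiplication is enough, as words are built from their right end.\<close>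

theorem hecke_generated:
  fixes S :: "('f, 'c::field) hecke set"
  assumes S: "S \<subseteq> carrier HR" and one: "hecke_scalar L 1 \<in> S"
    and add: "\<And>x y. x \<in> S \<Longrightarrow> y \<in> S \<Longrightarrow> x + y \<in> S"
    and scal: "\<And>a x. x \<in> S \<Longrightarrow> hecke_scalar L a \<circ> x \<in> S"
    and Pi: "\<And>x. x \<in> S \<Longrightarrow> TPi \<circ> x \<in> S" and Pi': "\<And>x. x \<in> S \<Longrightarrow> TPi' \<circ> x \<in> S"
    and n: "\<And>x. x \<in> S \<Longrightarrow> Tn \<circ> x \<in> S"
    and h: "\<And>a d x. a \<in> \<O> \<Longrightarrow> d \<in> \<O> \<Longrightarrow> red a \<noteq> 0 \<Longrightarrow> red d \<noteq> 0 \<Longrightarrow> x \<in> S \<Longrightarrow>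
      hecke_T L (dg a d) \<circ> x \<in> S"
  shows "S = carrier HR"
proof -
  define P where "P g \<longleftrightarrow> (\<exists>y\<in>S. is_dcoset_ind y g)" for g
  have P1: "P (mat 1)" unfolding P_def using one is_dcoset_ind_one by blast
  have PPi: "P (Pi ** g)" if "P g" for g
    using that Pi is_dcoset_ind_normalizes[OF normalizes_Pi] unfolding P_def by blast
  have PPi': "P (inv\<^bsub>GL2\<^esub> Pi ** g)" if "P g" for g
    using that Pi' is_dcoset_ind_normalizes[OF normalizes_inv[OF normalizes_Pi]] unfolding P_def by blast
  have Ph: "P (dg a d ** g)" if "P g" "a \<in> \<O>" "d \<in> \<O>" "red a \<noteq> 0" "red d \<noteq> 0" for g a d
    using that h is_dcoset_ind_normalizes[OF normalizes_dg[of a d]] unfolding P_def by blast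
  have Pn: "P (n_s ** g)" if "P g" "g \<in> carrier GL2" "\<And>s. s \<in> \<O> \<Longrightarrow> inv\<^bsub>GL2\<^esub> g ** ut s ** g \<in> L" for g
    using that n is_dcoset_ind_n_s[of g] unfolding P_def by blast
  \<comment> \<open>The centre is reached through \<open>Pi ** Pi\<close>, which is the scalar
    matrix \<open>\<varpi>\<close>.\<close>
  have Pz: "P (dg (varpi powi j) (varpi powi j))" for j
  proof (induction j rule: int_induct[where k = 0])
    case base
    then show ?case using P1 by (simp add: mat_1_eq_mat2)
  next
    case (step1 j)
    have "Pi ** (Pi ** dg (varpi powi j) (varpi powi j)) = dg (varpi powi (j + 1)) (varpi powi (j + 1))"
      by (simp add: Pi_eq power_int_add_1 mult.commute)
    then show ?case using PPi[OF PPi[OF step1(2)]] by simp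
  next
    case (step2 j)
    have "inv\<^bsub>GL2\<^esub> Pi ** (inv\<^bsub>GL2\<^esub> Pi ** dg (varpi powi j) (varpi powi j)) = dg (varpi powi (j - 1)) (varpi powi (j - 1))"
      by (simp add: inv_Pi power_int_diff)
    then show ?case using PPi'[OF PPi'[OF step2(2)]] by simp
  qed
  have Pd0: "P (dg a d)" if "a \<noteq> 0" "d \<noteq> 0" "val a = val d" for a d
  proof -
    let ?z = "varpi powi (val a)"
    have "P (dg (a / ?z) (d / ?z) ** dg ?z ?z)"
      using that unit_iff[of "a / ?z"] unit_iff[of "d / ?z"] Pz
      by (intro Ph) (auto simp: val_divide val_powi)
    then show ?thesis by simp
  qed
  \<comment> \<open>Here \<open>m\<close> is the length of the monomial matrix. The shift by one in
    the antidiagonal case makes \<open>Pi\<close> have length zero.\<close>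
  have len: "(a \<noteq> 0 \<longrightarrow> d \<noteq> 0 \<longrightarrow> nat \<bar>val a - val d\<bar> = m \<longrightarrow> P (dg a d)) \<and>
    (a \<noteq> 0 \<longrightarrow> d \<noteq> 0 \<longrightarrow> nat \<bar>val d - val a - 1\<bar> = m \<longrightarrow> P (mat2 0 a d 0))" for m a d
  proof (induction m arbitrary: a d)
    case 0
    have "P (mat2 0 a d 0)" if "a \<noteq> 0" "d \<noteq> 0" "val d = val a + 1"
    proof -
      have "P (Pi ** dg (d / varpi) a)" using that by (intro PPi Pd0) (auto simp: val_divide)
      then show ?thesis by (simp add: Pi_eq)
    qed
    then show ?case using Pd0[of a d] by auto
  next
    case (Suc m)
    have IHd: "P (dg a d)" if "a \<noteq> 0" "d \<noteq> 0" "nat \<bar>val a - val d\<bar> = m" for a d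
      using Suc.IH[of a d] that by blast
    have IHa: "P (mat2 0 a d 0)" if "a \<noteq> 0" "d \<noteq> 0" "nat \<bar>val d - val a - 1\<bar> = m" for a d
      using Suc.IH[of a d] that by blast
    \<comment> \<open>These facts feed \<open>is_dcoset_ind_n_s\<close>; the inequalities single out
      the monomial matrices whose length grows under left multiplication by
      \<open>n_s\<close>.\<close>
    have ud: "inv\<^bsub>GL2\<^esub> (dg a d) ** ut s ** dg a d \<in> L" if "a \<noteq> 0" "d \<noteq> 0" "val a \<le> val d" "s \<in> \<O>" for a d s
      using that OO_mult[of s "d / a"] by (auto simp: inv_GL2_mat2 L_mat2_iff OO_iff val_divide)
    have ua: "inv\<^bsub>GL2\<^esub> (mat2 0 a d 0) ** ut s ** mat2 0 a d 0 \<in> L"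
      if "a \<noteq> 0" "d \<noteq> 0" "val a < val d" "s \<in> \<O>" for a d s
    proof -
      have da: "d / a \<in> \<O>" "red (d / a) = 0"
        using that red_eq_0_iff[of "d / a"] by (auto simp: OO_iff val_divide)
      have "inv\<^bsub>GL2\<^esub> (mat2 0 a d 0) ** ut s ** mat2 0 a d 0 = mat2 1 0 (s * (d / a)) 1"
        using that by (simp add: inv_GL2_mat2)
      then show ?thesis using that da by (simp add: L_mat2_iff del: times_divide_eq_right)
    qed
    have "P (dg a d)" if nz: "a \<noteq> 0" "d \<noteq> 0" and l: "nat \<bar>val a - val d\<bar> = Suc m"
    proof (cases "val a > val d")
      case True
      have "P (n_s ** mat2 0 d (- a) 0)"
        using nz l True by (intro Pn IHa ua) (auto simp: GL2_mat2_iff)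
      then have "P (dg a d)" by (simp add: n_s_eq)
      then show ?thesis .
    next
      case False
      \<comment> \<open>Multiplying the target by \<open>n_s\<close> would lengthen it, so its
        reduced word starts with \<open>Pi ** n_s\<close> instead, and the diagonal factor is one
        step shorter.\<close>
      have "P (n_s ** dg a (- (d / varpi)))"
        using nz l False by (intro Pn IHd ud) (auto simp: GL2_mat2_iff val_divide)
      then have "P (Pi ** (n_s ** dg a (- (d / varpi))))" by (rule PPi)
      then show ?thesis by (simp add: n_s_eq Pi_eq)
    qed
    moreover have "P (mat2 0 a d 0)" if nz: "a \<noteq> 0" "d \<noteq> 0" and l: "nat \<bar>val d - val a - 1\<bar> = Suc m"
    proof (cases "val a \<ge> val d")
      case True
      have "P (n_s ** dg d (- a))"
        using nz l True by (intro Pn IHd ud) (auto simp: GL2_mat2_iff)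
      then show ?thesis by (simp add: n_s_eq)
    next
      case False
      have "P (n_s ** mat2 0 a (- (d / varpi)) 0)"
        using nz l False by (intro Pn IHa ua) (auto simp: GL2_mat2_iff val_divide)
      then have "P (Pi ** (n_s ** mat2 0 a (- (d / varpi)) 0))" by (rule PPi)
      then show ?thesis by (simp add: n_s_eq Pi_eq)
    qed
    ultimately show ?case by blast
  qed
  have ind: "\<exists>m y. y \<in> S \<and> is_dcoset_ind y m \<and> dcoset m g" if "g \<in> carrier GL2" for g
    using that
  proof (cases g rule: monomial_reduction)
    case (1 a d)
    then show ?thesis using len[of a d "nat \<bar>val a - val d\<bar>"] unfolding P_def by blast
  next
    case (2 a d)
    then show ?thesis using len[of a d "nat \<bar>val d - val a - 1\<bar>"] unfolding P_def by blast
  qed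
  have "x \<in> S" if x: "x \<in> carrier HR" for x
    using x
  proof (induction "card {C. x delta C \<noteq> 0}" arbitrary: x rule: less_induct)
    case less
    let ?supp = "\<lambda>x :: ('f, 'c) hecke. {C. x delta C \<noteq> 0}"
    have fin: "finite (?supp x)" using cInd_finite[OF HR_carrierD(1)[OF less.prems delta_cInd]] .
    show ?case
    proof (cases "?supp x = {}")
      case True
      \<comment> \<open>Empty support means \<open>x = 0\<close>, written as a scalar multiple of
        the identity so that \<open>scal\<close> applies.\<close>
      have "x = hecke_scalar L 0 \<circ> hecke_scalar L 1"
        using True less.prems
        by (intro HR_eqI) (simp_all del: HR_comp_one, simp add: fun_eq_iff hecke_scalar_def)
      then show ?thesis using scal[OF one, of 0] by simp
    next
      case False
      then obtain C where C: "x delta C \<noteq> 0" by auto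
      then have "C \<in> cosets" using cIndD[OF HR_carrierD(1)[OF less.prems delta_cInd]] by blast
      then obtain g where g: "g \<in> carrier GL2" "C = cs g" by (rule cosetsE)
      obtain m y where y: "y \<in> S" "is_dcoset_ind y m" "dcoset m g" using ind[OF g(1)] by blast
      have yc: "y \<in> carrier HR" using y S by blast
      let ?a = "hf x g"
      \<comment> \<open>Both \<open>x\<close> and the indicator \<open>y\<close> are constant on the
        double coset of \<open>m\<close>, so this multiple of \<open>y\<close> erases it and changes
        nothing elsewhere.\<close>
      let ?x = "x + (hecke_scalar L (- ?a) \<circ> y)"
      have xc: "?x \<in> carrier HR" using less.prems yc by simp
      have hfx: "hf ?x c = (if dcoset m c then 0 else hf x c)" if "c \<in> carrier GL2" for c
        using that y yc hf_dcoset[OF less.prems] by (simp add: hf_add hf_scalar is_dcoset_ind_def)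
      have "?supp ?x \<subset> ?supp x"
      proof
        show "?supp ?x \<subseteq> ?supp x"
        proof
          fix D assume D: "D \<in> ?supp ?x"
          then have "D \<in> cosets" using cIndD[OF HR_carrierD(1)[OF xc delta_cInd]] by blast
          then obtain c where "c \<in> carrier GL2" "D = cs c" by (rule cosetsE)
          then show "D \<in> ?supp x" using D hfx[of c] by (auto simp: hf_def split: if_splits)
        qed
        have "?x delta C = 0" using hfx[OF g(1)] y(3) g(2) by (simp add: hf_def)
        then show "?supp ?x \<noteq> ?supp x" using C by blast
      qed
      then have "?x \<in> S" using less.hyps[OF psubset_card_mono[OF fin] xc] by blast
      then have "?x + (hecke_scalar L ?a \<circ> y) \<in> S" using add scal y(1) by blast
      moreover have "?x + (hecke_scalar L ?a \<circ> y) = x"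
        using yc less.prems by (intro HR_eqI_hf) (auto simp: hf_add hf_scalar)
      ultimately show ?thesis by simp
    qed
  qed
  then show ?thesis using S by blast
qed

end

section \<open>Characters of the diagonal torus\<close>

lemma mem_diag2: "h \<in> diag2 \<longleftrightarrow> (\<exists>a d. a \<noteq> 0 \<and> d \<noteq> 0 \<and> h = mat2 a 0 0 d)"
  for h :: "'k::field^2^2"
  by (cases h) (auto simp: diag2_def GL2_mat2_iff)

lemma diag2_mat2 [simp]: "mat2 a 0 0 d \<in> diag2 \<longleftrightarrow> a \<noteq> 0 \<and> d \<noteq> 0"
  for a :: "'k::field"
  by (auto simp: mem_diag2)

lemma diag2_GL2: "h \<in> diag2 \<Longrightarrow> h \<in> carrier GL2"
  by (simp add: diag2_def)

lemma diag2_mult [simp]: "h \<in> diag2 \<Longrightarrow> h' \<in> diag2 \<Longrightarrow> h ** h' \<in> diag2"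
  by (auto simp: mem_diag2)

lemma diag2_one [simp]: "mat 1 \<in> diag2"
  by (simp add: mat_1_eq_mat2)

lemma diag2_inv [simp]: "h \<in> diag2 \<Longrightarrow> inv\<^bsub>GL2\<^esub> h \<in> diag2"
  by (auto simp: mem_diag2 inv_GL2_mat2)

definition swap :: "'k::field^2^2 \<Rightarrow> 'k^2^2" where "swap h = mat2 (h $ 2 $ 2) 0 0 (h $ 1 $ 1)"

lemma swap_mat2 [simp]: "swap (mat2 a b c d) = mat2 d 0 0 a"
  by (simp add: swap_def)

lemma swap_diag2 [simp]: "h \<in> diag2 \<Longrightarrow> swap h \<in> diag2" "h \<in> diag2 \<Longrightarrow> swap (swap h) = h"
  by (auto simp: mem_diag2)

lemma conj_s_eq:
  fixes h :: "'k::field^2^2"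
  assumes "h \<in> diag2" shows "conj_s chi h = chi (swap h)"
proof -
  have "inv\<^bsub>GL2\<^esub> (s_mat :: 'k^2^2) = s_mat"
    by (rule inv_GL2_unique) (simp_all add: s_mat_def GL2_mat2_iff mat_1_eq_mat2)
  moreover obtain a d where "h = mat2 a 0 0 d" using assms by (auto simp: mem_diag2)
  ultimately show ?thesis unfolding conj_s_def by (simp add: s_mat_def)
qed

lemma is_char_HD:
  assumes "is_char_H chi"
  shows "h \<in> diag2 \<Longrightarrow> chi h \<noteq> 0" "h \<in> diag2 \<Longrightarrow> h' \<in> diag2 \<Longrightarrow> chi (h ** h') = chi h * chi h'"
  using assms by (auto simp: is_char_H_def)

lemma char_H_one: "is_char_H chi \<Longrightarrow> chi (mat 1) = 1"
  using is_char_HD(1)[of chi "mat 1"] is_char_HD(2)[of chi "mat 1" "mat 1"] by simp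

lemma char_H_inv: "is_char_H chi \<Longrightarrow> h \<in> diag2 \<Longrightarrow> chi (inv\<^bsub>GL2\<^esub> h) = inverse (chi h)"
  using is_char_HD(2)[of chi h "inv\<^bsub>GL2\<^esub> h"] char_H_one[of chi] diag2_GL2[of h]
  by (simp add: inverse_unique)

lemma swap_mult: "h \<in> diag2 \<Longrightarrow> h' \<in> diag2 \<Longrightarrow> swap (h ** h') = swap h ** swap h'"
  by (auto simp: mem_diag2)

lemma is_char_H_conj_s [simp]: "is_char_H chi \<Longrightarrow> is_char_H (conj_s chi)"
  unfolding is_char_H_def by (simp add: conj_s_eq swap_mult)

lemma conj_s_conj_s: "h \<in> diag2 \<Longrightarrow> conj_s (conj_s chi) h = chi h"
  by (simp add: conj_s_eq)

lemma sum_diag2_shift: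
  fixes chi :: "'k::{field,finite}^2^2 \<Rightarrow> 'c::field"
  assumes chi: "is_char_H chi" and h0: "h0 \<in> diag2"
  shows "(\<Sum>h\<in>diag2. inverse (chi h) * F (h0 ** h)) = chi h0 * (\<Sum>h\<in>diag2. inverse (chi h) * F h)"
proof -
  have "(\<Sum>h\<in>diag2. inverse (chi h) * F (h0 ** h)) =
      (\<Sum>h\<in>diag2. chi h0 * (inverse (chi h) * F h))"
  proof (rule sum.reindex_bij_witness[where i = "\<lambda>h. inv\<^bsub>GL2\<^esub> h0 ** h" and j = "\<lambda>h. h0 ** h"])
    fix h :: "'k^2^2" assume h: "h \<in> diag2"
    show "chi h0 * (inverse (chi (h0 ** h)) * F (h0 ** h)) = inverse (chi h) * F (h0 ** h)"
      using is_char_HD[OF chi] h h0 by (simp add: field_simps)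
  qed (use h0 diag2_GL2[OF h0] in \<open>auto simp: matrix_mul_assoc\<close>)
  then show ?thesis by (simp add: sum_distrib_left)
qed

lemma sum_diag2_swap:
  fixes chi :: "'k::{field,finite}^2^2 \<Rightarrow> 'c::field"
  shows "(\<Sum>h\<in>diag2. inverse (chi h) * F (swap h)) = (\<Sum>h\<in>diag2. inverse (conj_s chi h) * F h)"
  by (rule sum.reindex_bij_witness[where i = swap and j = swap]) (auto simp: conj_s_eq)

text \<open>The constant in the quadratic relation \<open>T\<^sub>n\<^sup>2 = T\<^sub>n \<Sum>\<^sub>t T\<^bsub>diag(-t,-1/t)\<^esub>\<close> valid for \<open>q = 0\<close>.\<close>

definition quad_const :: "('k::{field,finite}^2^2 \<Rightarrow> 'c::field) \<Rightarrow> 'c" where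
  "quad_const chi = (\<Sum>t\<in>UNIV - {0}. chi (mat2 (- t) 0 0 (- inverse t)))"

lemma quad_const_eq: "quad_const chi = (\<Sum>t\<in>UNIV - {0}. chi (mat2 t 0 0 (inverse t)))"
  unfolding quad_const_def by (rule sum.reindex_bij_witness[where i = uminus and j = uminus]) auto

lemma char_H_antidiag:
  assumes "is_char_H chi" "t \<noteq> 0"
  shows "chi (mat2 t 0 0 (inverse t)) * chi (mat2 1 0 0 t) = chi (mat2 t 0 0 1)"
  using is_char_HD(2)[OF assms(1), of "mat2 t 0 0 (inverse t)" "mat2 1 0 0 t"] assms(2) by simp

text \<open>A character fixed by \<open>s\<close> is trivial on \<open>diag(t, 1/t)\<close>, so the
  sum counts the \<open>q - 1\<close> units, and \<open>q = 0\<close>.\<close>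

lemma quad_const_self:
  fixes chi :: "'k::{field,finite}^2^2 \<Rightarrow> 'c::field"
  assumes chi: "is_char_H chi" "self_conj chi" and q: "of_nat CARD('k) = (0::'c)"
  shows "quad_const chi = -1"
proof -
  have "chi (mat2 t 0 0 (inverse t)) = 1" if "t \<noteq> 0" for t
  proof -
    have "chi (mat2 t 0 0 1) = chi (mat2 1 0 0 t)"
      using chi(2) that conj_s_eq[of "mat2 t 0 0 1" chi] by (auto simp: self_conj_def)
    then show ?thesis
      using char_H_antidiag[OF chi(1) that] is_char_HD(1)[OF chi(1), of "mat2 1 0 0 t"] that by simp
  qed
  then have "quad_const chi = (\<Sum>t\<in>UNIV - {0 :: 'k}. 1)"
    unfolding quad_const_eq by (intro sum.cong) auto
  also have "\<dots> = (\<Sum>t\<in>(UNIV :: 'k set). 1) - 1" by (simp add: sum_diff1)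
  finally show ?thesis using q by simp
qed

text \<open>The sum of a nontrivial character of the unit group vanishes. Nontriviality comes from
  an \<open>h\<close> with \<open>chi h \<noteq> chi (swap h)\<close>: the quotient of
  \<open>h\<close> by \<open>swap h\<close> has the form \<open>diag(t, 1/t)\<close>.\<close>

lemma quad_const_nonself:
  fixes chi :: "'k::{field,finite}^2^2 \<Rightarrow> 'c::field"
  assumes chi: "is_char_H chi" "\<not> self_conj chi"
  shows "quad_const chi = 0"
proof -
  let ?f = "\<lambda>t. chi (mat2 t 0 0 (inverse t))"
  have fm: "?f (t * t') = ?f t * ?f t'" if "t \<noteq> 0" "t' \<noteq> 0" for t t'
    using is_char_HD(2)[OF chi(1), of "mat2 t 0 0 (inverse t)" "mat2 t' 0 0 (inverse t')"] that by simp
  obtain h where h: "h \<in> diag2" "chi h \<noteq> chi (swap h)"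
    using chi(2) conj_s_eq[of _ chi] by (auto simp: self_conj_def)
  then obtain a d where ad: "a \<noteq> 0" "d \<noteq> 0" "h = mat2 a 0 0 d" by (auto simp: mem_diag2)
  let ?t = "a / d"
  have t: "?t \<noteq> 0" using ad by simp
  have "?f ?t * chi (mat2 d 0 0 a) = chi (mat2 a 0 0 d)"
    using is_char_HD(2)[OF chi(1), of "mat2 ?t 0 0 (inverse ?t)" "mat2 d 0 0 a"] ad by simp
  then have ne: "?f ?t \<noteq> 1" using h ad by auto
  have "(\<Sum>t\<in>UNIV - {0}. ?f t) = (\<Sum>t\<in>UNIV - {0}. ?f ?t * ?f t)"
    by (rule sum.reindex_bij_witness[where i = "\<lambda>t. ?t * t" and j = "\<lambda>t. t / ?t"])
      (use t ad fm[OF t, of "_ / ?t"] in \<open>simp_all add: divide_simps\<close>)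
  then have "(\<Sum>t\<in>UNIV - {0}. ?f t) = ?f ?t * (\<Sum>t\<in>UNIV - {0}. ?f t)"
    unfolding sum_distrib_left .
  then have "(1 - ?f ?t) * (\<Sum>t\<in>UNIV - {0}. ?f t) = 0"
    by (simp only: left_diff_distrib) simp
  then show ?thesis using ne by (simp add: quad_const_eq)
qed

lemma quad_const_conj_s: "is_char_H chi \<Longrightarrow> quad_const (conj_s chi) = quad_const chi"
  unfolding quad_const_eq
  by (rule sum.reindex_bij_witness[where i = inverse and j = inverse]) (auto simp: conj_s_eq)

section \<open>Functionals on the Hecke algebra\<close>

locale mod_p_hecke = nonarch_local_field val red varpi
  for val :: "'f::field \<Rightarrow> int" and red :: "'f \<Rightarrow> 'k::{field,finite}" and varpi +
  fixes coeff :: "'c::field itself"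
  assumes q0: "of_nat CARD('k) = (0::'c)"
begin

abbreviation HC :: "('f, 'c) hecke ring" where "HC \<equiv> HR"
abbreviation dl :: "'k^2^2 \<Rightarrow> 'f^2^2" where "dl \<equiv> diag_lift val red"
abbreviation one1 :: "'f^2^2" where "one1 \<equiv> mat 1"

lemma dl:
  assumes "h \<in> diag2"
  obtains a d where "dl h = dg a d" "a \<in> \<O>" "d \<in> \<O>" "h = mat2 (red a) 0 0 (red d)"
    "red a \<noteq> 0" "red d \<noteq> 0"
proof -
  obtain x y where h: "h = mat2 x 0 0 y" "x \<noteq> 0" "y \<noteq> 0" using assms by (auto simp: mem_diag2)
  have "lf x \<noteq> 0" "lf y \<noteq> 0" using h lf(2) red_zero by metis+
  then have "dg (lf x) (lf y) \<in> K \<inter> diag2 \<and> red_mat red (dg (lf x) (lf y)) = h"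
    using h by (simp add: K_mat2_iff)
  then have *: "dl h \<in> K \<inter> diag2 \<and> red_mat red (dl h) = h"
    unfolding diag_lift_def by (rule someI)
  then obtain a d where "dl h = dg a d" by (auto simp: mem_diag2)
  then show thesis using that[of a d] * h by (auto simp: K_mat2_iff)
qed

lemma dl_normalizes [simp]: "h \<in> diag2 \<Longrightarrow> normalizes (dl h)"
  by (erule dl) simp

lemma dl_GL2 [simp]: "h \<in> diag2 \<Longrightarrow> dl h \<in> carrier GL2"
  by (simp add: normalizes_GL2)

lemma dl_K [simp]: "h \<in> diag2 \<Longrightarrow> dl h \<in> K"
  by (erule dl) (simp add: K_mat2_iff)

lemma red_dl [simp]: "h \<in> diag2 \<Longrightarrow> red_mat red (dl h) = h"
  by (erule dl) simp

lemma dg_cong: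
  assumes "a \<in> \<O>" "d \<in> \<O>" "red a \<noteq> 0" "red d \<noteq> 0" "h = mat2 (red a) 0 0 (red d)"
  shows "\<exists>l\<in>L. dg a d = dl h ** l"
proof -
  have "h \<in> diag2" using assms by simp
  then obtain a' d' where h: "dl h = dg a' d'" "a' \<in> \<O>" "d' \<in> \<O>" "h = mat2 (red a') 0 0 (red d')"
    "red a' \<noteq> 0" "red d' \<noteq> 0" by (rule dl)
  have "a' \<noteq> 0" "d' \<noteq> 0" using h by auto
  then show ?thesis using assms h
    by (intro bexI[of _ "dg (a / a') (d / d')"]) (auto simp: L_mat2_iff unit_divide red_divide)
qed

text \<open>Summing over the powers of \<open>\<varpi>\<close> makes \<open>bar\<close>, and every functional built from it, insensitive to
  the central element \<open>T\<^sub>\<Pi>\<^sup>2\<close>.\<close>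

definition zm :: "int \<Rightarrow> 'f^2^2" where "zm j = dg (varpi powi j) (varpi powi j)"

definition bar :: "('f, 'c) hecke \<Rightarrow> 'f^2^2 \<Rightarrow> 'c" where
  "bar x g = Sum_any (\<lambda>j. hf x (zm j ** g))"

lemma zm_commute: "zm j ** g = g ** zm j"
  by (cases g) (simp add: zm_def mult.commute)

lemma zm_left_commute: "A ** (zm j ** g) = zm j ** (A ** g)"
  by (metis matrix_mul_assoc zm_commute)

lemma zm_GL2 [simp]: "zm j \<in> carrier GL2"
  by (simp add: zm_def GL2_mat2_iff)

lemma zm_add: "zm i ** zm j = zm (i + j)"
  by (simp add: zm_def power_int_add)

lemma zm_zero: "zm 0 = mat 1"
  by (simp add: zm_def mat_1_eq_mat2)

lemma PiPi: "Pi ** Pi = zm 1"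
  by (simp add: Pi_eq zm_def)

text \<open>Different powers of \<open>\<varpi>\<close> move \<open>g\<close> into different cosets,
  since an element of \<open>L\<close> has diagonal entries of valuation zero. Finite support in the
  cosets therefore bounds \<open>j\<close>.\<close>

lemma bar_finite:
  assumes x: "x \<in> carrier HC" and g: "g \<in> carrier GL2"
  shows "finite {j. hf x (zm j ** g) \<noteq> 0}"
proof (rule finite_imageD[OF finite_subset[OF _ hf_finite[OF x]]])
  show "(\<lambda>j. cs (zm j ** g)) ` {j. hf x (zm j ** g) \<noteq> 0} \<subseteq> {C. \<exists>g\<in>carrier GL2. C = cs g \<and> hf x g \<noteq> 0}"
    using g by auto
  show "inj_on (\<lambda>j. cs (zm j ** g)) {j. hf x (zm j ** g) \<noteq> 0}"
  proof (rule inj_onI)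
    fix i j assume "cs (zm i ** g) = cs (zm j ** g)"
    then have "(zm i ** g) ** inv\<^bsub>GL2\<^esub> (zm j ** g) \<in> L" using g cs_eq_iff by simp
    moreover have "inv\<^bsub>GL2\<^esub> (zm j) = zm (- j)"
      by (rule inv_GL2_unique) (simp_all add: zm_add zm_zero)
    ultimately have "zm (i - j) \<in> L" using g by (simp add: inv_GL2_mult matrix_mul_assoc zm_add)
    then have "red (varpi powi (i - j)) = 1" "varpi powi (i - j) \<in> \<O>"
      by (auto simp: zm_def L_mat2_iff)
    then have "val (varpi powi (i - j)) = 0" by (intro unit_val) auto
    then show "i = j" by (simp add: val_powi)
  qed
qed

lemma bar_add:
  "x \<in> carrier HC \<Longrightarrow> y \<in> carrier HC \<Longrightarrow> g \<in> carrier GL2 \<Longrightarrow> bar (x + y) g = bar x g + bar y g"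
  by (simp add: bar_def hf_add Sum_any.distrib bar_finite)

lemma bar_scalar:
  "x \<in> carrier HC \<Longrightarrow> g \<in> carrier GL2 \<Longrightarrow> bar (hecke_scalar L a \<circ> x) g = a * bar x g"
  by (simp add: bar_def hf_scalar Sum_any_right_distrib bar_finite)

lemma bar_left [simp]: "l \<in> L \<Longrightarrow> bar x (l ** g) = bar x g"
proof -
  assume l: "l \<in> L"
  have "zm j ** (l ** g) = l ** (zm j ** g)" for j
    by (simp only: zm_left_commute)
  then show ?thesis using l by (simp add: bar_def)
qed

lemma bar_right [simp]: "x \<in> carrier HC \<Longrightarrow> l \<in> L \<Longrightarrow> bar x (g ** l) = bar x g"
  by (simp add: bar_def matrix_mul_assoc)

lemma bar_zm [simp]: "bar x (zm i ** g) = bar x g"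
  unfolding bar_def
  by (rule Sum_any.reindex_cong[where l = "\<lambda>j. j + i", symmetric])
    (auto simp: fun_eq_iff matrix_mul_assoc zm_add intro!: bij_betwI[where g = "\<lambda>j. j - i"])

lemma bar_right_normalizes:
  "x \<in> carrier HC \<Longrightarrow> normalizes M \<Longrightarrow> l \<in> L \<Longrightarrow> bar x (X ** l ** M) = bar x (X ** M)"
  using normalizes_left[of M l] by (metis bar_right matrix_mul_assoc)

lemma bar_dg:
  assumes "x \<in> carrier HC" "normalizes Q" "a \<in> \<O>" "d \<in> \<O>" "red a \<noteq> 0" "red d \<noteq> 0"
    "h = mat2 (red a) 0 0 (red d)"
  shows "bar x (X ** dg a d ** Q) = bar x (X ** dl h ** Q)"
proof -
  obtain l where "l \<in> L" "dg a d = dl h ** l" using dg_cong assms by blast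
  then show ?thesis using bar_right_normalizes[OF assms(1,2), of l "X ** dl h"]
    by (simp add: matrix_mul_assoc)
qed

text \<open>The product with \<open>T_\<Pi>\<close> shifts the kernel by the inverse of
  \<open>Pi\<close>, which differs from \<open>Pi\<close> by a central matrix invisible to
  \<open>bar\<close>. Hence \<open>T_\<Pi>\<close> and its inverse have the same effect.\<close>

lemma bar_TPi: "x \<in> carrier HC \<Longrightarrow> g \<in> carrier GL2 \<Longrightarrow> bar (TPi \<circ> x) g = bar x (Pi ** g)"
proof -
  assume x: "x \<in> carrier HC" and g: "g \<in> carrier GL2"
  have "inv\<^bsub>GL2\<^esub> Pi = zm (-1) ** Pi"
    unfolding inv_Pi by (simp add: zm_def Pi_eq field_simps)
  then have "inv\<^bsub>GL2\<^esub> Pi ** (zm j ** g) = zm j ** (zm (-1) ** (Pi ** g))" for j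
    unfolding zm_left_commute[of "inv\<^bsub>GL2\<^esub> Pi" j g] by (simp only: matrix_mul_assoc)
  then have "hf (TPi \<circ> x) (zm j ** g) = hf x (zm j ** (zm (-1) ** (Pi ** g)))" for j
    using x g by (simp only: hf_T_normalizes[OF normalizes_Pi] GL2_mult zm_GL2)
  then have "bar (TPi \<circ> x) g = bar x (zm (-1) ** (Pi ** g))" by (simp only: bar_def)
  then show ?thesis by simp
qed

lemma bar_TPi': "x \<in> carrier HC \<Longrightarrow> g \<in> carrier GL2 \<Longrightarrow> bar (TPi' \<circ> x) g = bar x (Pi ** g)"
proof -
  assume x: "x \<in> carrier HC" and g: "g \<in> carrier GL2"
  have "hf (TPi' \<circ> x) (zm j ** g) = hf x (zm j ** (Pi ** g))" for j
    using x g by (simp add: hf_T_normalizes[OF normalizes_inv[OF normalizes_Pi]] zm_left_commute)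
  then show ?thesis by (simp only: bar_def)
qed

lemma bar_Th:
  assumes "x \<in> carrier HC" "g \<in> carrier GL2" "a \<in> \<O>" "d \<in> \<O>" "red a \<noteq> 0" "red d \<noteq> 0"
  shows "bar (hecke_T L (dg a d) \<circ> x) g = bar x (dg (inverse a) (inverse d) ** g)"
proof -
  have nz: "a \<noteq> 0" "d \<noteq> 0" using assms by auto
  have "inv\<^bsub>GL2\<^esub> (dg a d) = dg (inverse a) (inverse d)"
    using nz by (simp add: inv_GL2_mat2 field_simps)
  then have "hf (hecke_T L (dg a d) \<circ> x) (zm j ** g) = hf x (zm j ** (dg (inverse a) (inverse d) ** g))" for j
    using assms by (simp add: hf_T_normalizes zm_left_commute)
  then show ?thesis by (simp only: bar_def)
qed

lemma bar_Tn:
  assumes "x \<in> carrier HC" "g \<in> carrier GL2"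
  shows "bar (Tn \<circ> x) g = (\<Sum>t\<in>UNIV. bar x (ni ** ut (lf t) ** g))"
proof -
  have c: "ni ** ut (lf t) ** g \<in> carrier GL2" for t
    using assms by (intro GL2_mult) (auto simp: GL2_mat2_iff)
  have "ni ** ut (lf t) ** (zm j ** g) = zm j ** (ni ** ut (lf t) ** g)" for j t
    by (rule zm_left_commute)
  then have "bar (Tn \<circ> x) g = Sum_any (\<lambda>j. \<Sum>t\<in>UNIV. hf x (zm j ** (ni ** ut (lf t) ** g)))"
    using assms by (simp add: bar_def hf_Tn)
  \<comment> \<open>A finite index set common to all \<open>t\<close>, so that the two summations
    can be exchanged.\<close>
  also have "\<dots> = (\<Sum>j\<in>(\<Union>t. {j. hf x (zm j ** (ni ** ut (lf t) ** g)) \<noteq> 0}).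
      \<Sum>t\<in>UNIV. hf x (zm j ** (ni ** ut (lf t) ** g)))"
    using bar_finite[OF assms(1) c] by (intro Sum_any.expand_superset) (auto dest: sum.not_neutral_contains_not_neutral)
  also have "\<dots> = (\<Sum>t\<in>UNIV. \<Sum>j\<in>(\<Union>t. {j. hf x (zm j ** (ni ** ut (lf t) ** g)) \<noteq> 0}).
      hf x (zm j ** (ni ** ut (lf t) ** g)))"
    by (rule sum.swap)
  also have "\<dots> = (\<Sum>t\<in>UNIV. bar x (ni ** ut (lf t) ** g))"
    unfolding bar_def using bar_finite[OF assms(1) c]
    by (intro sum.cong refl Sum_any.expand_superset[symmetric]) auto
  finally show ?thesis .
qed

section \<open>Averages over the torus and their behaviour under left multiplication\<close>

definition AA :: "('k^2^2 \<Rightarrow> 'c) \<Rightarrow> 'f^2^2 \<Rightarrow> 'f^2^2 \<Rightarrow> ('f, 'c) hecke \<Rightarrow> 'c" where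
  "AA chi P Q x = (\<Sum>h\<in>diag2. inverse (chi h) * bar x (P ** dl h ** Q))"

text \<open>With \<open>P\<close> and \<open>Q\<close> among \<open>1\<close> and \<open>Pi\<close>,
  the average \<open>AA\<close> samples length zero and \<open>NN\<close> length one. Left
  multiplication in the ring acts on the index \<open>P\<close>, while \<open>Q\<close> is a label
  carried along.\<close>

definition NN :: "('k^2^2 \<Rightarrow> 'c) \<Rightarrow> 'f^2^2 \<Rightarrow> 'f^2^2 \<Rightarrow> ('f, 'c) hecke \<Rightarrow> 'c" where
  "NN chi P Q x = (\<Sum>h\<in>diag2. inverse (chi h) * bar x (P ** n_s ** dl h ** Q))"

lemma AA_add:
  "x \<in> carrier HC \<Longrightarrow> y \<in> carrier HC \<Longrightarrow> P \<in> carrier GL2 \<Longrightarrow> Q \<in> carrier GL2 \<Longrightarrow>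
    AA chi P Q (x + y) = AA chi P Q x + AA chi P Q y"
  by (simp add: AA_def bar_add sum.distrib distrib_left)

lemma NN_add:
  "x \<in> carrier HC \<Longrightarrow> y \<in> carrier HC \<Longrightarrow> P \<in> carrier GL2 \<Longrightarrow> Q \<in> carrier GL2 \<Longrightarrow>
    NN chi P Q (x + y) = NN chi P Q x + NN chi P Q y"
  by (simp add: NN_def bar_add sum.distrib distrib_left)

lemma AA_scalar:
  "x \<in> carrier HC \<Longrightarrow> P \<in> carrier GL2 \<Longrightarrow> Q \<in> carrier GL2 \<Longrightarrow>
    AA chi P Q (hecke_scalar L a \<circ> x) = a * AA chi P Q x"
  by (simp add: AA_def bar_scalar sum_distrib_left mult.left_commute del: comp_apply)

lemma NN_scalar:
  "x \<in> carrier HC \<Longrightarrow> P \<in> carrier GL2 \<Longrightarrow> Q \<in> carrier GL2 \<Longrightarrow>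
    NN chi P Q (hecke_scalar L a \<circ> x) = a * NN chi P Q x"
  by (simp add: NN_def bar_scalar sum_distrib_left mult.left_commute del: comp_apply)

lemma AA_cong: "(\<And>h. h \<in> diag2 \<Longrightarrow> chi h = chi' h) \<Longrightarrow> AA chi P Q x = AA chi' P Q x"
  by (simp add: AA_def)

lemma NN_cong: "(\<And>h. h \<in> diag2 \<Longrightarrow> chi h = chi' h) \<Longrightarrow> NN chi P Q x = NN chi' P Q x"
  by (simp add: NN_def)

context
  fixes x :: "('f, 'c) hecke" and Q :: "'f^2^2"
  assumes x: "x \<in> carrier HC" and Q: "normalizes Q"
begin

lemma AA_TPi: "AA chi one1 Q (TPi \<circ> x) = AA chi Pi Q x" "AA chi Pi Q (TPi \<circ> x) = AA chi one1 Q x"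
  and AA_TPi': "AA chi one1 Q (TPi' \<circ> x) = AA chi Pi Q x" "AA chi Pi Q (TPi' \<circ> x) = AA chi one1 Q x"
  using x Q by (simp_all add: AA_def bar_TPi bar_TPi' matrix_mul_assoc PiPi)
    (simp_all add: matrix_mul_assoc[symmetric])

lemma NN_TPi: "NN chi one1 Q (TPi \<circ> x) = NN chi Pi Q x" "NN chi Pi Q (TPi \<circ> x) = NN chi one1 Q x"
  and NN_TPi': "NN chi one1 Q (TPi' \<circ> x) = NN chi Pi Q x" "NN chi Pi Q (TPi' \<circ> x) = NN chi one1 Q x"
  using x Q by (simp_all add: NN_def bar_TPi bar_TPi' matrix_mul_assoc PiPi)
    (simp_all add: matrix_mul_assoc[symmetric])

lemma AA_PiPi: "AA chi P (Pi ** Pi) x = AA chi P one1 x" "NN chi P (Pi ** Pi) x = NN chi P one1 x"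
  unfolding AA_def NN_def PiPi by (simp_all flip: zm_commute)

text \<open>Moving \<open>Pi\<close> to the right past the torus swaps the two diagonal entries,
  which conjugates the character.\<close>

lemma AA_Pi: "AA chi Pi Q x = AA (conj_s chi) one1 (Pi ** Q) x"
proof -
  have "bar x (Pi ** dl h ** Q) = bar x (one1 ** dl (swap h) ** (Pi ** Q))" if hd: "h \<in> diag2" for h
  proof -
    obtain a d where h: "dl h = dg a d" "a \<in> \<O>" "d \<in> \<O>" "h = mat2 (red a) 0 0 (red d)"
      "red a \<noteq> 0" "red d \<noteq> 0" using dl[OF hd] by blast
    have "Pi ** dl h ** Q = one1 ** dg d a ** (Pi ** Q)"
      by (simp add: matrix_mul_assoc h(1) Pi_eq mult.commute)
    then show ?thesis
      using bar_dg[OF x normalizes_mult[OF normalizes_Pi Q], of d a "swap h" one1] h(2-) by simp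
  qed
  then have "AA chi Pi Q x = (\<Sum>h\<in>diag2. inverse (chi h) * bar x (one1 ** dl (swap h) ** (Pi ** Q)))"
    unfolding AA_def by (intro sum.cong refl) simp
  also have "\<dots> = AA (conj_s chi) one1 (Pi ** Q) x"
    unfolding AA_def by (rule sum_diag2_swap)
  finally show ?thesis .
qed

text \<open>Here all \<open>q = 0\<close> summands of \<open>T\<^sub>n\<close> agree.\<close>

lemma bar_Tn_zero:
  assumes M: "M \<in> carrier GL2" "\<And>s. s \<in> \<O> \<Longrightarrow> \<exists>l\<in>L. ut s ** M = M ** l"
  shows "bar (Tn \<circ> x) M = 0"
proof -
  have "bar x (ni ** ut (lf t) ** M) = bar x (ni ** M)" for t
    using M(2)[of "lf t"] x by (metis bar_right lf(1) matrix_mul_assoc)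
  then show ?thesis using x M q0 by (simp add: bar_Tn)
qed

lemma AA_Tn:
  assumes P: "normalizes P" shows "AA chi P Q (Tn \<circ> x) = 0"
proof -
  have "bar (Tn \<circ> x) (P ** dl h ** Q) = 0" if "h \<in> diag2" for h
  proof -
    have M: "normalizes (P ** dl h ** Q)" using P Q that by simp
    show ?thesis by (rule bar_Tn_zero) (use M normalizes_left[OF M] in \<open>auto simp: L_mat2_iff\<close>)
  qed
  then show ?thesis by (simp add: AA_def)
qed

text \<open>The matrix \<open>Pi ** n_s\<close> is diagonal with entries \<open>1\<close> and
  \<open>- \<varpi>\<close>; an integral unipotent matrix passes through it with its entry
  multiplied by \<open>- \<varpi>\<close> and stays in \<open>L\<close>.\<close>

lemma NN_Tn_Pi: "NN chi Pi Q (Tn \<circ> x) = 0"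
proof -
  have "bar (Tn \<circ> x) (Pi ** n_s ** dl h ** Q) = 0" if "h \<in> diag2" for h
  proof (rule bar_Tn_zero)
    have M: "normalizes (dl h ** Q)" using Q that by simp
    show "Pi ** n_s ** dl h ** Q \<in> carrier GL2" using Q that by simp
    fix s assume s: "s \<in> \<O>"
    obtain l where l: "l \<in> L" "ut (- varpi * s) ** (dl h ** Q) = (dl h ** Q) ** l"
      using normalizes_left[OF M, of "ut (- varpi * s)"] s by (auto simp: L_mat2_iff)
    have e: "ut s ** (Pi ** n_s) = Pi ** n_s ** ut (- varpi * s)"
      by (simp add: Pi_eq n_s_eq mult.commute)
    have "ut s ** (Pi ** n_s ** dl h ** Q) = (ut s ** (Pi ** n_s)) ** (dl h ** Q)"
      by (simp only: matrix_mul_assoc)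
    also have "\<dots> = Pi ** n_s ** (ut (- varpi * s) ** (dl h ** Q))"
      unfolding e by (simp only: matrix_mul_assoc)
    finally have "ut s ** (Pi ** n_s ** dl h ** Q) = Pi ** n_s ** dl h ** Q ** l"
      unfolding l(2) by (simp only: matrix_mul_assoc)
    then show "\<exists>l\<in>L. ut s ** (Pi ** n_s ** dl h ** Q) = Pi ** n_s ** dl h ** Q ** l"
      using l(1) by blast
  qed
  then show ?thesis by (simp add: NN_def)
qed

text \<open>The summand \<open>t = 0\<close> of \<open>T_n\<close> cancels \<open>n_s\<close> and
  falls back to length zero. For \<open>t \<noteq> 0\<close> the Bruhat relation returns to the cell
  of \<open>n_s\<close> with a torus factor, and the character values of these factors add up to
  \<open>quad_const\<close>.\<close>

lemma NN_Tn:
  assumes chi: "is_char_H chi"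
  shows "NN chi one1 Q (Tn \<circ> x) = AA chi one1 Q x + quad_const chi * NN chi one1 Q x"
proof -
  let ?h = "\<lambda>t :: 'k. mat2 (- t) 0 0 (- inverse t)"
  have term0: "bar x (ni ** ut (lf 0) ** (one1 ** n_s ** dl h ** Q)) = bar x (one1 ** dl h ** Q)" for h
  proof -
    have e: "ni ** ut (lf 0) ** n_s = mat2 1 0 (- lf 0) 1" by (simp add: n_s_eq)
    have l: "mat2 1 0 (- lf 0) 1 \<in> L" by (simp add: L_mat2_iff)
    have "ni ** ut (lf 0) ** (one1 ** n_s ** dl h ** Q) = mat2 1 0 (- lf 0) 1 ** (dl h ** Q)"
      unfolding e[symmetric] by (simp only: matrix_mul_assoc matrix_mul_lid)
    then show ?thesis using l bar_left by (simp only: matrix_mul_lid)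
  qed
  have termt: "bar x (ni ** ut (lf t) ** (one1 ** n_s ** dl h ** Q)) = bar x (one1 ** n_s ** dl (?h t ** h) ** Q)"
    if t: "t \<noteq> 0" and h: "h \<in> diag2" for t h
  proof -
    let ?u = "lf t"
    have u: "?u \<noteq> 0" "red ?u \<noteq> 0" using t by (auto simp: dest: arg_cong[of _ _ red])
    have iu: "inverse ?u \<in> \<O>" "red (inverse ?u) = inverse t" using u by (auto simp: unit_inverse red_inverse)
    \<comment> \<open>The left side is the lower unipotent matrix with entry \<open>- ?u\<close>; as
      \<open>?u\<close> is a unit, it has an integral Bruhat decomposition.\<close>
    have e: "ni ** ut ?u ** n_s = ut (- inverse ?u) ** n_s ** dg (- ?u) (- inverse ?u) ** ut (- inverse ?u)"
      using u by (simp add: n_s_eq)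
    have M: "normalizes (dl h ** Q)" using Q h by simp
    have ul: "ut (- inverse ?u) \<in> L" using iu by simp
    have "ni ** ut ?u ** (one1 ** n_s ** dl h ** Q) = (ni ** ut ?u ** n_s) ** (dl h ** Q)"
      by (simp only: matrix_mul_assoc matrix_mul_lid)
    also have "\<dots> = ut (- inverse ?u) ** (n_s ** dg (- ?u) (- inverse ?u) ** ut (- inverse ?u) ** (dl h ** Q))"
      unfolding e by (simp only: matrix_mul_assoc)
    finally have "bar x (ni ** ut ?u ** (one1 ** n_s ** dl h ** Q)) =
        bar x (n_s ** dg (- ?u) (- inverse ?u) ** ut (- inverse ?u) ** (dl h ** Q))"
      using bar_left[OF ul] by simp
    also have "\<dots> = bar x (n_s ** dg (- ?u) (- inverse ?u) ** (dl h ** Q))"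
      by (rule bar_right_normalizes[OF x M ul])
    also have "\<dots> = bar x (n_s ** (dg (- ?u) (- inverse ?u) ** dl h) ** Q)"
      by (simp only: matrix_mul_assoc)
    also have "\<dots> = bar x (n_s ** dl (?h t ** h) ** Q)"
    proof -
      obtain a d where h: "dl h = dg a d" "a \<in> \<O>" "d \<in> \<O>" "h = mat2 (red a) 0 0 (red d)"
        "red a \<noteq> 0" "red d \<noteq> 0" using dl[OF h] by blast
      have "bar x (n_s ** dg (- ?u * a) (- inverse ?u * d) ** Q) = bar x (n_s ** dl (?h t ** h) ** Q)"
        by (rule bar_dg[OF x Q]) (use h iu t in auto)
      then show ?thesis unfolding h(1) by simp
    qed
    finally show ?thesis by simp
  qed
  have "bar (Tn \<circ> x) (one1 ** n_s ** dl h ** Q) = bar x (one1 ** dl h ** Q) +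
      (\<Sum>t\<in>UNIV - {0}. bar x (one1 ** n_s ** dl (?h t ** h) ** Q))" if h: "h \<in> diag2" for h
  proof -
    have "one1 ** n_s ** dl h ** Q \<in> carrier GL2" using Q h by simp
    then have "bar (Tn \<circ> x) (one1 ** n_s ** dl h ** Q) =
        (\<Sum>t\<in>UNIV. bar x (ni ** ut (lf t) ** (one1 ** n_s ** dl h ** Q)))" using x bar_Tn by simp
    also have "\<dots> = bar x (ni ** ut (lf 0) ** (one1 ** n_s ** dl h ** Q)) +
        (\<Sum>t\<in>UNIV - {0}. bar x (ni ** ut (lf t) ** (one1 ** n_s ** dl h ** Q)))"
      by (rule sum.remove) auto
    finally show ?thesis unfolding term0 using termt[OF _ h] by simp
  qed
  then have "NN chi one1 Q (Tn \<circ> x) = AA chi one1 Q x +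
      (\<Sum>h\<in>diag2. \<Sum>t\<in>UNIV - {0}. inverse (chi h) * bar x (one1 ** n_s ** dl (?h t ** h) ** Q))"
    unfolding NN_def AA_def by (simp add: distrib_left sum.distrib sum_distrib_left)
  also have "(\<Sum>h\<in>diag2. \<Sum>t\<in>UNIV - {0}. inverse (chi h) * bar x (one1 ** n_s ** dl (?h t ** h) ** Q)) =
      (\<Sum>t\<in>UNIV - {0}. \<Sum>h\<in>diag2. inverse (chi h) * bar x (one1 ** n_s ** dl (?h t ** h) ** Q))"
    by (rule sum.swap)
  also have "\<dots> = (\<Sum>t\<in>UNIV - {0}. chi (?h t) * NN chi one1 Q x)"
    unfolding NN_def by (intro sum.cong refl sum_diag2_shift chi) auto
  finally show ?thesis unfolding quad_const_def sum_distrib_right .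
qed

text \<open>The inverse torus element is swapped whenever it crosses \<open>Pi\<close> or
  \<open>n_s\<close>, so the parity of the crossings decides between \<open>chi\<close> and its
  conjugate.\<close>

lemma AA_NN_Th:
  assumes chi: "is_char_H chi" and ad: "a \<in> \<O>" "d \<in> \<O>" "red a \<noteq> 0" "red d \<noteq> 0"
  defines "h0 \<equiv> mat2 (red a) 0 0 (red d)"
  shows "AA chi one1 Q (hecke_T L (dg a d) \<circ> x) = inverse (chi h0) * AA chi one1 Q x"
    "AA chi Pi Q (hecke_T L (dg a d) \<circ> x) = inverse (conj_s chi h0) * AA chi Pi Q x"
    "NN chi one1 Q (hecke_T L (dg a d) \<circ> x) = inverse (conj_s chi h0) * NN chi one1 Q x"
    "NN chi Pi Q (hecke_T L (dg a d) \<circ> x) = inverse (chi h0) * NN chi Pi Q x"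
proof -
  let ?i = "inv\<^bsub>GL2\<^esub> h0"
  have nz: "a \<noteq> 0" "d \<noteq> 0" using ad by auto
  have h0: "h0 \<in> diag2" using ad by (simp add: h0_def)
  have i: "?i = mat2 (inverse (red a)) 0 0 (inverse (red d))" "?i \<in> diag2"
    using ad unfolding h0_def by (auto simp: inv_GL2_mat2 field_simps)
  have inv: "inverse a \<in> \<O>" "inverse d \<in> \<O>" using ad unit_inverse by auto
  have *: "bar x (X ** dg (inverse a) (inverse d) ** dl h ** Q) = bar x (X ** dl (?i ** h) ** Q)"
    "bar x (X ** dg (inverse d) (inverse a) ** dl h ** Q) = bar x (X ** dl (swap ?i ** h) ** Q)"
    if hd: "h \<in> diag2" for X h
  proof -
    obtain b c where h: "dl h = dg b c" "b \<in> \<O>" "c \<in> \<O>" "h = mat2 (red b) 0 0 (red c)"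
      "red b \<noteq> 0" "red c \<noteq> 0" using dl[OF hd] by blast
    have "bar x (X ** dg (inverse a * b) (inverse d * c) ** Q) = bar x (X ** dl (?i ** h) ** Q)"
      by (rule bar_dg[OF x Q]) (use h inv ad i in \<open>auto simp: red_inverse\<close>)
    moreover have "bar x (X ** dg (inverse d * b) (inverse a * c) ** Q) = bar x (X ** dl (swap ?i ** h) ** Q)"
      by (rule bar_dg[OF x Q]) (use h inv ad i in \<open>auto simp: red_inverse\<close>)
    ultimately show "bar x (X ** dg (inverse a) (inverse d) ** dl h ** Q) = bar x (X ** dl (?i ** h) ** Q)"
      "bar x (X ** dg (inverse d) (inverse a) ** dl h ** Q) = bar x (X ** dl (swap ?i ** h) ** Q)"
      unfolding h(1) by (simp_all flip: matrix_mul_assoc[of X])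
  qed
  have ch: "chi ?i = inverse (chi h0)" "chi (swap ?i) = inverse (conj_s chi h0)"
    using char_H_inv[OF chi h0] char_H_inv[OF is_char_H_conj_s[OF chi] h0] conj_s_eq[OF i(2), of chi] by auto
  have c1: "dg (inverse a) (inverse d) ** Pi = Pi ** dg (inverse d) (inverse a)"
    "dg (inverse a) (inverse d) ** n_s = n_s ** dg (inverse d) (inverse a)"
    "Pi ** dg (inverse d) (inverse a) ** n_s = Pi ** n_s ** dg (inverse a) (inverse d)"
    by (simp_all add: Pi_eq n_s_eq mult.commute)
  have bT: "bar (hecke_T L (dg a d) \<circ> x) g = bar x (dg (inverse a) (inverse d) ** g)"
    if "g \<in> carrier GL2" for g using bar_Th[OF x that ad] .
  have g: "M ** dl h ** Q \<in> carrier GL2" if "h \<in> diag2" "M \<in> carrier GL2" for h M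
    using that Q by simp
  have "AA chi one1 Q (hecke_T L (dg a d) \<circ> x) =
      (\<Sum>h\<in>diag2. inverse (chi h) * bar x (one1 ** dl (?i ** h) ** Q))"
    unfolding AA_def using bT[OF g[OF _ GL2_one]] *(1)[of _ one1]
    by (intro sum.cong refl) (simp add: matrix_mul_assoc)
  then show "AA chi one1 Q (hecke_T L (dg a d) \<circ> x) = inverse (chi h0) * AA chi one1 Q x"
    unfolding AA_def sum_diag2_shift[OF chi i(2), of "\<lambda>h. bar x (one1 ** dl h ** Q)"] ch by simp
  have "AA chi Pi Q (hecke_T L (dg a d) \<circ> x) =
      (\<Sum>h\<in>diag2. inverse (chi h) * bar x (Pi ** dl (swap ?i ** h) ** Q))"
    unfolding AA_def using bT[OF g[OF _ Pi_GL2]] *(2)[of _ Pi]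
    by (intro sum.cong refl) (simp add: matrix_mul_assoc c1)
  then show "AA chi Pi Q (hecke_T L (dg a d) \<circ> x) = inverse (conj_s chi h0) * AA chi Pi Q x"
    unfolding AA_def sum_diag2_shift[OF chi swap_diag2(1)[OF i(2)], of "\<lambda>h. bar x (Pi ** dl h ** Q)"] ch by simp
  have "NN chi one1 Q (hecke_T L (dg a d) \<circ> x) =
      (\<Sum>h\<in>diag2. inverse (chi h) * bar x (one1 ** n_s ** dl (swap ?i ** h) ** Q))"
    unfolding NN_def using bT[OF g[of _ "one1 ** n_s"]] *(2)[of _ n_s]
    by (intro sum.cong refl) (simp add: matrix_mul_assoc c1)
  then show "NN chi one1 Q (hecke_T L (dg a d) \<circ> x) = inverse (conj_s chi h0) * NN chi one1 Q x"
    unfolding NN_def sum_diag2_shift[OF chi swap_diag2(1)[OF i(2)], of "\<lambda>h. bar x (one1 ** n_s ** dl h ** Q)"] ch by simp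
  have "NN chi Pi Q (hecke_T L (dg a d) \<circ> x) =
      (\<Sum>h\<in>diag2. inverse (chi h) * bar x (Pi ** n_s ** dl (?i ** h) ** Q))"
    unfolding NN_def using bT[OF g[of _ "Pi ** n_s"]] *(1)[of _ "Pi ** n_s"]
    by (intro sum.cong refl) (simp add: matrix_mul_assoc c1)
  then show "NN chi Pi Q (hecke_T L (dg a d) \<circ> x) = inverse (chi h0) * NN chi Pi Q x"
    unfolding NN_def sum_diag2_shift[OF chi i(2), of "\<lambda>h. bar x (Pi ** n_s ** dl h ** Q)"] ch by simp
qed

end

section \<open>Values on elements supported on \<open>K\<close>\<close>

definition supp_K :: "('f, 'c) hecke \<Rightarrow> bool" where
  "supp_K x \<longleftrightarrow> x \<in> carrier HC \<and> (\<forall>g\<in>carrier GL2. hf x g \<noteq> 0 \<longrightarrow> g \<in> K)"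

lemma K_val_det: "g \<in> K \<Longrightarrow> val (det g) = 0"
proof (cases g)
  fix a b c d assume "g \<in> K" "g = mat2 a b c d"
  then show "val (det g) = 0" using unit_val[of "a * d - b * c"] by (auto simp: K_mat2_iff)
qed

lemma val_det_zm: "g \<in> carrier GL2 \<Longrightarrow> val (det (zm j ** g)) = 2 * j + val (det g)"
  by (simp add: det_mul zm_def GL2_iff val_mult val_powi)

text \<open>Determinants of elements of \<open>K\<close> are units, whereas a factor
  \<open>zm j\<close> adds \<open>2 * j\<close> to the valuation; only \<open>j = 0\<close>
  contributes.\<close>

lemma supp_K_bar:
  assumes x: "supp_K x" and g: "g \<in> K" shows "bar x g = hf x g"
proof -
  have "hf x (zm j ** g) = 0" if "j \<noteq> 0" for j
    using x g that K_val_det[of "zm j ** g"] K_val_det[OF g] val_det_zm[of g j] by (auto simp: supp_K_def)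
  then have "bar x g = (\<Sum>j\<in>{0}. hf x (zm j ** g))"
    unfolding bar_def by (intro Sum_any.expand_superset) auto
  then show ?thesis by (simp add: zm_zero)
qed

lemma supp_K_bar_odd:
  assumes x: "supp_K x" and g: "g \<in> carrier GL2" "odd (val (det g))" shows "bar x g = 0"
proof -
  have "hf x (zm j ** g) = 0" for j
  proof (rule ccontr)
    assume "hf x (zm j ** g) \<noteq> 0"
    then have "2 * j + val (det g) = 0"
      using x g K_val_det[of "zm j ** g"] val_det_zm[of g j] by (auto simp: supp_K_def)
    then show False using g(2) by presburger
  qed
  then show ?thesis by (simp add: bar_def)
qed

lemma val_det_dl: "h \<in> diag2 \<Longrightarrow> val (det (dl h)) = 0"
  by (rule K_val_det) simp

lemma det_dl_nz: "h \<in> diag2 \<Longrightarrow> det (dl h) \<noteq> 0"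
  using dl_GL2 by (simp add: GL2_iff)

text \<open>The parity of the valuation of the determinant kills the terms with exactly one
  \<open>Pi\<close>. For \<open>NN chi Pi Pi\<close> that valuation is two, leaving only
  \<open>j = -1\<close>, and the matrix then has the nonintegral entry
  \<open>a / \<varpi>\<close>.\<close>

lemma supp_K_AA_NN:
  assumes x: "supp_K x"
  shows "AA chi one1 one1 x = (\<Sum>h\<in>diag2. inverse (chi h) * hf x (dl h))"
    "AA chi one1 Pi x = 0" "AA chi Pi one1 x = 0" "AA chi Pi Pi x = AA (conj_s chi) one1 one1 x"
    "NN chi one1 one1 x = (\<Sum>h\<in>diag2. inverse (chi h) * hf x (n_s ** dl h))"
    "NN chi one1 Pi x = 0" "NN chi Pi one1 x = 0" "NN chi Pi Pi x = 0"
proof -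
  have xc: "x \<in> carrier HC" using x by (simp add: supp_K_def)
  have nK: "n_s \<in> K" by (simp add: n_s_eq K_mat2_iff)
  show "AA chi one1 one1 x = (\<Sum>h\<in>diag2. inverse (chi h) * hf x (dl h))"
    unfolding AA_def using supp_K_bar[OF x] by (intro sum.cong refl) simp
  show "NN chi one1 one1 x = (\<Sum>h\<in>diag2. inverse (chi h) * hf x (n_s ** dl h))"
    unfolding NN_def using supp_K_bar[OF x] nK by (intro sum.cong refl) simp
  have vPi: "val (det Pi) = 1" "det Pi \<noteq> 0" and vn: "det n_s = (1 :: 'f)" by (simp_all add: Pi_eq n_s_eq)
  show "AA chi one1 Pi x = 0" "AA chi Pi one1 x = 0" "NN chi one1 Pi x = 0" "NN chi Pi one1 x = 0"
    unfolding AA_def NN_def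
    by (rule sum.neutral, clarify, subst supp_K_bar_odd[OF x],
        simp_all add: det_mul vPi vn val_mult val_det_dl det_dl_nz)+
  show "AA chi Pi Pi x = AA (conj_s chi) one1 one1 x"
    using AA_Pi[OF xc normalizes_Pi, of chi] AA_PiPi[OF xc normalizes_Pi] by simp
  have "bar x (Pi ** n_s ** dl h ** Pi) = 0" if h: "h \<in> diag2" for h
  proof -
    have "hf x (zm j ** (Pi ** n_s ** dl h ** Pi)) = 0" for j
    proof (rule ccontr)
      let ?g = "Pi ** n_s ** dl h ** Pi"
      assume "hf x (zm j ** ?g) \<noteq> 0"
      then have k: "zm j ** ?g \<in> K" using x h by (simp add: supp_K_def)
      have "val (det ?g) = 2" using h by (simp add: det_mul vPi vn val_mult val_det_dl det_dl_nz)
      then have j: "j = -1" using K_val_det[OF k] val_det_zm[of ?g j] h by simp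
      obtain a d where ad: "dl h = dg a d" "a \<in> \<O>" "red a \<noteq> 0" using dl[OF h] by metis
      have "?g = mat2 0 a (- (varpi * d * varpi)) 0" unfolding ad(1) by (simp add: Pi_eq n_s_eq)
      then have "inverse varpi * a \<in> \<O>" using k j by (auto simp: zm_def K_mat2_iff)
      then have "red (varpi * (inverse varpi * a)) = 0" by simp
      moreover have "varpi * (inverse varpi * a) = a" by simp
      ultimately show False using ad by metis
    qed
    then show ?thesis by (simp add: bar_def)
  qed
  then show "NN chi Pi Pi x = 0" by (simp add: NN_def)
qed

lemma supp_K_one: "supp_K (hecke_scalar L a)"
  using L_subset_K by (auto simp: supp_K_def hf_hecke_scalar)

lemma one_AA_NN:
  assumes "is_char_H chi"
  shows "AA chi one1 one1 (hecke_scalar L a) = a" "NN chi one1 one1 (hecke_scalar L a) = 0"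
proof -
  have "hf (hecke_scalar L a) (dl h) = (if h = mat 1 then a else 0)" if h: "h \<in> diag2" for h
  proof -
    obtain b d where h': "dl h = dg b d" "b \<in> \<O>" "d \<in> \<O>" "h = mat2 (red b) 0 0 (red d)" using dl[OF h] by metis
    then have "dl h \<in> L \<longleftrightarrow> h = mat 1" by (auto simp: L_mat2_iff mat_1_eq_mat2)
    then show ?thesis using h by (simp add: hf_hecke_scalar)
  qed
  then have "AA chi one1 one1 (hecke_scalar L a) = (\<Sum>h\<in>diag2. if h = mat 1 then inverse (chi h) * a else 0)"
    unfolding supp_K_AA_NN(1)[OF supp_K_one] by (intro sum.cong refl) auto
  also have "\<dots> = inverse (chi (mat 1)) * a" by (simp add: sum.delta')
  finally show "AA chi one1 one1 (hecke_scalar L a) = a" using char_H_one[OF assms] by simp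
  have "hf (hecke_scalar L a) (n_s ** dl h) = 0" if h: "h \<in> diag2" for h
  proof -
    obtain b d where "dl h = dg b d" using dl[OF h] by metis
    then have "n_s ** dl h \<notin> L" by (simp add: n_s_eq L_mat2_iff)
    then show ?thesis using h by (simp add: hf_hecke_scalar)
  qed
  then show "NN chi one1 one1 (hecke_scalar L a) = 0"
    unfolding supp_K_AA_NN(5)[OF supp_K_one] by (simp add: sum.neutral)
qed

end

section \<open>Linear combinations and idempotents in the Hecke ring\<close>

lemma abelian_group_add_struct:
  fixes X :: "'m::ab_group_add set"
  assumes "0 \<in> X" "\<And>x y. x \<in> X \<Longrightarrow> y \<in> X \<Longrightarrow> x + y \<in> X" "\<And>x. x \<in> X \<Longrightarrow> - x \<in> X"
  shows "abelian_group (add_struct X)"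
  using assms
  by (intro abelian_groupI) (auto simp: add_struct_def add_ac intro!: bexI[of _ "- _"])

lemma add_struct_simps [simp]:
  "carrier (add_struct X) = X" "x \<oplus>\<^bsub>add_struct X\<^esub> y = x + y" "\<zero>\<^bsub>add_struct X\<^esub> = 0"
  by (simp_all add: add_struct_def)

context mod_p_hecke
begin

abbreviation sc :: "'c \<Rightarrow> ('f, 'c) hecke" where "sc a \<equiv> hecke_scalar L a"
abbreviation eH :: "('k^2^2 \<Rightarrow> 'c) \<Rightarrow> ('f, 'c) hecke" where "eH chi \<equiv> hecke_e val red chi"

lemma comp_left: "(x + y) \<circ> z = (x \<circ> z) + (y \<circ> z)" "(x - y) \<circ> z = (x \<circ> z) - (y \<circ> z)"
  "(- x) \<circ> z = - (x \<circ> z)" "0 \<circ> z = 0"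
  for x y z :: "('f, 'c) hecke"
  by (simp_all add: fun_eq_iff)

definition lin_functional :: "(('f, 'c) hecke \<Rightarrow> 'c) \<Rightarrow> bool" where
  "lin_functional F \<longleftrightarrow> (\<forall>x\<in>carrier HC. \<forall>y\<in>carrier HC. F (x + y) = F x + F y) \<and>
     (\<forall>x\<in>carrier HC. \<forall>a. F (sc a \<circ> x) = a * F x)"

lemma lin_functional_zero: "lin_functional F \<Longrightarrow> F 0 = 0"
  unfolding lin_functional_def by (metis HR_zero_closed add_cancel_left_left)

lemma HC_lincomb:
  assumes "finite S" "\<And>h. h \<in> S \<Longrightarrow> t h \<in> carrier HC"
  shows "(\<lambda>f C. \<Sum>h\<in>S. a h * t h f C) \<in> carrier HC"
    "lin_functional F \<Longrightarrow> F (\<lambda>f C. \<Sum>h\<in>S. a h * t h f C) = (\<Sum>h\<in>S. a h * F (t h))"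
proof -
  have "(\<lambda>f C. \<Sum>h\<in>S. a h * t h f C) \<in> carrier HC \<and>
    (lin_functional F \<longrightarrow> F (\<lambda>f C. \<Sum>h\<in>S. a h * t h f C) = (\<Sum>h\<in>S. a h * F (t h)))"
    using assms
  proof (induction S rule: finite_induct)
    case empty
    have "(\<lambda>f C. 0) = (0 :: ('f, 'c) hecke)" by (simp add: fun_eq_iff)
    then show ?case by (simp add: lin_functional_zero)
  next
    case (insert j S)
    have "(\<lambda>f C. \<Sum>h\<in>insert j S. a h * t h f C) = (sc (a j) \<circ> t j) + (\<lambda>f C. \<Sum>h\<in>S. a h * t h f C)"
      using insert by (simp add: fun_eq_iff scalar_comp_apply[unfolded comp_apply])
    then show ?case using insert by (auto simp: lin_functional_def)
  qed
  then show "(\<lambda>f C. \<Sum>h\<in>S. a h * t h f C) \<in> carrier HC"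
    "lin_functional F \<Longrightarrow> F (\<lambda>f C. \<Sum>h\<in>S. a h * t h f C) = (\<Sum>h\<in>S. a h * F (t h))" by auto
qed

text \<open>The order is the square of \<open>q - 1 = -1\<close>, so the normalising factor of
  \<open>e_\<chi>\<close> disappears.\<close>

lemma card_diag2: "of_nat (card (diag2 :: ('k^2^2) set)) = (1 :: 'c)"
proof -
  have "card (diag2 :: ('k^2^2) set) = card ((UNIV - {0 :: 'k}) \<times> (UNIV - {0 :: 'k}))"
    by (rule bij_betw_same_card[of "\<lambda>h. (h $ 1 $ 1, h $ 2 $ 2)"],
        rule bij_betwI[where g = "\<lambda>(a, d). mat2 a 0 0 d"]) (auto simp: mem_diag2)
  also have "\<dots> = (CARD('k) - 1) * (CARD('k) - 1)" by (simp add: card_cartesian_product card_Diff_subset)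
  finally have "of_nat (card (diag2 :: ('k^2^2) set)) = (of_nat (CARD('k) - 1) * of_nat (CARD('k) - 1) :: 'c)" by simp
  moreover have "of_nat (CARD('k) - 1) = (- 1 :: 'c)"
    using q0 by (simp add: of_nat_diff Suc_leI)
  ultimately show ?thesis by simp
qed

lemma eH_comp: "eH chi \<circ> x = (\<lambda>f C. \<Sum>h\<in>diag2. chi h * (hecke_T L (dl h) \<circ> x) f C)"
  by (simp add: fun_eq_iff hecke_e_def card_diag2)

lemma eH_eq: "eH chi = (\<lambda>f C. \<Sum>h\<in>diag2. chi h * hecke_T L (dl h) f C)"
  by (simp add: fun_eq_iff hecke_e_def card_diag2)

lemma eH_closed [simp]: "eH chi \<in> carrier HC"
  unfolding eH_eq by (rule HC_lincomb) auto

lemma eH_functional: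
  assumes F: "lin_functional F" and x: "x \<in> carrier HC" and chi: "\<And>h. h \<in> diag2 \<Longrightarrow> chi h \<noteq> 0"
    and h: "\<And>h. h \<in> diag2 \<Longrightarrow> F (hecke_T L (dl h) \<circ> x) = inverse (chi h) * F x"
  shows "F (eH chi \<circ> x) = F x"
proof -
  have "F (eH chi \<circ> x) = (\<Sum>h\<in>diag2. chi h * F (hecke_T L (dl h) \<circ> x))"
    unfolding eH_comp using x F by (intro HC_lincomb) (auto simp del: comp_apply)
  also have "\<dots> = (\<Sum>h\<in>(diag2 :: ('k^2^2) set). F x)" using h chi by (intro sum.cong refl) auto
  finally show ?thesis using card_diag2 by simp
qed

lemma lin_functional_AA: "P \<in> carrier GL2 \<Longrightarrow> Q \<in> carrier GL2 \<Longrightarrow> lin_functional (AA chi P Q)"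
  and lin_functional_NN: "P \<in> carrier GL2 \<Longrightarrow> Q \<in> carrier GL2 \<Longrightarrow> lin_functional (NN chi P Q)"
  by (simp_all add: lin_functional_def AA_add NN_add AA_scalar NN_scalar del: comp_apply)

lemma lin_functional_plus: "lin_functional F \<Longrightarrow> lin_functional G \<Longrightarrow> lin_functional (\<lambda>x. F x + G x)"
  and lin_functional_diff: "lin_functional F \<Longrightarrow> lin_functional G \<Longrightarrow> lin_functional (\<lambda>x. F x - G x)"
  by (simp_all add: lin_functional_def algebra_simps)

lemma normalizes_one [simp]: "normalizes one1"
  by (rule normalizes_L) simp

section \<open>The supersingular module in the case of equal characters\<close>

text \<open>The difference diagonalises left multiplication by \<open>T_n\<close>: with
  \<open>quad_const\<close> equal to \<open>-1\<close> its eigenvalue is \<open>-1\<close> for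
  \<open>P = 1\<close> and \<open>0\<close> for \<open>P = \<Pi>\<close>, the values prescribed on
  \<open>v_1\<close> and \<open>v_2\<close>.\<close>

definition RR :: "('k^2^2 \<Rightarrow> 'c) \<Rightarrow> 'f^2^2 \<Rightarrow> 'f^2^2 \<Rightarrow> ('f, 'c) hecke \<Rightarrow> 'c" where
  "RR chi P Q x = AA chi P Q x - NN chi P Q x"

text \<open>A row vector times the matrix with rows indexed by \<open>P\<close> and columns by
  \<open>Q\<close>; row vectors make this a right action.\<close>

definition M_act :: "('k^2^2 \<Rightarrow> 'c) \<Rightarrow> 'c \<times> 'c \<Rightarrow> ('f, 'c) hecke \<Rightarrow> 'c \<times> 'c" where
  "M_act chi v x = (fst v * RR chi one1 one1 x + snd v * RR chi Pi one1 x,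
    fst v * RR chi one1 Pi x + snd v * RR chi Pi Pi x)"

context
  fixes chi :: "'k^2^2 \<Rightarrow> 'c"
  assumes chi: "is_char_H chi" and self: "self_conj chi"
begin

lemma conj_s_self: "h \<in> diag2 \<Longrightarrow> conj_s chi h = chi h"
  using self by (auto simp: self_conj_def)

lemma lin_functional_RR: "P \<in> carrier GL2 \<Longrightarrow> Q \<in> carrier GL2 \<Longrightarrow> lin_functional (RR chi P Q)"
  unfolding RR_def[abs_def] by (intro lin_functional_diff lin_functional_AA lin_functional_NN)

lemma RR_lin:
  assumes "x \<in> carrier HC" "P \<in> {one1, Pi}" "Q \<in> {one1, Pi}"
  shows "y \<in> carrier HC \<Longrightarrow> RR chi P Q (x + y) = RR chi P Q x + RR chi P Q y"
    "RR chi P Q (sc a \<circ> x) = a * RR chi P Q x"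
  using assms lin_functional_RR[of P Q] by (auto simp: lin_functional_def)

lemma RR_gens:
  assumes x: "x \<in> carrier HC" and Q: "normalizes Q"
  shows "RR chi one1 Q (TPi \<circ> x) = RR chi Pi Q x" "RR chi Pi Q (TPi \<circ> x) = RR chi one1 Q x"
    "RR chi one1 Q (TPi' \<circ> x) = RR chi Pi Q x" "RR chi Pi Q (TPi' \<circ> x) = RR chi one1 Q x"
    "RR chi one1 Q (Tn \<circ> x) = - RR chi one1 Q x" "RR chi Pi Q (Tn \<circ> x) = 0"
  using assms chi quad_const_self[OF chi self q0]
  by (simp_all add: RR_def AA_TPi NN_TPi AA_TPi' NN_TPi' AA_Tn NN_Tn NN_Tn_Pi)

lemma RR_Th:
  assumes x: "x \<in> carrier HC" and Q: "normalizes Q"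
    and ad: "a \<in> \<O>" "d \<in> \<O>" "red a \<noteq> 0" "red d \<noteq> 0"
  shows "RR chi one1 Q (hecke_T L (dg a d) \<circ> x) = inverse (chi (mat2 (red a) 0 0 (red d))) * RR chi one1 Q x"
    "RR chi Pi Q (hecke_T L (dg a d) \<circ> x) = inverse (chi (mat2 (red a) 0 0 (red d))) * RR chi Pi Q x"
  using AA_NN_Th[OF x Q chi ad] conj_s_self[of "mat2 (red a) 0 0 (red d)"] ad
  by (simp_all add: RR_def algebra_simps)

lemma RR_one:
  "RR chi one1 one1 (sc a) = a" "RR chi one1 Pi (sc a) = 0"
  "RR chi Pi one1 (sc a) = 0" "RR chi Pi Pi (sc a) = a"
  using one_AA_NN[OF chi] one_AA_NN[OF is_char_H_conj_s[OF chi]]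
  by (simp_all add: RR_def supp_K_AA_NN(2-4,6-8)[OF supp_K_one])

text \<open>Generators on the left act only on the row index. So the set of \<open>x\<close> that
  multiply correctly with every \<open>y\<close> contains the identity and is closed under left
  multiplication by generators.\<close>

lemma RR_mult:
  assumes "x \<in> carrier HC" "y \<in> carrier HC" "P \<in> {one1, Pi}" "Q \<in> {one1, Pi}"
  shows "RR chi P Q (x \<circ> y) = RR chi P one1 x * RR chi one1 Q y + RR chi P Pi x * RR chi Pi Q y"
proof -
  let ?S = "{x \<in> carrier HC. \<forall>y\<in>carrier HC. \<forall>P\<in>{one1, Pi}. \<forall>Q\<in>{one1, Pi}.
    RR chi P Q (x \<circ> y) = RR chi P one1 x * RR chi one1 Q y + RR chi P Pi x * RR chi Pi Q y}"
  have "?S = carrier HC"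
  proof (rule hecke_generated)
    show "hecke_scalar L 1 \<in> ?S" by (auto simp: RR_one)
  next
    fix x y assume xy: "x \<in> ?S" "y \<in> ?S"
    have "RR chi P Q ((x + y) \<circ> z) = RR chi P one1 (x + y) * RR chi one1 Q z + RR chi P Pi (x + y) * RR chi Pi Q z"
      if "z \<in> carrier HC" "P \<in> {one1, Pi}" "Q \<in> {one1, Pi}" for z P Q
    proof -
      have "x \<in> carrier HC" "y \<in> carrier HC" using xy by auto
      then have "RR chi P Q ((x + y) \<circ> z) = RR chi P Q (x \<circ> z) + RR chi P Q (y \<circ> z)"
        using that unfolding comp_left(1) by (intro RR_lin) auto
      also have "RR chi P Q (x \<circ> z) = RR chi P one1 x * RR chi one1 Q z + RR chi P Pi x * RR chi Pi Q z"
        using xy(1) that by blast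
      also have "RR chi P Q (y \<circ> z) = RR chi P one1 y * RR chi one1 Q z + RR chi P Pi y * RR chi Pi Q z"
        using xy(2) that by blast
      finally show ?thesis using \<open>x \<in> carrier HC\<close> \<open>y \<in> carrier HC\<close> that(2)
        by (simp add: RR_lin algebra_simps del: comp_apply plus_fun_apply)
    qed
    then show "x + y \<in> ?S" using xy by simp
  next
    fix a x assume x: "x \<in> ?S"
    have "RR chi P Q ((sc a \<circ> x) \<circ> z) = RR chi P one1 (sc a \<circ> x) * RR chi one1 Q z + RR chi P Pi (sc a \<circ> x) * RR chi Pi Q z"
      if "z \<in> carrier HC" "P \<in> {one1, Pi}" "Q \<in> {one1, Pi}" for z P Q
    proof -
      have xc: "x \<in> carrier HC" using x by auto
      then have "RR chi P Q ((sc a \<circ> x) \<circ> z) = a * RR chi P Q (x \<circ> z)"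
        using that unfolding comp_assoc by (intro RR_lin) auto
      also have "RR chi P Q (x \<circ> z) = RR chi P one1 x * RR chi one1 Q z + RR chi P Pi x * RR chi Pi Q z"
        using x that by blast
      finally show ?thesis using xc that(2) RR_lin(2)[OF xc that(2)] by (simp add: algebra_simps del: comp_apply)
    qed
    then show "sc a \<circ> x \<in> ?S" using x by simp
  next
    fix x assume x: "x \<in> ?S"
    show "TPi \<circ> x \<in> ?S" using x by (auto simp: RR_gens comp_assoc)
    show "TPi' \<circ> x \<in> ?S" using x by (auto simp: RR_gens comp_assoc)
    show "Tn \<circ> x \<in> ?S" using x by (auto simp: RR_gens comp_assoc)
    fix a d assume "a \<in> \<O>" "d \<in> \<O>" "red a \<noteq> 0" "red d \<noteq> 0"
    then show "hecke_T L (dg a d) \<circ> x \<in> ?S" using x by (auto simp: RR_Th comp_assoc algebra_simps)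
  qed auto
  then show ?thesis using assms by blast
qed

lemma right_module_M: "right_module HC (add_struct UNIV) (M_act chi)"
proof (intro right_module.intro right_module_axioms.intro)
  show "ring HC" by (rule ring_HR)
  show "abelian_group (add_struct (UNIV :: ('c \<times> 'c) set))" by (rule abelian_group_add_struct) auto
qed (use lin_functional_RR in \<open>auto simp: M_act_def RR_mult RR_one algebra_simps lin_functional_def\<close>)

lemma is_M_gamma_M_act: "is_M_gamma val red varpi chi (M_act chi)"
proof -
  \<comment> \<open>The formulas for functionals concern products; writing a generator as its
    product with the identity yields its matrix.\<close>
  have Pi1: "TPi \<circ> sc 1 = (TPi :: ('f, 'c) hecke)" and n1: "Tn \<circ> sc 1 = (Tn :: ('f, 'c) hecke)" by simp_all
  have Th: "RR chi P Q (hecke_T L (dl h) \<circ> sc 1) = inverse (chi h) * RR chi P Q (sc 1)"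
    if hd: "h \<in> diag2" and PQ: "P \<in> {one1, Pi}" "Q \<in> {one1, Pi}" for P Q h
  proof -
    obtain a d where h: "dl h = dg a d" "a \<in> \<O>" "d \<in> \<O>" "h = mat2 (red a) 0 0 (red d)"
      "red a \<noteq> 0" "red d \<noteq> 0" using dl[OF hd] by blast
    show ?thesis using PQ RR_Th[of "sc 1" Q a d] h(2-) unfolding h(1) by auto
  qed
  have e: "RR chi P Q (eH chi' \<circ> sc 1) = RR chi P Q (sc 1)"
    if "P \<in> {one1, Pi}" "Q \<in> {one1, Pi}" "\<And>h. h \<in> diag2 \<Longrightarrow> chi' h = chi h" for P Q chi'
    by (rule eH_functional) (use that is_char_HD(1)[OF chi] Th[OF _ that(1,2)] lin_functional_RR in auto)
  have e': "RR chi P Q (eH chi') = RR chi P Q (sc 1)"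
    if "P \<in> {one1, Pi}" "Q \<in> {one1, Pi}" "\<And>h. h \<in> diag2 \<Longrightarrow> chi' h = chi h" for P Q chi'
    using e[OF that] by simp
  show ?thesis
    unfolding is_M_gamma_def
    using right_module_M RR_gens[of "sc 1" one1, unfolded Pi1 n1] RR_gens[of "sc 1" Pi, unfolded Pi1 n1]
      e'[of _ _ chi] e'[of _ _ "conj_s chi"] conj_s_self self
    by (simp add: M_act_def RR_one)
qed

end

section \<open>The module \<open>L\<^sub>\<gamma>\<close>\<close>

lemma HR_uminus [simp]: "x \<in> carrier HC \<Longrightarrow> - x \<in> carrier HC"
proof -
  assume x: "x \<in> carrier HC"
  have "- x = sc (-1) \<circ> x" using x by (simp add: fun_eq_iff scalar_comp_apply[unfolded comp_apply])
  then show ?thesis using x by simp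
qed

lemma HR_minus [simp]: "x \<in> carrier HC \<Longrightarrow> y \<in> carrier HC \<Longrightarrow> x - y \<in> carrier HC"
  using HR_add_closed[of x "- y"] by simp

lemma HR_a_inv: "x \<in> carrier HC \<Longrightarrow> \<ominus>\<^bsub>HC\<^esub> x = - x"
proof -
  assume x: "x \<in> carrier HC"
  interpret ring HC by (rule ring_HR)
  show ?thesis using minus_equality[of "- x" x] x by simp
qed

lemma HR_a_minus: "x \<in> carrier HC \<Longrightarrow> y \<in> carrier HC \<Longrightarrow> x \<ominus>\<^bsub>HC\<^esub> y = x - y"
  by (simp add: a_minus_def HR_a_inv)

lemma comp_right:
  assumes "z \<in> carrier HC" "x \<in> carrier HC" "y \<in> carrier HC"
  shows "z \<circ> (x + y) = (z \<circ> x) + (z \<circ> y)" "z \<circ> (x - y) = (z \<circ> x) - (z \<circ> y)" "z \<circ> (- y) = - (z \<circ> y)"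
    "z \<circ> 0 = (0 :: ('f, 'c) hecke)"
proof -
  interpret ring HC by (rule ring_HR)
  show add: "z \<circ> (x + y) = (z \<circ> x) + (z \<circ> y)" using r_distr[of x y z] assms by simp
  show z: "z \<circ> 0 = (0 :: ('f, 'c) hecke)" using r_null[of z] assms by simp
  show m: "z \<circ> (- y) = - (z \<circ> y)" using r_minus[of z y] assms HR_a_inv by simp
  show "z \<circ> (x - y) = (z \<circ> x) - (z \<circ> y)"
    using r_distr[of x "- y" z] assms m by simp
qed

lemma comp_sc: "x \<in> carrier HC \<Longrightarrow> x \<circ> sc a = sc a \<circ> x"
proof
  fix f assume x: "x \<in> carrier HC"
  show "(x \<circ> sc a) f = (sc a \<circ> x) f"
    using x HR_carrierD(1,2)[OF x, of f] HR_carrierD(4)[OF x, of f a] HR_zero[OF x]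
    by (cases "f \<in> cInd L") (simp_all add: hecke_scalar_def fun_eq_iff)
qed

lemma sc_apply: "x \<in> carrier HC \<Longrightarrow> (sc a \<circ> x) = (\<lambda>f C. a * x f C)"
  by (simp add: fun_eq_iff scalar_comp_apply[unfolded comp_apply])

lemma comp_lincomb:
  assumes z: "z \<in> carrier HC" and S: "finite S" "\<And>h. h \<in> S \<Longrightarrow> t h \<in> carrier HC"
  shows "z \<circ> (\<lambda>f C. \<Sum>h\<in>S. a h * t h f C) = (\<lambda>f C. \<Sum>h\<in>S. a h * (z \<circ> t h) f C)"
  using S
proof (induction S rule: finite_induct)
  case empty
  have "(\<lambda>f C. \<Sum>h\<in>{}. a h * u h f C) = 0" for u :: "_ \<Rightarrow> ('f, 'c) hecke" by (simp add: fun_eq_iff)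
  then show ?case using comp_right(4)[OF z z z] by metis
next
  case (insert j S)
  have *: "(\<lambda>f C. \<Sum>h\<in>insert j S. a h * u h f C) = (sc (a j) \<circ> u j) + (\<lambda>f C. \<Sum>h\<in>S. a h * u h f C)"
    if "u j \<in> carrier HC" for u
    using insert that by (simp add: fun_eq_iff scalar_comp_apply[unfolded comp_apply])
  have c: "(\<lambda>f C. \<Sum>h\<in>S. a h * t h f C) \<in> carrier HC" using insert by (intro HC_lincomb) auto
  have t: "t j \<in> carrier HC" "z \<circ> t j \<in> carrier HC" using insert z by auto
  have zs: "z \<circ> (sc (a j) \<circ> t j) = sc (a j) \<circ> (z \<circ> t j)"
    by (simp only: comp_assoc[symmetric] comp_sc[OF z])
  have IH: "z \<circ> (\<lambda>f C. \<Sum>h\<in>S. a h * t h f C) = (\<lambda>f C. \<Sum>h\<in>S. a h * (z \<circ> t h) f C)"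
    using insert by blast
  show ?case
    unfolding *[of t, OF t(1)] *[of "\<lambda>h. z \<circ> t h", OF t(2)]
    using comp_right(1)[OF z _ c, of "sc (a j) \<circ> t j"] t by (simp only: zs IH HR_mult_closed hecke_scalar_closed)
qed

section \<open>Relations among the generators\<close>

lemma TPi_T_dg:
  assumes "a \<in> \<O>" "d \<in> \<O>" "red a \<noteq> 0" "red d \<noteq> 0"
  shows "TPi \<circ> hecke_T L (dg a d) = (hecke_T L (dg d a) \<circ> TPi :: ('f, 'c) hecke)"
proof -
  have "Pi ** dg a d = dg d a ** Pi" by (simp add: Pi_eq mult.commute)
  then show ?thesis using assms by (simp add: T_normalizes_mult)
qed

lemma ni_ut_cong:
  assumes "z \<in> \<O>" "z' \<in> \<O>" "red z = red z'"
  shows "\<exists>l\<in>L. ni ** ut z = l ** (ni ** ut z')"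
  using assms by (intro bexI[of _ "mat2 1 0 (z' - z) 1"]) (auto simp: L_mat2_iff)

lemma hf_ni_ut_cong:
  assumes "normalizes M" "z \<in> \<O>" "z' \<in> \<O>" "red z = red z'"
  shows "hf y (M ** (ni ** ut z) ** c) = hf y (M ** (ni ** ut z') ** c)"
proof -
  obtain l where l: "l \<in> L" "ni ** ut z = l ** (ni ** ut z')" using ni_ut_cong assms by blast
  obtain l' where l': "l' \<in> L" "M ** l = l' ** M" using normalizes_right[OF assms(1) l(1)] by blast
  have "M ** (ni ** ut z) ** c = (M ** l) ** (ni ** ut z') ** c"
    unfolding l(2) by (simp only: matrix_mul_assoc)
  also have "\<dots> = l' ** (M ** (ni ** ut z') ** c)" unfolding l'(2) by (simp only: matrix_mul_assoc)
  finally show ?thesis using l' hf_left by simp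
qed

text \<open>Pushing a torus element through the representatives of \<open>n_s\<close> swaps it and
  rescales the parameter \<open>t\<close>, which only permutes the residue field.\<close>

lemma Tn_T_dg:
  assumes ad: "a \<in> \<O>" "d \<in> \<O>" "red a \<noteq> 0" "red d \<noteq> 0"
  shows "Tn \<circ> hecke_T L (dg a d) = (hecke_T L (dg d a) \<circ> Tn :: ('f, 'c) hecke)"
proof (rule HR_eqI_hf)
  have N: "normalizes (dg a d)" "normalizes (dg d a)" using ad by simp_all
  have N': "normalizes (dg (inverse a) (inverse d))" "inverse a \<in> \<O>" "inverse d \<in> \<O>"
    using ad by (auto simp: unit_inverse red_inverse)
  show "Tn \<circ> hecke_T L (dg a d) \<in> carrier HC" "hecke_T L (dg d a) \<circ> Tn \<in> carrier HC" using N by auto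
  fix c :: "'f^2^2" assume c: "c \<in> carrier GL2"
  let ?one = "sc 1"
  have nz: "a \<noteq> 0" "d \<noteq> 0" using ad by auto
  have i: "inv\<^bsub>GL2\<^esub> (dg a d) = dg (inverse a) (inverse d)" "inv\<^bsub>GL2\<^esub> (dg d a) = dg (inverse d) (inverse a)"
    using nz by (simp_all add: inv_GL2_mat2 field_simps)
  have g: "ni ** ut z ** c \<in> carrier GL2" for z using c by (intro GL2_mult) (auto simp: GL2_mat2_iff)
  have g': "dg (inverse d) (inverse a) ** c \<in> carrier GL2" using c nz by (intro GL2_mult) (auto simp: GL2_mat2_iff)
  have "hf (Tn \<circ> (hecke_T L (dg a d) \<circ> ?one)) c =
      (\<Sum>t\<in>UNIV. hf ?one (dg (inverse a) (inverse d) ** (ni ** ut (lf t) ** c)))"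
    using N c g by (simp add: hf_Tn hf_T_normalizes i del: HR_comp_one)
  also have "\<dots> = (\<Sum>t\<in>UNIV. hf ?one (dg (inverse a) (inverse d) ** (ni ** ut (lf t)) ** c))"
    by (simp only: matrix_mul_assoc)
  also have "\<dots> = (\<Sum>t\<in>UNIV. hf ?one (dg (inverse a) (inverse d) ** (ni ** ut (lf (t * red d / red a))) ** c))"
    by (rule sum.reindex_bij_witness[where i = "\<lambda>t. t * red d / red a" and j = "\<lambda>t. t * red a / red d"])
      (use ad in auto)
  also have "\<dots> = (\<Sum>t\<in>UNIV. hf ?one (dg (inverse a) (inverse d) ** (ni ** ut (lf t * d / a)) ** c))"
    using ad N' by (intro sum.cong refl hf_ni_ut_cong) (auto simp: unit_divide red_divide)
  also have "\<dots> = (\<Sum>t\<in>UNIV. hf ?one (ni ** ut (lf t) ** (dg (inverse d) (inverse a) ** c)))"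
  proof (intro sum.cong refl arg_cong[of _ _ "hf ?one"])
    fix t
    have "dg (inverse a) (inverse d) ** (ni ** ut (lf t * d / a)) = ni ** ut (lf t) ** dg (inverse d) (inverse a)"
      using nz by (simp add: field_simps)
    then show "dg (inverse a) (inverse d) ** (ni ** ut (lf t * d / a)) ** c = ni ** ut (lf t) ** (dg (inverse d) (inverse a) ** c)"
      by (simp only: matrix_mul_assoc)
  qed
  also have "\<dots> = hf (hecke_T L (dg d a) \<circ> (Tn \<circ> ?one)) c"
    using N c g' by (simp add: hf_Tn hf_T_normalizes i del: HR_comp_one)
  finally show "hf (Tn \<circ> hecke_T L (dg a d)) c = hf (hecke_T L (dg d a) \<circ> Tn :: ('f, 'c) hecke) c"
    using N by simp
qed

text \<open>The products of representatives with first parameter \<open>0\<close> give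
  \<open>q\<close> equal terms and vanish; the Bruhat relation sorts the others by their torus part.
  The factor \<open>1\<close> puts the sum into the form of \<open>comp_lincomb\<close>.\<close>

lemma Tn_Tn: "Tn \<circ> Tn = (\<lambda>f C. \<Sum>t\<in>UNIV - {0}. 1 * (hecke_T L (dg (- inverse (lf t)) (- lf t)) \<circ> Tn) f (C :: ('f^2^2) set) :: 'c)"
  (is "_ = ?R")
proof (rule HR_eqI_hf)
  have u: "lf t \<noteq> 0" "inverse (lf t) \<in> \<O>" "red (inverse (lf t)) = inverse t" if "t \<noteq> 0" for t
    using that unit_inverse[of "lf t"] red_inverse[of "lf t"] by (auto dest: arg_cong[of _ _ red])
  have N: "normalizes (dg (- inverse (lf t)) (- lf t))" "normalizes (dg (- lf t) (- inverse (lf t)))"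
    if "t \<noteq> 0" for t
    using u[OF that] that by simp_all
  show "Tn \<circ> Tn \<in> carrier HC" by simp
  show "?R \<in> carrier HC" by (rule HC_lincomb) (use N in \<open>auto simp del: comp_apply\<close>)
  fix c :: "'f^2^2" assume c: "c \<in> carrier GL2"
  let ?one = "sc 1"
  have g: "ni ** ut z ** c \<in> carrier GL2" for z using c by (intro GL2_mult) (auto simp: GL2_mat2_iff)
  have g2: "ni ** ut z' ** (ni ** ut z ** c) \<in> carrier GL2" for z z' by (rule GL2_mult[OF _ g]) (simp add: GL2_mat2_iff)
  have t0: "hf ?one (ni ** ut (lf 0) ** (ni ** ut (lf t) ** c)) = hf ?one (dg (-1) (-1) ** c)" for t
  proof -
    let ?l = "mat2 1 0 (- lf 0) 1 ** ut (lf t)"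
    have l: "?l \<in> L" by (intro L_closed) (auto simp: L_mat2_iff)
    have e: "ni ** ut (lf 0) ** (ni ** ut (lf t)) = ?l ** dg (-1) (-1)"
      by simp
    have "ni ** ut (lf 0) ** (ni ** ut (lf t) ** c) = ?l ** (dg (-1) (-1) ** c)"
      using e by (simp only: matrix_mul_assoc)
    then show ?thesis using l hf_left by metis
  qed
  have tt: "(\<Sum>t\<in>UNIV. hf ?one (ni ** ut (lf t') ** (ni ** ut (lf t) ** c))) =
      hf (hecke_T L (dg (- inverse (lf t')) (- lf t')) \<circ> Tn) c" if t': "t' \<noteq> 0" for t'
  proof -
    let ?u = "lf t'"
    note u = u[OF t']
    let ?M = "dg (- inverse ?u) (- ?u)"
    have d: "- ?u \<in> \<O>" "- inverse ?u \<in> \<O>" "red (- ?u) \<noteq> 0" "red (- inverse ?u) \<noteq> 0" using u t' by auto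
    have iM: "inv\<^bsub>GL2\<^esub> (dg (- ?u) (- inverse ?u)) = ?M" using u by (simp add: inv_GL2_mat2 field_simps)
    have "hf ?one (ni ** ut ?u ** (ni ** ut (lf t) ** c)) = hf ?one (?M ** (ni ** ut (lf (t - inverse t'))) ** c)" for t
    proof -
      \<comment> \<open>The unit \<open>?u\<close> yields the torus part \<open>?M\<close> and
        shifts the second parameter by a constant, so summing over \<open>t\<close> gives all of
        \<open>T_n\<close> again.\<close>
      have e: "ni ** ut ?u ** (ni ** ut (lf t)) = ut (- inverse ?u) ** (?M ** (ni ** ut (lf t - inverse ?u)))"
        using u by (simp add: algebra_simps)
      have ul: "ut (- inverse ?u) \<in> L" using u by simp
      have "ni ** ut ?u ** (ni ** ut (lf t) ** c) = ut (- inverse ?u) ** (?M ** (ni ** ut (lf t - inverse ?u)) ** c)"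
        using e by (simp only: matrix_mul_assoc)
      then have "hf ?one (ni ** ut ?u ** (ni ** ut (lf t) ** c)) = hf ?one (?M ** (ni ** ut (lf t - inverse ?u)) ** c)"
        using hf_left[OF ul] by simp
      also have "\<dots> = hf ?one (?M ** (ni ** ut (lf (t - inverse t'))) ** c)"
        using u N[OF t'] by (intro hf_ni_ut_cong) auto
      finally show ?thesis .
    qed
    then have "(\<Sum>t\<in>UNIV. hf ?one (ni ** ut ?u ** (ni ** ut (lf t) ** c))) =
        (\<Sum>t\<in>UNIV. hf ?one (?M ** (ni ** ut (lf (t - inverse t'))) ** c))" by simp
    also have "\<dots> = (\<Sum>t\<in>UNIV. hf ?one (?M ** (ni ** ut (lf t)) ** c))"
      by (rule sum.reindex_bij_witness[where i = "\<lambda>t. t + inverse t'" and j = "\<lambda>t. t - inverse t'"]) auto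
    also have "\<dots> = (\<Sum>t\<in>UNIV. hf ?one (?M ** (ni ** ut (lf t) ** c)))" by (simp only: matrix_mul_assoc)
    also have "\<dots> = hf (Tn \<circ> (hecke_T L (dg (- ?u) (- inverse ?u)) \<circ> ?one)) c"
      using N[OF t'] c g by (simp add: hf_Tn hf_T_normalizes iM del: HR_comp_one)
    also have "\<dots> = hf (hecke_T L ?M \<circ> Tn) c"
      using N[OF t'] Tn_T_dg[OF d(1,2,3,4)] by simp
    finally show ?thesis .
  qed
  have "hf (Tn \<circ> (Tn \<circ> ?one)) c = (\<Sum>t\<in>UNIV. \<Sum>t'\<in>UNIV. hf ?one (ni ** ut (lf t') ** (ni ** ut (lf t) ** c)))"
    using c g by (simp add: hf_Tn del: HR_comp_one)
  also have "\<dots> = (\<Sum>t'\<in>UNIV. \<Sum>t\<in>UNIV. hf ?one (ni ** ut (lf t') ** (ni ** ut (lf t) ** c)))"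
    by (rule sum.swap)
  also have "\<dots> = (\<Sum>t\<in>UNIV. hf ?one (ni ** ut (lf 0) ** (ni ** ut (lf t) ** c))) +
      (\<Sum>t'\<in>UNIV - {0}. \<Sum>t\<in>UNIV. hf ?one (ni ** ut (lf t') ** (ni ** ut (lf t) ** c)))"
    by (rule sum.remove) auto
  also have "(\<Sum>t\<in>UNIV. hf ?one (ni ** ut (lf 0) ** (ni ** ut (lf t) ** c))) = 0"
    unfolding t0 using q0 by simp
  also have "(\<Sum>t'\<in>UNIV - {0}. \<Sum>t\<in>UNIV. hf ?one (ni ** ut (lf t') ** (ni ** ut (lf t) ** c))) =
      (\<Sum>t'\<in>UNIV - {0}. hf (hecke_T L (dg (- inverse (lf t')) (- lf t')) \<circ> Tn) c)"
    by (intro sum.cong refl tt) auto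
  also have "\<dots> = hf ?R c"
    by (simp add: hf_def)
  finally show "hf (Tn \<circ> Tn) c = hf ?R c"
    by (simp only: HR_comp_one Tn_closed add_0_left)
qed

lemma eH_T_dg:
  assumes chi: "is_char_H chi" and ad: "a \<in> \<O>" "d \<in> \<O>" "red a \<noteq> 0" "red d \<noteq> 0"
  shows "eH chi \<circ> hecke_T L (dg a d) = sc (inverse (chi (mat2 (red a) 0 0 (red d)))) \<circ> eH chi"
proof -
  let ?h0 = "mat2 (red a) 0 0 (red d)"
  have h0: "?h0 \<in> diag2" using ad by simp
  have T: "hecke_T L (dl h) \<circ> hecke_T L (dg a d) = (hecke_T L (dl (h ** ?h0)) :: ('f, 'c) hecke)"
    if hd: "h \<in> diag2" for h
  proof -
    obtain b c where h: "dl h = dg b c" "b \<in> \<O>" "c \<in> \<O>" "h = mat2 (red b) 0 0 (red c)"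
      "red b \<noteq> 0" "red c \<noteq> 0" using dl[OF hd] by blast
    obtain l where l: "l \<in> L" "dg (b * a) (c * d) = dl (h ** ?h0) ** l"
      using dg_cong[of "b * a" "c * d" "h ** ?h0"] h ad by auto
    have "hecke_T L (dl h) \<circ> hecke_T L (dg a d) = (hecke_T L (dg (b * a) (c * d)) :: ('f, 'c) hecke)"
      using T_normalizes_mult[of "dl h" "dg a d", where 'c = 'c] dl_normalizes[OF hd] ad h(1) by simp
    then show ?thesis
      using T_normalizes_coset[OF dl_normalizes l(1), of "h ** ?h0", where 'c = 'c] l(2) hd h0 by simp
  qed
  have "eH chi \<circ> hecke_T L (dg a d) = (\<lambda>f C. \<Sum>h\<in>diag2. chi h * hecke_T L (dl (h ** ?h0)) f C)"
    unfolding eH_comp using T by (simp add: fun_eq_iff)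
  also have "\<dots> = (\<lambda>f C. \<Sum>h\<in>diag2. inverse (chi ?h0) * (chi h * hecke_T L (dl h) f C))"
  proof (intro ext)
    fix f :: "('f^2^2) set \<Rightarrow> 'c" and C
    show "(\<Sum>h\<in>diag2. chi h * hecke_T L (dl (h ** ?h0)) f C) =
      (\<Sum>h\<in>diag2. inverse (chi ?h0) * (chi h * hecke_T L (dl h) f C))"
    proof (rule sum.reindex_bij_witness[where i = "\<lambda>h. h ** inv\<^bsub>GL2\<^esub> ?h0" and j = "\<lambda>h. h ** ?h0"])
      fix h :: "'k^2^2" assume h: "h \<in> diag2"
      show "inverse (chi ?h0) * (chi (h ** ?h0) * hecke_T L (dl (h ** ?h0)) f C) = chi h * hecke_T L (dl (h ** ?h0)) f C"
        using is_char_HD[OF chi] h h0 by simp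
    qed (use h0 diag2_GL2[OF h0] in auto)
  qed
  also have "\<dots> = sc (inverse (chi ?h0)) \<circ> eH chi"
    unfolding sc_apply[OF eH_closed] by (simp add: eH_eq sum_distrib_left)
  finally show ?thesis .
qed

text \<open>The square is translation by a central matrix, and elements of the ring commute with
  translations by definition.\<close>

lemma TPi_sq_central:
  assumes x: "x \<in> carrier HC" shows "(TPi \<circ> TPi) \<circ> x = x \<circ> (TPi \<circ> TPi)"
proof -
  have i: "inv\<^bsub>GL2\<^esub> (Pi ** Pi) = zm (-1)"
    by (rule inv_GL2_unique) (simp_all add: PiPi zm_add zm_zero)
  have sq: "(TPi \<circ> TPi) f = rtrans (zm (-1)) f" if f: "f \<in> cInd L" for f :: "('f^2^2) set \<Rightarrow> 'c"
  proof
    fix C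
    have eq: "TPi \<circ> TPi = (hecke_T L (Pi ** Pi) :: ('f, 'c) hecke)" by (simp add: T_normalizes_mult)
    show "(TPi \<circ> TPi) f C = rtrans (zm (-1)) f C"
    proof (cases "C \<in> cosets")
      case True
      then obtain c where c: "c \<in> carrier GL2" "C = cs c" by (rule cosetsE)
      show ?thesis unfolding eq using T_normalizes_apply[of "Pi ** Pi" f c] f c
        by (simp add: i rtrans_def r_coset_mult zm_commute)
    next
      case False
      then show ?thesis
        unfolding eq using cInd_outside[OF rtrans_cInd[OF f zm_GL2, of "-1"] False] f
        by (simp add: hecke_T_def)
    qed
  qed
  show ?thesis
  proof
    fix f show "((TPi \<circ> TPi) \<circ> x) f = (x \<circ> (TPi \<circ> TPi)) f"
    proof (cases "f \<in> cInd L")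
      case True
      then show ?thesis using sq[OF True] sq[OF HR_carrierD(1)[OF x True]] HR_carrierD(5)[OF x zm_GL2 True]
        by (simp only: comp_apply)
    next
      case False
      have c: "(TPi :: ('f,'c) hecke) \<in> carrier HC" by simp
      show ?thesis using HR_carrierD(2)[OF x False] HR_carrierD(2)[OF c False] HR_zero[OF x] HR_zero[OF c]
        by simp
    qed
  qed
qed

end

context mod_p_hecke
begin

text \<open>\<open>\<circ>\<close> binds weaker than \<open>+\<close>, so products in the Hecke ring get a symbol of their own.\<close>

abbreviation cmp :: "('f, 'c) hecke \<Rightarrow> ('f, 'c) hecke \<Rightarrow> ('f, 'c) hecke" (infixl "\<odot>" 70) where
  "x \<odot> y \<equiv> x \<circ> y"

section \<open>The quotient by \<open>T_\<Pi>\<^sup>2 - 1\<close>\<close>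

definition zz :: "('f, 'c) hecke" where "zz = TPi \<odot> TPi - sc 1"
definition cc :: "('f, 'c) hecke" where "cc = TPi \<odot> Tn - Tn \<odot> TPi"

lemma zz_closed [simp]: "zz \<in> carrier HC" and cc_closed [simp]: "cc \<in> carrier HC"
  by (simp_all add: zz_def cc_def)

lemma zz_comp: "x \<in> carrier HC \<Longrightarrow> zz \<odot> x = TPi \<odot> (TPi \<odot> x) - x"
  by (simp add: zz_def comp_left comp_assoc)

lemma cc_comp: "cc \<odot> x = TPi \<odot> (Tn \<odot> x) - Tn \<odot> (TPi \<odot> x)"
  by (simp add: cc_def comp_left comp_assoc)

lemma zz_central: "x \<in> carrier HC \<Longrightarrow> x \<odot> zz = zz \<odot> x"
  unfolding zz_def using TPi_sq_central[of x] by (simp add: comp_left comp_right)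

lemma T_Pi_ideal_eq: "T_Pi_ideal val red varpi = {zz \<odot> x | x. x \<in> carrier HC}"
  unfolding T_Pi_ideal_def Let_def by (simp add: HR_a_minus zz_def)

abbreviation pj :: "('f, 'c) hecke \<Rightarrow> ('f, 'c) hecke set" where "pj \<equiv> hecke1_proj val red varpi"
abbreviation R1 :: "('f, 'c) hecke set ring" where "R1 \<equiv> hecke1_ring val red varpi"

lemma ideal_T_Pi: "ideal (T_Pi_ideal val red varpi) HC"
proof (rule idealI)
  show "ring HC" by (rule ring_HR)
  interpret ring HC by (rule ring_HR)
  show "subgroup (T_Pi_ideal val red varpi) (add_monoid HC)"
  proof (rule subgroup.intro)
    show "T_Pi_ideal val red varpi \<subseteq> carrier (add_monoid HC)" by (auto simp: T_Pi_ideal_eq)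
    fix x y :: "('f, 'c) hecke" assume "x \<in> T_Pi_ideal val red varpi" "y \<in> T_Pi_ideal val red varpi"
    then obtain u v where uv: "u \<in> carrier HC" "v \<in> carrier HC" "x = zz \<odot> u" "y = zz \<odot> v"
      by (auto simp: T_Pi_ideal_eq)
    then have "x + y = zz \<odot> (u + v)" using comp_right(1)[OF zz_closed uv(1,2)] by (simp only:)
    then show "x \<otimes>\<^bsub>add_monoid HC\<^esub> y \<in> T_Pi_ideal val red varpi"
      using uv HR_add_closed by (auto simp: T_Pi_ideal_eq simp del: comp_apply)
  next
    have "zz \<odot> 0 = (0 :: ('f, 'c) hecke)" using comp_right(4)[OF zz_closed HR_zero_closed HR_zero_closed] .
    then have "0 = zz \<odot> (0 :: ('f, 'c) hecke)" by (simp only:)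
    then show "\<one>\<^bsub>add_monoid HC\<^esub> \<in> T_Pi_ideal val red varpi"
      using HR_zero_closed by (auto simp: T_Pi_ideal_eq simp del: comp_apply)
  next
    fix x :: "('f, 'c) hecke" assume "x \<in> T_Pi_ideal val red varpi"
    then obtain u where u: "u \<in> carrier HC" "x = zz \<odot> u" by (auto simp: T_Pi_ideal_eq)
    then have "- x = zz \<odot> (- u)" using comp_right(3)[OF zz_closed u(1) u(1)] by (simp only:)
    moreover have "inv\<^bsub>add_monoid HC\<^esub> x = - x" using u HR_a_inv[of x] by (simp add: a_inv_def)
    ultimately have eq: "inv\<^bsub>add_monoid HC\<^esub> x = zz \<odot> (- u)" by (rule trans[rotated])
    show "inv\<^bsub>add_monoid HC\<^esub> x \<in> T_Pi_ideal val red varpi"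
      unfolding T_Pi_ideal_eq eq using HR_uminus[OF u(1)] by blast
  qed
  fix a x :: "('f, 'c) hecke" assume "a \<in> T_Pi_ideal val red varpi" and x: "x \<in> carrier HC"
  then obtain u where u: "u \<in> carrier HC" "a = zz \<odot> u" by (auto simp: T_Pi_ideal_eq)
  have "x \<odot> a = zz \<odot> (x \<odot> u)" unfolding u(2) comp_assoc[symmetric] zz_central[OF x] ..
  then show "x \<otimes>\<^bsub>HC\<^esub> a \<in> T_Pi_ideal val red varpi"
    unfolding T_Pi_ideal_eq HR_simps using HR_mult_closed[OF x u(1)] by blast
  have "a \<odot> x = zz \<odot> (u \<odot> x)" unfolding u(2) comp_assoc ..
  then show "a \<otimes>\<^bsub>HC\<^esub> x \<in> T_Pi_ideal val red varpi"
    unfolding T_Pi_ideal_eq HR_simps using HR_mult_closed[OF u(1) x] by blast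
qed

lemma pj_def': "pj x = {zz \<odot> w + x | w. w \<in> carrier HC}"
  unfolding hecke1_proj_def a_r_coset_def' T_Pi_ideal_eq HR_simps by blast

lemma pj_hom: "x \<in> carrier HC \<Longrightarrow> y \<in> carrier HC \<Longrightarrow> pj x \<oplus>\<^bsub>R1\<^esub> pj y = pj (x + y)"
  "x \<in> carrier HC \<Longrightarrow> y \<in> carrier HC \<Longrightarrow> pj x \<otimes>\<^bsub>R1\<^esub> pj y = pj (x \<odot> y)"
  using ring_hom_add[OF ideal.rcos_ring_hom[OF ideal_T_Pi], of x y]
    ring_hom_mult[OF ideal.rcos_ring_hom[OF ideal_T_Pi], of x y]
  by (simp_all add: hecke1_ring_def hecke1_proj_def)

lemma R1_carrier: "carrier R1 = pj ` carrier HC"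
  unfolding hecke1_ring_def FactRing_def A_RCOSETS_def' by (auto simp: hecke1_proj_def)

lemma pj_eq_iff:
  assumes "x \<in> carrier HC" "y \<in> carrier HC"
  shows "pj x = pj y \<longleftrightarrow> (\<exists>w\<in>carrier HC. x - y = zz \<odot> w)"
proof
  assume eq: "pj x = pj y"
  have z: "zz \<odot> 0 = (0 :: ('f, 'c) hecke)" using comp_right(4)[OF zz_closed HR_zero_closed HR_zero_closed] .
  have "x = zz \<odot> 0 + x" unfolding z by (rule add_0_left[symmetric])
  then have "x \<in> pj x" using HR_zero_closed unfolding pj_def' by blast
  then obtain w where "w \<in> carrier HC" "x = zz \<odot> w + y" unfolding eq unfolding pj_def' by blast
  then show "\<exists>w\<in>carrier HC. x - y = zz \<odot> w" by (metis add_diff_cancel)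
next
  assume "\<exists>w\<in>carrier HC. x - y = zz \<odot> w"
  then obtain w where w: "w \<in> carrier HC" "x - y = zz \<odot> w" by blast
  have *: "zz \<odot> v + x = zz \<odot> (v + w) + y" "zz \<odot> v + y = zz \<odot> (v - w) + x" if "v \<in> carrier HC" for v
    unfolding comp_right(1)[OF zz_closed that w(1)] comp_right(2)[OF zz_closed that w(1)] w(2)[symmetric]
    by (simp_all only: algebra_simps)
  show "pj x = pj y"
    unfolding pj_def' using * HR_add_closed[OF _ w(1)] HR_minus[OF _ w(1)] by blast
qed

context
  fixes chi :: "'k^2^2 \<Rightarrow> 'c"
  assumes chi: "is_char_H chi" and nonself: "\<not> self_conj chi"
begin

abbreviation e :: "('f, 'c) hecke" where "e \<equiv> eH chi"
abbreviation chi' :: "'k^2^2 \<Rightarrow> 'c" where "chi' \<equiv> conj_s chi"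

lemma chi': "is_char_H chi'" using chi by simp

lemma quad: "quad_const chi = 0" "quad_const chi' = 0"
  using quad_const_nonself[OF chi nonself] quad_const_conj_s[OF chi] by auto

text \<open>These are the coordinates with respect to \<open>1, T\<^sub>\<Pi>, T\<^sub>n, T\<^sub>\<Pi> T\<^sub>n\<close>; they vanish on the relations defining \<open>L\<^sub>\<gamma>\<close>.\<close>

definition coord0 where "coord0 = AA chi one1 one1"
definition coord1 where "coord1 = AA chi one1 Pi"
definition coord2 where "coord2 = (\<lambda>x. NN chi' one1 one1 x + NN chi Pi Pi x)"
definition coord3 where "coord3 = (\<lambda>x. NN chi' one1 Pi x + NN chi Pi one1 x)"

definition coords :: "('f, 'c) hecke \<Rightarrow> 'c \<times> 'c \<times> 'c \<times> 'c" where
  "coords x = (coord0 x, coord1 x, coord2 x, coord3 x)"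

lemma lin_functional_coord: "lin_functional coord0" "lin_functional coord1" "lin_functional coord2" "lin_functional coord3"
  unfolding coord0_def coord1_def coord2_def coord3_def
  by (intro lin_functional_plus lin_functional_AA lin_functional_NN; simp)+

lemma coords_add: "x \<in> carrier HC \<Longrightarrow> y \<in> carrier HC \<Longrightarrow> coords (x + y) = coords x + coords y"
  using lin_functional_coord by (simp add: coords_def lin_functional_def)

definition scale4 :: "'c \<Rightarrow> 'c \<times> 'c \<times> 'c \<times> 'c \<Rightarrow> 'c \<times> 'c \<times> 'c \<times> 'c" where
  "scale4 a v = (case v of (p, q, r, s) \<Rightarrow> (a * p, a * q, a * r, a * s))"

lemma coords_sc: "x \<in> carrier HC \<Longrightarrow> coords (sc a \<odot> x) = scale4 a (coords x)"
  using lin_functional_coord by (simp add: coords_def lin_functional_def scale4_def del: comp_apply)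

lemma coords_uminus: "x \<in> carrier HC \<Longrightarrow> coords (- x) = - coords x"
proof -
  assume x: "x \<in> carrier HC"
  have "- x = sc (-1) \<odot> x" unfolding sc_apply[OF x] by (simp add: fun_eq_iff)
  then show ?thesis using coords_sc[OF x, of "-1"] by (simp add: scale4_def coords_def del: comp_apply)
qed

lemma coords_diff: "x \<in> carrier HC \<Longrightarrow> y \<in> carrier HC \<Longrightarrow> coords (x - y) = coords x - coords y"
  using coords_add[of x "- y"] coords_uminus[of y] by simp

text \<open>The average \<open>NN\<close> for \<open>chi'\<close> at \<open>P = 1\<close> and the
  one for \<open>chi\<close> at \<open>P = \<Pi>\<close> transform by the same character under the
  torus; this is why they may be added within one coordinate.\<close>

lemma coords_e: assumes x: "x \<in> carrier HC" shows "coords (e \<odot> x) = coords x"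
proof -
  have Th: "coord0 (hecke_T L (dl h) \<odot> x) = inverse (chi h) * coord0 x \<and> coord1 (hecke_T L (dl h) \<odot> x) = inverse (chi h) * coord1 x
    \<and> coord2 (hecke_T L (dl h) \<odot> x) = inverse (chi h) * coord2 x \<and> coord3 (hecke_T L (dl h) \<odot> x) = inverse (chi h) * coord3 x"
    if hd: "h \<in> diag2" for h
  proof -
    obtain a d where h: "dl h = dg a d" "a \<in> \<O>" "d \<in> \<O>" "h = mat2 (red a) 0 0 (red d)"
      "red a \<noteq> 0" "red d \<noteq> 0" using dl[OF hd] by blast
    have "conj_s chi' h = chi h" using conj_s_conj_s[OF hd] .
    then show ?thesis
      using AA_NN_Th[OF x normalizes_one chi h(2,3,5,6)] AA_NN_Th[OF x normalizes_Pi chi h(2,3,5,6)]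
        AA_NN_Th[OF x normalizes_one chi' h(2,3,5,6)] AA_NN_Th[OF x normalizes_Pi chi' h(2,3,5,6)] h(4)
      unfolding h(1) coord0_def coord1_def coord2_def coord3_def by (simp add: distrib_left)
  qed
  show ?thesis
    using eH_functional[OF lin_functional_coord(1) x, of chi] eH_functional[OF lin_functional_coord(2) x, of chi]
      eH_functional[OF lin_functional_coord(3) x, of chi] eH_functional[OF lin_functional_coord(4) x, of chi]
      Th is_char_HD(1)[OF chi] by (simp add: coords_def)
qed

lemma coords_TPi_TPi: "x \<in> carrier HC \<Longrightarrow> coords (TPi \<odot> (TPi \<odot> x)) = coords x"
  by (simp add: coords_def coord0_def coord1_def coord2_def coord3_def AA_TPi NN_TPi)

lemma AA_chi'_Pi:
  assumes x: "x \<in> carrier HC"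
  shows "AA chi' Pi one1 x = AA chi one1 Pi x" "AA chi' Pi Pi x = AA chi one1 one1 x"
proof -
  have "AA (conj_s chi') one1 Q x = AA chi one1 Q x" for Q
    by (rule AA_cong) (simp add: conj_s_conj_s)
  then show "AA chi' Pi one1 x = AA chi one1 Pi x" "AA chi' Pi Pi x = AA chi one1 one1 x"
    using AA_Pi[OF x normalizes_one, of chi'] AA_Pi[OF x normalizes_Pi, of chi'] AA_PiPi[OF x normalizes_one]
    by simp_all
qed

text \<open>As \<open>T_n\<close> kills \<open>NN\<close> at \<open>P = \<Pi>\<close>, each summand
  of \<open>coord2\<close> and \<open>coord3\<close> sees only one of the two products. Adding the
  summands makes the values on both products agree, so the commutator is killed.\<close>

lemma coords_TPi_Tn:
  assumes x: "x \<in> carrier HC"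
  shows "coords (TPi \<odot> (Tn \<odot> x)) = (0, 0, AA chi one1 Pi x, AA chi one1 one1 x)"
    "coords (Tn \<odot> (TPi \<odot> x)) = (0, 0, AA chi one1 Pi x, AA chi one1 one1 x)"
  using x by (simp_all add: coords_def coord0_def coord1_def coord2_def coord3_def AA_TPi NN_TPi AA_Tn NN_Tn NN_Tn_Pi
      quad chi AA_chi'_Pi)

lemma coords_zz: "x \<in> carrier HC \<Longrightarrow> coords (zz \<odot> x) = 0"
  by (simp add: zz_comp coords_diff coords_TPi_TPi)

lemma coords_cc: "x \<in> carrier HC \<Longrightarrow> coords (cc \<odot> x) = 0"
  by (simp add: cc_comp coords_diff coords_TPi_Tn)

text \<open>The averages \<open>a\<close>, \<open>a'\<close>, \<open>b\<close>, \<open>b'\<close>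
  are also the only data through which such an element acts on the invariants in
  \<open>hecke_K_act_eig\<close>.\<close>

lemma coords_supp_K:
  assumes "supp_K x"
  defines "a \<equiv> AA chi one1 one1 x" and "a' \<equiv> AA chi' one1 one1 x"
    and "b \<equiv> NN chi one1 one1 x" and "b' \<equiv> NN chi' one1 one1 x"
  shows "coords x = (a, 0, b', 0)" "coords (TPi \<odot> x) = (0, a', 0, b)" "coords (Tn \<odot> x) = (0, 0, a', 0)"
    "coords (TPi \<odot> (Tn \<odot> x)) = (0, 0, 0, a)"
proof -
  have x: "x \<in> carrier HC" using assms(1) by (simp add: supp_K_def)
  show "coords x = (a, 0, b', 0)" "coords (TPi \<odot> x) = (0, a', 0, b)" "coords (Tn \<odot> x) = (0, 0, a', 0)"
    "coords (TPi \<odot> (Tn \<odot> x)) = (0, 0, 0, a)"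
    using x supp_K_AA_NN(2-4,6-8)[OF assms(1)]
    by (simp_all add: coords_TPi_Tn) (simp_all add: coords_def coord0_def coord1_def coord2_def coord3_def AA_TPi NN_TPi
      AA_Tn NN_Tn NN_Tn_Pi chi quad a_def a'_def b_def b'_def)
qed

definition gens :: "'c \<times> 'c \<times> 'c \<times> 'c \<Rightarrow> ('f, 'c) hecke" where
  "gens v = (case v of (a, b, c, d) \<Rightarrow>
     sc a \<odot> sc 1 + (sc b \<odot> TPi + (sc c \<odot> Tn + sc d \<odot> (TPi \<odot> Tn))))"

lemma gens_closed [simp]: "gens v \<in> carrier HC"
  by (cases v) (simp add: gens_def)

lemma gens_comp:
  assumes "x \<in> carrier HC"
  shows "gens (a, b, c, d) \<odot> x =
    sc a \<odot> x + (sc b \<odot> (TPi \<odot> x) + (sc c \<odot> (Tn \<odot> x) + sc d \<odot> (TPi \<odot> (Tn \<odot> x))))"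
  using assms by (simp add: gens_def comp_left comp_assoc del: comp_apply)

lemma coords_gens_comp:
  assumes x: "x \<in> carrier HC"
  shows "coords (gens (a, b, c, d) \<odot> x) = scale4 a (coords x) + (scale4 b (coords (TPi \<odot> x)) +
    (scale4 c (coords (Tn \<odot> x)) + scale4 d (coords (TPi \<odot> (Tn \<odot> x)))))"
  unfolding gens_comp[OF x] using x by (simp add: coords_add coords_sc del: comp_apply)

lemma coords_gens_supp_K:
  assumes "supp_K x"
  shows "coords (gens (p, q, r, s) \<odot> x) =
    (p * AA chi one1 one1 x, q * AA chi' one1 one1 x,
     p * NN chi' one1 one1 x + r * AA chi' one1 one1 x, q * NN chi one1 one1 x + s * AA chi one1 one1 x)"
  using assms coords_gens_comp[of x p q r s] coords_supp_K[OF assms]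
  by (simp add: supp_K_def scale4_def del: comp_apply)

lemma coords_gens [simp]: "coords (gens v) = v"
proof (cases v)
  case (fields p q r s)
  have "coords (gens v \<odot> sc 1) = v"
    unfolding fields coords_gens_supp_K[OF supp_K_one] using one_AA_NN[OF chi] one_AA_NN[OF chi'] by simp
  then show ?thesis by (simp del: comp_apply)
qed

lemma gens_add: "gens (v + w) = gens v + gens w"
proof -
  obtain p q r s where v: "v = (p, q, r, s)" by (cases v)
  obtain p' q' r' s' where w: "w = (p', q', r', s')" by (cases w)
  have add: "sc (a + b) \<odot> x = sc a \<odot> x + sc b \<odot> x" if "x \<in> carrier HC" for a b x
    unfolding sc_apply[OF that] by (simp add: fun_eq_iff distrib_right)
  have c: "(TPi :: ('f,'c) hecke) \<in> carrier HC" "(Tn :: ('f,'c) hecke) \<in> carrier HC"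
    "TPi \<odot> Tn \<in> carrier HC" by simp_all
  show ?thesis
    unfolding v w gens_def add_Pair prod.case add[OF c(1)] add[OF c(2)] add[OF c(3)]
      add[OF hecke_scalar_closed] by (simp only: ac_simps)
qed

lemma gens_scale4: "gens (scale4 a v) = sc a \<odot> gens v"
proof (cases v)
  case (fields p q r s)
  have m: "sc (a * b) \<odot> x = sc a \<odot> (sc b \<odot> x)" if "x \<in> carrier HC" for b x
    unfolding sc_apply[OF HR_mult_closed[OF hecke_scalar_closed that]] unfolding sc_apply[OF that]
    by (simp add: mult.assoc)
  have c: "(TPi :: ('f,'c) hecke) \<in> carrier HC" "(Tn :: ('f,'c) hecke) \<in> carrier HC"
    "TPi \<odot> Tn \<in> carrier HC" by simp_all
  have d: "sc a \<odot> (x + y) = sc a \<odot> x + sc a \<odot> y" if "x \<in> carrier HC" "y \<in> carrier HC" for x y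
    using that by (intro comp_right(1)) auto
  show ?thesis
    unfolding fields gens_def scale4_def prod.case m[OF c(1)] m[OF c(2)] m[OF c(3)] m[OF hecke_scalar_closed]
    by (simp only: d HR_add_closed HR_mult_closed hecke_scalar_closed c)
qed

text \<open>The preimage in \<open>\<H>\<close> of the denominator of \<open>L_\<gamma>\<close>.
  Working here postpones cosets of cosets to the very end.\<close>

definition L_rel :: "('f, 'c) hecke set" where
  "L_rel = {e \<odot> cc \<odot> x + zz \<odot> y | x y. x \<in> carrier HC \<and> y \<in> carrier HC}"

lemma L_relI: "x \<in> carrier HC \<Longrightarrow> y \<in> carrier HC \<Longrightarrow> z = e \<odot> cc \<odot> x + zz \<odot> y \<Longrightarrow> z \<in> L_rel"
  unfolding L_rel_def by blast

lemma L_relE: assumes "z \<in> L_rel" obtains x y where "x \<in> carrier HC" "y \<in> carrier HC" "z = e \<odot> cc \<odot> x + zz \<odot> y"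
  using assms unfolding L_rel_def by blast

lemma comp_zero [simp]: "x \<in> carrier HC \<Longrightarrow> x \<odot> 0 = (0 :: ('f, 'c) hecke)"
  by (rule comp_right(4)) auto

lemma ecc_closed: "e \<odot> cc \<in> carrier HC" by simp

lemma L_rel_zero: "0 \<in> L_rel"
  by (rule L_relI[of 0 0]) (simp_all add: ecc_closed del: comp_apply)

lemma L_rel_zz: "y \<in> carrier HC \<Longrightarrow> zz \<odot> y \<in> L_rel"
  by (rule L_relI[of 0 y]) (simp_all add: ecc_closed del: comp_apply)

lemma L_rel_cc: "x \<in> carrier HC \<Longrightarrow> e \<odot> (cc \<odot> x) \<in> L_rel"
  by (rule L_relI[of x 0]) (simp_all add: comp_assoc del: comp_apply)

lemma L_rel_add: assumes "u \<in> L_rel" "v \<in> L_rel" shows "u + v \<in> L_rel"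
proof -
  obtain x y where xy: "x \<in> carrier HC" "y \<in> carrier HC" "u = e \<odot> cc \<odot> x + zz \<odot> y" using assms(1) by (rule L_relE)
  obtain x' y' where xy': "x' \<in> carrier HC" "y' \<in> carrier HC" "v = e \<odot> cc \<odot> x' + zz \<odot> y'" using assms(2) by (rule L_relE)
  have "u + v = e \<odot> cc \<odot> (x + x') + zz \<odot> (y + y')"
    unfolding xy(3) xy'(3) comp_right(1)[OF ecc_closed xy(1) xy'(1)] comp_right(1)[OF zz_closed xy(2) xy'(2)]
    by (simp only: ac_simps)
  then show ?thesis using xy xy' by (intro L_relI[of "x + x'" "y + y'"]) auto
qed

lemma L_rel_right: assumes "u \<in> L_rel" "t \<in> carrier HC" shows "u \<odot> t \<in> L_rel"
proof -
  obtain x y where xy: "x \<in> carrier HC" "y \<in> carrier HC" "u = e \<odot> cc \<odot> x + zz \<odot> y" using assms(1) by (rule L_relE)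
  show ?thesis using xy assms(2) by (intro L_relI[of "x \<odot> t" "y \<odot> t"]) (simp_all only: comp_left comp_assoc HR_mult_closed)
qed

lemma L_rel_sc: "u \<in> L_rel \<Longrightarrow> u \<in> carrier HC \<Longrightarrow> sc a \<odot> u \<in> L_rel"
  using L_rel_right[of u "sc a"] comp_sc[of u a] by simp

lemma L_rel_closed: "u \<in> L_rel \<Longrightarrow> u \<in> carrier HC"
  by (erule L_relE) simp

lemma L_rel_uminus: "u \<in> L_rel \<Longrightarrow> - u \<in> L_rel"
proof -
  assume u: "u \<in> L_rel"
  have "- u = sc (-1) \<odot> u" unfolding sc_apply[OF L_rel_closed[OF u]] by (simp add: fun_eq_iff)
  then show ?thesis using L_rel_sc[OF u L_rel_closed[OF u], of "-1"] by (simp only:)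
qed

lemma coords_L_rel: "u \<in> L_rel \<Longrightarrow> coords u = 0"
  by (erule L_relE) (simp add: coords_add coords_zz coords_cc coords_e comp_assoc del: comp_apply)

section \<open>Four elements span modulo the relations\<close>

definition gens_span :: "('f, 'c) hecke set" where
  "gens_span = {x \<in> carrier HC. \<exists>v. e \<odot> (x - gens v) \<in> L_rel}"

lemma gens_spanI: "x \<in> carrier HC \<Longrightarrow> e \<odot> (x - gens v) \<in> L_rel \<Longrightarrow> x \<in> gens_span"
  unfolding gens_span_def by blast

lemma gens_span_add: assumes "x \<in> gens_span" "y \<in> gens_span" shows "x + y \<in> gens_span"
proof -
  obtain v w where vw: "x \<in> carrier HC" "y \<in> carrier HC" "e \<odot> (x - gens v) \<in> L_rel" "e \<odot> (y - gens w) \<in> L_rel"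
    using assms by (auto simp: gens_span_def simp del: comp_apply)
  have "(x + y) - gens (v + w) = (x - gens v) + (y - gens w)" unfolding gens_add by simp
  then have "e \<odot> ((x + y) - gens (v + w)) = e \<odot> (x - gens v) + e \<odot> (y - gens w)"
    using vw comp_right(1)[OF eH_closed, of "x - gens v" "y - gens w"] by (simp only: HR_minus gens_closed)
  then show ?thesis using vw L_rel_add by (intro gens_spanI[of _ "v + w"]) (simp_all only: HR_add_closed)
qed

lemma gens_span_sc: assumes "x \<in> gens_span" shows "sc a \<odot> x \<in> gens_span"
proof -
  obtain v where v: "x \<in> carrier HC" "e \<odot> (x - gens v) \<in> L_rel"
    using assms by (auto simp: gens_span_def simp del: comp_apply)
  have "(sc a \<odot> x) - gens (scale4 a v) = sc a \<odot> (x - gens v)"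
    unfolding gens_scale4 using v by (simp only: comp_right(2) hecke_scalar_closed gens_closed)
  then have "e \<odot> ((sc a \<odot> x) - gens (scale4 a v)) = sc a \<odot> (e \<odot> (x - gens v))"
    by (simp only: comp_assoc[symmetric] comp_sc[OF eH_closed])
  then show ?thesis using v L_rel_sc[OF v(2)] by (intro gens_spanI[of _ "scale4 a v"]) (simp_all del: comp_apply)
qed

lemma gens_span_L_rel: assumes x: "x \<in> carrier HC" "e \<odot> x \<in> L_rel" shows "x \<in> gens_span"
proof (rule gens_spanI[of x 0])
  have "gens 0 = 0" using gens_add[of 0 0] by simp
  then show "e \<odot> (x - gens 0) \<in> L_rel" using x by (simp del: comp_apply)
qed (use x in simp)

lemma gens_span_gens: "gens v \<in> gens_span"
  using L_rel_zero by (intro gens_spanI[of _ v]) (simp_all del: comp_apply)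

lemma gens_span_basis: "sc 1 \<in> gens_span" "TPi \<in> gens_span" "Tn \<in> gens_span" "TPi \<odot> Tn \<in> gens_span"
proof -
  have "sc 0 = 0" by (simp add: fun_eq_iff hecke_scalar_def)
  then have "gens (1, 0, 0, 0) = sc 1" "gens (0, 1, 0, 0) = TPi" "gens (0, 0, 1, 0) = Tn" "gens (0, 0, 0, 1) = TPi \<odot> Tn"
    by (simp_all add: gens_def comp_left del: comp_apply)
  then show "sc 1 \<in> gens_span" "TPi \<in> gens_span" "Tn \<in> gens_span" "TPi \<odot> Tn \<in> gens_span" using gens_span_gens by metis+
qed

lemma gens_span_congr:
  assumes "x \<in> carrier HC" "y \<in> gens_span" "e \<odot> (x - y) \<in> L_rel" shows "x \<in> gens_span"
proof -
  have y: "y \<in> carrier HC" using assms(2) by (simp add: gens_span_def)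
  have "x - y \<in> gens_span" using assms y by (intro gens_span_L_rel) (simp_all del: comp_apply)
  then have "(x - y) + y \<in> gens_span" using assms(2) by (rule gens_span_add)
  then show ?thesis by simp
qed

text \<open>The relations are stable under right multiplication, so it suffices to multiply the four
  spanning elements by \<open>t\<close>.\<close>

lemma gens_span_right:
  assumes t: "t \<in> carrier HC" and b: "t \<in> gens_span" "TPi \<odot> t \<in> gens_span" "Tn \<odot> t \<in> gens_span" "TPi \<odot> (Tn \<odot> t) \<in> gens_span"
    and x: "x \<in> gens_span"
  shows "x \<odot> t \<in> gens_span"
proof -
  obtain v where v: "x \<in> carrier HC" "e \<odot> (x - gens v) \<in> L_rel"
    using x by (auto simp: gens_span_def simp del: comp_apply)
  obtain p q r s where pq: "v = (p, q, r, s)" by (cases v)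
  have g: "gens v \<odot> t \<in> gens_span" unfolding pq gens_comp[OF t] by (intro gens_span_add gens_span_sc b)
  have "e \<odot> ((x \<odot> t) - (gens v \<odot> t)) = (e \<odot> (x - gens v)) \<odot> t"
    by (simp only: comp_assoc comp_left)
  then have "e \<odot> ((x \<odot> t) - (gens v \<odot> t)) \<in> L_rel" using L_rel_right[OF v(2) t] by (simp only:)
  then show ?thesis using v t by (intro gens_span_congr[OF _ g]) auto
qed

lemma e_comp_cc: "x \<in> carrier HC \<Longrightarrow> e \<odot> ((Tn \<odot> (TPi \<odot> x)) - (TPi \<odot> (Tn \<odot> x))) \<in> L_rel"
proof -
  assume x: "x \<in> carrier HC"
  have "(Tn \<odot> (TPi \<odot> x)) - (TPi \<odot> (Tn \<odot> x)) = - (cc \<odot> x)" unfolding cc_comp by (rule minus_diff_eq[symmetric])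
  then have "e \<odot> ((Tn \<odot> (TPi \<odot> x)) - (TPi \<odot> (Tn \<odot> x))) = - (e \<odot> (cc \<odot> x))"
    using comp_right(3)[OF eH_closed, of "cc \<odot> x" "cc \<odot> x"] x by (simp only: HR_mult_closed cc_closed)
  then show ?thesis using L_rel_uminus[OF L_rel_cc[OF x]] by (simp only:)
qed

text \<open>Centrality brings \<open>zz\<close> from the middle of a word to its front, past
  \<open>x\<close> and \<open>e\<close>, where \<open>L_rel\<close> contains it.\<close>

lemma e_comp_zz: "x \<in> carrier HC \<Longrightarrow> y \<in> carrier HC \<Longrightarrow> e \<odot> ((x \<odot> (TPi \<odot> (TPi \<odot> y))) - (x \<odot> y)) \<in> L_rel"
proof -
  assume x: "x \<in> carrier HC" and y: "y \<in> carrier HC"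
  have "(x \<odot> (TPi \<odot> (TPi \<odot> y))) - (x \<odot> y) = x \<odot> (zz \<odot> y)"
    unfolding zz_comp[OF y] using x y by (simp only: comp_right(2) HR_mult_closed hecke_T_normalizes_closed normalizes_Pi)
  also have "\<dots> = zz \<odot> (x \<odot> y)" by (simp only: comp_assoc[symmetric] zz_central[OF x])
  finally have "e \<odot> ((x \<odot> (TPi \<odot> (TPi \<odot> y))) - (x \<odot> y)) = e \<odot> (zz \<odot> (x \<odot> y))" by (simp only:)
  also have "\<dots> = zz \<odot> (e \<odot> (x \<odot> y))" by (simp only: comp_assoc[symmetric] zz_central[OF eH_closed])
  finally show ?thesis using x y L_rel_zz[of "e \<odot> (x \<odot> y)"] by (simp only: HR_mult_closed eH_closed)
qed

lemma gens_span_TPi: "x \<in> gens_span \<Longrightarrow> x \<odot> TPi \<in> gens_span"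
proof (rule gens_span_right)
  have o: "sc 1 \<odot> y = y" "y \<odot> sc 1 = y" if "y \<in> carrier HC" for y using that by simp_all
  have c: "(TPi :: ('f,'c) hecke) \<in> carrier HC" "(Tn :: ('f,'c) hecke) \<in> carrier HC" by simp_all
  show "TPi \<in> gens_span" by (rule gens_span_basis)
  show "TPi \<odot> TPi \<in> gens_span"
    by (rule gens_span_congr[OF _ gens_span_basis(1)])
      (use e_comp_zz[of "sc 1" "sc 1"] c in \<open>simp_all add: o del: comp_apply\<close>)
  show "Tn \<odot> TPi \<in> gens_span"
    by (rule gens_span_congr[OF _ gens_span_basis(4)]) (use e_comp_cc[of "sc 1"] c in \<open>simp_all add: o del: comp_apply\<close>)
  \<comment> \<open>The word \<open>TPi Tn TPi\<close> is first commuted into this one, which is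
    congruent to \<open>Tn\<close>.\<close>
  have "Tn \<odot> (TPi \<odot> TPi) \<in> gens_span"
    by (rule gens_span_congr[OF _ gens_span_basis(3)])
      (use e_comp_zz[of Tn "sc 1"] c in \<open>simp_all add: o del: comp_apply\<close>)
  moreover have "e \<odot> ((TPi \<odot> (Tn \<odot> TPi)) - (Tn \<odot> (TPi \<odot> TPi))) \<in> L_rel"
  proof -
    have "(TPi \<odot> (Tn \<odot> TPi)) - (Tn \<odot> (TPi \<odot> TPi)) = cc \<odot> TPi" by (simp only: cc_comp)
    then show ?thesis using L_rel_cc[OF c(1)] by (simp only:)
  qed
  ultimately show "TPi \<odot> (Tn \<odot> TPi) \<in> gens_span" by (rule gens_span_congr[rotated]) simp
qed simp

text \<open>Modulo the relations \<open>T_\<Pi>\<close> is its own inverse.\<close>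

lemma gens_span_TPi': "x \<in> gens_span \<Longrightarrow> x \<odot> TPi' \<in> gens_span"
proof -
  assume xS: "x \<in> gens_span"
  have x: "x \<in> carrier HC" using xS by (simp add: gens_span_def)
  have c: "(TPi :: ('f,'c) hecke) \<in> carrier HC" "(TPi' :: ('f,'c) hecke) \<in> carrier HC" by simp_all
  have i: "TPi \<odot> TPi' = (sc 1 :: ('f, 'c) hecke)"
  proof (rule HR_eqI_hf)
    fix g :: "'f^2^2" assume "g \<in> carrier GL2"
    then show "hf (TPi \<odot> TPi') g = hf (sc 1) g"
      by (simp add: hf_T_normalizes hf_T_normalizes' hf_one matrix_mul_assoc)
  qed simp_all
  have "e \<odot> ((x \<odot> (TPi \<odot> (TPi \<odot> TPi'))) - (x \<odot> TPi')) \<in> L_rel" by (rule e_comp_zz[OF x c(2)])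
  then have "e \<odot> ((x \<odot> TPi) - (x \<odot> TPi')) \<in> L_rel" using c by (simp add: i del: comp_apply)
  then have "- (e \<odot> ((x \<odot> TPi) - (x \<odot> TPi'))) \<in> L_rel" by (rule L_rel_uminus)
  moreover have "- (e \<odot> ((x \<odot> TPi) - (x \<odot> TPi'))) = e \<odot> ((x \<odot> TPi') - (x \<odot> TPi))"
    using x c by (simp add: comp_right del: comp_apply)
  ultimately have "e \<odot> ((x \<odot> TPi') - (x \<odot> TPi)) \<in> L_rel" by (simp only:)
  then show ?thesis by (rule gens_span_congr[OF HR_mult_closed[OF x c(2)] gens_span_TPi[OF xS]])
qed

lemma e_T_dg:
  assumes "a \<in> \<O>" "d \<in> \<O>" "red a \<noteq> 0" "red d \<noteq> 0" "y \<in> carrier HC"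
  shows "e \<odot> (hecke_T L (dg a d) \<odot> y) = e \<odot> (sc (inverse (chi (mat2 (red a) 0 0 (red d)))) \<odot> y)"
  using eH_T_dg[OF chi assms(1-4)] comp_sc[OF eH_closed, of chi "inverse (chi (mat2 (red a) 0 0 (red d)))"]
  by (simp only: comp_assoc[symmetric])

text \<open>By the quadratic relation the idempotent turns the torus elements into a character sum,
  which is \<open>quad_const chi = 0\<close>. Crossing \<open>T_\<Pi>\<close> in the second product
  swaps them and merely reindexes the sum.\<close>

lemma e_Tn_Tn: "e \<odot> (Tn \<odot> Tn) = 0" "e \<odot> (TPi \<odot> (Tn \<odot> Tn)) = 0"
proof -
  let ?a = "\<lambda>t. - inverse (lf t)" and ?d = "\<lambda>t. - lf t"
  have u: "?a t \<in> \<O>" "red (?a t) = - inverse t" "?d t \<in> \<O>" "red (?d t) = - t" if "t \<noteq> 0" for t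
    using that unit_inverse[of "lf t"] red_inverse[of "lf t"] by auto
  have c: "hecke_T L (dg (?a t) (?d t)) \<odot> (Tn :: ('f, 'c) hecke) \<in> carrier HC"
    "(TPi :: ('f,'c) hecke) \<odot> (hecke_T L (dg (?a t) (?d t)) \<odot> Tn) \<in> carrier HC" if "t \<noteq> 0" for t
    using u[OF that] that by auto
  have z: "(\<lambda>f C. \<Sum>t\<in>UNIV - {0}. 1 * (sc (g t) \<odot> y) f C) = sc (\<Sum>t\<in>UNIV - {0}. g t) \<odot> y"
    if "y \<in> carrier HC" for g y
    unfolding sc_apply[OF that] by (simp add: sum_distrib_right)
  have z0: "sc 0 \<odot> y = 0" if "y \<in> carrier HC" for y
    unfolding sc_apply[OF that] by (simp add: fun_eq_iff)
  have "e \<odot> (Tn \<odot> Tn) = (\<lambda>f C. \<Sum>t\<in>UNIV - {0}. 1 * (e \<odot> (hecke_T L (dg (?a t) (?d t)) \<odot> Tn)) f C)"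
    unfolding Tn_Tn using c by (intro comp_lincomb) (auto simp del: comp_apply)
  also have "\<dots> = (\<lambda>f C. \<Sum>t\<in>UNIV - {0}. 1 * (sc (inverse (chi (mat2 (- inverse t) 0 0 (- t)))) \<odot> (e \<odot> Tn)) f C)"
  proof (intro ext sum.cong refl arg_cong[of _ _ "(*) 1"])
    fix f :: "('f^2^2) set \<Rightarrow> 'c" and C and t :: 'k assume "t \<in> UNIV - {0}"
    then have "e \<odot> (hecke_T L (dg (?a t) (?d t)) \<odot> Tn) = sc (inverse (chi (mat2 (- inverse t) 0 0 (- t)))) \<odot> (e \<odot> Tn)"
      using u[of t] e_T_dg[of "?a t" "?d t" Tn] comp_sc[OF eH_closed]
      by (simp add: comp_assoc[symmetric] del: comp_apply)
    then show "(e \<odot> (hecke_T L (dg (?a t) (?d t)) \<odot> Tn)) f C = (sc (inverse (chi (mat2 (- inverse t) 0 0 (- t)))) \<odot> (e \<odot> Tn)) f C"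
      by (simp only:)
  qed
  also have "\<dots> = sc (\<Sum>t\<in>UNIV - {0}. inverse (chi (mat2 (- inverse t) 0 0 (- t)))) \<odot> (e \<odot> Tn)"
    by (rule z) simp
  also have "(\<Sum>t\<in>UNIV - {0}. inverse (chi (mat2 (- inverse t) 0 0 (- t)))) = quad_const chi"
    unfolding quad_const_def
  proof (intro sum.cong refl)
    fix t :: 'k assume "t \<in> UNIV - {0}"
    then have t: "t \<noteq> 0" by simp
    have "chi (mat2 (- t) 0 0 (- inverse t)) * chi (mat2 (- inverse t) 0 0 (- t)) = 1"
      using is_char_HD(2)[OF chi, of "mat2 (- t) 0 0 (- inverse t)" "mat2 (- inverse t) 0 0 (- t)"] t
        char_H_one[OF chi] by (simp add: mat_1_eq_mat2)
    then show "inverse (chi (mat2 (- inverse t) 0 0 (- t))) = chi (mat2 (- t) 0 0 (- inverse t))"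
      by (metis inverse_unique mult.commute)
  qed
  finally have "e \<odot> (Tn \<odot> Tn) = sc (quad_const chi) \<odot> (e \<odot> Tn)" .
  moreover have "sc 0 \<odot> (e \<odot> Tn) = 0" by (rule z0) simp
  ultimately show "e \<odot> (Tn \<odot> Tn) = 0" unfolding quad by (rule trans)
  have TT: "TPi \<odot> (hecke_T L (dg (?a t) (?d t)) \<odot> Tn) = (hecke_T L (dg (?d t) (?a t)) \<odot> (TPi \<odot> Tn) :: ('f, 'c) hecke)"
    if "t \<noteq> 0" for t
    using TPi_T_dg[of "?a t" "?d t"] u[OF that] that by (simp add: comp_assoc[symmetric] del: comp_apply)
  have "e \<odot> (TPi \<odot> (Tn \<odot> Tn)) = e \<odot> (\<lambda>f C. \<Sum>t\<in>UNIV - {0}. 1 * (TPi \<odot> (hecke_T L (dg (?a t) (?d t)) \<odot> Tn)) f C)"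
    unfolding Tn_Tn using c by (intro arg_cong[of _ _ "(\<circ>) e"] comp_lincomb) (auto simp del: comp_apply)
  also have "\<dots> = (\<lambda>f C. \<Sum>t\<in>UNIV - {0}. 1 * (e \<odot> (TPi \<odot> (hecke_T L (dg (?a t) (?d t)) \<odot> Tn))) f C)"
    using c by (intro comp_lincomb) (auto simp del: comp_apply)
  also have "\<dots> = (\<lambda>f C. \<Sum>t\<in>UNIV - {0}. 1 * (sc (inverse (chi (mat2 (- t) 0 0 (- inverse t)))) \<odot> (e \<odot> (TPi \<odot> Tn))) f C)"
  proof (intro ext sum.cong refl arg_cong[of _ _ "(*) 1"])
    fix f :: "('f^2^2) set \<Rightarrow> 'c" and C and t :: 'k assume "t \<in> UNIV - {0}"
    then have "e \<odot> (TPi \<odot> (hecke_T L (dg (?a t) (?d t)) \<odot> Tn)) = sc (inverse (chi (mat2 (- t) 0 0 (- inverse t)))) \<odot> (e \<odot> (TPi \<odot> Tn))"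
      using u[of t] e_T_dg[of "?d t" "?a t" "TPi \<odot> Tn"] comp_sc[OF eH_closed]
      by (simp add: TT) (simp add: comp_assoc[symmetric] del: comp_apply)
    then show "(e \<odot> (TPi \<odot> (hecke_T L (dg (?a t) (?d t)) \<odot> Tn))) f C = (sc (inverse (chi (mat2 (- t) 0 0 (- inverse t)))) \<odot> (e \<odot> (TPi \<odot> Tn))) f C"
      by (simp only:)
  qed
  also have "\<dots> = sc (\<Sum>t\<in>UNIV - {0}. inverse (chi (mat2 (- t) 0 0 (- inverse t)))) \<odot> (e \<odot> (TPi \<odot> Tn))"
    by (rule z) simp
  also have "(\<Sum>t\<in>UNIV - {0}. inverse (chi (mat2 (- t) 0 0 (- inverse t)))) = quad_const chi"
    unfolding quad_const_def
  proof (rule sum.reindex_bij_witness[where i = inverse and j = inverse])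
    fix t :: 'k assume "t \<in> UNIV - {0}"
    then have t: "t \<noteq> 0" by simp
    have "chi (mat2 (- inverse t) 0 0 (- t)) * chi (mat2 (- t) 0 0 (- inverse t)) = 1"
      using is_char_HD(2)[OF chi, of "mat2 (- inverse t) 0 0 (- t)" "mat2 (- t) 0 0 (- inverse t)"] t
        char_H_one[OF chi] by (simp add: mat_1_eq_mat2)
    then show "chi (mat2 (- inverse t) 0 0 (- inverse (inverse t))) = inverse (chi (mat2 (- t) 0 0 (- inverse t)))"
      by (metis inverse_unique mult.commute inverse_inverse_eq)
  qed auto
  finally have "e \<odot> (TPi \<odot> (Tn \<odot> Tn)) = sc (quad_const chi) \<odot> (e \<odot> (TPi \<odot> Tn))" .
  moreover have "sc 0 \<odot> (e \<odot> (TPi \<odot> Tn)) = 0" by (rule z0) simp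
  ultimately show "e \<odot> (TPi \<odot> (Tn \<odot> Tn)) = 0" unfolding quad by (rule trans)
qed

lemma gens_span_Tn: "x \<in> gens_span \<Longrightarrow> x \<odot> Tn \<in> gens_span"
proof (rule gens_span_right)
  show "Tn \<in> gens_span" "TPi \<odot> Tn \<in> gens_span" by (rule gens_span_basis)+
  show "Tn \<odot> Tn \<in> gens_span" "TPi \<odot> (Tn \<odot> Tn) \<in> gens_span"
    by (rule gens_span_L_rel, simp, unfold e_Tn_Tn, rule L_rel_zero)+
qed simp

lemma gens_span_dg:
  assumes ad: "a \<in> \<O>" "d \<in> \<O>" "red a \<noteq> 0" "red d \<noteq> 0" and x: "x \<in> gens_span"
  shows "x \<odot> hecke_T L (dg a d) \<in> gens_span"
proof (rule gens_span_right[OF _ _ _ _ _ x])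
  have N: "hecke_T L (dg a d) \<in> carrier HC" "hecke_T L (dg d a) \<in> carrier HC" using ad by auto
  show "hecke_T L (dg a d) \<in> carrier HC" by (rule N)
  have key: "z \<in> gens_span" if "z \<in> carrier HC" "y \<in> gens_span" "e \<odot> z = e \<odot> (sc b \<odot> y)" for z y b
  proof (rule gens_span_congr[OF that(1) gens_span_sc[OF that(2), of b]])
    have "y \<in> carrier HC" using that(2) by (simp add: gens_span_def)
    then have "e \<odot> (z - (sc b \<odot> y)) = 0" using that by (simp add: comp_right del: comp_apply)
    then show "e \<odot> (z - (sc b \<odot> y)) \<in> L_rel" using L_rel_zero by simp
  qed
  have c: "(TPi :: ('f,'c) hecke) \<in> carrier HC" "(Tn :: ('f,'c) hecke) \<in> carrier HC" by simp_all
  show "hecke_T L (dg a d) \<in> gens_span"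
    by (rule key[OF _ gens_span_basis(1), of _ "inverse (chi (mat2 (red a) 0 0 (red d)))"])
      (use e_T_dg[OF ad, of "sc 1"] N in \<open>simp_all del: comp_apply\<close>)
  have "TPi \<odot> hecke_T L (dg a d) = hecke_T L (dg d a) \<odot> (TPi :: ('f,'c) hecke)" by (rule TPi_T_dg[OF ad])
  then show "TPi \<odot> hecke_T L (dg a d) \<in> gens_span"
    by (intro key[OF _ gens_span_basis(2), of _ "inverse (chi (mat2 (red d) 0 0 (red a)))"])
      (use e_T_dg[of d a TPi] ad N c in \<open>simp_all del: comp_apply\<close>)
  have 1: "Tn \<odot> hecke_T L (dg a d) = hecke_T L (dg d a) \<odot> (Tn :: ('f,'c) hecke)" by (rule Tn_T_dg[OF ad])
  then show "Tn \<odot> hecke_T L (dg a d) \<in> gens_span"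
    by (intro key[OF _ gens_span_basis(3), of _ "inverse (chi (mat2 (red d) 0 0 (red a)))"])
      (use e_T_dg[of d a Tn] ad N c in \<open>simp_all del: comp_apply\<close>)
  have "TPi \<odot> (Tn \<odot> hecke_T L (dg a d)) = hecke_T L (dg a d) \<odot> (TPi \<odot> (Tn :: ('f,'c) hecke))"
    unfolding 1 comp_assoc[symmetric] TPi_T_dg[OF ad(2,1,4,3)] ..
  then show "TPi \<odot> (Tn \<odot> hecke_T L (dg a d)) \<in> gens_span"
    by (intro key[OF _ gens_span_basis(4), of _ "inverse (chi (mat2 (red a) 0 0 (red d)))"])
      (use e_T_dg[OF ad, of "TPi \<odot> Tn"] N c in \<open>simp_all del: comp_apply\<close>)
qed

text \<open>Generation is formulated for left multiplication, whereas \<open>gens_span\<close> is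
  stable on the right. The set of all \<open>z\<close> whose right multiplication preserves
  \<open>gens_span\<close> converts one into the other.\<close>

lemma gens_span_eq: "gens_span = carrier HC"
proof -
  let ?S = "{z \<in> carrier HC. \<forall>s\<in>gens_span. s \<odot> z \<in> gens_span}"
  have Sc: "s \<in> gens_span \<Longrightarrow> s \<in> carrier HC" for s by (simp add: gens_span_def)
  have cl: "t \<odot> z \<in> ?S" if "t \<in> carrier HC" "\<And>s. s \<in> gens_span \<Longrightarrow> s \<odot> t \<in> gens_span" "z \<in> ?S" for t z
    using that by (auto simp: comp_assoc[symmetric] simp del: comp_apply)
  have "?S = carrier HC"
  proof (rule hecke_generated)
    show "?S \<subseteq> carrier HC" by blast
    show "hecke_scalar L 1 \<in> ?S" using Sc by (auto simp del: comp_apply)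
    show "x + y \<in> ?S" if "x \<in> ?S" "y \<in> ?S" for x y
    proof -
      have "s \<odot> (x + y) \<in> gens_span" if s: "s \<in> gens_span" for s
        using \<open>x \<in> ?S\<close> \<open>y \<in> ?S\<close> s gens_span_add Sc[OF s] by (auto simp: comp_right simp del: comp_apply)
      then show ?thesis using that by simp
    qed
    show "sc a \<odot> x \<in> ?S" if "x \<in> ?S" for a x
      by (rule cl[OF _ _ that]) (use gens_span_sc Sc in \<open>auto simp: comp_sc simp del: comp_apply\<close>)
    show "TPi \<odot> x \<in> ?S" if "x \<in> ?S" for x by (rule cl[OF _ gens_span_TPi that]) auto
    show "TPi' \<odot> x \<in> ?S" if "x \<in> ?S" for x by (rule cl[OF _ gens_span_TPi' that]) auto
    show "Tn \<odot> x \<in> ?S" if "x \<in> ?S" for x by (rule cl[OF _ gens_span_Tn that]) auto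
    show "hecke_T L (dg a d) \<odot> x \<in> ?S"
      if "a \<in> \<O>" "d \<in> \<O>" "red a \<noteq> 0" "red d \<noteq> 0" "x \<in> ?S" for a d x
      by (rule cl[OF _ gens_span_dg[OF that(1-4)] that(5)]) (use that in auto)
  qed
  then have "z \<in> gens_span" if "z \<in> carrier HC" for z
    using that gens_span_basis(1) HR_comp_one(2)[OF that] by force
  then show ?thesis using Sc by blast
qed

text \<open>The two bounds meet here: spanning replaces \<open>x\<close> by some
  \<open>gens v\<close>, and the coordinates, which vanish on the relations, return
  \<open>v\<close>.\<close>

theorem L_rel_iff: "x \<in> carrier HC \<Longrightarrow> e \<odot> x \<in> L_rel \<longleftrightarrow> coords x = 0"
proof
  assume x: "x \<in> carrier HC"
  show "e \<odot> x \<in> L_rel \<Longrightarrow> coords x = 0" using coords_L_rel[of "e \<odot> x"] coords_e[OF x] by simp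
  assume l: "coords x = 0"
  obtain v where v: "e \<odot> (x - gens v) \<in> L_rel" using x gens_span_eq unfolding gens_span_def by blast
  have "coords (x - gens v) = 0" using coords_L_rel[OF v] coords_e[of "x - gens v"] x by simp
  then have "v = 0" using l coords_diff[OF x, of "gens v"] by simp
  moreover have "gens 0 = 0" using gens_add[of 0 0] by simp
  ultimately show "e \<odot> x \<in> L_rel" using v by (simp del: comp_apply)
qed

section \<open>The module \<open>L_\<gamma>\<close> in coordinates\<close>

abbreviation Lg :: "('f, 'c) hecke set set ring" where "Lg \<equiv> L_gamma val red varpi chi"
abbreviation Lact where "Lact \<equiv> L_gamma_act val red varpi chi"
abbreviation Lden :: "('f, 'c) hecke set set" where "Lden \<equiv> L_denom val red varpi chi"

text \<open>Every element of \<open>L_\<gamma>\<close> is the class of some \<open>e x\<close>, so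
  the module is treated as a quotient of \<open>\<H>\<close> itself.\<close>

definition cl :: "('f, 'c) hecke \<Rightarrow> ('f, 'c) hecke set set" where
  "cl x = Lden +>\<^bsub>R1\<^esub> pj (e \<odot> x)"

lemma L_denom_eq: "Lden = {pj (e \<odot> cc \<odot> z) | z. z \<in> carrier HC}"
proof -
  have "Lden = {pj (e \<odot> cc) \<otimes>\<^bsub>R1\<^esub> X | X. X \<in> carrier R1}"
    unfolding L_denom_def Let_def by (simp add: HR_a_minus cc_def)
  also have "\<dots> = {pj (e \<odot> cc \<odot> z) | z. z \<in> carrier HC}"
    unfolding R1_carrier using pj_hom(2)[OF ecc_closed] by (auto simp del: comp_apply)
  finally show ?thesis .
qed

lemma cl_eq: "x \<in> carrier HC \<Longrightarrow> cl x = {pj (e \<odot> cc \<odot> z + e \<odot> x) | z. z \<in> carrier HC}"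
proof -
  assume x: "x \<in> carrier HC"
  have "cl x = {pj (e \<odot> cc \<odot> z) \<oplus>\<^bsub>R1\<^esub> pj (e \<odot> x) | z. z \<in> carrier HC}"
    unfolding cl_def a_r_coset_def' L_denom_eq by blast
  also have "\<dots> = {pj (e \<odot> cc \<odot> z + e \<odot> x) | z. z \<in> carrier HC}"
    using pj_hom(1) x by (metis (no_types, lifting) HR_mult_closed ecc_closed eH_closed)
  finally show ?thesis .
qed

lemma cl_eq_iff:
  assumes x: "x \<in> carrier HC" and y: "y \<in> carrier HC"
  shows "cl x = cl y \<longleftrightarrow> coords x = coords y"
proof -
  have "cl x = cl y \<longleftrightarrow> e \<odot> (x - y) \<in> L_rel"
  proof
    assume eq: "cl x = cl y"
    have "e \<odot> cc \<odot> 0 + e \<odot> x = e \<odot> x" using comp_zero[OF ecc_closed] by (simp only: add_0_left)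
    then have "pj (e \<odot> x) \<in> cl x" unfolding cl_eq[OF x] using HR_zero_closed by (metis (mono_tags, lifting) mem_Collect_eq)
    then obtain z where z: "z \<in> carrier HC" "pj (e \<odot> x) = pj (e \<odot> cc \<odot> z + e \<odot> y)"
      unfolding eq cl_eq[OF y] by blast
    then obtain w where w: "w \<in> carrier HC" "e \<odot> x - (e \<odot> cc \<odot> z + e \<odot> y) = zz \<odot> w"
      using pj_eq_iff[of "e \<odot> x" "e \<odot> cc \<odot> z + e \<odot> y"] x y by (auto simp del: comp_apply)
    have "e \<odot> (x - y) = e \<odot> x - e \<odot> y" using x y by (rule comp_right(2)[OF eH_closed])
    also have "\<dots> = e \<odot> cc \<odot> z + zz \<odot> w" unfolding w(2)[symmetric] by (simp only: algebra_simps)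
    finally show "e \<odot> (x - y) \<in> L_rel" using z w by (intro L_relI)
  next
    \<comment> \<open>One inclusion is enough, because \<open>L_rel\<close> is closed under negation
      and the roles can be exchanged.\<close>
    have sub: "cl x \<subseteq> cl y" if x: "x \<in> carrier HC" and y: "y \<in> carrier HC" and k: "e \<odot> (x - y) \<in> L_rel" for x y
    proof
      fix X assume "X \<in> cl x"
      then obtain z where z: "z \<in> carrier HC" "X = pj (e \<odot> cc \<odot> z + e \<odot> x)" unfolding cl_eq[OF x] by blast
      obtain u w where uw: "u \<in> carrier HC" "w \<in> carrier HC" "e \<odot> (x - y) = e \<odot> cc \<odot> u + zz \<odot> w"
        using k by (rule L_relE)
      have d: "e \<odot> x - e \<odot> y = e \<odot> cc \<odot> u + zz \<odot> w" using uw(3) x y comp_right(2)[OF eH_closed] by metis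
      have "(e \<odot> cc \<odot> z + e \<odot> x) - (e \<odot> cc \<odot> (z + u) + e \<odot> y) = (e \<odot> x - e \<odot> y) - e \<odot> cc \<odot> u"
        unfolding comp_right(1)[OF ecc_closed z(1) uw(1)] by (simp only: algebra_simps)
      also have "\<dots> = zz \<odot> w" unfolding d by (simp only: algebra_simps)
      finally have "pj (e \<odot> cc \<odot> z + e \<odot> x) = pj (e \<odot> cc \<odot> (z + u) + e \<odot> y)"
        using pj_eq_iff[of "e \<odot> cc \<odot> z + e \<odot> x" "e \<odot> cc \<odot> (z + u) + e \<odot> y"] x y z uw
        by (metis HR_add_closed HR_mult_closed ecc_closed eH_closed)
      then show "X \<in> cl y" unfolding cl_eq[OF y] using z uw HR_add_closed by blast
    qed
    assume k: "e \<odot> (x - y) \<in> L_rel"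
    have "e \<odot> (y - x) = - (e \<odot> (x - y))"
      using x y by (simp add: comp_right del: comp_apply)
    then have "e \<odot> (y - x) \<in> L_rel" using L_rel_uminus[OF k] by (simp only:)
    then show "cl x = cl y" using sub[OF x y k] sub[OF y x] by blast
  qed
  also have "\<dots> \<longleftrightarrow> coords x = coords y" using L_rel_iff[of "x - y"] coords_diff[OF x y] x y by simp
  finally show ?thesis .
qed

lemma L_gamma_carrier: "carrier Lg = cl ` carrier HC"
proof -
  have "L_numer val red varpi chi = (\<lambda>x. pj (e \<odot> x)) ` carrier HC"
    unfolding L_numer_def R1_carrier using pj_hom(2)[OF eH_closed] by (auto simp del: comp_apply)
  then show ?thesis unfolding L_gamma_def cl_def by (auto simp del: comp_apply)
qed

lemma L_gamma_add:
  assumes x: "x \<in> carrier HC" and y: "y \<in> carrier HC"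
  shows "cl x \<oplus>\<^bsub>Lg\<^esub> cl y = cl (x + y)"
proof -
  have *: "pj (e \<odot> cc \<odot> z + e \<odot> x) \<oplus>\<^bsub>R1\<^esub> pj (e \<odot> cc \<odot> z' + e \<odot> y) = pj (e \<odot> cc \<odot> (z + z') + e \<odot> (x + y))"
    if "z \<in> carrier HC" "z' \<in> carrier HC" for z z'
  proof -
    have "e \<odot> cc \<odot> (z + z') + e \<odot> (x + y) = (e \<odot> cc \<odot> z + e \<odot> x) + (e \<odot> cc \<odot> z' + e \<odot> y)"
      unfolding comp_right(1)[OF ecc_closed that] comp_right(1)[OF eH_closed x y] by (simp only: ac_simps)
    then show ?thesis using pj_hom(1)[of "e \<odot> cc \<odot> z + e \<odot> x" "e \<odot> cc \<odot> z' + e \<odot> y"] that x y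
      by (simp only: HR_add_closed HR_mult_closed ecc_closed eH_closed)
  qed
  have "cl x \<oplus>\<^bsub>Lg\<^esub> cl y = (\<Union>X\<in>cl x. \<Union>Y\<in>cl y. {X \<oplus>\<^bsub>R1\<^esub> Y})"
    by (simp add: L_gamma_def set_add_def')
  also have "\<dots> = cl (x + y)"
  proof (intro equalityI subsetI)
    fix X assume "X \<in> (\<Union>X\<in>cl x. \<Union>Y\<in>cl y. {X \<oplus>\<^bsub>R1\<^esub> Y})"
    then obtain z z' where "z \<in> carrier HC" "z' \<in> carrier HC"
      "X = pj (e \<odot> cc \<odot> z + e \<odot> x) \<oplus>\<^bsub>R1\<^esub> pj (e \<odot> cc \<odot> z' + e \<odot> y)"
      unfolding cl_eq[OF x] cl_eq[OF y] by blast
    then show "X \<in> cl (x + y)" using * HR_add_closed unfolding cl_eq[OF HR_add_closed[OF x y]] by blast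
  next
    fix X assume "X \<in> cl (x + y)"
    then obtain z where z: "z \<in> carrier HC" "X = pj (e \<odot> cc \<odot> z + e \<odot> (x + y))"
      unfolding cl_eq[OF HR_add_closed[OF x y]] by blast
    have "X = pj (e \<odot> cc \<odot> z + e \<odot> x) \<oplus>\<^bsub>R1\<^esub> pj (e \<odot> cc \<odot> 0 + e \<odot> y)"
      using *[OF z(1) HR_zero_closed] z(2) by (simp only: add_0_right)
    then show "X \<in> (\<Union>X\<in>cl x. \<Union>Y\<in>cl y. {X \<oplus>\<^bsub>R1\<^esub> Y})"
      unfolding cl_eq[OF x] cl_eq[OF y] using z(1) HR_zero_closed by blast
  qed
  finally show ?thesis .
qed

lemma L_gamma_zero: "\<zero>\<^bsub>Lg\<^esub> = cl 0"
  unfolding cl_eq[OF HR_zero_closed] comp_zero[OF eH_closed]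
  by (simp add: L_gamma_def L_denom_eq)

lemma L_gamma_act_cl:
  assumes x: "x \<in> carrier HC" and t: "t \<in> carrier HC"
  shows "Lact (cl x) t = cl (x \<odot> t)"
proof -
  have *: "pj (e \<odot> cc \<odot> z') \<oplus>\<^bsub>R1\<^esub> (pj (e \<odot> cc \<odot> z + e \<odot> x) \<otimes>\<^bsub>R1\<^esub> pj t) = pj (e \<odot> cc \<odot> (z' + (z \<odot> t)) + e \<odot> (x \<odot> t))"
    if "z \<in> carrier HC" "z' \<in> carrier HC" for z z'
  proof -
    have "pj (e \<odot> cc \<odot> z + e \<odot> x) \<otimes>\<^bsub>R1\<^esub> pj t = pj ((e \<odot> cc \<odot> z + e \<odot> x) \<odot> t)"
      using that x t by (intro pj_hom(2)) (simp_all only: HR_add_closed HR_mult_closed ecc_closed eH_closed)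
    also have "(e \<odot> cc \<odot> z + e \<odot> x) \<odot> t = e \<odot> cc \<odot> (z \<odot> t) + e \<odot> (x \<odot> t)"
      by (simp only: comp_left comp_assoc)
    finally have "pj (e \<odot> cc \<odot> z') \<oplus>\<^bsub>R1\<^esub> (pj (e \<odot> cc \<odot> z + e \<odot> x) \<otimes>\<^bsub>R1\<^esub> pj t) =
        pj (e \<odot> cc \<odot> z' + (e \<odot> cc \<odot> (z \<odot> t) + e \<odot> (x \<odot> t)))"
      using pj_hom(1)[of "e \<odot> cc \<odot> z'" "e \<odot> cc \<odot> (z \<odot> t) + e \<odot> (x \<odot> t)"] that x t
      by (simp only: HR_add_closed HR_mult_closed ecc_closed eH_closed)
    then show ?thesis
      unfolding comp_right(1)[OF ecc_closed that(2) HR_mult_closed[OF that(1) t]] by (simp only: add.assoc)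
  qed
  have "Lact (cl x) t = (\<Union>X\<in>Lden. \<Union>Y\<in>cl x. {X \<oplus>\<^bsub>R1\<^esub> (Y \<otimes>\<^bsub>R1\<^esub> pj t)})"
    unfolding L_gamma_act_def set_add_def' by blast
  also have "\<dots> = cl (x \<odot> t)"
  proof (intro equalityI subsetI)
    fix X assume "X \<in> (\<Union>X\<in>Lden. \<Union>Y\<in>cl x. {X \<oplus>\<^bsub>R1\<^esub> (Y \<otimes>\<^bsub>R1\<^esub> pj t)})"
    then obtain z z' where z: "z \<in> carrier HC" "z' \<in> carrier HC"
      "X = pj (e \<odot> cc \<odot> z') \<oplus>\<^bsub>R1\<^esub> (pj (e \<odot> cc \<odot> z + e \<odot> x) \<otimes>\<^bsub>R1\<^esub> pj t)"
      unfolding cl_eq[OF x] L_denom_eq by blast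
    then have "X = pj (e \<odot> cc \<odot> (z' + (z \<odot> t)) + e \<odot> (x \<odot> t))" using * by metis
    moreover have "z' + (z \<odot> t) \<in> carrier HC" using z t HR_add_closed HR_mult_closed by blast
    ultimately show "X \<in> cl (x \<odot> t)" unfolding cl_eq[OF HR_mult_closed[OF x t]] by blast
  next
    fix X assume "X \<in> cl (x \<odot> t)"
    then obtain z where z: "z \<in> carrier HC" "X = pj (e \<odot> cc \<odot> z + e \<odot> (x \<odot> t))"
      unfolding cl_eq[OF HR_mult_closed[OF x t]] by blast
    have "X = pj (e \<odot> cc \<odot> z) \<oplus>\<^bsub>R1\<^esub> (pj (e \<odot> cc \<odot> 0 + e \<odot> x) \<otimes>\<^bsub>R1\<^esub> pj t)"
      using *[OF HR_zero_closed z(1)] z(2) by (simp only: comp_left add_0_right)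
    then show "X \<in> (\<Union>X\<in>Lden. \<Union>Y\<in>cl x. {X \<oplus>\<^bsub>R1\<^esub> (Y \<otimes>\<^bsub>R1\<^esub> pj t)})"
      unfolding cl_eq[OF x] L_denom_eq using z(1) HR_zero_closed by blast
  qed
  finally show ?thesis .
qed

lemma right_module_L_gamma: "right_module HC Lg Lact"
proof (intro right_module.intro right_module_axioms.intro)
  show "ring HC" by (rule ring_HR)
  show "abelian_group Lg"
  proof (rule abelian_groupI)
    fix X assume "X \<in> carrier Lg"
    then obtain x where x: "x \<in> carrier HC" "X = cl x" by (auto simp: L_gamma_carrier)
    show "\<zero>\<^bsub>Lg\<^esub> \<oplus>\<^bsub>Lg\<^esub> X = X" using x by (simp add: L_gamma_zero L_gamma_add)
    show "\<exists>Y\<in>carrier Lg. Y \<oplus>\<^bsub>Lg\<^esub> X = \<zero>\<^bsub>Lg\<^esub>"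
      using x by (intro bexI[of _ "cl (- x)"]) (simp_all add: L_gamma_zero L_gamma_add L_gamma_carrier)
  qed (auto simp: L_gamma_carrier L_gamma_add L_gamma_zero ac_simps)
qed (auto simp: L_gamma_carrier L_gamma_add L_gamma_act_cl comp_left comp_right comp_assoc simp del: comp_apply)

lemma cl_gens_bij: "bij_betw (\<lambda>v. cl (gens v)) UNIV (carrier Lg)"
proof (rule bij_betwI[where g = "\<lambda>X. coords (SOME x. x \<in> carrier HC \<and> X = cl x)"])
  have s: "(SOME x. x \<in> carrier HC \<and> X = cl x) \<in> carrier HC \<and> X = cl (SOME x. x \<in> carrier HC \<and> X = cl x)"
    if "X \<in> carrier Lg" for X
  proof -
    have ex: "\<exists>x. x \<in> carrier HC \<and> X = cl x" using that by (auto simp: L_gamma_carrier)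
    show ?thesis by (rule someI_ex[OF ex])
  qed
  show "(\<lambda>v. cl (gens v)) \<in> UNIV \<rightarrow> carrier Lg" by (simp add: L_gamma_carrier)
  show "coords (SOME x. x \<in> carrier HC \<and> cl (gens v) = cl x) = v" for v
    using s[of "cl (gens v)"] cl_eq_iff[OF gens_closed, of "SOME x. x \<in> carrier HC \<and> cl (gens v) = cl x" v]
    by (simp add: L_gamma_carrier)
  show "cl (gens (coords (SOME x. x \<in> carrier HC \<and> X = cl x))) = X" if "X \<in> carrier Lg" for X
  proof -
    let ?y = "SOME x. x \<in> carrier HC \<and> X = cl x"
    have y: "?y \<in> carrier HC" "X = cl ?y" using s[OF that] by blast+
    have "cl (gens (coords ?y)) = cl ?y" using cl_eq_iff[OF gens_closed y(1)] coords_gens by blast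
    then show ?thesis using y(2) by (rule trans[OF _ sym])
  qed
qed simp

lemma cl_gens_add: "cl (gens (v + w)) = cl (gens v) \<oplus>\<^bsub>Lg\<^esub> cl (gens w)"
  by (simp add: L_gamma_add gens_add)

lemma cl_gens_act:
  assumes "supp_K x"
  shows "Lact (cl (gens (p, q, r, s))) x = cl (gens
    (p * AA chi one1 one1 x, q * AA chi' one1 one1 x,
     p * NN chi' one1 one1 x + r * AA chi' one1 one1 x, q * NN chi one1 one1 x + s * AA chi one1 one1 x))"
proof -
  have x: "x \<in> carrier HC" using assms by (simp add: supp_K_def)
  show ?thesis
    unfolding L_gamma_act_cl[OF gens_closed x] using x
    by (subst cl_eq_iff) (simp_all add: coords_gens_supp_K[OF assms] del: comp_apply)
qed

end

end

section \<open>Representations of \<open>GL\<^sub>2(\<bold>F\<^sub>p)\<close> in characteristic \<open>p\<close>\<close>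

abbreviation uk :: "'k::field \<Rightarrow> 'k^2^2" where "uk t \<equiv> mat2 1 t 0 1"
abbreviation nik :: "'k::field^2^2" where "nik \<equiv> mat2 0 1 (-1) 0"

lemma unip2_eq: "unip2 = range uk"
proof (intro equalityI subsetI)
  fix A :: "'a^2^2" assume "A \<in> unip2"
  then show "A \<in> range uk" by (cases A) (auto simp: unip2_def)
qed (auto simp: unip2_def GL2_mat2_iff)

lemma GL2_decomp:
  fixes g :: "'k::field^2^2"
  assumes "g \<in> carrier GL2"
  shows "(\<exists>x h. h \<in> diag2 \<and> g = uk x ** h) \<or> (\<exists>x y h. h \<in> diag2 \<and> g = uk x ** nik ** h ** uk y)"
proof (cases g)
  fix a b c d assume g: "g = mat2 a b c d"
  have D: "a * d - b * c \<noteq> 0" using assms g by (simp add: GL2_mat2_iff)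
  show ?thesis
  proof (cases "c = 0")
    case True
    then have "mat2 a 0 0 d \<in> diag2" "g = uk (b / d) ** mat2 a 0 0 d" using D g by auto
    then show ?thesis by blast
  next
    case False
    have "mat2 (- c) 0 0 (b - a * d / c) \<in> diag2" using D False by (auto simp: field_simps)
    moreover have "g = uk (a / c) ** nik ** mat2 (- c) 0 0 (b - a * d / c) ** uk (d / c)"
      using False g by (simp add: field_simps)
    ultimately show ?thesis by blast
  qed
qed

text \<open>The right action of \<open>T_n\<close> on invariants: \<open>nik\<close> is the inverse
  of \<open>n_s\<close>, and the \<open>uk t\<close> run through \<open>U\<close>, the image of
  \<open>I_1 / K_1\<close>.\<close>

definition TT :: "('c::field, 'k::{field,finite}^2^2, 'v::ab_group_add) rep \<Rightarrow> 'v \<Rightarrow> 'v" where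
  "TT V v = (\<Sum>t\<in>UNIV. act V (uk t ** nik) v)"

definition eig :: "('c::field, 'k::{field,finite}^2^2, 'v::ab_group_add) rep \<Rightarrow> ('k^2^2 \<Rightarrow> 'c) \<Rightarrow> 'v \<Rightarrow> bool" where
  "eig V psi v \<longleftrightarrow> v \<in> invariants unip2 V \<and> (\<forall>h\<in>diag2. act V h v = scl V (psi h) v)"

locale gamma_rep =
  fixes V :: "('c::field, 'k::{field,finite}^2^2, 'v::ab_group_add) rep"
  assumes rep: "is_rep GL2 V"
    and card_k: "CARD('k) = CHAR('k)" and char_c: "CHAR('c) = CHAR('k)"
begin

sublocale V: vector_space "scl V"
  using rep by (simp add: is_rep_on_def)

abbreviation Uinv :: "'v set" where "Uinv \<equiv> invariants unip2 V"

lemma act_add: "g \<in> carrier GL2 \<Longrightarrow> act V g (v + w) = act V g v + act V g w"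
  and act_scale: "g \<in> carrier GL2 \<Longrightarrow> act V g (scl V a v) = scl V a (act V g v)"
  and act_one [simp]: "act V (mat 1) v = v"
  and act_mult: "g \<in> carrier GL2 \<Longrightarrow> h \<in> carrier GL2 \<Longrightarrow> act V g (act V h v) = act V (g ** h) v"
  using rep by (simp_all add: is_rep_on_def)

lemma act_zero [simp]: "g \<in> carrier GL2 \<Longrightarrow> act V g 0 = 0"
  using act_add[of g 0 0] by simp

lemma act_sum: "g \<in> carrier GL2 \<Longrightarrow> act V g (sum f S) = (\<Sum>i\<in>S. act V g (f i))"
  by (induction S rule: infinite_finite_induct) (auto simp: act_add)

lemma uk_GL2 [simp]: "uk t \<in> carrier GL2" and nik_GL2 [simp]: "nik \<in> carrier GL2"
  for t :: 'k
  by (simp_all add: GL2_mat2_iff)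

lemma Uinv_iff: "v \<in> Uinv \<longleftrightarrow> (\<forall>t. act V (uk t) v = v)"
  by (auto simp: invariants_def unip2_eq)

lemma Uinv_add: "v \<in> Uinv \<Longrightarrow> w \<in> Uinv \<Longrightarrow> v + w \<in> Uinv"
  and Uinv_scale: "v \<in> Uinv \<Longrightarrow> scl V a v \<in> Uinv"
  by (simp_all add: Uinv_iff act_add act_scale)

lemma eigD: "eig V psi v \<Longrightarrow> v \<in> Uinv" "eig V psi v \<Longrightarrow> h \<in> diag2 \<Longrightarrow> act V h v = scl V (psi h) v"
  by (auto simp: eig_def)

lemma q_zero: "of_nat CARD('k) = (0::'c)"
  unfolding card_k char_c[symmetric] by simp

lemma prime_char: "prime CHAR('k)"
  by (rule prime_CHAR_semidom) (use card_k[symmetric] in simp)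

lemma TT_add: "TT V (v + w) = TT V v + TT V w"
  by (simp add: TT_def act_add sum.distrib del: mat2_mult)

lemma TT_scale: "TT V (scl V a v) = scl V a (TT V v)"
  by (simp add: TT_def act_scale V.scale_sum_right del: mat2_mult)

lemma TT_Uinv: "TT V v \<in> Uinv"
  unfolding Uinv_iff
proof
  fix s :: 'k
  have "act V (uk s) (TT V v) = (\<Sum>t\<in>UNIV. act V (uk s ** (uk t ** nik)) v)"
    unfolding TT_def by (simp add: act_sum act_mult del: mat2_mult)
  also have "\<dots> = (\<Sum>t\<in>UNIV. act V (uk t ** nik) v)"
    by (rule sum.reindex_bij_witness[where i = "\<lambda>t. t - s" and j = "\<lambda>t. t + s"]) (auto simp: algebra_simps)
  finally show "act V (uk s) (TT V v) = TT V v" by (simp add: TT_def)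
qed

lemma TT_diag:
  assumes h: "h \<in> diag2" shows "TT V (act V h v) = act V (swap h) (TT V v)"
proof -
  obtain a d where ad: "h = mat2 a 0 0 d" "a \<noteq> 0" "d \<noteq> 0" using h by (auto simp: mem_diag2)
  have g: "h \<in> carrier GL2" "swap h \<in> carrier GL2"
    using diag2_GL2[OF h] diag2_GL2[OF swap_diag2(1)[OF h]] by auto
  have "act V (swap h) (TT V v) = (\<Sum>t\<in>UNIV. act V (swap h ** (uk t ** nik)) v)"
    unfolding TT_def using g by (simp add: act_sum act_mult del: mat2_mult)
  also have "\<dots> = (\<Sum>t\<in>UNIV. act V ((uk t ** nik) ** h) v)"
    by (rule sum.reindex_bij_witness[where i = "\<lambda>t. t * a / d" and j = "\<lambda>t. t * d / a"])
      (use ad in \<open>auto simp: field_simps\<close>)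
  also have "\<dots> = TT V (act V h v)"
    unfolding TT_def using g by (simp add: act_mult del: mat2_mult)
  finally show ?thesis by simp
qed

lemma eig_TT: "eig V psi v \<Longrightarrow> eig V (conj_s psi) (TT V v)"
  unfolding eig_def
proof (intro conjI ballI)
  fix h :: "'k^2^2" assume v: "v \<in> Uinv \<and> (\<forall>h\<in>diag2. act V h v = scl V (psi h) v)" and h: "h \<in> diag2"
  then show "act V h (TT V v) = scl V (conj_s psi h) (TT V v)"
    using TT_diag[of "swap h" v] by (simp add: conj_s_eq TT_scale)
qed (rule TT_Uinv)

text \<open>The Bruhat computation behind the quadratic relation, now on vectors:
  \<open>t = 0\<close> gives \<open>q\<close> equal vectors, hence zero, and for
  \<open>t \<noteq> 0\<close> the torus part acts on \<open>v\<close> through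
  \<open>psi\<close>.\<close>

lemma TT_TT:
  assumes v: "eig V psi v" shows "TT V (TT V v) = scl V (quad_const psi) (TT V v)"
proof -
  let ?h = "\<lambda>t. mat2 (- t) 0 0 (- inverse t)"
  have 0: "(\<Sum>s\<in>UNIV. act V (uk s ** nik ** (uk 0 ** nik)) v) = 0"
  proof -
    have "act V (uk s ** nik ** (uk 0 ** nik)) v = act V (mat2 (-1) 0 0 (-1)) v" for s
    proof -
      have "uk s ** nik ** (uk 0 ** nik) = mat2 (-1) 0 0 (-1) ** uk s" by simp
      then have "act V (uk s ** nik ** (uk 0 ** nik)) v = act V (mat2 (-1) 0 0 (-1)) (act V (uk s) v)"
        by (simp add: act_mult GL2_mat2_iff del: mat2_mult)
      then show ?thesis using eigD(1)[OF v] by (simp add: Uinv_iff)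
    qed
    moreover have "(\<Sum>s\<in>(UNIV :: 'k set). w) = 0" for w :: 'v
    proof -
      have "(\<Sum>s\<in>(UNIV :: 'k set). w) = scl V (of_nat CARD('k)) w"
        by (simp add: V.sum_constant_scale)
      then show ?thesis using q_zero by simp
    qed
    ultimately show ?thesis by simp
  qed
  have t: "(\<Sum>s\<in>UNIV. act V (uk s ** nik ** (uk t ** nik)) v) = scl V (psi (?h t)) (TT V v)" if "t \<noteq> 0" for t
  proof -
    have hd: "?h t \<in> diag2" using that by simp
    have "act V (uk s ** nik ** (uk t ** nik)) v = scl V (psi (?h t)) (act V (uk (s - inverse t) ** nik) v)" for s
    proof -
      have "uk s ** nik ** (uk t ** nik) = (uk (s - inverse t) ** nik) ** (?h t ** uk (- inverse t))"
        using that by (simp add: algebra_simps)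
      then have "act V (uk s ** nik ** (uk t ** nik)) v =
          act V (uk (s - inverse t) ** nik) (act V (?h t) (act V (uk (- inverse t)) v))"
        using diag2_GL2[OF hd] by (simp add: act_mult matrix_mul_assoc del: mat2_mult)
      also have "act V (uk (- inverse t)) v = v" using eigD(1)[OF v] by (simp add: Uinv_iff)
      finally show ?thesis using eigD(2)[OF v hd] by (simp add: act_scale del: mat2_mult)
    qed
    then have "(\<Sum>s\<in>UNIV. act V (uk s ** nik ** (uk t ** nik)) v) =
        (\<Sum>s\<in>UNIV. scl V (psi (?h t)) (act V (uk (s - inverse t) ** nik) v))" by (simp only:)
    also have "\<dots> = (\<Sum>s\<in>UNIV. scl V (psi (?h t)) (act V (uk s ** nik) v))"
      by (rule sum.reindex_bij_witness[where i = "\<lambda>s. s + inverse t" and j = "\<lambda>s. s - inverse t"]) auto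
    finally show ?thesis by (simp add: TT_def V.scale_sum_right)
  qed
  have "TT V (TT V v) = (\<Sum>s\<in>UNIV. \<Sum>t\<in>UNIV. act V (uk s ** nik ** (uk t ** nik)) v)"
    unfolding TT_def by (simp add: act_sum act_mult del: mat2_mult)
  also have "\<dots> = (\<Sum>t\<in>UNIV. \<Sum>s\<in>UNIV. act V (uk s ** nik ** (uk t ** nik)) v)" by (rule sum.swap)
  also have "\<dots> = (\<Sum>s\<in>UNIV. act V (uk s ** nik ** (uk 0 ** nik)) v) +
      (\<Sum>t\<in>UNIV - {0}. \<Sum>s\<in>UNIV. act V (uk s ** nik ** (uk t ** nik)) v)" by (rule sum.remove) auto
  also have "(\<Sum>t\<in>UNIV - {0}. \<Sum>s\<in>UNIV. act V (uk s ** nik ** (uk t ** nik)) v) =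
      (\<Sum>t\<in>UNIV - {0}. scl V (psi (?h t)) (TT V v))" by (intro sum.cong refl t) auto
  finally show ?thesis unfolding 0 by (simp add: quad_const_def V.scale_sum_left)
qed

text \<open>The operator \<open>u - 1\<close> for the generator \<open>u = uk 1\<close> of
  \<open>U\<close>. It turns representations of \<open>U\<close> into modules over a truncated
  polynomial ring, with the invariants as its kernel.\<close>

definition nilp :: "'v \<Rightarrow> 'v" where "nilp w = act V (uk 1) w - w"

lemma nilp_simps [simp]: "nilp 0 = 0" "nilp (v + w) = nilp v + nilp w" "nilp (scl V a v) = scl V a (nilp v)"
  by (simp_all add: nilp_def act_add act_scale V.scale_right_diff_distrib)

lemma nilp_pow_simps [simp]: "(nilp ^^ n) 0 = 0" "(nilp ^^ n) (v + w) = (nilp ^^ n) v + (nilp ^^ n) w"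
  "(nilp ^^ n) (scl V a v) = scl V a ((nilp ^^ n) v)"
  by (induction n) auto

lemma nilp_pow_sum: "(nilp ^^ n) (sum f S) = (\<Sum>i\<in>S. (nilp ^^ n) (f i))"
  by (induction S rule: infinite_finite_induct) auto

lemma act_uk_of_nat: "act V (uk (of_nat (Suc k))) w = act V (uk 1) (act V (uk (of_nat k)) w)"
  by (simp add: act_mult add.commute)

text \<open>Multiples of \<open>1\<close> below the characteristic are distinct, and by
  \<open>card_k\<close> there are as many of them as elements.\<close>

lemma surj_of_nat: "\<exists>n. (t :: 'k) = of_nat n"
proof -
  have "inj_on (of_nat :: nat \<Rightarrow> 'k) {..<CHAR('k)}"
  proof (rule inj_onI)
    fix i j assume ij: "i \<in> {..<CHAR('k)}" "j \<in> {..<CHAR('k)}" "(of_nat i :: 'k) = of_nat j"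
    have "a = b" if "a \<le> b" "b < CHAR('k)" "(of_nat a :: 'k) = of_nat b" for a b
    proof -
      have "of_nat (b - a) = (0 :: 'k)" using that by (simp add: of_nat_diff)
      then have "CHAR('k) dvd b - a" by (simp add: of_nat_eq_0_iff_char_dvd)
      then show ?thesis using that by (auto dest: dvd_imp_le)
    qed
    then show "i = j" using ij by (metis lessThan_iff nle_le)
  qed
  then have "card ((of_nat :: nat \<Rightarrow> 'k) ` {..<CHAR('k)}) = CARD('k)" by (simp add: card_image card_k)
  then have "(of_nat :: nat \<Rightarrow> 'k) ` {..<CHAR('k)} = UNIV" by (intro card_subset_eq) auto
  then show ?thesis by blast
qed

lemma Uinv_nilp: "w \<in> Uinv \<longleftrightarrow> nilp w = 0"
proof
  assume "nilp w = 0"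
  then have 1: "act V (uk 1) w = w" by (simp add: nilp_def)
  have "act V (uk (of_nat n)) w = w" for n
  proof (induction n)
    case 0
    then show ?case using act_one[of w] by (simp add: mat_1_eq_mat2)
  next
    case (Suc n)
    then show ?case using act_uk_of_nat[of n w] 1 by simp
  qed
  then show "w \<in> Uinv" unfolding Uinv_iff using surj_of_nat by metis
qed (simp add: nilp_def Uinv_iff)

lemma nilp_binomial:
  "(nilp ^^ n) w = (\<Sum>k\<le>n. scl V ((-1) ^ (n - k) * of_nat (n choose k)) (act V (uk (of_nat k)) w))"
proof (induction n)
  case 0
  then show ?case using act_one[of w] by (simp add: mat_1_eq_mat2)
next
  case (Suc n)
  let ?c = "\<lambda>n k. (-1) ^ (n - k) * of_nat (n choose k) :: 'c"
  let ?u = "\<lambda>k. act V (uk (of_nat k)) w"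
  have c: "?c (Suc n) (Suc k) = ?c n k - ?c n (Suc k)" if "k \<le> n" for k
  proof (cases "k = n")
    case False
    then have "n - k = Suc (n - Suc k)" using that by simp
    then show ?thesis by (simp add: algebra_simps)
  qed (simp add: binomial_eq_0)
  have "(nilp ^^ Suc n) w = nilp ((nilp ^^ n) w)" by simp
  also have "\<dots> = (\<Sum>k\<le>n. scl V (?c n k) (nilp (?u k)))"
    unfolding Suc using nilp_pow_sum[of 1 "\<lambda>k. scl V (?c n k) (?u k)" "{..n}"] by simp
  also have "\<dots> = (\<Sum>k\<le>n. scl V (?c n k) (?u (Suc k))) - (\<Sum>k\<le>n. scl V (?c n k) (?u k))"
    by (simp only: nilp_def act_uk_of_nat V.scale_right_diff_distrib sum_subtractf)
  also have "(\<Sum>k\<le>n. scl V (?c n k) (?u k)) = (\<Sum>k\<le>Suc n. scl V (?c n k) (?u k))" by (simp add: binomial_eq_0)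
  also have "\<dots> = scl V (?c n 0) (?u 0) + (\<Sum>k\<le>n. scl V (?c n (Suc k)) (?u (Suc k)))"
    by (rule sum.atMost_Suc_shift)
  also have "(\<Sum>k\<le>n. scl V (?c n k) (?u (Suc k))) - (scl V (?c n 0) (?u 0) + (\<Sum>k\<le>n. scl V (?c n (Suc k)) (?u (Suc k)))) =
     scl V (?c (Suc n) 0) (?u 0) + (\<Sum>k\<le>n. scl V (?c n k - ?c n (Suc k)) (?u (Suc k)))"
    by (simp add: V.scale_left_diff_distrib sum_subtractf binomial_eq_0)
  also have "\<dots> = scl V (?c (Suc n) 0) (?u 0) + (\<Sum>k\<le>n. scl V (?c (Suc n) (Suc k)) (?u (Suc k)))"
    using c by simp
  also have "\<dots> = (\<Sum>k\<le>Suc n. scl V (?c (Suc n) k) (?u k))"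
    by (rule sum.atMost_Suc_shift[symmetric])
  finally show ?case .
qed

text \<open>In characteristic \<open>p\<close> one has \<open>(u - 1)^p = u^p - 1\<close>: the
  middle binomial coefficients vanish, and the two end terms both involve \<open>w\<close> because
  \<open>uk (of_nat p)\<close> is the identity.\<close>

lemma nilp_nilpotent: "(nilp ^^ CHAR('k)) w = 0"
proof -
  let ?p = "CHAR('k)"
  have p: "prime ?p" "?p > 0" using prime_char by (auto simp: prime_gt_0_nat)
  have z: "of_nat (?p choose k) = (0 :: 'c)" if "0 < k" "k < ?p" for k
    unfolding of_nat_eq_0_iff_char_dvd char_c using that p by (intro dvd_choose_prime) auto
  have m: "(-1) ^ ?p + 1 = (0 :: 'c)"
    using minus_power_prime_CHAR[OF char_c[symmetric] p(1), of 1] by simp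
  have "(nilp ^^ ?p) w = (\<Sum>k\<in>{0, ?p}. scl V ((-1) ^ (?p - k) * of_nat (?p choose k)) (act V (uk (of_nat k)) w))"
    unfolding nilp_binomial using z by (intro sum.mono_neutral_right) auto
  also have "\<dots> = scl V ((-1) ^ ?p + 1) w"
    using p act_one[of w] by (simp add: mat_1_eq_mat2 V.scale_left_distrib)
  finally show ?thesis using m by simp
qed

lemma nilp_min:
  assumes "w \<noteq> 0"
  obtains m where "(nilp ^^ m) w \<noteq> 0" "(nilp ^^ Suc m) w = 0"
proof -
  define m where "m = (LEAST m. (nilp ^^ m) w = 0)"
  have 0: "(nilp ^^ m) w = 0" unfolding m_def by (rule LeastI, rule nilp_nilpotent)
  then have "m \<noteq> 0" using assms by (metis funpow_0)
  then obtain k where k: "m = Suc k" by (cases m) auto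
  have "(nilp ^^ k) w \<noteq> 0" using not_less_Least[of k "\<lambda>m. (nilp ^^ m) w = 0"] k unfolding m_def by auto
  then show thesis using that[of k] 0 k by simp
qed

text \<open>The last nonzero iterate of \<open>nilp\<close> on any nonzero vector is invariant; this
  is the fixed point theorem for a p-group.\<close>

lemma subrep_U_invariant:
  assumes W: "is_rep_on GL2 W V" and ne: "W \<noteq> {0}"
  obtains w where "w \<in> W" "w \<in> Uinv" "w \<noteq> 0"
proof -
  have sub: "V.subspace W" and cl: "\<And>g v. g \<in> carrier GL2 \<Longrightarrow> v \<in> W \<Longrightarrow> act V g v \<in> W"
    using W by (auto simp: is_rep_on_def)
  obtain x where x: "x \<in> W" "x \<noteq> 0" using ne V.subspace_0[OF sub] by blast
  have W_nilp: "(nilp ^^ m) x \<in> W" for m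
    using x cl V.subspace_diff[OF sub] by (induction m) (auto simp: nilp_def)
  obtain m where m: "(nilp ^^ m) x \<noteq> 0" "(nilp ^^ Suc m) x = 0" using nilp_min[OF x(2)] by blast
  show thesis by (rule that[of "(nilp ^^ m) x"]) (use m W_nilp Uinv_nilp in auto)
qed

text \<open>Over the truncated polynomial ring a cyclic module is a single Jordan block: the
  iterates of \<open>nilp\<close> on \<open>z\<close> span it, and the last nonzero one spans the
  kernel.\<close>

lemma cyclic_U_invariants:
  assumes y: "y \<in> V.span (range (\<lambda>t. act V (uk t) z))" "y \<in> Uinv"
    and v: "v \<in> V.span (range (\<lambda>t. act V (uk t) z))" "v \<in> Uinv" "v \<noteq> 0"
  shows "\<exists>a. y = scl V a v"
proof -
  have "z \<noteq> 0"
  proof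
    assume "z = 0"
    then have "range (\<lambda>t. act V (uk t) z) \<subseteq> {0}" by auto
    then have "V.span (range (\<lambda>t. act V (uk t) z)) \<subseteq> {0}"
      by (rule V.span_minimal) (rule V.subspace_single_0)
    then show False using v by blast
  qed
  then obtain m where m: "(nilp ^^ m) z \<noteq> 0" "(nilp ^^ Suc m) z = 0" using nilp_min by blast
  let ?S = "V.span ((\<lambda>i. (nilp ^^ i) z) ` {..m})"
  have S_nilp: "nilp w \<in> ?S" if "w \<in> ?S" for w
    using that
  proof (induction w rule: V.span_induct_alt)
    case (step c x y)
    then obtain i where i: "i \<le> m" "x = (nilp ^^ i) z" by auto
    have "nilp x \<in> ?S"
    proof (cases "i = m")
      case True
      then have "nilp x = 0" using i m by simp
      then show ?thesis by (simp add: V.span_zero)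
    next
      case False
      then have "nilp x = (nilp ^^ Suc i) z" "Suc i \<le> m" using i by auto
      then show ?thesis by (metis V.span_base atMost_iff imageI)
    qed
    then show ?case using step by (simp add: V.span_add V.span_scale)
  qed (simp add: V.span_zero)
  have gen: "act V (uk (of_nat n)) z \<in> ?S" for n
  proof (induction n)
    case 0
    have "(nilp ^^ 0) z \<in> ?S" by (rule V.span_base) blast
    then show ?case using act_one[of z] by (simp add: mat_1_eq_mat2)
  next
    case (Suc n)
    have "act V (uk (of_nat (Suc n))) z = act V (uk (of_nat n)) z + nilp (act V (uk (of_nat n)) z)"
      unfolding act_uk_of_nat by (simp add: nilp_def)
    then show ?case using Suc S_nilp[OF Suc] V.span_add by metis
  qed
  have "range (\<lambda>t. act V (uk t) z) \<subseteq> ?S" using gen surj_of_nat by (metis image_subsetI)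
  then have sub: "V.span (range (\<lambda>t. act V (uk t) z)) \<subseteq> ?S" by (intro V.span_minimal) auto
  have key: "\<exists>a. x = scl V a ((nilp ^^ m) z)" if x: "x \<in> ?S" "x \<in> Uinv" for x
  proof -
    have "\<exists>a. x = (\<Sum>i\<le>m. scl V (a i) ((nilp ^^ i) z))"
      using x(1)
    proof (induction x rule: V.span_induct_alt)
      case base
      show ?case by (rule exI[of _ "\<lambda>_. 0"]) simp
    next
      case (step c x y)
      then obtain i a where i: "i \<le> m" "x = (nilp ^^ i) z" and a: "y = (\<Sum>i\<le>m. scl V (a i) ((nilp ^^ i) z))" by auto
      have "scl V c x + y = (\<Sum>j\<le>m. scl V (a j + (if j = i then c else 0)) ((nilp ^^ j) z))"
        using i a by (simp add: V.scale_left_distrib sum.distrib if_distrib[of "\<lambda>c. scl V c _"] sum.delta cong: if_cong)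
      then show ?case by (rule exI[of _ "\<lambda>j. a j + (if j = i then c else 0)"])
    qed
    then obtain a where a: "x = (\<Sum>i\<le>m. scl V (a i) ((nilp ^^ i) z))" by blast
    have high: "(nilp ^^ i) z = 0" if "i > m" for i
    proof -
      have "i = (i - Suc m) + Suc m" using that by simp
      then have "(nilp ^^ i) z = (nilp ^^ (i - Suc m)) ((nilp ^^ Suc m) z)" by (metis comp_apply funpow_add)
      then show ?thesis using m by simp
    qed
    \<comment> \<open>Applying \<open>nilp ^^ (m - j)\<close> isolates \<open>a j\<close>: smaller
      indices vanish by induction, and larger ones are pushed beyond \<open>m\<close>.\<close>
    have a0: "a j = 0" if "j < m" for j
      using that
    proof (induction j rule: less_induct)
      case (less j)
      have "nilp x = 0" using x(2) Uinv_nilp by blast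
      moreover have "(nilp ^^ (m - j)) x = (nilp ^^ (m - j - 1)) (nilp x)"
        using less.prems by (metis Suc_diff_Suc comp_apply diff_Suc_1 funpow_Suc_right diff_diff_left Suc_eq_plus1 add.commute plus_1_eq_Suc)
      ultimately have "(nilp ^^ (m - j)) x = 0" by simp
      moreover have "(nilp ^^ (m - j)) x = (\<Sum>i\<le>m. scl V (a i) ((nilp ^^ (m - j + i)) z))"
        unfolding a by (simp add: nilp_pow_sum funpow_add)
      moreover have "(\<Sum>i\<le>m. scl V (a i) ((nilp ^^ (m - j + i)) z)) = (\<Sum>i\<in>{j}. scl V (a i) ((nilp ^^ (m - j + i)) z))"
      proof (rule sum.mono_neutral_right)
        show "\<forall>i\<in>{..m} - {j}. scl V (a i) ((nilp ^^ (m - j + i)) z) = 0"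
        proof
          fix i assume "i \<in> {..m} - {j}"
          then consider "i < j" | "i > j" by fastforce
          then show "scl V (a i) ((nilp ^^ (m - j + i)) z) = 0"
            using less high[of "m - j + i"] by cases auto
        qed
      qed (use less.prems in auto)
      ultimately show ?case using m less.prems by simp
    qed
    have "x = (\<Sum>i\<in>{m}. scl V (a i) ((nilp ^^ i) z))"
      unfolding a by (rule sum.mono_neutral_right) (use a0 in auto)
    then show ?thesis by auto
  qed
  obtain a where a: "y = scl V a ((nilp ^^ m) z)" using key y sub by blast
  obtain b where b: "v = scl V b ((nilp ^^ m) z)" using key v sub by blast
  have "b \<noteq> 0" using b v by auto
  then have "y = scl V (a / b) v" using a b by simp
  then show ?thesis by blast
qed

text \<open>The subrepresentation generated by an eigenvector \<open>v\<close> of \<open>U\<close>, \<open>H\<close> and \<open>T\<^sub>n\<close> is already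
  generated over the cyclic group \<open>U\<close> by \<open>n\<inverse> v\<close>, since \<open>n T\<^sub>n v - v\<close> is a combination of the
  \<open>u n\<inverse> v\<close> with \<open>u \<noteq> 1\<close>.\<close>

lemma eigenvector_subrep:
  assumes psi: "is_char_H psi" and v: "eig V psi v" "v \<noteq> 0" and T: "TT V v = scl V lam v"
  obtains Y where "is_rep_on GL2 Y V" "v \<in> Y" "\<And>y. y \<in> Y \<Longrightarrow> y \<in> Uinv \<Longrightarrow> \<exists>a. y = scl V a v"
proof -
  define z where "z = act V nik v"
  let ?Y = "V.span (range (\<lambda>t. act V (uk t) z))"
  have base: "act V (uk t) z \<in> ?Y" for t by (rule V.span_base) blast
  have zz: "act V (uk t ** nik) v = act V (uk t) z" for t by (simp add: z_def act_mult del: mat2_mult)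
  have vu: "act V (uk t) v = v" for t using eigD(1)[OF v(1)] by (simp add: Uinv_iff)
  have key: "act V (uk x ** nik ** h ** uk y) v = scl V (psi h) (act V (uk x) z)" if "h \<in> diag2" for x y h
  proof -
    have "act V (uk x ** nik ** h ** uk y) v = act V (uk x ** nik) (act V h (act V (uk y) v))"
      using diag2_GL2[OF that] by (simp add: act_mult matrix_mul_assoc del: mat2_mult)
    also have "\<dots> = scl V (psi h) (act V (uk x) z)"
      unfolding vu eigD(2)[OF v(1) that] by (simp add: act_scale zz del: mat2_mult)
    finally show ?thesis .
  qed
  have vY: "v \<in> ?Y"
  proof (cases "lam = 0")
    case False
    have "TT V v \<in> ?Y" unfolding TT_def zz by (intro V.span_sum base)
    then have "scl V (inverse lam) (scl V lam v) \<in> ?Y" unfolding T by (rule V.span_scale)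
    then show ?thesis using False by simp
  next
    case True
    let ?n = "mat2 0 (-1) 1 0 :: 'k^2^2"
    have n: "?n \<in> carrier GL2" by (simp add: GL2_mat2_iff)
    have "0 = act V ?n (TT V v)" using T True n by simp
    also have "\<dots> = (\<Sum>t\<in>UNIV. act V (?n ** (uk t ** nik)) v)"
      unfolding TT_def using n by (simp add: act_sum act_mult del: mat2_mult)
    also have "\<dots> = act V (?n ** (uk 0 ** nik)) v + (\<Sum>t\<in>UNIV - {0}. act V (?n ** (uk t ** nik)) v)"
      by (rule sum.remove) auto
    also have "act V (?n ** (uk 0 ** nik)) v = v" using act_one[of v] by (simp add: mat_1_eq_mat2)
    finally have "v = - (\<Sum>t\<in>UNIV - {0}. act V (?n ** (uk t ** nik)) v)" by (simp add: eq_neg_iff_add_eq_0)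
    moreover have "act V (?n ** (uk t ** nik)) v \<in> ?Y" if "t \<noteq> 0" for t
    proof -
      have "?n ** (uk t ** nik) = uk (- inverse t) ** nik ** mat2 t 0 0 (inverse t) ** uk (- inverse t)"
        using that by simp
      then have "act V (?n ** (uk t ** nik)) v = scl V (psi (mat2 t 0 0 (inverse t))) (act V (uk (- inverse t)) z)"
        using key[of "mat2 t 0 0 (inverse t)"] that by (simp del: mat2_mult)
      then show ?thesis using base V.span_scale by metis
    qed
    ultimately show ?thesis by (metis (no_types, lifting) V.span_neg V.span_sum DiffE singletonI)
  qed
  \<comment> \<open>By the Bruhat decomposition, stability under the group reduces to
    \<open>U\<close>, \<open>H\<close> and \<open>nik\<close>; closure under products does the
    rest.\<close>
  define St where "St = {g \<in> carrier GL2. \<forall>y\<in>?Y. act V g y \<in> ?Y}"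
  have StI: "g \<in> St" if g: "g \<in> carrier GL2" "\<And>t. act V (g ** (uk t ** nik)) v \<in> ?Y" for g
  proof -
    have "act V g y \<in> ?Y" if "y \<in> ?Y" for y
      using that
    proof (induction y rule: V.span_induct_alt)
      case base
      then show ?case using g by (simp add: V.span_zero)
    next
      case (step c x y)
      then obtain t where "x = act V (uk t ** nik) v" using zz by auto
      then have "act V g x \<in> ?Y" using g by (simp add: act_mult del: mat2_mult)
      then show ?case using step g by (simp add: act_add act_scale V.span_add V.span_scale)
    qed
    then show ?thesis using g by (simp add: St_def)
  qed
  have St_mult: "g ** h \<in> St" if "g \<in> St" "h \<in> St" for g h
    using that by (auto simp: St_def act_mult[symmetric])
  have St_u: "uk x \<in> St" for x
  proof (rule StI)
    fix t
    have "uk x ** (uk t ** nik) = uk (x + t) ** nik" by (simp add: algebra_simps)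
    then show "act V (uk x ** (uk t ** nik)) v \<in> ?Y" using zz[of "x + t"] base[of "x + t"] by (simp only:)
  qed simp
  have St_h: "h \<in> St" if h: "h \<in> diag2" for h
  proof (rule StI)
    show "h \<in> carrier GL2" by (rule diag2_GL2[OF h])
    fix t
    obtain a d where ad: "h = mat2 a 0 0 d" "a \<noteq> 0" "d \<noteq> 0" using h by (auto simp: mem_diag2)
    have "h ** (uk t ** nik) = uk (t * a / d) ** nik ** swap h ** uk 0" using ad by simp
    then show "act V (h ** (uk t ** nik)) v \<in> ?Y"
      using key[of "swap h"] h base V.span_scale by (metis swap_diag2(1))
  qed
  have St_n: "nik \<in> St"
  proof (rule StI)
    fix t :: 'k
    show "act V (nik ** (uk t ** nik)) v \<in> ?Y"
    proof (cases "t = 0")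
      case True
      \<comment> \<open>Here \<open>nik ** nik = -1\<close> leads back from the span of the
        \<open>u z\<close> to \<open>v\<close> itself, so membership of \<open>v\<close> is
        essential.\<close>
      have "act V (mat2 (-1) 0 0 (-1)) v \<in> ?Y"
        using eigD(2)[OF v(1), of "mat2 (-1) 0 0 (-1)"] vY V.span_scale by simp
      then show ?thesis using True by simp
    next
      case False
      have "nik ** (uk t ** nik) = uk (- inverse t) ** nik ** mat2 (- t) 0 0 (- inverse t) ** uk (- inverse t)"
        using False by simp
      then show ?thesis using key[of "mat2 (- t) 0 0 (- inverse t)"] False base V.span_scale
        by (metis diag2_mat2 inverse_nonzero_iff_nonzero neg_equal_0_iff_equal)
    qed
  qed simp
  have St_all: "g \<in> St" if "g \<in> carrier GL2" for g
    using GL2_decomp[OF that] St_mult St_u St_h St_n by metis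
  have "is_rep_on GL2 ?Y V"
    unfolding is_rep_on_def using St_all rep V.vector_space_axioms
    by (auto simp: St_def act_add act_scale act_mult)
  then show thesis using that[of ?Y] vY cyclic_U_invariants[OF _ _ vY eigD(1)[OF v(1)] v(2)] by blast
qed

text \<open>The subrepresentation generated by \<open>v\<close> meets the image of \<open>W\<close>
  by essentiality. A nonzero \<open>U\<close>-invariant in the intersection is a multiple of
  \<open>v\<close> by cyclicity, and of \<open>i e0\<close> because it comes from
  \<open>W\<close>.\<close>

lemma essential_eigenvector:
  assumes i: "rep_hom_on GL2 UNIV W V i" "inj i" "is_rep GL2 W"
    and ess: "\<And>Y. is_rep_on GL2 Y V \<Longrightarrow> Y \<noteq> {0} \<Longrightarrow> Y \<inter> range i \<noteq> {0}"
    and e0: "\<And>w. w \<in> invariants unip2 W \<Longrightarrow> \<exists>a. w = scl W a e0"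
    and psi: "is_char_H psi" and v: "eig V psi v" and T: "TT V v = scl V lam v"
  shows "\<exists>a. v = scl V a (i e0)"
proof (cases "v = 0")
  case True
  then show ?thesis by (metis V.scale_zero_left)
next
  case False
  obtain Y where Y: "is_rep_on GL2 Y V" "v \<in> Y" "\<And>y. y \<in> Y \<Longrightarrow> y \<in> Uinv \<Longrightarrow> \<exists>a. y = scl V a v"
    using eigenvector_subrep[OF psi v False T] by blast
  have hom: "i (x + y) = i x + i y" "i (scl W a x) = scl V a (i x)"
    "g \<in> carrier GL2 \<Longrightarrow> i (act W g x) = act V g (i x)" for x y a g
    using i(1) by (auto simp: rep_hom_on_def)
  have i0: "i 0 = 0" using hom(1)[of 0 0] by simp
  have subY: "V.subspace Y" using Y by (simp add: is_rep_on_def)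
  have ri: "V.subspace (range i)"
  proof (rule V.subspaceI)
    show "0 \<in> range i" using i0 by (intro range_eqI[of _ _ 0]) simp
    fix x y a assume "x \<in> range i" "y \<in> range i"
    then obtain x' y' where "x = i x'" "y = i y'" by blast
    then have "x + y = i (x' + y')" "scl V a x = i (scl W a x')" using hom(1,2) by simp_all
    then show "x + y \<in> range i" "scl V a x \<in> range i" by blast+
  qed
  have A: "is_rep_on GL2 (Y \<inter> range i) V"
    using Y(1) V.subspace_inter[OF subY ri] hom(3)[symmetric] by (auto simp: is_rep_on_def)
  have B: "Y \<inter> range i \<noteq> {0}" using ess[OF Y(1)] Y(2) False by blast
  obtain w where "w \<in> Y \<inter> range i" and w': "w \<in> Uinv" "w \<noteq> 0" by (rule subrep_U_invariant[OF A B])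
  then have w: "w \<in> Y" "w \<in> range i" "w \<in> Uinv" "w \<noteq> 0" by auto
  obtain a where a: "w = scl V a v" using Y(3) w by blast
  obtain w' where w': "w = i w'" using w by blast
  have "act W g w' = w'" if "g \<in> unip2" for g
  proof -
    have "g \<in> carrier GL2" using that by (simp add: unip2_def)
    then have "i (act W g w') = i w'" using w(3) w' that hom(3) by (auto simp: invariants_def)
    then show ?thesis using i(2) by (simp add: inj_eq)
  qed
  then obtain b where "w' = scl W b e0" using e0[of w'] by (auto simp: invariants_def)
  then have "scl V a v = scl V b (i e0)" using a w' hom(2) by simp
  moreover have "a \<noteq> 0" using a w by auto
  moreover have "v = scl V (inverse a) (scl V a v)" using \<open>a \<noteq> 0\<close> by simp
  ultimately have "v = scl V (inverse a) (scl V b (i e0))" by (simp only:)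
  then have "v = scl V (inverse a * b) (i e0)" by (simp only: V.scale_scale)
  then show ?thesis by blast
qed

section \<open>Diagonalising the torus\<close>

definition emb :: "'k \<Rightarrow> 'c" where "emb x = of_nat (SOME n. x = of_nat n)"

text \<open>Equal characteristics make the choice of \<open>n\<close> immaterial, so
  \<open>emb\<close> is the inclusion of the prime field; its powers supply enough characters of
  \<open>H\<close>.\<close>

lemma emb_of_nat: "emb (of_nat n) = of_nat n"
proof -
  have eq: "(of_nat a :: 'c) = of_nat b" if "a \<le> b" "(of_nat a :: 'k) = of_nat b" for a b
  proof -
    have "of_nat (b - a) = (0 :: 'k)" using that by (simp add: of_nat_diff)
    then have "of_nat (b - a) = (0 :: 'c)" by (simp add: of_nat_eq_0_iff_char_dvd char_c)
    then show ?thesis using that by (simp add: of_nat_diff)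
  qed
  have "(of_nat n :: 'k) = of_nat (SOME m. (of_nat n :: 'k) = of_nat m)" by (rule someI_ex) blast
  then show ?thesis unfolding emb_def using eq by (metis nle_le)
qed

lemma emb_mult: "emb (x * y) = emb x * emb y"
  using surj_of_nat[of x] surj_of_nat[of y] by (metis emb_of_nat of_nat_mult)

lemma emb_one [simp]: "emb 1 = 1"
  using emb_of_nat[of 1] by simp

lemma emb_eq_one_iff: "emb x = 1 \<longleftrightarrow> x = 1"
proof
  assume x1: "emb x = 1"
  obtain n where n: "x = of_nat n" using surj_of_nat by blast
  then have c1: "(of_nat n :: 'c) = 1" using x1 emb_of_nat by metis
  show "x = 1"
  proof (cases n)
    case 0
    then show ?thesis using c1 by simp
  next
    case (Suc m)
    then have "(of_nat m :: 'c) = 0" using c1 by simp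
    then have "(of_nat m :: 'k) = 0" by (simp add: of_nat_eq_0_iff_char_dvd char_c)
    then show ?thesis using n Suc by simp
  qed
qed simp

lemma emb_nz: "x \<noteq> 0 \<Longrightarrow> emb x \<noteq> 0"
  using emb_mult[of x "inverse x"] by auto

lemma emb_pow: "x \<noteq> 0 \<Longrightarrow> emb x ^ (CHAR('k) - 1) = 1"
proof -
  assume x: "x \<noteq> 0"
  have p: "prime CHAR('c)" "CHAR('k) > 0" using prime_char char_c by (auto simp: prime_gt_0_nat)
  have "(of_nat n :: 'c) ^ CHAR('c) = of_nat n" for n
    using p by (induction n) (auto simp: freshmans_dream power_0_left)
  then have 1: "emb x ^ CHAR('k) = emb x" using surj_of_nat[of x] emb_of_nat char_c by metis
  have 2: "emb x ^ CHAR('k) = emb x * emb x ^ (CHAR('k) - 1)" using p(2) by (cases "CHAR('k)") auto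
  from 2 1 have "emb x * emb x ^ (CHAR('k) - 1) = emb x" by (rule trans[OF sym])
  then show ?thesis using emb_nz[OF x] by simp
qed

text \<open>Orthogonality of the characters of the unit group, as a geometric series; the value at
  \<open>x = 1\<close> is \<open>p - 1\<close>.\<close>

lemma emb_sum: "x \<noteq> 0 \<Longrightarrow> (\<Sum>i<CHAR('k) - 1. emb x ^ i) = (if x = 1 then -1 else 0)"
proof (cases "x = 1")
  case True
  have "CHAR('k) \<ge> 1" using prime_gt_0_nat[OF prime_char] by linarith
  then have "of_nat (CHAR('k) - 1) = (- 1 :: 'c)" 
    using q_zero[unfolded card_k] by (simp add: of_nat_diff)
  then show ?thesis using True by simp
next
  case False
  assume "x \<noteq> 0"
  then show ?thesis using False emb_pow[of x] emb_eq_one_iff[of x] geometric_sum[of "emb x" "CHAR('k) - 1"] by simp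
qed

lemma left_inverse_mult: "a \<noteq> 0 \<Longrightarrow> inverse a * (a * b) = b" for a b :: 'c
  by simp

text \<open>Fourier inversion on \<open>H\<close>, a group of order prime to \<open>p\<close> whose
  characters are the products of powers of \<open>emb\<close>. No denominator appears, since the
  order of \<open>H\<close> is \<open>1\<close> in the coefficients.\<close>

lemma eigen_decomposition:
  assumes v: "v \<in> Uinv" and P: "\<And>psi w. is_char_H psi \<Longrightarrow> eig V psi w \<Longrightarrow> w \<in> S"
    and S: "V.subspace S"
  shows "v \<in> S"
proof -
  let ?p = "CHAR('k) - 1"
  let ?x = "\<lambda>i j h. emb (h $ 1 $ 1) ^ i * emb (h $ 2 $ 2) ^ j :: 'c"
  define w where "w i j = (\<Sum>h\<in>diag2. scl V (?x i j h) (act V h v))" for i j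
  have xm: "?x i j (h ** h') = ?x i j h * ?x i j h'" "?x i j h \<noteq> 0" if "h \<in> diag2" "h' \<in> diag2" for i j h h'
    using that emb_nz by (auto simp: mem_diag2 emb_mult power_mult_distrib)
  have char: "is_char_H (\<lambda>h. inverse (?x i j h))" for i j
    unfolding is_char_H_def using xm by (simp add: mult.commute)
  have wS: "w i j \<in> S" for i j
  proof (rule P[OF char])
    show "eig V (\<lambda>h. inverse (?x i j h)) (w i j)"
      unfolding eig_def
    proof (intro conjI ballI)
      show "w i j \<in> Uinv"
        unfolding Uinv_iff
      proof
        fix t
        have "act V (uk t) (act V h v) = act V h v" if h: "h \<in> diag2" for h
        proof -
          obtain a d where ad: "h = mat2 a 0 0 d" "a \<noteq> 0" "d \<noteq> 0" using h by (auto simp: mem_diag2)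
          have "uk t ** h = h ** uk (t * d / a)" using ad by simp
          then have "act V (uk t) (act V h v) = act V h (act V (uk (t * d / a)) v)"
            using diag2_GL2[OF h] by (simp add: act_mult)
          then show ?thesis using v by (simp add: Uinv_iff)
        qed
        then show "act V (uk t) (w i j) = w i j" by (simp add: w_def act_sum act_scale)
      qed
      fix h0 :: "'k^2^2" assume h0: "h0 \<in> diag2"
      have g0: "h0 \<in> carrier GL2" using diag2_GL2[OF h0] .
      have "act V h0 (w i j) = (\<Sum>h\<in>diag2. scl V (?x i j h) (act V (h0 ** h) v))"
        unfolding w_def act_sum[OF g0] using g0
        by (intro sum.cong refl) (simp add: act_scale act_mult diag2_GL2)
      also have "\<dots> = (\<Sum>h\<in>diag2. scl V (inverse (?x i j h0)) (scl V (?x i j h) (act V h v)))"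
      proof (rule sum.reindex_bij_witness[where i = "\<lambda>h. inv\<^bsub>GL2\<^esub> h0 ** h" and j = "\<lambda>h. h0 ** h"])
        fix h :: "'k^2^2" assume h: "h \<in> diag2"
        have "inverse (?x i j h0) * ?x i j (h0 ** h) = ?x i j h"
          unfolding xm(1)[OF h0 h, of i j] using xm(2)[OF h0 h, of i j] by (rule_tac left_inverse_mult)
        then show "scl V (inverse (?x i j h0)) (scl V (?x i j (h0 ** h)) (act V (h0 ** h) v)) = scl V (?x i j h) (act V (h0 ** h) v)"
          by simp
      qed (use h0 g0 in \<open>auto simp: matrix_mul_assoc\<close>)
      finally show "act V h0 (w i j) = scl V (inverse (?x i j h0)) (w i j)"
        by (simp add: w_def V.scale_sum_right)
    qed
  qed
  have "(\<Sum>i<?p. \<Sum>j<?p. w i j) = (\<Sum>i<?p. \<Sum>h\<in>diag2. \<Sum>j<?p. scl V (?x i j h) (act V h v))"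
    unfolding w_def by (intro sum.cong refl sum.swap)
  also have "\<dots> = (\<Sum>h\<in>diag2. \<Sum>i<?p. \<Sum>j<?p. scl V (?x i j h) (act V h v))" by (rule sum.swap)
  also have "\<dots> = (\<Sum>h\<in>diag2. scl V ((\<Sum>i<?p. emb (h $ 1 $ 1) ^ i) * (\<Sum>j<?p. emb (h $ 2 $ 2) ^ j)) (act V h v))"
    by (simp add: sum_product V.scale_sum_left)
  also have "\<dots> = (\<Sum>h\<in>(diag2 :: ('k^2^2) set). if h = mat 1 then v else 0)"
  proof (intro sum.cong refl)
    fix h :: "'k^2^2" assume "h \<in> diag2"
    then obtain a d where ad: "h = mat2 a 0 0 d" "a \<noteq> 0" "d \<noteq> 0" by (auto simp: mem_diag2)
    show "scl V ((\<Sum>i<?p. emb (h $ 1 $ 1) ^ i) * (\<Sum>j<?p. emb (h $ 2 $ 2) ^ j)) (act V h v) = (if h = mat 1 then v else 0)"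
      using ad emb_sum[of a] emb_sum[of d] act_one[of v] by (auto simp: mat_1_eq_mat2)
  qed
  also have "\<dots> = v" by simp
  finally have "v = (\<Sum>i<?p. \<Sum>j<?p. w i j)" by simp
  then show ?thesis using wS by (simp add: V.subspace_sum[OF S])
qed

end

section \<open>Injective envelopes and their \<open>U\<close>-invariants\<close>

lemma vector_space_fun: "vector_space (\<lambda>(a::'c::field) (f :: 'i \<Rightarrow> 'c) x. a * f x)"
  by unfold_locales (auto simp: fun_eq_iff algebra_simps)

lemma is_rep_onD:
  assumes "is_rep_on G W V"
  shows "vector_space (scl V)" "module.subspace (scl V) W"
    "g \<in> carrier G \<Longrightarrow> v \<in> W \<Longrightarrow> act V g v \<in> W"
    "g \<in> carrier G \<Longrightarrow> v \<in> W \<Longrightarrow> w \<in> W \<Longrightarrow> act V g (v + w) = act V g v + act V g w"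
    "g \<in> carrier G \<Longrightarrow> v \<in> W \<Longrightarrow> act V g (scl V a v) = scl V a (act V g v)"
    "v \<in> W \<Longrightarrow> act V \<one>\<^bsub>G\<^esub> v = v"
    "g \<in> carrier G \<Longrightarrow> h \<in> carrier G \<Longrightarrow> v \<in> W \<Longrightarrow> act V (g \<otimes>\<^bsub>G\<^esub> h) v = act V g (act V h v)"
  using assms by (auto simp: is_rep_on_def)

lemma rep_homD:
  assumes "rep_hom_on G W V V' f"
  shows "v \<in> W \<Longrightarrow> w \<in> W \<Longrightarrow> f (v + w) = f v + f w" "v \<in> W \<Longrightarrow> f (scl V a v) = scl V' a (f v)"
    "g \<in> carrier G \<Longrightarrow> v \<in> W \<Longrightarrow> f (act V g v) = act V' g (f v)"
  using assms by (auto simp: rep_hom_on_def)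

text \<open>The test objects of \<open>injective_rep\<close> are spaces of sequences; a space of functions on a finite
  set embeds into one of these.\<close>

lemma injective_extend:
  fixes E :: "('c::field, 'g, 'v::ab_group_add) rep" and Q :: "'g \<Rightarrow> ('i::finite \<Rightarrow> 'c) \<Rightarrow> 'i \<Rightarrow> 'c"
  defines "R \<equiv> \<lparr>scl = (\<lambda>a f x. a * f x), act = Q\<rparr>"
  assumes inj: "injective_rep G E" and R: "is_rep G R"
    and A: "is_rep_on G A R" and f: "rep_hom_on G A R E f" and G: "group G"
  obtains f' where "rep_hom_on G UNIV R E f'" "\<And>x. x \<in> A \<Longrightarrow> f' x = f x"
proof -
  obtain c :: "'i \<Rightarrow> nat" where c: "inj c"
    using finite_imp_inj_to_nat_seg[of "UNIV :: 'i set"] by auto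
  define dec :: "(nat \<Rightarrow> 'c) \<Rightarrow> 'i \<Rightarrow> 'c" where "dec x = (\<lambda>i. x (c i))" for x
  define enc :: "('i \<Rightarrow> 'c) \<Rightarrow> nat \<Rightarrow> 'c" where "enc f = (\<lambda>n. if n \<in> range c then f (inv_into UNIV c n) else 0)" for f
  define Q' where "Q' g x = enc (Q g (dec x))" for g x
  let ?N = "\<lparr>scl = (\<lambda>(a::'c) x (n::nat). a * x n), act = Q'\<rparr>"
  have de: "dec (enc f) = f" for f using c by (simp add: dec_def enc_def)
  have enc_lin: "enc (f + g) = enc f + enc g" "enc (\<lambda>x. a * f x) = (\<lambda>n. a * enc f n)" "enc 0 = 0" for f g a
    by (auto simp: enc_def fun_eq_iff)
  have dec_lin: "dec (x + y) = dec x + dec y" "dec (\<lambda>n. a * x n) = (\<lambda>i. a * dec x i)" for x y a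
    by (auto simp: dec_def fun_eq_iff)
  have vs: "vector_space (\<lambda>(a::'c) (x :: nat \<Rightarrow> 'c) n. a * x n)" by (rule vector_space_fun)
  have sub: "module.subspace (\<lambda>(a::'c) (x :: nat \<Rightarrow> 'c) n. a * x n) (enc ` X)"
    if X: "module.subspace (\<lambda>(a::'c) (x :: 'i \<Rightarrow> 'c) n. a * x n) X" for X
  proof -
    interpret N: vector_space "\<lambda>(a::'c) (x :: nat \<Rightarrow> 'c) n. a * x n" by (rule vs)
    interpret I: vector_space "\<lambda>(a::'c) (x :: 'i \<Rightarrow> 'c) n. a * x n" by (rule vector_space_fun)
    show ?thesis
    proof (rule N.subspaceI)
      show "0 \<in> enc ` X" using I.subspace_0[OF X] enc_lin(3) by (metis imageI)
      fix x y a assume "x \<in> enc ` X" "y \<in> enc ` X"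
      then obtain u v where "u \<in> X" "v \<in> X" "x = enc u" "y = enc v" by blast
      then show "x + y \<in> enc ` X" "(\<lambda>n. a * x n) \<in> enc ` X"
        using I.subspace_add[OF X] I.subspace_scale[OF X] enc_lin(1,2) by (metis imageI)+
    qed
  qed
  have repN: "is_rep_on G (enc ` X) ?N" if X: "is_rep_on G X R" for X
    unfolding is_rep_on_def
  proof (intro conjI ballI allI)
    note d = is_rep_onD[OF X, unfolded R_def rep.simps]
    show "vector_space (scl ?N)" using vs by simp
    show "module.subspace (scl ?N) (enc ` X)" using sub[OF d(2)] by simp
    fix g h x y a assume g: "g \<in> carrier G" and h: "h \<in> carrier G" and "x \<in> enc ` X" "y \<in> enc ` X"
    then obtain u v where u: "u \<in> X" "x = enc u" "v \<in> X" "y = enc v" by blast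
    show "act ?N g x \<in> enc ` X" using d(3)[OF g u(1)] u by (simp add: Q'_def de)
    show "act ?N g (x + y) = act ?N g x + act ?N g y"
      using d(4)[OF g u(1,3)] u by (simp add: Q'_def dec_lin de enc_lin)
    show "act ?N g (scl ?N a x) = scl ?N a (act ?N g x)"
      using d(5)[OF g u(1)] u by (simp add: Q'_def dec_lin de enc_lin)
    show "act ?N (g \<otimes>\<^bsub>G\<^esub> h) x = act ?N g (act ?N h x)"
      using d(7)[OF g h u(1)] u by (simp add: Q'_def de)
  next
    note d = is_rep_onD[OF X, unfolded R_def rep.simps]
    fix x assume "x \<in> enc ` X"
    then obtain u where u: "u \<in> X" "x = enc u" by blast
    show "act ?N \<one>\<^bsub>G\<^esub> x = x" using d(6)[OF u(1)] u by (simp add: Q'_def de)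
  qed
  have "rep_hom_on G (enc ` A) ?N E (f \<circ> dec)"
    unfolding rep_hom_on_def
  proof (intro conjI ballI allI)
    note d = rep_homD[OF f, unfolded R_def rep.simps]
    fix x y a assume "x \<in> enc ` A" "y \<in> enc ` A"
    then obtain u v where u: "u \<in> A" "x = enc u" "v \<in> A" "y = enc v" by blast
    show "(f \<circ> dec) (x + y) = (f \<circ> dec) x + (f \<circ> dec) y" using d(1)[OF u(1,3)] u by (simp add: dec_lin de)
    show "(f \<circ> dec) (scl ?N a x) = scl E a ((f \<circ> dec) x)" using d(2)[OF u(1)] u by (simp add: dec_lin de)
    fix g assume "g \<in> carrier G"
    then show "(f \<circ> dec) (act ?N g x) = act E g ((f \<circ> dec) x)" using d(3)[OF _ u(1)] u by (simp add: Q'_def de)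
  qed
  then have "\<exists>k. rep_hom_on G (enc ` UNIV) ?N E k \<and> (\<forall>x\<in>enc ` A. k x = (f \<circ> dec) x)"
    by (rule conjunct2[OF inj[unfolded injective_rep_def], rule_format, OF repN[OF R] repN[OF A] image_mono[OF subset_UNIV]])
  then obtain k where k: "rep_hom_on G (enc ` UNIV) ?N E k" "\<And>x. x \<in> enc ` A \<Longrightarrow> k x = (f \<circ> dec) x"
    by blast
  show thesis
  proof (rule that[of "k \<circ> enc"])
    show "rep_hom_on G UNIV R E (k \<circ> enc)"
      unfolding rep_hom_on_def
    proof (intro conjI ballI allI)
      note d = rep_homD[OF k(1), unfolded rep.simps]
      fix u v :: "'i \<Rightarrow> 'c" and a
      show "(k \<circ> enc) (u + v) = (k \<circ> enc) u + (k \<circ> enc) v" using d(1) by (simp add: enc_lin)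
      show "(k \<circ> enc) (scl R a u) = scl E a ((k \<circ> enc) u)" using d(2) by (simp add: enc_lin R_def)
      fix g assume "g \<in> carrier G"
      then show "(k \<circ> enc) (act R g u) = act E g ((k \<circ> enc) u)"
        using d(3)[of g "enc u"] by (simp add: R_def Q'_def de)
    qed
    show "(k \<circ> enc) x = f x" if "x \<in> A" for x using k(2)[of "enc x"] that by (simp add: de)
  qed
qed

lemma is_rep_rep_sum:
  assumes V: "is_rep G V" and W: "is_rep G W" shows "is_rep G (rep_sum V W)"
proof -
  note v = is_rep_onD[OF V] and w = is_rep_onD[OF W]
  interpret V: vector_space "scl V" by (rule v(1))
  interpret W: vector_space "scl W" by (rule w(1))
  have vs: "vector_space (scl (rep_sum V W))"
    by unfold_locales (auto simp: rep_sum_def V.scale_right_distrib V.scale_left_distrib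
        W.scale_right_distrib W.scale_left_distrib)
  interpret S: vector_space "scl (rep_sum V W)" by (rule vs)
  show ?thesis
    unfolding is_rep_on_def using vs S.subspace_UNIV v(3-) w(3-) by (auto simp: rep_sum_def)
qed

lemma is_rep_ind_borel_rep: "is_rep GL2 (ind_borel_rep :: ('c::field, 'k::field^2^2, _) rep)"
proof -
  interpret vector_space "\<lambda>(a::'c) (f :: 'k^2^2 \<Rightarrow> 'c) x. a * f x" by (rule vector_space_fun)
  show ?thesis
    unfolding is_rep_on_def ind_borel_rep_def
    using vector_space_axioms by (auto simp: matrix_mul_assoc)
qed

context gamma_rep
begin

section \<open>Invariants controlled by a single eigenline\<close>

lemma eig_add: "eig V psi v \<Longrightarrow> eig V psi w \<Longrightarrow> eig V psi (v + w)"
  and eig_scale: "eig V psi v \<Longrightarrow> eig V psi (scl V a v)"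
  by (auto simp: eig_def Uinv_add Uinv_scale act_add act_scale diag2_GL2 V.scale_right_distrib mult.commute)

lemma eig_cong: "eig V psi v \<Longrightarrow> (\<And>h. h \<in> diag2 \<Longrightarrow> psi h = psi' h) \<Longrightarrow> eig V psi' v"
  by (simp add: eig_def)

lemma eig_unique:
  assumes "eig V psi v" "eig V psi' v" "v \<noteq> 0" "h \<in> diag2" shows "psi h = psi' h"
  using eigD(2)[OF assms(1,4)] eigD(2)[OF assms(2,4)] assms(3) V.scale_right_imp_eq by metis

lemma TT_zero [simp]: "TT V 0 = 0"
  using TT_scale[of 0 0] by simp

lemma TT_neg: "TT V (- v) = - TT V v"
  using TT_scale[of "-1" v] by simp

lemma TT_diff: "TT V (v - w) = TT V v - TT V w"
  using TT_add[of v "- w"] TT_neg[of w] by simp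

text \<open>On characters fixed by \<open>s\<close> the operator \<open>T\<^sub>n\<close> satisfies \<open>T\<^sub>n\<^sup>2 = - T\<^sub>n\<close>, so every
  \<open>H\<close>-eigenvector is a sum of eigenvectors of \<open>T\<^sub>n\<close>.\<close>

lemma self_conj_eigenvector:
  assumes line: "\<And>psi v lam. is_char_H psi \<Longrightarrow> eig V psi v \<Longrightarrow> TT V v = scl V lam v \<Longrightarrow> v \<in> S"
    and S: "V.subspace S" and psi: "is_char_H psi" "self_conj psi" and v: "eig V psi v"
  shows "v \<in> S"
proof -
  have T: "eig V psi (TT V v)"
    using eig_cong[OF eig_TT[OF v]] psi(2) by (auto simp: self_conj_def)
  have TT: "TT V (TT V v) = - TT V v"
    using TT_TT[OF v] quad_const_self[OF psi q_zero] by simp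
  have "v + TT V v \<in> S"
    by (rule line[OF psi(1) eig_add[OF v T], of 0]) (simp add: TT_add TT)
  moreover have "TT V v \<in> S" by (rule line[OF psi(1) T, of "-1"]) (simp add: TT)
  ultimately show ?thesis using V.subspace_diff[OF S] by force
qed

text \<open>If a component of character \<open>psi\<close>, not fixed by \<open>s\<close>, survived
  \<open>T_n\<close>, its image would lie on the line of \<open>e\<close>. Then
  \<open>conj_s psi\<close> would agree with \<open>chi\<close>, and \<open>psi\<close> would be
  fixed by \<open>s\<close> after all.\<close>

lemma invariants_line:
  assumes line: "\<And>psi v lam. is_char_H psi \<Longrightarrow> eig V psi v \<Longrightarrow> TT V v = scl V lam v \<Longrightarrow> \<exists>a. v = scl V a e"
    and chi: "self_conj chi" and e: "eig V chi e"
    and v: "v \<in> Uinv"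
  shows "\<exists>a. v = scl V a e"
proof -
  let ?S = "V.span {e}"
  have S: "w \<in> ?S \<longleftrightarrow> (\<exists>a. w = scl V a e)" for w by (auto simp: V.span_singleton)
  have "v \<in> ?S"
  proof (rule eigen_decomposition[OF v _ V.subspace_span])
    fix psi w assume psi: "is_char_H psi" and w: "eig V psi w"
    show "w \<in> ?S"
    proof (cases "self_conj psi")
      case True
      show ?thesis
        by (rule self_conj_eigenvector[OF _ V.subspace_span psi True w]) (use line S in blast)
    next
      case False
      have TT0: "TT V (TT V w) = 0" using TT_TT[OF w] quad_const_nonself[OF psi False] by simp
      have "TT V w = 0"
      proof (rule ccontr)
        assume ne: "TT V w \<noteq> 0"
        obtain a where a: "TT V w = scl V a e"
          using line[OF is_char_H_conj_s[OF psi] eig_TT[OF w], of 0] TT0 by auto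
        have "conj_s psi h = chi h" if "h \<in> diag2" for h
          by (rule eig_unique[OF eig_TT[OF w] _ ne that]) (simp add: a eig_scale[OF e])
        then have "psi h = conj_s psi h" if "h \<in> diag2" for h
          using that chi by (metis conj_s_eq self_conj_def swap_diag2)
        then show False using False by (simp add: self_conj_def)
      qed
      then show ?thesis using line[OF psi w, of 0] S by simp
    qed
  qed
  then show ?thesis using S by blast
qed

text \<open>An eigenvector surviving \<open>T_n\<close> has its image on the line of
  \<open>e\<close> and hence the character of \<open>w\<close>. Subtracting a multiple of
  \<open>w\<close> kills the image and leaves an eigenvector of \<open>T_n\<close>, which is on that
  line too.\<close>

lemma invariants_plane:
  assumes line: "\<And>psi v lam. is_char_H psi \<Longrightarrow> eig V psi v \<Longrightarrow> TT V v = scl V lam v \<Longrightarrow> \<exists>a. v = scl V a e"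
    and e: "eig V chi e" and w: "eig V (conj_s chi) w" "TT V w = e" and chi: "is_char_H chi"
    and v: "v \<in> Uinv"
  shows "\<exists>a b. v = scl V a e + scl V b w"
proof -
  let ?S = "V.span {e, w}"
  have S: "u \<in> ?S \<longleftrightarrow> (\<exists>a b. u = scl V a e + scl V b w)" for u
    by (auto simp: V.span_insert V.span_singleton algebra_simps)
  have "v \<in> ?S"
  proof (rule eigen_decomposition[OF v _ V.subspace_span])
    fix psi u assume psi: "is_char_H psi" and u: "eig V psi u"
    have line': "x \<in> ?S" if x: "is_char_H psi" "eig V psi x" "TT V x = scl V lam x" for psi x lam
    proof -
      obtain a where "x = scl V a e" using line[OF x] by blast
      then show ?thesis by (simp add: V.span_base V.span_scale)
    qed
    show "u \<in> ?S"
    proof (cases "self_conj psi \<or> TT V u = 0")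
      case True
      then show ?thesis
      proof
        assume "self_conj psi"
        then show ?thesis by (rule_tac self_conj_eigenvector[OF _ V.subspace_span psi _ u]) (rule line')
      next
        assume "TT V u = 0"
        then show ?thesis using line'[OF psi u, of 0] by simp
      qed
    next
      case False
      then have TT0: "TT V (TT V u) = 0" using TT_TT[OF u] quad_const_nonself[OF psi] by simp
      obtain a where a: "TT V u = scl V a e"
        using line[OF is_char_H_conj_s[OF psi] eig_TT[OF u], of 0] TT0 by auto
      have "conj_s psi h = chi h" if "h \<in> diag2" for h
        by (rule eig_unique[OF eig_TT[OF u] _ _ that]) (use False in \<open>simp_all add: a eig_scale[OF e]\<close>)
      then have "psi h = conj_s chi h" if "h \<in> diag2" for h
        using that by (metis conj_s_conj_s conj_s_eq swap_diag2(1))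
      then have "eig V (conj_s chi) (u + scl V (- a) w)"
        by (intro eig_add eig_scale w(1) eig_cong[OF u])
      then have "u + scl V (- a) w \<in> ?S"
        by (rule line'[OF is_char_H_conj_s[OF chi], of _ 0]) (simp add: TT_diff TT_scale a w(2))
      moreover have "scl V a w \<in> ?S" by (simp add: V.span_base V.span_scale)
      ultimately have "(u + scl V (- a) w) + scl V a w \<in> ?S" by (rule V.span_add)
      then show ?thesis by simp
    qed
  qed
  then show ?thesis using S by blast
qed

end

lemma TT_hom:
  fixes V :: "('c::field, 'k::{field,finite}^2^2, 'v::ab_group_add) rep"
  assumes f: "rep_hom_on GL2 UNIV V W f"
  shows "TT W (f v) = f (TT V v)"
proof -
  have f0: "f 0 = 0" using rep_homD(1)[OF f, of 0 0] by simp
  have sum: "f (sum g S) = (\<Sum>i\<in>S. f (g i))" for g and S :: "'k set"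
    using rep_homD(1)[OF f] f0 by (induction S rule: infinite_finite_induct) auto
  have "act W (uk t ** nik) (f v) = f (act V (uk t ** nik) v)" for t :: 'k
    using rep_homD(3)[OF f, of "uk t ** nik" v] by (simp add: GL2_mat2_iff)
  then show ?thesis by (simp only: TT_def sum)
qed

lemma eig_hom:
  fixes V :: "('c::field, 'k::{field,finite}^2^2, 'v::ab_group_add) rep"
  assumes f: "rep_hom_on GL2 UNIV V W f" and v: "eig V psi v"
  shows "eig W psi (f v)"
proof -
  have "act W g (f v) = f v" if "g \<in> unip2" for g
    using rep_homD(3)[OF f, of g v] v that by (auto simp: eig_def invariants_def unip2_def)
  moreover have "act W h (f v) = scl W (psi h) (f v)" if "h \<in> diag2" for h
    using rep_homD(3)[OF f, of h v] rep_homD(2)[OF f, of v] v that diag2_GL2[OF that] by (auto simp: eig_def)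
  ultimately show ?thesis by (simp add: eig_def invariants_def)
qed

text \<open>The function on the Borel subgroup given by a character \<open>\<psi>\<close> generates \<open>Ind \<psi>\<close>. The
  representation generated by its image under \<open>T\<^sub>n\<close> maps to \<open>E\<close>: by the cyclicity statement, the
  subrepresentation generated by the pair \<open>(T\<^sub>n f, e)\<close> is the graph of a homomorphism.\<close>

lemma injective_lift:
  fixes E :: "('c::field, 'k::{field,finite}^2^2, 'v::ab_group_add) rep"
  assumes inj: "injective_rep GL2 E" and card: "CARD('k) = CHAR('k)" "CHAR('c) = CHAR('k)"
    and chi: "is_char_H chi" "\<not> self_conj chi" and e: "eig E chi e" "TT E e = 0"
  obtains w where "eig E (conj_s chi) w" "TT E w = e"
proof -
  \<comment> \<open>Right translation on all functions on matrices. \<open>gamma_rep\<close>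
    requires a representation on a whole type, and the functions equivariant under the Borel
    subgroup lie inside this one.\<close>
  let ?R = "ind_borel_rep :: ('c, 'k^2^2, 'k^2^2 \<Rightarrow> 'c) rep"
  have repE: "is_rep GL2 E" using inj by (simp add: injective_rep_def)
  interpret E: gamma_rep E by unfold_locales (use repE card in auto)
  interpret R: gamma_rep ?R by unfold_locales (use is_rep_ind_borel_rep card in auto)
  let ?P = "rep_sum ?R E"
  interpret P: gamma_rep ?P
    by unfold_locales (use is_rep_rep_sum[OF is_rep_ind_borel_rep repE] card in auto)
  let ?psi = "conj_s chi"
  have psi: "is_char_H ?psi" using chi by simp
  define f0 :: "'k^2^2 \<Rightarrow> 'c" where
    "f0 x = (if x \<in> borel2 then ?psi (mat2 (x $ 1 $ 1) 0 0 (x $ 2 $ 2)) else 0)" for x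
  have borel: "mat2 a b c d \<in> borel2 \<longleftrightarrow> c = 0 \<and> a \<noteq> 0 \<and> d \<noteq> 0" for a b c d :: 'k
    by (auto simp: borel2_def GL2_mat2_iff)
  have f0_mult: "f0 (x ** mat2 a b 0 d) = ?psi (mat2 a 0 0 d) * f0 x" if ad: "a \<noteq> 0" "d \<noteq> 0" for x a b d
  proof (cases x)
    fix p q r s assume x: "x = mat2 p q r s"
    have "?psi (mat2 (p * a) 0 0 (s * d)) = ?psi (mat2 p 0 0 s) * ?psi (mat2 a 0 0 d)" if "p \<noteq> 0" "s \<noteq> 0"
      using is_char_HD(2)[OF psi, of "mat2 p 0 0 s" "mat2 a 0 0 d"] that ad by simp
    then show ?thesis using ad by (auto simp: f0_def x borel)
  qed
  have psi1: "?psi (mat2 1 0 0 1) = 1" using char_H_one[OF psi] by (simp add: mat_1_eq_mat2)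
  have f0: "eig ?R ?psi f0"
    unfolding eig_def R.Uinv_iff
  proof (intro conjI allI ballI)
    show "act ?R (uk t) f0 = f0" for t
      using f0_mult[of 1 1 _ t] psi1 by (simp add: ind_borel_rep_def)
    show "act ?R h f0 = scl ?R (?psi h) f0" if "h \<in> diag2" for h
      using f0_mult[of _ _ _ 0] that by (auto simp: ind_borel_rep_def mem_diag2)
  qed
  define v' where "v' = TT ?R f0"
  have v': "eig ?R chi v'"
    unfolding v'_def by (rule R.eig_cong[OF R.eig_TT[OF f0]]) (simp add: conj_s_conj_s)
  have "quad_const ?psi = 0" using quad_const_conj_s[OF chi(1)] quad_const_nonself[OF chi] by simp
  then have Tv': "TT ?R v' = 0" using R.TT_TT[OF f0] by (simp add: v'_def)
  have sum_fun: "sum g S x = (\<Sum>t\<in>S. g t x)" for g :: "'k \<Rightarrow> 'k^2^2 \<Rightarrow> 'c" and S x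
    by (induction S rule: infinite_finite_induct) auto
  \<comment> \<open>At \<open>n_s\<close> the arguments are lower unipotent matrices, and only the
    one with \<open>t = 0\<close> lies in the Borel subgroup; so \<open>v'\<close> is
    nonzero.\<close>
  have "v' (mat2 0 (-1) 1 0) = (\<Sum>t\<in>UNIV. f0 (mat2 0 (-1) 1 0 ** (uk t ** nik)))"
    unfolding v'_def TT_def sum_fun by (simp add: ind_borel_rep_def)
  also have "\<dots> = (\<Sum>t\<in>(UNIV :: 'k set). if t = 0 then 1 else 0)"
    by (intro sum.cong refl) (auto simp: f0_def borel psi1)
  finally have v'1: "v' (mat2 0 (-1) 1 0) = 1" by simp
  have v'0: "v' \<noteq> 0" using v'1 by auto
  have Psimps: "act ?P g (x, y) = (act ?R g x, act E g y)" "scl ?P a (x, y) = (scl ?R a x, scl E a y)" for g a x y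
    by (simp_all add: rep_sum_def)
  have sum_pair: "(\<Sum>t\<in>S. (g t, h t)) = (sum g S, sum h S)"
    for g :: "'k \<Rightarrow> 'k^2^2 \<Rightarrow> 'c" and h :: "'k \<Rightarrow> 'v" and S
    by (induction S rule: infinite_finite_induct) (auto simp: zero_prod_def)
  have eigP: "eig ?P chi (v', e)"
    using v' e(1) by (simp add: eig_def invariants_def Psimps)
  have TP: "TT ?P (v', e) = scl ?P 0 (v', e)"
  proof -
    have "TT ?P (v', e) = (TT ?R v', TT E e)" unfolding TT_def Psimps by (rule sum_pair)
    then show ?thesis using Tv' e(2) P.V.scale_zero_left by (simp add: zero_prod_def)
  qed
  have ne: "(v', e) \<noteq> 0" using v'0 by (simp add: zero_prod_def)
  obtain Y where Y: "is_rep_on GL2 Y ?P" "(v', e) \<in> Y" "\<And>y. y \<in> Y \<Longrightarrow> y \<in> P.Uinv \<Longrightarrow> \<exists>a. y = scl ?P a (v', e)"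
    using P.eigenvector_subrep[OF chi(1) eigP ne TP] by blast
  have subY: "P.V.subspace Y" and clY: "g \<in> carrier GL2 \<Longrightarrow> p \<in> Y \<Longrightarrow> act ?P g p \<in> Y" for g p
    using Y(1) by (auto simp: is_rep_on_def)
  \<comment> \<open>The pairs with first component zero form a subrepresentation. A nonzero one
    would contain a nonzero invariant, hence a nonzero multiple of \<open>(v', e)\<close>,
    contradicting \<open>v' \<noteq> 0\<close>.\<close>
  have graph0: "y = 0" if "(0, y) \<in> Y" for y
  proof (rule ccontr)
    assume "y \<noteq> 0"
    let ?W = "{p \<in> Y. fst p = 0}"
    have subW: "P.V.subspace ?W"
    proof (rule P.V.subspaceI)
      show "0 \<in> ?W" using P.V.subspace_0[OF subY] by simp
      fix p q a assume "p \<in> ?W" "q \<in> ?W"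
      then show "p + q \<in> ?W" "scl ?P a p \<in> ?W"
        using P.V.subspace_add[OF subY] P.V.subspace_scale[OF subY] R.V.scale_zero_right
        by (auto simp: rep_sum_def split: prod.splits)
    qed
    have W: "is_rep_on GL2 ?W ?P"
      unfolding is_rep_on_def using subW P.V.vector_space_axioms Y(1) clY R.act_zero
      by (auto simp: is_rep_on_def) (auto simp: rep_sum_def)
    have neW: "?W \<noteq> {0}"
    proof
      assume W0: "?W = {0}"
      have "(0, y) \<in> ?W" using that by simp
      then have "(0, y) = (0 :: ('k^2^2 \<Rightarrow> 'c) \<times> 'v)" unfolding W0 by simp
      then show False using \<open>y \<noteq> 0\<close> by (simp add: zero_prod_def)
    qed
    obtain p where p: "p \<in> ?W" "p \<in> P.Uinv" "p \<noteq> 0" by (rule P.subrep_U_invariant[OF W neW])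
    then obtain a where a: "p = scl ?P a (v', e)" using Y(3)[of p] by auto
    then have "scl ?R a v' = 0" using p(1) by (simp add: Psimps)
    then have "a = 0" using v'0 by simp
    then show False using a p(3) P.V.scale_zero_left by simp
  qed
  have graph: "y = y'" if "(x, y) \<in> Y" "(x, y') \<in> Y" for x y y'
    using graph0[of "y - y'"] P.V.subspace_diff[OF subY that] by (simp add: zero_fun_def)
  define A where "A = fst ` Y"
  define f where "f x = (THE y. (x, y) \<in> Y)" for x
  have f: "f x = y" if "(x, y) \<in> Y" for x y
    unfolding f_def using graph that by blast
  have fA: "(x, f x) \<in> Y" if "x \<in> A" for x
    using that f by (auto simp: A_def)
  have YA: "(x + x', f x + f x') \<in> Y" "(scl ?R a x, scl E a (f x)) \<in> Y"
    "g \<in> carrier GL2 \<Longrightarrow> (act ?R g x, act E g (f x)) \<in> Y" if "x \<in> A" "x' \<in> A" for x x' a g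
    using P.V.subspace_add[OF subY fA[OF that(1)] fA[OF that(2)]]
      P.V.subspace_scale[OF subY fA[OF that(1)], of a] clY[OF _ fA[OF that(1)], of g] by (simp_all add: Psimps)
  have inA: "x \<in> A" if "(x, y) \<in> Y" for x y using that by (force simp: A_def)
  have "(0, 0) \<in> Y" using P.V.subspace_0[OF subY] by (simp add: zero_prod_def)
  then have subA: "R.V.subspace A"
    using inA[OF YA(1)] inA[OF YA(2)] inA by (intro R.V.subspaceI) blast+
  have A: "is_rep_on GL2 A ?R"
    unfolding is_rep_on_def using subA R.rep inA[OF YA(3)] by (auto simp: is_rep_on_def)
  have hom: "rep_hom_on GL2 A ?R E f"
    unfolding rep_hom_on_def using f[OF YA(1)] f[OF YA(2)] f[OF YA(3)] by blast
  obtain f' where f': "rep_hom_on GL2 UNIV ?R E f'" "\<And>x. x \<in> A \<Longrightarrow> f' x = f x"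
    using injective_extend[OF inj is_rep_ind_borel_rep[unfolded ind_borel_rep_def]
        A[unfolded ind_borel_rep_def] hom[unfolded ind_borel_rep_def] group_GL2]
    unfolding ind_borel_rep_def by blast
  \<comment> \<open>Before extension the homomorphism is known on the subspace containing
    \<open>v'\<close>; injectivity gives \<open>f0\<close> an image, and \<open>T_n\<close> of that
    image is forced to be \<open>e\<close>.\<close>
  have "TT E (f' f0) = f' v'" unfolding v'_def by (rule TT_hom[OF f'(1)])
  also have "\<dots> = e" using f'(2)[OF inA[OF Y(2)]] f[OF Y(2)] by simp
  finally have "TT E (f' f0) = e" .
  moreover have "eig E ?psi (f' f0)" by (rule eig_hom[OF f'(1) f0])
  ultimately show thesis using that by blast
qed

section \<open>The invariants of the irreducible representations\<close>

lemma dim_one_generator: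
  assumes "vector_space s" "vector_space.dim s S = 1"
  obtains b where "b \<in> S" "b \<noteq> 0" "\<And>v. v \<in> S \<Longrightarrow> \<exists>a. v = s a b"
proof -
  interpret vector_space s by (rule assms(1))
  obtain B where B: "B \<subseteq> S" "independent B" "S \<subseteq> span B" "card B = dim S"
    using basis_exists by blast
  then obtain b where b: "B = {b}" using assms(2) card_1_singletonE by metis
  then show thesis using that[of b] B dependent_single by (auto simp: span_singleton)
qed

context
  fixes V :: "('c::field, 'k::{field,finite}^2^2, 'v::ab_group_add) rep" and chi :: "'k^2^2 \<Rightarrow> 'c"
  assumes card: "CARD('k) = CHAR('k)" "CHAR('c) = CHAR('k)" and chi: "is_char_H chi"
    and rep: "is_rep GL2 V"
begin

interpretation gamma_rep V by unfold_locales (use rep card in auto)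

text \<open>The vector \<open>T_n e\<close> carries the conjugate character, while all invariants
  carry \<open>chi\<close>; so it vanishes.\<close>

lemma rho_nonself:
  assumes rho: "is_rho chi {} V" and nonself: "\<not> self_conj chi"
  obtains e where "e \<noteq> 0" "eig V chi e" "TT V e = 0" "\<And>v. v \<in> Uinv \<Longrightarrow> \<exists>a. v = scl V a e"
proof -
  have r: "V.dim Uinv = 1" "b \<in> borel2 \<Longrightarrow> v \<in> Uinv \<Longrightarrow> act V b v = scl V (chi (mat2 (b $ 1 $ 1) 0 0 (b $ 2 $ 2))) v" for b v
    using rho nonself by (auto simp: is_rho_def)
  obtain e where e: "e \<in> Uinv" "e \<noteq> 0" "\<And>v. v \<in> Uinv \<Longrightarrow> \<exists>a. v = scl V a e"
    using dim_one_generator[OF V.vector_space_axioms r(1)] by blast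
  have eig: "eig V chi e"
    unfolding eig_def
  proof (intro conjI ballI e(1))
    fix h :: "'k^2^2" assume h: "h \<in> diag2"
    then obtain a d where ad: "h = mat2 a 0 0 d" by (auto simp: mem_diag2)
    have "h \<in> borel2" using h diag2_GL2[OF h] by (auto simp: borel2_def ad)
    then show "act V h e = scl V (chi h) e" using r(2)[of h e] e(1) ad by simp
  qed
  have "TT V e = 0"
  proof (rule ccontr)
    assume ne: "TT V e \<noteq> 0"
    obtain a where "TT V e = scl V a e" using e(3)[OF TT_Uinv] by blast
    then have "eig V chi (TT V e)" using eig_scale[OF eig] by simp
    then have "chi h = conj_s chi h" if "h \<in> diag2" for h
      using eig_unique[OF _ eig_TT[OF eig] ne that] by blast
    then show False using nonself by (simp add: self_conj_def)
  qed
  then show thesis using that e eig by blast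
qed

text \<open>The matrices \<open>uk t ** nik\<close> have determinant \<open>1\<close>, so
  \<open>T_n\<close> adds up \<open>q\<close> copies of \<open>e\<close>.\<close>

lemma rho_det:
  assumes rho: "is_rho chi {s_mat} V" and self: "self_conj chi"
  obtains e where "e \<noteq> 0" "eig V chi e" "TT V e = 0" "\<And>v. v \<in> Uinv \<Longrightarrow> \<exists>a. v = scl V a e"
proof -
  obtain chi' V' where cu: "is_char_units chi'" and ch: "\<And>h. h \<in> diag2 \<Longrightarrow> chi h = chi' (det h)"
    and t: "is_trivial_rep V'" and V: "V = twist_det chi' V'"
    using rho self by (auto simp: is_rho_def)
  have s: "scl V = scl V'" and a: "act V g v = scl V' (chi' (det g)) (act V' g v)" for g v
    by (simp_all add: V twist_det_def)
  have t': "V.dim UNIV = 1" "g \<in> carrier GL2 \<Longrightarrow> act V' g v = v" for g v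
    using t by (auto simp: is_trivial_rep_def s)
  obtain e where e0: "e \<noteq> 0" and gen: "\<And>v. v \<in> UNIV \<Longrightarrow> \<exists>a. v = scl V a e"
    using dim_one_generator[OF V.vector_space_axioms t'(1)] by blast
  have e: "e \<noteq> 0" "\<exists>a. v = scl V a e" for v by (rule e0, rule gen[OF UNIV_I])
  have one: "chi' 1 = 1"
  proof -
    have "chi' 1 \<noteq> 0" "chi' (1 * 1) = chi' 1 * chi' 1"
      using cu one_neq_zero unfolding is_char_units_def by blast+
    then show ?thesis by simp
  qed
  have act: "g \<in> carrier GL2 \<Longrightarrow> act V g v = scl V (chi' (det g)) v" for g v
    using a[of g v] t'(2)[of g v] s by simp
  have "eig V chi e"
    unfolding eig_def Uinv_iff using act one ch diag2_GL2 by (auto simp: GL2_mat2_iff)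
  moreover have "TT V e = 0"
  proof -
    have "act V (uk t ** nik) e = e" for t :: 'k using act[of "uk t ** nik" e] one by (simp add: GL2_mat2_iff)
    then have "TT V e = (\<Sum>t\<in>(UNIV :: 'k set). e)" by (simp only: TT_def)
    also have "\<dots> = scl V (of_nat CARD('k)) e" by (simp add: V.sum_constant_scale)
    finally show ?thesis using q_zero by simp
  qed
  ultimately show thesis using that e by blast
qed

text \<open>The operator \<open>T_n\<close> takes the indicator of the Borel subgroup to that of the
  big cell; their sum is constant and dies in the quotient, whence the eigenvalue \<open>-1\<close>.
  Since \<open>e\<close> generates the whole representation, cyclicity bounds all its
  invariants.\<close>

lemma rho_steinberg:
  assumes rho: "is_rho chi {} V" and self: "self_conj chi"
  obtains e where "e \<noteq> 0" "eig V chi e" "TT V e = - e" "\<And>v. v \<in> Uinv \<Longrightarrow> \<exists>a. v = scl V a e"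
proof -
  obtain chi' V' where cu: "is_char_units chi'" and ch: "\<And>h. h \<in> diag2 \<Longrightarrow> chi h = chi' (det h)"
    and t: "is_steinberg V'" and V: "V = twist_det chi' V'"
    using rho self by (auto simp: is_rho_def)
  have s: "scl V = scl V'" and a: "act V g v = scl V' (chi' (det g)) (act V' g v)" for g v
    by (simp_all add: V twist_det_def)
  obtain pi where pi: "rep_hom_on GL2 ind_borel ind_borel_rep V' pi" "pi ` ind_borel = UNIV"
    "\<And>f. f \<in> ind_borel \<Longrightarrow> pi f = 0 \<longleftrightarrow> (\<exists>a. \<forall>g\<in>carrier GL2. f g = a)"
    using t by (auto simp: is_steinberg_def)
  have one: "chi' 1 = 1"
  proof -
    have "chi' 1 \<noteq> 0" "chi' (1 * 1) = chi' 1 * chi' 1"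
      using cu one_neq_zero unfolding is_char_units_def by blast+
    then show ?thesis by simp
  qed
  let ?act = "\<lambda>(g :: 'k^2^2) (f :: 'k^2^2 \<Rightarrow> 'c) x. f (x ** g)"
  have pi_add: "pi (f + f') = pi f + pi f'" and pi_scale: "pi (\<lambda>x. c * f x) = scl V c (pi f)"
    and pi_act: "g \<in> carrier GL2 \<Longrightarrow> pi (?act g f) = act V' g (pi f)"
    if "f \<in> ind_borel" "f' \<in> ind_borel" for f f' c g
    using rep_homD[OF pi(1)] that s by (auto simp: ind_borel_rep_def)
  have borel: "mat2 a b c d \<in> borel2 \<longleftrightarrow> c = 0 \<and> a \<noteq> 0 \<and> d \<noteq> 0" for a b c d :: 'k
    by (auto simp: borel2_def GL2_mat2_iff)
  have borel_GL2: "b \<in> borel2 \<Longrightarrow> b \<in> carrier GL2" for b :: "'k^2^2" by (simp add: borel2_def)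
  have borel_mult: "b ** g \<in> borel2 \<longleftrightarrow> g \<in> borel2" if "b \<in> borel2" for b g :: "'k^2^2"
    using that by (cases b; cases g) (auto simp: borel)
  have GL2_right: "x ** g \<in> carrier GL2 \<longleftrightarrow> x \<in> carrier GL2" if "g \<in> carrier GL2" for x g :: "'k^2^2"
    using that by (simp add: GL2_iff det_mul)
  define fB :: "'k^2^2 \<Rightarrow> 'c" where "fB x = (if x \<in> borel2 then 1 else 0)" for x
  have fB: "fB \<in> ind_borel"
    using borel_mult borel_GL2 by (auto simp: ind_borel_def fB_def)
  have act_ind: "?act g f \<in> ind_borel" if "f \<in> ind_borel" "g \<in> carrier GL2" for f g
    using that GL2_right[OF that(2)] by (auto simp: ind_borel_def matrix_mul_assoc[symmetric])
  have lin_ind: "f + f' \<in> ind_borel" "(\<lambda>x. c * f x) \<in> ind_borel" "0 \<in> ind_borel"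
    if "f \<in> ind_borel" "f' \<in> ind_borel" for f f' :: "'k^2^2 \<Rightarrow> 'c" and c
    using that borel_GL2 by (auto simp: ind_borel_def)
  have zero_ind: "0 \<in> (ind_borel :: ('k^2^2 \<Rightarrow> 'c) set)" using lin_ind(3)[OF fB fB] .
  have sum_ind: "(\<Sum>t\<in>S. g t) \<in> ind_borel \<and> pi (\<Sum>t\<in>S. g t) = (\<Sum>t\<in>S. pi (g t))"
    if "\<And>t. g t \<in> ind_borel" for g :: "'k \<Rightarrow> 'k^2^2 \<Rightarrow> 'c" and S
  proof -
    have "pi 0 = 0" using pi_add[OF zero_ind zero_ind] by simp
    then show ?thesis using that lin_ind(1) zero_ind pi_add
      by (induction S rule: infinite_finite_induct) auto
  qed
  have sum_fun: "sum g S x = (\<Sum>t\<in>S. g t x)" for g :: "'k \<Rightarrow> 'k^2^2 \<Rightarrow> 'c" and S x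
    by (induction S rule: infinite_finite_induct) auto
  define e where "e = pi fB"
  have e0: "e \<noteq> 0"
  proof
    assume "e = 0"
    then obtain a where "\<forall>g\<in>carrier GL2. fB g = a" using pi(3)[OF fB] by (auto simp: e_def)
    then have "fB (mat2 1 0 0 1) = a" "fB (mat2 0 (-1) 1 0) = a" by (auto simp: GL2_mat2_iff)
    then show False by (simp add: fB_def borel)
  qed
  have fB_right: "?act b fB = fB" if "b \<in> borel2" for b
  proof
    fix x :: "'k^2^2"
    have "x ** b \<in> borel2 \<longleftrightarrow> x \<in> borel2" using that by (cases b; cases x) (auto simp: borel)
    then show "?act b fB x = fB x" by (simp add: fB_def)
  qed
  have act_e: "act V b e = scl V (chi' (det b)) e" if "b \<in> borel2" for b
    unfolding a s[symmetric] using pi_act[OF fB fB borel_GL2[OF that]] fB_right[OF that] by (simp add: e_def)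
  have eig: "eig V chi e"
    unfolding eig_def Uinv_iff
  proof (intro conjI allI ballI)
    show "act V (uk t) e = e" for t using act_e[of "uk t"] one by (simp add: borel)
    show "act V h e = scl V (chi h) e" if "h \<in> diag2" for h
      using act_e[of h] ch[OF that] that by (auto simp: mem_diag2 borel)
  qed
  define ft where "ft t = ?act (uk t ** nik) fB" for t
  have g: "uk t ** nik \<in> carrier GL2" for t :: 'k by (simp add: GL2_mat2_iff)
  have ft: "ft t \<in> ind_borel" for t unfolding ft_def by (rule act_ind[OF fB g])
  have act_ft: "act V (uk t ** nik) e = pi (ft t)" for t
    unfolding a s[symmetric] ft_def e_def using pi_act[OF fB fB g[of t]] one by simp
  \<comment> \<open>Cosets of the Borel subgroup are points of the projective line, with the bottom
    row as homogeneous coordinates; \<open>fB\<close> and the \<open>ft t\<close> are the indicators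
    of these points.\<close>
  have ft_val: "ft t x = (if c \<noteq> 0 \<and> t = - d / c then 1 else 0)" if "x \<in> carrier GL2" "x = mat2 p q c d" for t x p q c d
  proof -
    have D: "p * d - q * c \<noteq> 0" using that by (simp add: GL2_mat2_iff)
    have "x ** (uk t ** nik) = mat2 (- (p * t + q)) p (- (c * t + d)) c" using that(2) by simp
    moreover have "p * t + q \<noteq> 0" if "c * t + d = 0"
    proof
      assume "p * t + q = 0"
      then have "q = - (p * t)" "d = - (c * t)" using that by (simp_all add: eq_neg_iff_add_eq_0 add.commute)
      then show False using D by simp
    qed
    ultimately have "x ** (uk t ** nik) \<in> borel2 \<longleftrightarrow> c * t + d = 0 \<and> c \<noteq> 0" by (auto simp only: borel neg_equal_0_iff_equal)
    also have "\<dots> \<longleftrightarrow> c \<noteq> 0 \<and> t = - d / c"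
    proof (cases "c = 0")
      case False
      then have "t = - d / c \<longleftrightarrow> t * c = - d" by (rule nonzero_eq_divide_eq)
      also have "\<dots> \<longleftrightarrow> c * t + d = 0" by (simp add: eq_neg_iff_add_eq_0 mult.commute)
      finally show ?thesis using False by blast
    qed simp
    finally show ?thesis by (simp only: ft_def fB_def)
  qed
  have fB_val: "fB x = (if c = 0 then 1 else 0)" if "x \<in> carrier GL2" "x = mat2 p q c d" for x p q c d
    using that by (auto simp: fB_def borel GL2_mat2_iff)
  have T: "TT V e = - e"
  proof -
    let ?s = "\<Sum>t\<in>UNIV. ft t"
    have s: "?s \<in> ind_borel" "pi ?s = TT V e"
      using sum_ind[of ft UNIV, OF ft] act_ft by (auto simp: TT_def simp del: mat2_mult)
    have "(?s + fB) x = 1" if x: "x \<in> carrier GL2" for x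
    proof (cases x)
      fix p q c d assume X: "x = mat2 p q c d"
      show ?thesis
        using ft_val[OF x X] fB_val[OF x X] by (simp add: sum_fun)
    qed
    then have "pi (?s + fB) = 0" using pi(3)[OF lin_ind(1)[OF s(1) fB]] by blast
    then have "TT V e + e = 0" using pi_add[OF s(1) fB] s(2) by (simp add: e_def)
    then show ?thesis by (simp add: eq_neg_iff_add_eq_0)
  qed
  obtain Y where Y: "is_rep_on GL2 Y V" "e \<in> Y" "\<And>y. y \<in> Y \<Longrightarrow> y \<in> Uinv \<Longrightarrow> \<exists>a. y = scl V a e"
    using eigenvector_subrep[OF chi eig e0, of "-1"] T by auto
  have subY: "V.subspace Y" and clY: "g \<in> carrier GL2 \<Longrightarrow> v \<in> Y \<Longrightarrow> act V g v \<in> Y" for g v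
    using Y(1) by (auto simp: is_rep_on_def)
  have "v \<in> Y" for v
  proof -
    obtain f where f: "f \<in> ind_borel" "v = pi f" using pi(2) by (metis UNIV_I imageE)
    \<comment> \<open>The value of \<open>f\<close> at the point where \<open>ft t\<close> lives.
      The sign comes from \<open>t = - d / c\<close> there, while the coset is represented with
      \<open>uk (d / c)\<close>.\<close>
    let ?c = "\<lambda>t. f (mat2 0 (-1) 1 0 ** uk (- t))"
    let ?g = "(\<lambda>x. f (mat 1) * fB x) + (\<Sum>t\<in>UNIV. (\<lambda>x. ?c t * ft t x))"
    have fb: "f (b ** g) = f g" if "b \<in> borel2" "g \<in> carrier GL2" for b g
      using f that by (auto simp: ind_borel_def)
    have "f x = ?g x" for x
    proof (cases "x \<in> carrier GL2")
      case False
      have "ft t x = 0" for t using ft[of t] False by (simp add: ind_borel_def)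
      then show ?thesis using f fB False by (simp add: ind_borel_def sum_fun)
    next
      case True
      obtain p q c d where X: "x = mat2 p q c d" by (rule mat2_cases)
      show ?thesis
      proof (cases "c = 0")
        case c: True
        have "f (x ** mat 1) = f (mat 1)" using True c X by (intro fb) (auto simp: borel GL2_mat2_iff)
        then show ?thesis using c ft_val[OF True X] fB_val[OF True X] by (simp add: sum_fun)
      next
        case c: False
        have "x = mat2 (- (q - p * d / c)) p 0 c ** (mat2 0 (-1) 1 0 ** uk (d / c))"
          using c X by (simp add: field_simps)
        moreover have "mat2 (- (q - p * d / c)) p 0 c \<in> borel2"
          using True X c by (auto simp: borel GL2_mat2_iff field_simps)
        ultimately have "f x = ?c (- d / c)"
          using fb[of "mat2 (- (q - p * d / c)) p 0 c" "mat2 0 (-1) 1 0 ** uk (d / c)"]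
          by (simp add: GL2_mat2_iff)
        moreover have "(\<Sum>t\<in>UNIV. ?c t * ft t x) = ?c (- d / c)"
          using c ft_val[OF True X] by (simp add: if_distrib[of "\<lambda>z. _ * z"] cong: if_cong)
        ultimately show ?thesis using c fB_val[OF True X] by (simp add: sum_fun)
      qed
    qed
    then have "f = ?g" by (rule ext)
    moreover have "pi ?g = scl V (f (mat 1)) e + (\<Sum>t\<in>UNIV. scl V (?c t) (pi (ft t)))"
    proof -
      have si: "(\<lambda>x. ?c t * ft t x) \<in> ind_borel" for t using lin_ind(2)[OF ft ft] .
      have ss: "(\<Sum>t\<in>UNIV. (\<lambda>x. ?c t * ft t x)) \<in> ind_borel"
        "pi (\<Sum>t\<in>UNIV. (\<lambda>x. ?c t * ft t x)) = (\<Sum>t\<in>UNIV. pi (\<lambda>x. ?c t * ft t x))"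
        using sum_ind[of "\<lambda>t x. ?c t * ft t x" UNIV, OF si] by blast+
      show ?thesis
        unfolding pi_add[OF lin_ind(2)[OF fB fB] ss(1)] ss(2) pi_scale[OF fB fB] e_def
        using pi_scale[OF ft ft] by simp
    qed
    moreover have "\<dots> \<in> Y"
      using Y(2) clY[OF g Y(2)] act_ft
      by (intro V.subspace_add[OF subY] V.subspace_scale[OF subY] V.subspace_sum[OF subY]) auto
    ultimately show ?thesis using f(2) by simp
  qed
  then show thesis using that[OF e0 eig T] Y(3) by blast
qed

end

section \<open>The invariants of the injective envelopes\<close>

text \<open>The invariant line of \<open>rho\<close> embeds in the envelope, and essentiality forces
  every common eigenvector of \<open>H\<close> and \<open>T_n\<close> onto its image.\<close>

lemma envelope_line:
  fixes E :: "('c::field, 'k::{field,finite}^2^2, 'w::ab_group_add) rep"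
    and rho :: "('c, 'k^2^2, 'v::ab_group_add) rep"
  assumes card: "CARD('k) = CHAR('k)" "CHAR('c) = CHAR('k)"
    and env: "injective_envelope GL2 rho E" and e: "e \<noteq> 0" "eig rho chi e" "TT rho e = scl rho lam e"
    and rhoU: "\<And>v. v \<in> invariants unip2 rho \<Longrightarrow> \<exists>a. v = scl rho a e"
  obtains e' where "e' \<noteq> 0" "eig E chi e'" "TT E e' = scl E lam e'"
    "\<And>psi v lam. is_char_H psi \<Longrightarrow> eig E psi v \<Longrightarrow> TT E v = scl E lam v \<Longrightarrow> \<exists>a. v = scl E a e'"
proof -
  obtain i where i: "rep_hom_on GL2 UNIV rho E i" "inj i"
    "\<And>W. is_rep_on GL2 W E \<Longrightarrow> W \<noteq> {0} \<Longrightarrow> W \<inter> range i \<noteq> {0}" and rep: "is_rep GL2 rho"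
    and inj: "injective_rep GL2 E"
    using env by (auto simp: injective_envelope_def)
  interpret E: gamma_rep E by unfold_locales (use inj card in \<open>auto simp: injective_rep_def\<close>)
  have i0: "i 0 = 0" using rep_homD(1)[OF i(1), of 0 0] by simp
  show thesis
  proof (rule that[of "i e"])
    show "i e \<noteq> 0" using i0 i(2) e(1) by (metis injD)
    show "eig E chi (i e)" by (rule eig_hom[OF i(1) e(2)])
    show "TT E (i e) = scl E lam (i e)"
      unfolding TT_hom[OF i(1)] e(3) using rep_homD(2)[OF i(1), of e lam] by simp
    show "\<exists>a. v = scl E a (i e)" if "is_char_H psi" "eig E psi v" "TT E v = scl E lam v" for psi v lam
      by (rule E.essential_eigenvector[OF i(1,2) rep i(3) rhoU that])
  qed
qed

section \<open>The action of the Hecke algebra of \<open>K\<close> on invariants\<close>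

text \<open>The third conclusion lets the transported action be computed without inverting the
  bijection; it is what compares this action with that of \<open>\<H>_K\<close>.\<close>

lemma right_module_transport:
  fixes X :: "'m::ab_group_add set"
  assumes N: "right_module R N actN" and f: "bij_betw f X (carrier N)"
    and add: "\<And>x y. x \<in> X \<Longrightarrow> y \<in> X \<Longrightarrow> f (x + y) = f x \<oplus>\<^bsub>N\<^esub> f y"
    and X: "0 \<in> X" "\<And>x y. x \<in> X \<Longrightarrow> y \<in> X \<Longrightarrow> x + y \<in> X" "\<And>x. x \<in> X \<Longrightarrow> - x \<in> X"
  defines "tact \<equiv> \<lambda>x r. inv_into X f (actN (f x) r)"
  shows "right_module R (add_struct X) tact" "right_module_iso R (add_struct X) tact N actN"
    "\<And>x y r. x \<in> X \<Longrightarrow> y \<in> X \<Longrightarrow> f y = actN (f x) r \<Longrightarrow> tact x r = y"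
proof -
  interpret N: right_module R N actN by (rule N)
  have fc: "f x \<in> carrier N" if "x \<in> X" for x using bij_betwE[OF f] that by blast
  have inv: "inv_into X f y \<in> X" "f (inv_into X f y) = y" if "y \<in> carrier N" for y
    using that f by (auto simp: bij_betw_def inv_into_into f_inv_into_f)
  have inj: "x = y" if "f x = f y" "x \<in> X" "y \<in> X" for x y
    using f that by (auto simp: bij_betw_def inj_on_def)
  have actX: "tact x r \<in> X" "f (tact x r) = actN (f x) r" if "x \<in> X" "r \<in> carrier R" for x r
    using inv[OF N.ract_closed[OF fc[OF that(1)] that(2)]] by (auto simp: tact_def)
  show "right_module R (add_struct X) tact"
  proof (intro right_module.intro right_module_axioms.intro)
    show "ring R" by (rule N.R.ring_axioms)
    show "abelian_group (add_struct X)" using X by (rule abelian_group_add_struct)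
  next
    fix m r assume m: "m \<in> carrier (add_struct X)" and r: "r \<in> carrier R"
    then show "tact m r \<in> carrier (add_struct X)" using actX by simp
    fix m' assume m': "m' \<in> carrier (add_struct X)"
    show "tact (m \<oplus>\<^bsub>add_struct X\<^esub> m') r = tact m r \<oplus>\<^bsub>add_struct X\<^esub> tact m' r"
      by (rule inj) (use m m' r actX X add fc N.ract_add_left in auto)
  next
    fix m r r' assume m: "m \<in> carrier (add_struct X)" and r: "r \<in> carrier R" "r' \<in> carrier R"
    show "tact m (r \<oplus>\<^bsub>R\<^esub> r') = tact m r \<oplus>\<^bsub>add_struct X\<^esub> tact m r'"
      by (rule inj) (use m r actX X add fc N.ract_add_right in auto)
    show "tact m (r \<otimes>\<^bsub>R\<^esub> r') = tact (tact m r) r'"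
      by (rule inj) (use m r actX X fc N.ract_mult in auto)
  next
    fix m assume m: "m \<in> carrier (add_struct X)"
    show "tact m \<one>\<^bsub>R\<^esub> = m" by (rule inj) (use m actX fc N.ract_one in auto)
  qed
  show "right_module_iso R (add_struct X) tact N actN"
    unfolding right_module_iso_def using f add actX by (intro exI[of _ f]) auto
  show "tact x r = y" if "x \<in> X" "y \<in> X" "f y = actN (f x) r" for x y r
    unfolding tact_def that(3)[symmetric] using f that(2) by (simp add: bij_betw_def inv_into_f_f)
qed

context mod_p_hecke
begin

lemma delta_eq: "(\<lambda>D. if D = L then 1 else 0) = (delta :: _ \<Rightarrow> 'c)"
  by (simp add: delta_def)

lemma cs_subset_K: "k \<in> K \<Longrightarrow> cs k \<subseteq> K"
  by (auto simp: mem_cs intro!: K_mult[OF subsetD[OF L_subset_K]])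

text \<open>The extension of \<open>\<psi> delta\<close> satisfies the defining property. It is the
  only candidate, because \<open>delta\<close> lies in \<open>IndK\<close> and determines an element
  of the ring.\<close>

lemma hecke_K_incl_supp:
  assumes psi: "\<psi> \<in> hecke_K K L"
  shows "supp_K (hecke_K_incl K L \<psi> :: ('f, 'c) hecke)" "hf (hecke_K_incl K L \<psi>) g = \<psi> delta (cs g)"
proof -
  let ?I = "IndK K L :: (('f^2^2) set \<Rightarrow> 'c) set"
  have d: "f \<in> ?I \<Longrightarrow> \<psi> f \<in> ?I" "f \<in> ?I \<Longrightarrow> f' \<in> ?I \<Longrightarrow> \<psi> (f + f') = \<psi> f + \<psi> f'"
    "f \<in> ?I \<Longrightarrow> \<psi> (\<lambda>C. a * f C) = (\<lambda>C. a * \<psi> f C)" "k \<in> K \<Longrightarrow> f \<in> ?I \<Longrightarrow> \<psi> (rtrans k f) = rtrans k (\<psi> f)"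
    for f f' a k
    using psi by (auto simp: hecke_K_def equiv_End_def)
  have I: "f \<in> cInd L" "f C \<noteq> 0 \<Longrightarrow> C \<subseteq> K" if "f \<in> ?I" for f C using that by (auto simp: IndK_def)
  have dI: "delta \<in> ?I" using L_subset_K by (auto simp: IndK_def delta_def split: if_splits)
      (use delta_cInd in \<open>simp add: delta_def\<close>)
  have tI: "rtrans k f \<in> ?I" if "k \<in> K" "f \<in> ?I" for k f
  proof -
    have "C \<subseteq> K" if "rtrans k f C \<noteq> 0" for C
    proof
      fix x assume "x \<in> C"
      then have "x ** k \<in> C #>\<^bsub>GL2\<^esub> k" by (auto simp: r_coset_def)
      then have "x ** k \<in> K" using I(2)[OF \<open>f \<in> ?I\<close>, of "C #>\<^bsub>GL2\<^esub> k"] that by (auto simp: rtrans_def)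
      then have "x ** k ** inv\<^bsub>GL2\<^esub> k \<in> K" by (rule K_mult) (rule K_inv[OF \<open>k \<in> K\<close>])
      then show "x \<in> K" using K_GL2[OF \<open>k \<in> K\<close>] by simp
    qed
    then show ?thesis using rtrans_cInd[OF I(1)[OF that(2)] K_GL2[OF that(1)]] by (simp add: IndK_def)
  qed
  have lin: "(\<lambda>C. \<Sum>i\<in>S. a i * f i C) \<in> ?I \<and> \<psi> (\<lambda>C. \<Sum>i\<in>S. a i * f i C) = (\<lambda>C. \<Sum>i\<in>S. a i * \<psi> (f i) C)"
    if "finite S" "\<And>i. i \<in> S \<Longrightarrow> f i \<in> ?I" for S :: "('f^2^2) set set" and a f
    using that
  proof (induction S rule: finite_induct)
    case empty
    have z: "(0 :: _ \<Rightarrow> 'c) \<in> ?I" by (simp add: IndK_def)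
    then have "\<psi> 0 = 0" using d(2)[OF z z] by simp
    then show ?case using z by (simp add: zero_fun_def)
  next
    case (insert j S)
    let ?u = "\<lambda>C. a j * f j C" and ?v = "\<lambda>C. \<Sum>i\<in>S. a i * f i C"
    have add: "(\<lambda>C. \<Sum>i\<in>insert j S. a i * h i C) = (\<lambda>C. a j * h j C) + (\<lambda>C. \<Sum>i\<in>S. a i * h i C)"
      for h :: "_ \<Rightarrow> ('f^2^2) set \<Rightarrow> 'c"
      using insert by (auto simp: fun_eq_iff)
    have u: "?u \<in> ?I" using insert cInd_scale[of "f j" "a j"] by (auto simp: IndK_def)
    have v: "?v \<in> ?I" using insert by blast
    have "C \<subseteq> K" if "(?u + ?v) C \<noteq> 0" for C
    proof (cases "?u C = 0")
      case True
      then have "?v C \<noteq> 0" using that by (simp only: plus_fun_apply add_0 not_False_eq_True)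
      then show ?thesis by (rule I(2)[OF v])
    qed (rule I(2)[OF u])
    then have "?u + ?v \<in> ?I" using cInd_add[OF I(1)[OF u] I(1)[OF v]] by (simp add: IndK_def)
    moreover have "\<psi> (?u + ?v) = (\<lambda>C. a j * \<psi> (f j) C) + (\<lambda>C. \<Sum>i\<in>S. a i * \<psi> (f i) C)"
      using d(2)[OF u v] d(3)[of "f j" "a j"] insert by simp
    ultimately show ?case unfolding add by (rule conjI)
  qed
  let ?X = "\<psi> delta"
  have X: "?X \<in> ?I" by (rule d(1)[OF dI])
  have Xinv: "rtrans l ?X = ?X" if "l \<in> L" for l
    using d(4)[OF _ dI, of l] L_subset_K that by auto
  let ?x = "extension ?X"
  have x: "?x \<in> carrier HC" by (rule extension_closed[OF I(1)[OF X] Xinv])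
  have xd: "?x delta = ?X" by (rule extension_delta[OF Xinv])
  have ext: "?x f = \<psi> f" if f: "f \<in> ?I" for f
  proof -
    let ?S = "{D. f D \<noteq> 0}"
    have S: "finite ?S" "?S \<subseteq> cosets" using cInd_finite[OF I(1)[OF f]] cIndD[OF I(1)[OF f]] by auto
    have kD: "inv\<^bsub>GL2\<^esub> (rep_of D) \<in> K" if "D \<in> ?S" for D
      using rep_of(3)[of D] S I(2)[OF f, of D] that by (intro K_inv) auto
    have "\<psi> f = \<psi> (\<lambda>C. \<Sum>D\<in>?S. f D * rtrans (inv\<^bsub>GL2\<^esub> (rep_of D)) delta C)"
      using cInd_expand[OF I(1)[OF f] S(1) _ S(2)] by simp
    also have "\<dots> = (\<lambda>C. \<Sum>D\<in>?S. f D * \<psi> (rtrans (inv\<^bsub>GL2\<^esub> (rep_of D)) delta) C)"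
      using lin[OF S(1), of "\<lambda>D. rtrans (inv\<^bsub>GL2\<^esub> (rep_of D)) delta" f] tI[OF kD dI] by blast
    also have "\<dots> = (\<lambda>C. \<Sum>D\<in>?S. f D * rtrans (inv\<^bsub>GL2\<^esub> (rep_of D)) ?X C)"
      using d(4)[OF kD dI] by (intro ext sum.cong refl) simp
    finally show ?thesis using I(1)[OF f] by (simp add: extension_def rtrans_def)
  qed
  have "hecke_K_incl K L \<psi> = ?x"
    unfolding hecke_K_incl_def
  proof (rule the_equality)
    show "?x \<in> carrier HC \<and> (\<forall>f\<in>?I. ?x f = \<psi> f)" using x ext by blast
    fix y assume "y \<in> carrier HC \<and> (\<forall>f\<in>?I. y f = \<psi> f)"
    then show "y = ?x" using HR_eqI[OF _ x, of y] dI xd by auto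
  qed
  then have hf: "hf (hecke_K_incl K L \<psi>) g = \<psi> delta (cs g)" for g by (simp add: hf_def xd)
  then show "hf (hecke_K_incl K L \<psi>) g = \<psi> delta (cs g)" .
  have "g \<in> K" if "\<psi> delta (cs g) \<noteq> 0" for g
    using I(2)[OF X that] cs_self by blast
  then show "supp_K (hecke_K_incl K L \<psi>)"
    using x hf \<open>hecke_K_incl K L \<psi> = ?x\<close> by (simp add: supp_K_def)
qed

section \<open>Passing from \<open>K\<close> to its reduction\<close>

lemma invariants_inflate:
  fixes V :: "('c, 'k^2^2, 'v) rep"
  shows "invariants L (inflate red V) = invariants unip2 V"
proof -
  have "red_mat red ` L = unip2"
  proof
    show "unip2 \<subseteq> red_mat red ` L"
    proof
      fix g :: "'k^2^2" assume "g \<in> unip2"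
      then obtain t where "g = uk t" by (auto simp: unip2_eq)
      then have "g = red_mat red (ut (lf t))" by simp
      moreover have "ut (lf t) \<in> L" using ut_L by simp
      ultimately show "g \<in> red_mat red ` L" by (rule image_eqI)
    qed
  qed (auto simp: iwahori1_def)
  moreover have "invariants L (inflate red V) = invariants (red_mat red ` L) V"
    by (simp add: invariants_def inflate_def)
  ultimately show ?thesis by simp
qed

lemma L_iff: "x \<in> K \<Longrightarrow> x \<in> L \<longleftrightarrow> red_mat red x \<in> unip2"
  by (simp add: iwahori1_def)

lemma cs_eq_K_iff:
  assumes "k \<in> K" "k' \<in> K"
  shows "cs k = cs k' \<longleftrightarrow> red_mat red k ** inv\<^bsub>GL2\<^esub> (red_mat red k') \<in> unip2"
  using cs_eq_iff[of k k'] L_iff[of "k ** inv\<^bsub>GL2\<^esub> k'"] assms by (simp add: red_mat_mult red_mat_inv)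

abbreviation nu :: "('k^2^2) \<times> 'k \<Rightarrow> 'f^2^2" where "nu p \<equiv> n_s ** dl (fst p) ** ut (lf (snd p))"

lemma red_nu: "h \<in> diag2 \<Longrightarrow> nu (h, t) \<in> K \<and> red_mat red (nu (h, t)) = mat2 0 (-1) 1 0 ** h ** uk t"
proof -
  assume h: "h \<in> diag2"
  have "n_s \<in> K" "red_mat red n_s = mat2 0 (-1) 1 0" "ut (lf t) \<in> K" by (simp_all add: n_s_eq K_mat2_iff)
  then show ?thesis using h by (simp add: red_mat_mult del: mat2_mult)
qed

text \<open>Reduction identifies these cosets with the right cosets of \<open>U\<close> in \<Gamma>,
  and the Bruhat decomposition lists the latter by \<open>h\<close> and
  \<open>n_s h u\<close>.\<close>

lemma cosets_in_K:
  "{C. C \<in> cosets \<and> C \<subseteq> K} = (\<lambda>h. cs (dl h)) ` diag2 \<union> (\<lambda>p. cs (nu p)) ` (diag2 \<times> UNIV)"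
  "inj_on (\<lambda>h. cs (dl h)) diag2" "inj_on (\<lambda>p. cs (nu p)) (diag2 \<times> UNIV)"
  "(\<lambda>h. cs (dl h)) ` diag2 \<inter> (\<lambda>p. cs (nu p)) ` (diag2 \<times> UNIV) = {}"
proof -
  have u: "mat2 a b c d \<in> unip2 \<longleftrightarrow> a = 1 \<and> d = 1 \<and> c = 0" for a b c d :: 'k by (rule unip2_mat2_iff)
  show "inj_on (\<lambda>h. cs (dl h)) diag2"
    by (rule inj_onI) (auto simp: cs_eq_K_iff mem_diag2 inv_GL2_mat2 u)
  show "inj_on (\<lambda>p. cs (nu p)) (diag2 \<times> UNIV)"
  proof (rule inj_onI, clarify)
    fix h h' :: "'k^2^2" and t t' assume h: "h \<in> diag2" "h' \<in> diag2"
      and eq: "cs (nu (h, t)) = cs (nu (h', t'))"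
    obtain a d a' d' where ad: "h = mat2 a 0 0 d" "h' = mat2 a' 0 0 d'" "a \<noteq> 0" "d \<noteq> 0" "a' \<noteq> 0" "d' \<noteq> 0"
      using h by (auto simp: mem_diag2)
    have k: "nu (h, t) \<in> K" "nu (h', t') \<in> K" "red_mat red (nu (h, t)) = mat2 0 (- d) a (a * t)"
      "red_mat red (nu (h', t')) = mat2 0 (- d') a' (a' * t')" using red_nu h ad by simp_all
    have "mat2 0 (- d) a (a * t) ** inv\<^bsub>GL2\<^esub> (mat2 0 (- d') a' (a' * t')) \<in> unip2"
      using eq cs_eq_K_iff[OF k(1,2)] unfolding k by (simp only:)
    then have 1: "d = d'" "a = a'" "a * (a' * t') / (d' * a') - a * t * a' / (d' * a') = 0"
      using ad by (auto simp: inv_GL2_mat2 u mult.commute)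
    then have "a * (a' * t') = a * t * a'" using ad by (simp add: field_simps)
    then show "h = h' \<and> t = t'" using 1 ad by simp
  qed
  show "(\<lambda>h. cs (dl h)) ` diag2 \<inter> (\<lambda>p. cs (nu p)) ` (diag2 \<times> UNIV) = {}"
  proof -
    have "cs (dl h) \<noteq> cs (nu (h', t))" if h: "h \<in> diag2" "h' \<in> diag2" for h h' t
    proof
      assume eq: "cs (dl h) = cs (nu (h', t))"
      obtain a d a' d' where ad: "h = mat2 a 0 0 d" "h' = mat2 a' 0 0 d'" "a \<noteq> 0" "d \<noteq> 0" "a' \<noteq> 0" "d' \<noteq> 0"
        using h by (auto simp: mem_diag2)
      have k: "nu (h', t) \<in> K" "red_mat red (nu (h', t)) = mat2 0 (- d') a' (a' * t)" using red_nu h ad by simp_all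
      have "h ** inv\<^bsub>GL2\<^esub> (mat2 0 (- d') a' (a' * t)) \<in> unip2"
        using eq cs_eq_K_iff[OF dl_K[OF h(1)] k(1)] h unfolding k by simp
      then show False using ad by (simp add: inv_GL2_mat2 u)
    qed
    then show ?thesis by auto
  qed
  show "{C. C \<in> cosets \<and> C \<subseteq> K} = (\<lambda>h. cs (dl h)) ` diag2 \<union> (\<lambda>p. cs (nu p)) ` (diag2 \<times> UNIV)"
  proof (intro equalityI subsetI)
    fix C assume "C \<in> {C. C \<in> cosets \<and> C \<subseteq> K}"
    then have C: "C \<in> cosets" "C \<subseteq> K" by auto
    let ?k = "rep_of C"
    have k: "?k \<in> K" "C = cs ?k" using rep_of[OF C(1)] C(2) by auto
    obtain a b c d where g: "red_mat red ?k = mat2 a b c d" by (rule mat2_cases)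
    have D: "a * d - b * c \<noteq> 0" using red_mat_GL2[OF k(1)] unfolding g by (simp add: GL2_mat2_iff)
    show "C \<in> (\<lambda>h. cs (dl h)) ` diag2 \<union> (\<lambda>p. cs (nu p)) ` (diag2 \<times> UNIV)"
    proof (cases "c = 0")
      case True
      let ?h = "mat2 a 0 0 d"
      have h: "?h \<in> diag2" using D True by auto
      then have "red_mat red ?k ** inv\<^bsub>GL2\<^esub> (red_mat red (dl ?h)) \<in> unip2"
        using True D by (simp add: g inv_GL2_mat2 u)
      then have "C = cs (dl ?h)" using cs_eq_K_iff[OF k(1) dl_K[OF h]] k(2) by simp
      then show ?thesis using h by blast
    next
      case False
      let ?d = "a * d / c - b"
      let ?h = "mat2 c 0 0 ?d"
      have d0: "?d \<noteq> 0" using D False by (simp add: field_simps)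
      have h: "?h \<in> diag2" using False d0 by simp
      have r: "nu (?h, d / c) \<in> K" "red_mat red (nu (?h, d / c)) = mat2 0 (- ?d) c d"
        using red_nu[OF h, of "d / c"] False by simp_all
      have "mat2 a b c d ** inv\<^bsub>GL2\<^esub> (mat2 0 (- ?d) c d) = uk (a / c)"
      proof -
        have e: "mat2 a b c d = uk (a / c) ** mat2 0 (- ?d) c d" using False by simp
        have "mat2 0 (- ?d) c d \<in> carrier GL2" using False d0 by (simp add: GL2_mat2_iff)
        then show ?thesis unfolding e by (simp del: mat2_mult)
      qed
      then have "C = cs (nu (?h, d / c))"
        using cs_eq_K_iff[OF k(1) r(1)] k(2) unfolding g r(2) by (simp add: u)
      then show ?thesis using h by blast
    qed
  next
    fix C assume "C \<in> (\<lambda>h. cs (dl h)) ` diag2 \<union> (\<lambda>p. cs (nu p)) ` (diag2 \<times> UNIV)"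
    then obtain k where k: "k \<in> K" "C = cs k"
    proof
      assume "C \<in> (\<lambda>h. cs (dl h)) ` diag2"
      then show thesis using dl_K that by blast
    next
      assume "C \<in> (\<lambda>p. cs (nu p)) ` (diag2 \<times> UNIV)"
      then obtain h t where ht: "h \<in> diag2" "C = cs (nu (h, t))" by blast
      show thesis using that[OF conjunct1[OF red_nu[OF ht(1)]] ht(2)] .
    qed
    then show "C \<in> {C. C \<in> cosets \<and> C \<subseteq> K}" using cs_subset_K[OF k(1)] K_GL2[OF k(1)] by simp
  qed
qed

text \<open>The cosets of torus type act on \<open>v\<close> by scalars. On the others the sum over
  \<open>u\<close> assembles \<open>T_n v\<close>, on which the torus acts through the conjugate
  character; this explains \<open>conj_s chi\<close> in \<open>NN\<close>.\<close>

lemma hecke_K_act_eig: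
  fixes E :: "('c, 'k^2^2, 'v::ab_group_add) rep"
  assumes E: "gamma_rep E" and psi: "\<psi> \<in> hecke_K K L" and chi: "is_char_H chi" and v: "eig E chi v"
  defines "x \<equiv> hecke_K_incl K L \<psi>"
  shows "hecke_K_act K L (inflate red E) v \<psi> =
    scl E (AA chi one1 one1 x) v + scl E (NN (conj_s chi) one1 one1 x) (TT E v)"
proof -
  interpret gamma_rep E by (rule E)
  have x: "supp_K x" "x \<in> carrier HC" "\<psi> delta (cs g) = hf x g" for g
    using hecke_K_incl_supp[OF psi] by (auto simp: x_def supp_K_def)
  let ?F = "\<lambda>C. scl E (\<psi> delta C) (act E (red_mat red (inv\<^bsub>GL2\<^esub> (rep_of C))) v)"
  have F: "?F (cs k) = scl E (hf x k) (act E (inv\<^bsub>GL2\<^esub> (red_mat red k)) v)" if k: "k \<in> K" for k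
  proof -
    have C: "cs k \<in> cosets" using K_GL2[OF k] by simp
    obtain l where l: "l \<in> L" "rep_of (cs k) = l ** k" using rep_of(3)[OF C] by (auto simp: mem_cs)
    have lK: "l \<in> K" using l L_subset_K by auto
    have "red_mat red (inv\<^bsub>GL2\<^esub> (rep_of (cs k))) = inv\<^bsub>GL2\<^esub> (red_mat red k) ** red_mat red (inv\<^bsub>GL2\<^esub> l)"
      unfolding l(2) using k lK by (simp add: inv_GL2_mult red_mat_mult red_mat_inv)
    moreover have "red_mat red (inv\<^bsub>GL2\<^esub> l) \<in> unip2" using L_inv[OF l(1)] L_iff[OF K_inv[OF lK]] by simp
    moreover have "act E u v = v" if "u \<in> unip2" for u using eigD(1)[OF v] that by (simp add: invariants_def)
    ultimately have "act E (red_mat red (inv\<^bsub>GL2\<^esub> (rep_of (cs k)))) v = act E (inv\<^bsub>GL2\<^esub> (red_mat red k)) v"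
      using act_mult[of "inv\<^bsub>GL2\<^esub> (red_mat red k)" "red_mat red (inv\<^bsub>GL2\<^esub> l)" v] k lK by simp
    then show ?thesis using x(3) by simp
  qed
  have hv: "act E (inv\<^bsub>GL2\<^esub> h) v = scl E (inverse (chi h)) v" if "h \<in> diag2" for h
    using eigD(2)[OF v, of "inv\<^bsub>GL2\<^esub> h"] char_H_inv[OF chi that] that by simp
  have hTv: "act E (inv\<^bsub>GL2\<^esub> h) (TT E v) = scl E (inverse (conj_s chi h)) (TT E v)" if "h \<in> diag2" for h
    using eigD(2)[OF eig_TT[OF v], of "inv\<^bsub>GL2\<^esub> h"] char_H_inv[OF is_char_H_conj_s[OF chi] that] that by simp
  have "hecke_K_act K L (inflate red E) v \<psi> = (\<Sum>C\<in>{C. C \<in> cosets \<and> C \<subseteq> K}. ?F C)"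
    by (simp add: hecke_K_act_def inflate_def delta_eq)
  also have "\<dots> = (\<Sum>C\<in>(\<lambda>h. cs (dl h)) ` diag2. ?F C) + (\<Sum>C\<in>(\<lambda>p. cs (nu p)) ` (diag2 \<times> UNIV). ?F C)"
    unfolding cosets_in_K(1) by (rule sum.union_disjoint) (simp_all add: cosets_in_K(4))
  also have "(\<Sum>C\<in>(\<lambda>h. cs (dl h)) ` diag2. ?F C) = (\<Sum>h\<in>diag2. ?F (cs (dl h)))"
    by (rule sum.reindex[OF cosets_in_K(2), unfolded comp_def])
  also have "\<dots> = (\<Sum>h\<in>diag2. scl E (inverse (chi h) * hf x (dl h)) v)"
  proof (intro sum.cong refl)
    fix h :: "'k^2^2" assume h: "h \<in> diag2"
    show "?F (cs (dl h)) = scl E (inverse (chi h) * hf x (dl h)) v"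
      unfolding F[OF dl_K[OF h]] red_dl[OF h] hv[OF h] by (simp add: mult.commute)
  qed
  also have "\<dots> = scl E (AA chi one1 one1 x) v"
    unfolding supp_K_AA_NN(1)[OF x(1)] by (simp add: V.scale_sum_left)
  also have "(\<Sum>C\<in>(\<lambda>p. cs (nu p)) ` (diag2 \<times> UNIV). ?F C) = (\<Sum>p\<in>diag2 \<times> UNIV. ?F (cs (nu p)))"
    by (rule sum.reindex[OF cosets_in_K(3), unfolded comp_def])
  also have "\<dots> = (\<Sum>h\<in>diag2. \<Sum>t\<in>UNIV. ?F (cs (nu (h, t))))"
    by (simp only: sum.cartesian_product split_def prod.collapse)
  also have "\<dots> = (\<Sum>h\<in>diag2. scl E (inverse (conj_s chi h) * hf x (n_s ** dl h)) (TT E v))"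
  proof (intro sum.cong refl)
    fix h :: "'k^2^2" assume h: "h \<in> diag2"
    obtain a d where ad: "h = mat2 a 0 0 d" "a \<noteq> 0" "d \<noteq> 0" using h by (auto simp: mem_diag2)
    have i: "inv\<^bsub>GL2\<^esub> h = mat2 (inverse a) 0 0 (inverse d)" using ad by (simp add: inv_GL2_mat2 field_simps)
    have hG: "inv\<^bsub>GL2\<^esub> h \<in> carrier GL2" using diag2_GL2[OF h] by simp
    have "?F (cs (nu (h, t))) = scl E (hf x (n_s ** dl h)) (act E (uk (- t) ** inv\<^bsub>GL2\<^esub> h ** nik) v)" for t
    proof -
      have k: "nu (h, t) \<in> K" "red_mat red (nu (h, t)) = mat2 0 (-1) 1 0 ** h ** uk t" using red_nu[OF h] by auto
      have "inv\<^bsub>GL2\<^esub> (mat2 0 (-1) 1 0 ** h ** uk t) = uk (- t) ** inv\<^bsub>GL2\<^esub> h ** nik"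
        by (rule inv_GL2_unique) (use ad in \<open>simp_all add: inv_GL2_mat2 GL2_mat2_iff mat_1_eq_mat2\<close>)
      then have "?F (cs (nu (h, t))) = scl E (hf x (nu (h, t))) (act E (uk (- t) ** inv\<^bsub>GL2\<^esub> h ** nik) v)"
        unfolding F[OF k(1)] k(2) by (simp only:)
      \<comment> \<open>Right invariance of the kernel removes the dependence on \<open>t\<close>,
        so the coefficient can leave the sum.\<close>
      also have "hf x (nu (h, t)) = hf x (n_s ** dl h)" using x(2) by simp
      finally show ?thesis .
    qed
    then have "(\<Sum>t\<in>UNIV. ?F (cs (nu (h, t)))) =
        (\<Sum>t\<in>UNIV. scl E (hf x (n_s ** dl h)) (act E (uk (- t) ** inv\<^bsub>GL2\<^esub> h ** nik) v))" by (rule sum.cong[OF refl])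
    also have "\<dots> = scl E (hf x (n_s ** dl h)) (\<Sum>t\<in>UNIV. act E (uk (- t) ** inv\<^bsub>GL2\<^esub> h ** nik) v)"
      by (simp only: V.scale_sum_right)
    also have "(\<Sum>t\<in>UNIV. act E (uk (- t) ** inv\<^bsub>GL2\<^esub> h ** nik) v) = (\<Sum>t\<in>UNIV. act E (inv\<^bsub>GL2\<^esub> h ** (uk t ** nik)) v)"
      by (rule sum.reindex_bij_witness[where i = "\<lambda>t. - (t * d / a)" and j = "\<lambda>t. - (t * a / d)"])
        (use ad in \<open>simp_all add: inv_GL2_mat2 field_simps\<close>)
    also have "\<dots> = act E (inv\<^bsub>GL2\<^esub> h) (TT E v)"
      unfolding TT_def using hG by (simp add: act_sum act_mult del: mat2_mult)
    finally show "(\<Sum>t\<in>UNIV. ?F (cs (nu (h, t)))) = scl E (inverse (conj_s chi h) * hf x (n_s ** dl h)) (TT E v)"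
      unfolding hTv[OF h] by (simp add: mult.commute)
  qed
  also have "\<dots> = scl E (NN (conj_s chi) one1 one1 x) (TT E v)"
    unfolding supp_K_AA_NN(5)[OF x(1)] by (simp add: V.scale_sum_left)
  finally show ?thesis .
qed

lemma hecke_K_act_linear:
  fixes E :: "('c, 'k^2^2, 'v::ab_group_add) rep"
  assumes E: "gamma_rep E"
  shows "hecke_K_act K L (inflate red E) (scl E a v + scl E b w) \<psi> =
    scl E a (hecke_K_act K L (inflate red E) v \<psi>) + scl E b (hecke_K_act K L (inflate red E) w \<psi>)"
proof -
  interpret gamma_rep E by (rule E)
  have g: "red_mat red (inv\<^bsub>GL2\<^esub> (rep_of C)) \<in> carrier GL2" if "C \<in> cosets" "C \<subseteq> K" for C
    using rep_of(3)[OF that(1)] that(2) by (intro red_mat_GL2 K_inv) auto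
  show ?thesis
    unfolding hecke_K_act_def inflate_def rep.simps V.scale_sum_right sum.distrib[symmetric]
    using g by (intro sum.cong refl) (simp add: act_add act_scale V.scale_right_distrib mult.commute)
qed

lemma hecke_K_act_rep_sum:
  fixes E1 :: "('c, 'k^2^2, 'v::ab_group_add) rep" and E2 :: "('c, 'k^2^2, 'w::ab_group_add) rep"
  shows "hecke_K_act K L (inflate red (rep_sum E1 E2)) (v, w) \<psi> =
    (hecke_K_act K L (inflate red E1) v \<psi>, hecke_K_act K L (inflate red E2) w \<psi>)"
proof -
  have "(\<Sum>C\<in>S. (f C, g C)) = (sum f S, sum g S)" for S and f :: "('f^2^2) set \<Rightarrow> 'v" and g :: "_ \<Rightarrow> 'w"
    by (induction S rule: infinite_finite_induct) (auto simp: zero_prod_def)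
  then show ?thesis by (simp add: hecke_K_act_def inflate_def rep_sum_def)
qed

lemma invariants_rep_sum:
  fixes E1 :: "('c, 'k^2^2, 'v::ab_group_add) rep" and E2 :: "('c, 'k^2^2, 'w::ab_group_add) rep"
  shows "invariants L (inflate red (rep_sum E1 E2)) = invariants unip2 E1 \<times> invariants unip2 E2"
  unfolding invariants_inflate by (auto simp: invariants_def rep_sum_def)

end

lemma gamma_repI:
  fixes E :: "('c::field, 'k::{field,finite}^2^2, 'v::ab_group_add) rep"
  shows "CARD('k) = CHAR('k) \<Longrightarrow> CHAR('c) = CHAR('k) \<Longrightarrow> is_rep GL2 E \<Longrightarrow> gamma_rep E"
  by (simp add: gamma_rep_def)

section \<open>Matching bases and extending the action\<close>

lemma extension_self:
  fixes val :: "'f::field \<Rightarrow> int" and red :: "'f \<Rightarrow> 'k::{field,finite}" and chi :: "'k^2^2 \<Rightarrow> 'c::field"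
    and \<rho>1 :: "('c, 'k^2^2, 'v1::ab_group_add) rep" and \<rho>2 :: "('c, 'k^2^2, 'v2::ab_group_add) rep"
    and E1 :: "('c, 'k^2^2, 'w1::ab_group_add) rep" and E2 :: "('c, 'k^2^2, 'w2::ab_group_add) rep"
  assumes H: "mod_p_hecke TYPE('c) val red varpi"
    and card: "CARD('k) = CHAR('k)" "CHAR('c) = CHAR('k)"
    and chi: "is_char_H chi" "self_conj chi"
    and E: "injective_envelope GL2 \<rho>1 E1" "injective_envelope GL2 \<rho>2 E2"
    and rho: "is_rho chi {} \<rho>1" "is_rho chi {s_mat} \<rho>2"
  shows "\<exists>ract ractM.
     extends_hecke_K val red (inflate red (rep_sum E1 E2)) ract \<and>
     is_M_gamma val red varpi chi ractM \<and>
     right_module_iso (hecke_ring (iwahori1 val red))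
       (add_struct (invariants (iwahori1 val red) (inflate red (rep_sum E1 E2)))) ract
       (add_struct UNIV) ractM"
proof -
  interpret mod_p_hecke val red varpi "TYPE('c)" by (rule H)
  have r: "is_rep GL2 \<rho>1" "is_rep GL2 \<rho>2" "is_rep GL2 E1" "is_rep GL2 E2"
    using E by (auto simp: injective_envelope_def injective_rep_def)
  interpret E1: gamma_rep E1 by (rule gamma_repI[OF card r(3)])
  interpret E2: gamma_rep E2 by (rule gamma_repI[OF card r(4)])
  interpret R1: gamma_rep \<rho>1 by (rule gamma_repI[OF card r(1)])
  obtain f1 where f1: "f1 \<noteq> 0" "eig \<rho>1 chi f1" "TT \<rho>1 f1 = scl \<rho>1 (-1) f1"
    "\<And>v. v \<in> invariants unip2 \<rho>1 \<Longrightarrow> \<exists>a. v = scl \<rho>1 a f1"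
    using rho_steinberg[OF card chi(1) r(1) rho(1) chi(2)] by (metis R1.V.scale_minus_left R1.V.scale_one)
  interpret R2: gamma_rep \<rho>2 by (rule gamma_repI[OF card r(2)])
  obtain f2 where f2: "f2 \<noteq> 0" "eig \<rho>2 chi f2" "TT \<rho>2 f2 = scl \<rho>2 0 f2"
    "\<And>v. v \<in> invariants unip2 \<rho>2 \<Longrightarrow> \<exists>a. v = scl \<rho>2 a f2"
    using rho_det[OF card chi(1) r(2) rho(2) chi(2)] by (metis R2.V.scale_zero_left)
  obtain e1 where e1: "e1 \<noteq> 0" "eig E1 chi e1" "TT E1 e1 = scl E1 (-1) e1"
    "\<And>psi v lam. is_char_H psi \<Longrightarrow> eig E1 psi v \<Longrightarrow> TT E1 v = scl E1 lam v \<Longrightarrow> \<exists>a. v = scl E1 a e1"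
    using envelope_line[OF card E(1) f1] by blast
  obtain e2 where e2: "e2 \<noteq> 0" "eig E2 chi e2" "TT E2 e2 = scl E2 0 e2"
    "\<And>psi v lam. is_char_H psi \<Longrightarrow> eig E2 psi v \<Longrightarrow> TT E2 v = scl E2 lam v \<Longrightarrow> \<exists>a. v = scl E2 a e2"
    using envelope_line[OF card E(2) f2] by blast
  let ?X = "invariants unip2 E1 \<times> invariants unip2 E2"
  \<comment> \<open>The line in the Steinberg envelope plays \<open>v_1\<close>, with
    \<open>T_n\<close>-eigenvalue \<open>-1\<close>; the line in the other envelope plays
    \<open>v_2\<close>, with eigenvalue \<open>0\<close>.\<close>
  define g where "g p = (scl E1 (fst p) e1, scl E2 (snd p) e2)" for p
  have gX: "g p \<in> ?X" for p
    using E1.eigD(1)[OF e1(2)] E2.eigD(1)[OF e2(2)] by (simp add: g_def E1.Uinv_scale E2.Uinv_scale)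
  have "inj g" using e1(1) e2(1) by (auto simp: inj_def g_def E1.V.scale_cancel_right E2.V.scale_cancel_right)
  moreover have "?X \<subseteq> range g"
  proof
    fix p assume "p \<in> ?X"
    then have p: "fst p \<in> invariants unip2 E1" "snd p \<in> invariants unip2 E2" by (simp_all add: mem_Times_iff)
    obtain a where "fst p = scl E1 a e1"
    proof -
      have "\<exists>a. fst p = scl E1 a e1" by (rule E1.invariants_line[OF _ chi(2) e1(2) p(1)]) (rule e1(4))
      then show thesis using that by blast
    qed
    moreover obtain b where "snd p = scl E2 b e2"
    proof -
      have "\<exists>b. snd p = scl E2 b e2" by (rule E2.invariants_line[OF _ chi(2) e2(2) p(2)]) (rule e2(4))
      then show thesis using that by blast
    qed
    ultimately have "p = g (a, b)" by (simp add: g_def prod_eq_iff)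
    then show "p \<in> range g" by blast
  qed
  ultimately have g: "bij_betw g UNIV ?X" unfolding bij_betw_def using gX by blast
  let ?f = "inv_into UNIV g"
  have f: "bij_betw ?f ?X UNIV" by (rule bij_betw_inv_into[OF g])
  have fg: "?f (g p) = p" for p using g by (simp add: bij_betw_def inv_into_f_f)
  have gf: "\<exists>p. x = g p" if "x \<in> ?X" for x using g that unfolding bij_betw_def by blast
  have g_add: "g (p + q) = g p + g q" for p q
    by (simp add: g_def E1.V.scale_left_distrib E2.V.scale_left_distrib)
  have g_zero: "g 0 = 0" and g_neg: "g (- p) = - g p" for p by (simp_all add: g_def zero_prod_def)
  have X: "0 \<in> ?X" "x \<in> ?X \<Longrightarrow> y \<in> ?X \<Longrightarrow> x + y \<in> ?X" "x \<in> ?X \<Longrightarrow> - x \<in> ?X" for x y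
    using gX gf g_add g_zero g_neg by metis+
  have f_add: "?f (x + y) = ?f x + ?f y" if "x \<in> ?X" "y \<in> ?X" for x y
    using gf[OF that(1)] gf[OF that(2)] fg g_add by metis
  have M: "right_module HC (add_struct UNIV) (M_act chi)" by (rule right_module_M[OF chi])
  let ?ract = "\<lambda>x r. inv_into ?X ?f (M_act chi (?f x) r)"
  have f': "bij_betw ?f ?X (carrier (add_struct UNIV))" using f by (simp only: add_struct_simps)
  have f_add': "?f (x + y) = ?f x \<oplus>\<^bsub>add_struct UNIV\<^esub> ?f y" if "x \<in> ?X" "y \<in> ?X" for x y
    using f_add[OF that] by (simp only: add_struct_simps)
  have tr: "right_module HC (add_struct ?X) ?ract"
    "right_module_iso HC (add_struct ?X) ?ract (add_struct UNIV) (M_act chi)"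
    "\<And>x y r. x \<in> ?X \<Longrightarrow> y \<in> ?X \<Longrightarrow> ?f y = M_act chi (?f x) r \<Longrightarrow> ?ract x r = y"
    using right_module_transport[OF M f' f_add' X] by blast+
  have inv: "invariants L (inflate red (rep_sum E1 E2)) = ?X" by (rule invariants_rep_sum)
  have act: "?ract v (hecke_K_incl K L \<psi>) = hecke_K_act K L (inflate red (rep_sum E1 E2)) v \<psi>"
    if psi: "\<psi> \<in> hecke_K K L" and v: "v \<in> ?X" for \<psi> v
  proof -
    let ?x = "hecke_K_incl K L \<psi>"
    obtain p where p: "v = g p" using gf[OF v] by blast
    have sx: "supp_K ?x" by (rule hecke_K_incl_supp[OF psi])
    have cong: "AA (conj_s chi) P Q x = AA chi P Q x" "NN (conj_s chi) P Q x = NN chi P Q x" for P Q x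
      using conj_s_self[OF chi] by (intro AA_cong NN_cong; simp)+
    \<comment> \<open>Support in \<open>K\<close> makes the matrix diagonal: the mixed entries
      vanish by parity, and \<open>NN\<close> is lost in the second diagonal entry.\<close>
    have m: "M_act chi p ?x = (fst p * (AA chi one1 one1 ?x - NN chi one1 one1 ?x), snd p * AA chi one1 one1 ?x)"
      unfolding M_act_def RR_def by (simp add: supp_K_AA_NN(2-4,6-8)[OF sx] cong)
    have 1: "hecke_K_act K L (inflate red E1) (scl E1 a e1) \<psi> = scl E1 (a * (AA chi one1 one1 ?x - NN chi one1 one1 ?x)) e1" for a
      using hecke_K_act_linear[OF E1.gamma_rep_axioms, of a e1 0 0 \<psi>]
        hecke_K_act_eig[OF E1.gamma_rep_axioms psi chi(1) e1(2)]
      by (simp add: e1(3) cong E1.V.scale_right_distrib E1.V.scale_left_distrib E1.V.scale_left_diff_distrib algebra_simps)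
    have 2: "hecke_K_act K L (inflate red E2) (scl E2 a e2) \<psi> = scl E2 (a * AA chi one1 one1 ?x) e2" for a
      using hecke_K_act_linear[OF E2.gamma_rep_axioms, of a e2 0 0 \<psi>]
        hecke_K_act_eig[OF E2.gamma_rep_axioms psi chi(1) e2(2)]
      by (simp add: e2(3))
    have eq: "hecke_K_act K L (inflate red (rep_sum E1 E2)) v \<psi> = g (M_act chi p ?x)"
      unfolding p g_def hecke_K_act_rep_sum 1 2 m by simp
    show ?thesis unfolding eq by (rule tr(3)[OF v gX]) (simp add: fg p)
  qed
  show ?thesis
    by (intro exI[of _ ?ract] exI[of _ "M_act chi"])
      (use tr(1,2) act is_M_gamma_M_act[OF chi] in \<open>simp add: extends_hecke_K_def inv\<close>)
qed

text \<open>The class of \<open>1\<close> in \<open>L_\<gamma>\<close> has character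
  \<open>chi\<close> and is not killed by \<open>T_n\<close>. It must therefore correspond to the
  vector above the socle of \<open>E2\<close>, not to one in \<open>E1\<close>.\<close>

lemma extension_nonself:
  fixes val :: "'f::field \<Rightarrow> int" and red :: "'f \<Rightarrow> 'k::{field,finite}" and chi :: "'k^2^2 \<Rightarrow> 'c::field"
    and \<rho>1 :: "('c, 'k^2^2, 'v1::ab_group_add) rep" and \<rho>2 :: "('c, 'k^2^2, 'v2::ab_group_add) rep"
    and E1 :: "('c, 'k^2^2, 'w1::ab_group_add) rep" and E2 :: "('c, 'k^2^2, 'w2::ab_group_add) rep"
  assumes H: "mod_p_hecke TYPE('c) val red varpi"
    and card: "CARD('k) = CHAR('k)" "CHAR('c) = CHAR('k)"
    and chi: "is_char_H chi" "\<not> self_conj chi"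
    and E: "injective_envelope GL2 \<rho>1 E1" "injective_envelope GL2 \<rho>2 E2"
    and rho: "is_rho chi {} \<rho>1" "is_rho (conj_s chi) {} \<rho>2"
  shows "\<exists>ract.
     extends_hecke_K val red (inflate red (rep_sum E1 E2)) ract \<and>
     right_module_iso (hecke_ring (iwahori1 val red))
       (add_struct (invariants (iwahori1 val red) (inflate red (rep_sum E1 E2)))) ract
       (L_gamma val red varpi chi) (L_gamma_act val red varpi chi)"
proof -
  interpret mod_p_hecke val red varpi "TYPE('c)" by (rule H)
  let ?chi = "conj_s chi"
  have chi': "is_char_H ?chi" "\<not> self_conj ?chi"
  proof -
    show "is_char_H ?chi" using chi by simp
    show "\<not> self_conj ?chi" using chi(2) conj_s_conj_s[of _ chi] by (auto simp: self_conj_def) metis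
  qed
  have cc: "conj_s ?chi h = chi h" if "h \<in> diag2" for h using conj_s_conj_s[OF that] .
  have r: "is_rep GL2 \<rho>1" "is_rep GL2 \<rho>2" "is_rep GL2 E1" "is_rep GL2 E2"
    and inj: "injective_rep GL2 E1" "injective_rep GL2 E2"
    using E by (auto simp: injective_envelope_def injective_rep_def)
  interpret E1: gamma_rep E1 by (rule gamma_repI[OF card r(3)])
  interpret E2: gamma_rep E2 by (rule gamma_repI[OF card r(4)])
  interpret R1: gamma_rep \<rho>1 by (rule gamma_repI[OF card r(1)])
  interpret R2: gamma_rep \<rho>2 by (rule gamma_repI[OF card r(2)])
  obtain f1 where f1: "f1 \<noteq> 0" "eig \<rho>1 chi f1" "TT \<rho>1 f1 = scl \<rho>1 0 f1"
    "\<And>v. v \<in> invariants unip2 \<rho>1 \<Longrightarrow> \<exists>a. v = scl \<rho>1 a f1"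
    using rho_nonself[OF card chi(1) r(1) rho(1) chi(2)] by (metis R1.V.scale_zero_left)
  obtain f2 where f2: "f2 \<noteq> 0" "eig \<rho>2 ?chi f2" "TT \<rho>2 f2 = scl \<rho>2 0 f2"
    "\<And>v. v \<in> invariants unip2 \<rho>2 \<Longrightarrow> \<exists>a. v = scl \<rho>2 a f2"
    using rho_nonself[OF card chi'(1) r(2) rho(2) chi'(2)] by (metis R2.V.scale_zero_left)
  obtain e1 where e1: "e1 \<noteq> 0" "eig E1 chi e1" "TT E1 e1 = scl E1 0 e1"
    "\<And>psi v lam. is_char_H psi \<Longrightarrow> eig E1 psi v \<Longrightarrow> TT E1 v = scl E1 lam v \<Longrightarrow> \<exists>a. v = scl E1 a e1"
    using envelope_line[OF card E(1) f1] by blast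
  obtain e2 where e2: "e2 \<noteq> 0" "eig E2 ?chi e2" "TT E2 e2 = scl E2 0 e2"
    "\<And>psi v lam. is_char_H psi \<Longrightarrow> eig E2 psi v \<Longrightarrow> TT E2 v = scl E2 lam v \<Longrightarrow> \<exists>a. v = scl E2 a e2"
    using envelope_line[OF card E(2) f2] by blast
  have T1: "TT E1 e1 = 0" and T2: "TT E2 e2 = 0" using e1(3) e2(3) by simp_all
  obtain w1 where w1: "eig E1 ?chi w1" "TT E1 w1 = e1"
    using injective_lift[OF inj(1) card chi e1(2) T1] by blast
  obtain w2 where w2': "eig E2 (conj_s ?chi) w2" "TT E2 w2 = e2"
    using injective_lift[OF inj(2) card chi' e2(2) T2] by blast
  have w2: "eig E2 chi w2" by (rule E2.eig_cong[OF w2'(1) cc])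
  let ?X = "invariants unip2 E1 \<times> invariants unip2 E2"
  text \<open>The basis \<open>w\<^sub>2, w\<^sub>1, e\<^sub>2, e\<^sub>1\<close> of the invariants corresponds to \<open>e\<^sub>\<chi>, e\<^sub>\<chi> T\<^sub>\<Pi>, e\<^sub>\<chi> T\<^sub>n, e\<^sub>\<chi> T\<^sub>\<Pi> T\<^sub>n\<close>.\<close>
  define g where "g v = (case v of (p, q, r, s) \<Rightarrow> (scl E1 s e1 + scl E1 q w1, scl E2 r e2 + scl E2 p w2))" for v
  have gX: "g v \<in> ?X" for v
    using E1.eigD(1)[OF e1(2)] E2.eigD(1)[OF e2(2)] E1.eigD(1)[OF w1(1)] E2.eigD(1)[OF w2]
    by (simp add: g_def E1.Uinv_scale E2.Uinv_scale E1.Uinv_add E2.Uinv_add split: prod.split)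
  \<comment> \<open>Applying \<open>T_n\<close> kills \<open>e1\<close> and sends \<open>w1\<close>
    to \<open>e1\<close>, so it extracts the coefficient \<open>q\<close> first.\<close>
  have ind1: "s = 0 \<and> q = 0" if "scl E1 s e1 + scl E1 q w1 = 0" for s q
  proof -
    have "TT E1 (scl E1 s e1 + scl E1 q w1) = scl E1 q e1" by (simp add: E1.TT_add E1.TT_scale T1 w1(2))
    then have "q = 0" using that e1(1) by simp
    then show ?thesis using that e1(1) by simp
  qed
  have ind2: "r = 0 \<and> p = 0" if "scl E2 r e2 + scl E2 p w2 = 0" for r p
  proof -
    have "TT E2 (scl E2 r e2 + scl E2 p w2) = scl E2 p e2" by (simp add: E2.TT_add E2.TT_scale T2 w2'(2))
    then have "p = 0" using that e2(1) by simp
    then show ?thesis using that e2(1) by simp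
  qed
  have g_add: "g (v + w) = g v + g w" for v w
    by (cases v; cases w) (simp add: g_def E1.V.scale_left_distrib E2.V.scale_left_distrib algebra_simps)
  have g_neg: "g (- v) = - g v" for v
    by (cases v) (simp add: g_def)
  have g0: "v = 0" if "g v = 0" for v
    using that ind1 ind2 by (cases v) (auto simp: g_def zero_prod_def)
  have "inj g"
  proof (rule injI)
    fix v w assume "g v = g w"
    then have "g (v + - w) = 0" by (simp only: g_add g_neg) simp
    then show "v = w" using g0 by fastforce
  qed
  moreover have "?X \<subseteq> range g"
  proof
    fix p assume "p \<in> ?X"
    then have p: "fst p \<in> invariants unip2 E1" "snd p \<in> invariants unip2 E2" by (simp_all add: mem_Times_iff)
    obtain s q where "fst p = scl E1 s e1 + scl E1 q w1"
    proof -
      have "\<exists>a b. fst p = scl E1 a e1 + scl E1 b w1"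
        by (rule E1.invariants_plane[OF _ e1(2) w1 chi(1) p(1)]) (rule e1(4))
      then show thesis using that by blast
    qed
    moreover obtain r t where "snd p = scl E2 r e2 + scl E2 t w2"
    proof -
      have "\<exists>a b. snd p = scl E2 a e2 + scl E2 b w2"
        by (rule E2.invariants_plane[OF _ e2(2) w2' chi'(1) p(2)]) (rule e2(4))
      then show thesis using that by blast
    qed
    ultimately have "p = g (t, q, r, s)" by (simp add: g_def prod_eq_iff)
    then show "p \<in> range g" by blast
  qed
  ultimately have g: "bij_betw g UNIV ?X" unfolding bij_betw_def using gX by blast
  let ?Lg = "L_gamma val red varpi chi" and ?Lact = "L_gamma_act val red varpi chi"
  let ?c = "\<lambda>v. cl chi (gens v)"
  let ?f = "?c \<circ> inv_into UNIV g"
  have f: "bij_betw ?f ?X (carrier ?Lg)"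
    by (rule bij_betw_trans[OF bij_betw_inv_into[OF g] cl_gens_bij[OF chi]])
  have fg: "?f (g p) = ?c p" for p using g by (simp add: bij_betw_def inv_into_f_f)
  have gf: "\<exists>p. x = g p" if "x \<in> ?X" for x using g that unfolding bij_betw_def by blast
  have g_zero: "g 0 = 0" by (simp add: g_def zero_prod_def)
  have X: "0 \<in> ?X" "x \<in> ?X \<Longrightarrow> y \<in> ?X \<Longrightarrow> x + y \<in> ?X" "x \<in> ?X \<Longrightarrow> - x \<in> ?X" for x y
    using gX gf g_add g_zero g_neg by metis+
  have f_add: "?f (x + y) = ?f x \<oplus>\<^bsub>?Lg\<^esub> ?f y" if xy: "x \<in> ?X" "y \<in> ?X" for x y
  proof -
    obtain p where p: "x = g p" using gf[OF xy(1)] by blast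
    obtain q where q: "y = g q" using gf[OF xy(2)] by blast
    show ?thesis unfolding p q g_add[symmetric] fg by (rule cl_gens_add[OF chi])
  qed
  have M: "right_module HC ?Lg ?Lact" by (rule right_module_L_gamma[OF chi])
  let ?ract = "\<lambda>x r. inv_into ?X ?f (?Lact (?f x) r)"
  have tr: "right_module HC (add_struct ?X) ?ract"
    "right_module_iso HC (add_struct ?X) ?ract ?Lg ?Lact"
    "\<And>x y r. x \<in> ?X \<Longrightarrow> y \<in> ?X \<Longrightarrow> ?f y = ?Lact (?f x) r \<Longrightarrow> ?ract x r = y"
    using right_module_transport[OF M f f_add X] by blast+
  have inv: "invariants L (inflate red (rep_sum E1 E2)) = ?X" by (rule invariants_rep_sum)
  have act: "?ract v (hecke_K_incl K L \<psi>) = hecke_K_act K L (inflate red (rep_sum E1 E2)) v \<psi>"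
    if psi: "\<psi> \<in> hecke_K K L" and v: "v \<in> ?X" for \<psi> v
  proof -
    let ?x = "hecke_K_incl K L \<psi>"
    obtain p q r s where p: "v = g (p, q, r, s)" using gf[OF v] by (metis prod_cases4)
    have sx: "supp_K ?x" by (rule hecke_K_incl_supp[OF psi])
    let ?a = "AA chi one1 one1 ?x" and ?a' = "AA ?chi one1 one1 ?x"
      and ?b = "NN chi one1 one1 ?x" and ?b' = "NN ?chi one1 one1 ?x"
    have cong: "NN (conj_s ?chi) one1 one1 ?x = ?b" by (rule NN_cong) (rule cc)
    have "hecke_K_act K L (inflate red E1) (scl E1 s e1 + scl E1 q w1) \<psi> =
        scl E1 (q * ?b + s * ?a) e1 + scl E1 (q * ?a') w1"
      unfolding hecke_K_act_linear[OF E1.gamma_rep_axioms] hecke_K_act_eig[OF E1.gamma_rep_axioms psi chi(1) e1(2)]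
        hecke_K_act_eig[OF E1.gamma_rep_axioms psi chi'(1) w1(1)]
      by (simp add: T1 w1(2) cong E1.V.scale_right_distrib E1.V.scale_left_distrib)
    moreover have "hecke_K_act K L (inflate red E2) (scl E2 r e2 + scl E2 p w2) \<psi> =
        scl E2 (p * ?b' + r * ?a') e2 + scl E2 (p * ?a) w2"
      unfolding hecke_K_act_linear[OF E2.gamma_rep_axioms] hecke_K_act_eig[OF E2.gamma_rep_axioms psi chi'(1) e2(2)]
        hecke_K_act_eig[OF E2.gamma_rep_axioms psi chi(1) w2]
      by (simp add: T2 w2'(2) E2.V.scale_right_distrib E2.V.scale_left_distrib)
    ultimately have eq: "hecke_K_act K L (inflate red (rep_sum E1 E2)) v \<psi> =
        g (p * ?a, q * ?a', p * ?b' + r * ?a', q * ?b + s * ?a)"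
      unfolding p g_def prod.case hecke_K_act_rep_sum by simp
    show ?thesis unfolding eq
    proof (rule tr(3)[OF v gX])
      show "?f (g (p * ?a, q * ?a', p * ?b' + r * ?a', q * ?b + s * ?a)) = ?Lact (?f v) ?x"
        unfolding p fg cl_gens_act[OF chi sx] ..
    qed
  qed
  show ?thesis
    by (intro exI[of _ ?ract]) (use tr(1,2) act in \<open>simp add: extends_hecke_K_def inv\<close>)
qed

theorem proposition4p15:
  fixes val :: "'f::field \<Rightarrow> int"
    and red :: "'f \<Rightarrow> 'k::{field,finite}"
    and varpi :: 'f
    and chi :: "'k^2^2 \<Rightarrow> 'c::alg_closed_field"
    and \<rho>1 :: "('c, 'k^2^2, 'v1::ab_group_add) rep"
    and \<rho>2 :: "('c, 'k^2^2, 'v2::ab_group_add) rep"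
    and E1 :: "('c, 'k^2^2, 'w1::ab_group_add) rep"
    and E2 :: "('c, 'k^2^2, 'w2::ab_group_add) rep"
  assumes F: "nonarch_local_field val red varpi"
    and q_eq_p: "CARD('k) = CHAR('k)"
    and coeffs: "alg_closure_of_Fp CHAR('k) TYPE('c)"
    and chi: "is_char_H chi"
    and E1: "injective_envelope GL2 \<rho>1 E1"
    and E2: "injective_envelope GL2 \<rho>2 E2"
  shows
    "(self_conj chi \<and> is_rho chi {} \<rho>1 \<and> is_rho chi {s_mat} \<rho>2 \<longrightarrow>
        (\<exists>ract ractM.
           extends_hecke_K val red (inflate red (rep_sum E1 E2)) ract \<and>
           is_M_gamma val red varpi chi ractM \<and>
           right_module_iso (hecke_ring (iwahori1 val red))
             (add_struct (invariants (iwahori1 val red) (inflate red (rep_sum E1 E2)))) ract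
             (add_struct UNIV) ractM)) \<and>
     (\<not> self_conj chi \<and> is_rho chi {} \<rho>1 \<and> is_rho (conj_s chi) {} \<rho>2 \<longrightarrow>
        (\<exists>ract.
           extends_hecke_K val red (inflate red (rep_sum E1 E2)) ract \<and>
           right_module_iso (hecke_ring (iwahori1 val red))
             (add_struct (invariants (iwahori1 val red) (inflate red (rep_sum E1 E2)))) ract
             (L_gamma val red varpi chi) (L_gamma_act val red varpi chi)))"
proof -
  have char: "CHAR('c) = CHAR('k)" using coeffs by (simp add: alg_closure_of_Fp_def)
  have "of_nat CARD('k) = (0 :: 'c)" unfolding q_eq_p char[symmetric] by simp
  then have H: "mod_p_hecke TYPE('c) val red varpi"
    using F by (simp add: mod_p_hecke_def mod_p_hecke_axioms_def)
  show ?thesis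
    using extension_self[OF H q_eq_p char chi _ E1 E2] extension_nonself[OF H q_eq_p char chi _ E1 E2] by blast
qed

end
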